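(* Let $\Gamma$ be a charmenable group and $X$ a URS of $\Gamma$. Then either every $H\in X$ is contained in the amenable radical $\mathrm{Rad}(\Gamma)$ or $X$ carries a $\Gamma$-invariant (Borel) probability measure. Furthermore, if $\Gamma$ is charfinite then $X$ is finite.
   Context: $\mathrm{Sub}(\Gamma)$ is the compact space of all subgroups of $\Gamma$ with the Chabauty topology, on which $\Gamma$ acts by conjugation. A *URS* of $\Gamma$ is a minimal (non-empty closed) $\Gamma$-invariant subset of $\mathrm{Sub}(\Gamma)$. For a countable discrete group $\Gamma$, $\mathrm{PD}_1(\Gamma)\subset \ell^\infty(\Gamma)$ is the compact convex set of positive definite functions $\phi$ on $\Gamma$ with $\phi(e)=1$, with the topology of pointwise convergence and the $\Gamma$-action coming from conjugation. A *character* is a conjugation-invariant element of $\mathrm{PD}_1(\Gamma)$; $\mathrm{Char}(\Gamma)$ is the compact convex set of characters, and its extreme points are the *extremal characters*. Let $(\pi,H,\xi)$ be the GNS triple of a character $\phi$. Then $\phi$ is *amenable* if $\pi\otimes\overline{\pi}$ weakly contains the trivial representation; *von Neumann amenable* if moreover $\pi(\Gamma)''$ is an amenable (injective) von Neumann algebra; *finite* if $H$ is finite dimensional. $\mathrm{Rad}(\Gamma)$ is the amenable radical (largest amenable normal subgroup); a function is supported on a subset if it vanishes outside it. $\Gamma$ is *charmenable* if: (1) every non-empty compact convex $\Gamma$-invariant subset of $\mathrm{PD}_1(\Gamma)$ contains a character; (2) every extremal character of $\Gamma$ is either supported on $\mathrm{Rad}(\Gamma)$ or von Neumann amenable. $\Gamma$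 is *charfinite* if it also satisfies: (3) $\mathrm{Rad}(\Gamma)$ is finite; (4) for each finite dimension, $\Gamma$ has finitely many isomorphism classes of unitary representations of that dimension; (5) every amenable extremal character of $\Gamma$ is finite. *)

theory Defs
  imports
    "HOL-Algebra.Coset"
    "HOL-Library.Function_Algebras"
    "HOL-Probability.Probability_Measure"
begin

section \<open>Amenability, the space of subgroups, uniformly recurrent subgroups\<close>

text \<open>
  Groups are discrete. A mean is a functional on the functions that are bounded on the carrier;
  positivity forces its value to depend only on the restriction of a function to the carrier.
\<close>

definition bounded_funs :: "('a, 'b) monoid_scheme \<Rightarrow> ('a \<Rightarrow> real) set" where
  "bounded_funs G = {f. bounded (f ` carrier G)}"

definition invariant_mean :: "('a, 'b) monoid_scheme \<Rightarrow> (('a \<Rightarrow> real) \<Rightarrow> real) \<Rightarrow> bool" where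
  "invariant_mean G m \<longleftrightarrow>
     (\<forall>f\<in>bounded_funs G. \<forall>h\<in>bounded_funs G. m (\<lambda>x. f x + h x) = m f + m h) \<and>
     (\<forall>f\<in>bounded_funs G. \<forall>c. m (\<lambda>x. c * f x) = c * m f) \<and>
     (\<forall>f\<in>bounded_funs G. (\<forall>x\<in>carrier G. 0 \<le> f x) \<longrightarrow> 0 \<le> m f) \<and>
     m (\<lambda>x. 1) = 1 \<and>
     (\<forall>g\<in>carrier G. \<forall>f\<in>bounded_funs G. m (\<lambda>x. f (inv\<^bsub>G\<^esub> g \<otimes>\<^bsub>G\<^esub> x)) = m f)"

definition amenable_group :: "('a, 'b) monoid_scheme \<Rightarrow> bool" where
  "amenable_group G \<longleftrightarrow> (\<exists>m. invariant_mean G m)"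

definition amenable_radical :: "('a, 'b) monoid_scheme \<Rightarrow> 'a set" where
  "amenable_radical G = (GREATEST N. N \<lhd> G \<and> amenable_group (G\<lparr>carrier := N\<rparr>))"

text \<open>The topology induced from the product of the discrete two-point spaces.\<close>

definition chabauty :: "('a, 'b) monoid_scheme \<Rightarrow> 'a set topology" where
  "chabauty G =
     pullback_topology {H. subgroup H G} (\<lambda>H. \<lambda>g\<in>carrier G. g \<in> H)
       (product_topology (\<lambda>_. discrete_topology (UNIV :: bool set)) (carrier G))"

definition conj_subgroup :: "('a, 'b) monoid_scheme \<Rightarrow> 'a \<Rightarrow> 'a set \<Rightarrow> 'a set" where
  "conj_subgroup G g H = (\<lambda>h. g \<otimes>\<^bsub>G\<^esub> h \<otimes>\<^bsub>G\<^esub> inv\<^bsub>G\<^esub> g) ` H"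

definition closed_invariant :: "('a, 'b) monoid_scheme \<Rightarrow> 'a set set \<Rightarrow> bool" where
  "closed_invariant G X \<longleftrightarrow>
     X \<noteq> {} \<and> closedin (chabauty G) X \<and> (\<forall>g\<in>carrier G. \<forall>H\<in>X. conj_subgroup G g H \<in> X)"

definition URS :: "('a, 'b) monoid_scheme \<Rightarrow> 'a set set \<Rightarrow> bool" where
  "URS G X \<longleftrightarrow>
     closed_invariant G X \<and> (\<forall>Y. Y \<subseteq> X \<longrightarrow> closed_invariant G Y \<longrightarrow> Y = X)"

definition invariant_borel_prob ::
    "('a, 'b) monoid_scheme \<Rightarrow> 'a set set \<Rightarrow> 'a set measure \<Rightarrow> bool" where
  "invariant_borel_prob G X \<mu> \<longleftrightarrow>
     prob_space \<mu> \<and> space \<mu> = X \<and>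
     sets \<mu> = sigma_sets X {U. openin (subtopology (chabauty G) X) U} \<and>
     (\<forall>g\<in>carrier G. \<forall>A\<in>sets \<mu>. emeasure \<mu> (conj_subgroup G g ` A) = emeasure \<mu> A)"


section \<open>Positive definite functions and characters\<close>

text \<open>
  Real scalars act pointwise, so that convexity and extreme points of the library apply to
  functions on the group. Such functions are taken to be extensional on the carrier: the
  coordinates outside the carrier are then constant, and the product topology on the function
  type is the topology of pointwise convergence on the group.
\<close>

instantiation "fun" :: (type, real_vector) real_vector
begin

definition scaleR_fun :: "real \<Rightarrow> ('a \<Rightarrow> 'b) \<Rightarrow> 'a \<Rightarrow> 'b" where
  "scaleR_fun r f = (\<lambda>x. r *\<^sub>R f x)"

instance
  by standard (simp_all add: scaleR_fun_def fun_eq_iff scaleR_right_distrib scaleR_left_distrib)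

end

definition PD1 :: "('a, 'b) monoid_scheme \<Rightarrow> ('a \<Rightarrow> complex) set" where
  "PD1 G = {\<phi> \<in> extensional (carrier G).
     \<phi> \<one>\<^bsub>G\<^esub> = 1 \<and>
     (\<forall>F c. finite F \<longrightarrow> F \<subseteq> carrier G \<longrightarrow>
        (\<Sum>g\<in>F. \<Sum>h\<in>F. c g * cnj (c h) * \<phi> (inv\<^bsub>G\<^esub> h \<otimes>\<^bsub>G\<^esub> g)) \<in> \<real>\<^sub>\<ge>\<^sub>0)}"

definition conj_fun :: "('a, 'b) monoid_scheme \<Rightarrow> 'a \<Rightarrow> ('a \<Rightarrow> complex) \<Rightarrow> 'a \<Rightarrow> complex" where
  "conj_fun G g \<phi> = (\<lambda>x\<in>carrier G. \<phi> (inv\<^bsub>G\<^esub> g \<otimes>\<^bsub>G\<^esub> x \<otimes>\<^bsub>G\<^esub> g))"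

definition characters :: "('a, 'b) monoid_scheme \<Rightarrow> ('a \<Rightarrow> complex) set" where
  "characters G = {\<phi> \<in> PD1 G. \<forall>g\<in>carrier G. conj_fun G g \<phi> = \<phi>}"

definition extremal_character :: "('a, 'b) monoid_scheme \<Rightarrow> ('a \<Rightarrow> complex) \<Rightarrow> bool" where
  "extremal_character G \<phi> \<longleftrightarrow> \<phi> extreme_point_of characters G"

definition supported_on ::
    "('a, 'b) monoid_scheme \<Rightarrow> ('a \<Rightarrow> complex) \<Rightarrow> 'a set \<Rightarrow> bool" where
  "supported_on G \<phi> S \<longleftrightarrow> (\<forall>g\<in>carrier G - S. \<phi> g = 0)"


section \<open>Hilbert spaces\<close>

text \<open>
  Hilbert spaces are realised as closed linear subspaces of the space of square-summable families
  over some index type; over the index type \<^typ>\<open>nat\<close> these are, up to unitary equivalence, all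
  separable complex Hilbert spaces. Inner products are linear in the first variable.
\<close>

definition cscale :: "complex \<Rightarrow> ('i \<Rightarrow> complex) \<Rightarrow> 'i \<Rightarrow> complex" where
  "cscale c x = (\<lambda>i. c * x i)"

interpretation cfun: vector_space cscale
  by standard (simp_all add: cscale_def fun_eq_iff distrib_left distrib_right)

definition ell2 :: "('i \<Rightarrow> complex) set" where
  "ell2 = {x. (\<lambda>i. (cmod (x i))\<^sup>2) summable_on UNIV}"

definition ip :: "('i \<Rightarrow> complex) \<Rightarrow> ('i \<Rightarrow> complex) \<Rightarrow> complex" where
  "ip x y = (\<Sum>\<^sub>\<infinity>i. x i * cnj (y i))"

definition l2norm :: "('i \<Rightarrow> complex) \<Rightarrow> real" where
  "l2norm x = sqrt (\<Sum>\<^sub>\<infinity>i. (cmod (x i))\<^sup>2)"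

definition l2_closure :: "('i \<Rightarrow> complex) set \<Rightarrow> ('i \<Rightarrow> complex) set" where
  "l2_closure S = {x \<in> ell2. \<forall>e>0. \<exists>y\<in>S. l2norm (x - y) < e}"

definition hilbert :: "('i \<Rightarrow> complex) set \<Rightarrow> bool" where
  "hilbert H \<longleftrightarrow> H \<subseteq> ell2 \<and> cfun.subspace H \<and> l2_closure H \<subseteq> H"

definition finite_dim :: "('i \<Rightarrow> complex) set \<Rightarrow> bool" where
  "finite_dim H \<longleftrightarrow> (\<exists>B. finite B \<and> H = cfun.span B)"

definition linear_between ::
    "('i \<Rightarrow> complex) set \<Rightarrow> ('j \<Rightarrow> complex) set \<Rightarrow> (('i \<Rightarrow> complex) \<Rightarrow> 'j \<Rightarrow> complex) \<Rightarrow> bool" where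
  "linear_between H K T \<longleftrightarrow>
     T ` H \<subseteq> K \<and>
     (\<forall>x\<in>H. \<forall>y\<in>H. T (x + y) = T x + T y) \<and>
     (\<forall>c. \<forall>x\<in>H. T (cscale c x) = cscale c (T x))"

definition unitary_between ::
    "('i \<Rightarrow> complex) set \<Rightarrow> ('j \<Rightarrow> complex) set \<Rightarrow> (('i \<Rightarrow> complex) \<Rightarrow> 'j \<Rightarrow> complex) \<Rightarrow> bool" where
  "unitary_between H K U \<longleftrightarrow>
     linear_between H K U \<and> bij_betw U H K \<and> (\<forall>x\<in>H. \<forall>y\<in>H. ip (U x) (U y) = ip x y)"

text \<open>Operators are extensional on their Hilbert space, so that equality of operators is equality
  of functions and composition is \<^const>\<open>compose\<close>.\<close>

type_synonym 'i operator = "('i \<Rightarrow> complex) \<Rightarrow> 'i \<Rightarrow> complex"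

definition bounded_ops :: "('i \<Rightarrow> complex) set \<Rightarrow> 'i operator set" where
  "bounded_ops H = {T \<in> extensional H.
     linear_between H H T \<and> (\<exists>C. \<forall>x\<in>H. l2norm (T x) \<le> C * l2norm x)}"

definition op_add :: "('i \<Rightarrow> complex) set \<Rightarrow> 'i operator \<Rightarrow> 'i operator \<Rightarrow> 'i operator" where
  "op_add H S T = (\<lambda>x\<in>H. S x + T x)"

definition op_scale :: "('i \<Rightarrow> complex) set \<Rightarrow> complex \<Rightarrow> 'i operator \<Rightarrow> 'i operator" where
  "op_scale H c T = (\<lambda>x\<in>H. cscale c (T x))"

definition positive_op :: "('i \<Rightarrow> complex) set \<Rightarrow> 'i operator \<Rightarrow> bool" where
  "positive_op H T \<longleftrightarrow> (\<forall>x\<in>H. ip (T x) x \<in> \<real>\<^sub>\<ge>\<^sub>0)"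

definition commutant :: "('i \<Rightarrow> complex) set \<Rightarrow> 'i operator set \<Rightarrow> 'i operator set" where
  "commutant H S = {T \<in> bounded_ops H. \<forall>A\<in>S. compose H T A = compose H A T}"

definition conditional_expectation ::
    "('i \<Rightarrow> complex) set \<Rightarrow> 'i operator set \<Rightarrow> ('i operator \<Rightarrow> 'i operator) \<Rightarrow> bool" where
  "conditional_expectation H M E \<longleftrightarrow>
     (\<forall>T\<in>bounded_ops H. E T \<in> M) \<and>
     (\<forall>S\<in>bounded_ops H. \<forall>T\<in>bounded_ops H. E (op_add H S T) = op_add H (E S) (E T)) \<and>
     (\<forall>c. \<forall>T\<in>bounded_ops H. E (op_scale H c T) = op_scale H c (E T)) \<and>
     (\<forall>T\<in>bounded_ops H. positive_op H T \<longrightarrow> positive_op H (E T)) \<and>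
     (\<forall>T\<in>M. E T = T) \<and>
     (\<forall>A\<in>M. \<forall>B\<in>M. \<forall>T\<in>bounded_ops H.
        E (compose H (compose H A T) B) = compose H (compose H A (E T)) B)"

text \<open>Injectivity of a von Neumann algebra \<open>M\<close> acting on \<open>H\<close>: the algebra of all bounded operators
  on \<open>H\<close> admits a conditional expectation onto \<open>M\<close>.\<close>

definition injective_vN :: "('i \<Rightarrow> complex) set \<Rightarrow> 'i operator set \<Rightarrow> bool" where
  "injective_vN H M \<longleftrightarrow> (\<exists>E. conditional_expectation H M E)"


section \<open>Unitary representations\<close>

definition unitary_rep ::
    "('a, 'b) monoid_scheme \<Rightarrow> ('i \<Rightarrow> complex) set \<Rightarrow> ('a \<Rightarrow> 'i operator) \<Rightarrow> bool" where
  "unitary_rep G H \<pi> \<longleftrightarrow>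
     hilbert H \<and>
     (\<forall>g\<in>carrier G. \<pi> g \<in> extensional H \<and> unitary_between H H (\<pi> g)) \<and>
     (\<forall>g\<in>carrier G. \<forall>h\<in>carrier G. \<pi> (g \<otimes>\<^bsub>G\<^esub> h) = compose H (\<pi> g) (\<pi> h))"

definition unitarily_equivalent ::
    "('a, 'b) monoid_scheme \<Rightarrow> ('i \<Rightarrow> complex) set \<Rightarrow> ('a \<Rightarrow> 'i operator)
      \<Rightarrow> ('j \<Rightarrow> complex) set \<Rightarrow> ('a \<Rightarrow> 'j operator) \<Rightarrow> bool" where
  "unitarily_equivalent G H \<pi> K \<rho> \<longleftrightarrow>
     (\<exists>U. unitary_between H K U \<and> (\<forall>g\<in>carrier G. \<forall>x\<in>H. U (\<pi> g x) = \<rho> g (U x)))"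

text \<open>\<open>\<pi>\<close> is weakly contained in \<open>\<rho>\<close>: every diagonal coefficient of \<open>\<pi>\<close> is a pointwise limit of
  finite sums of diagonal coefficients of \<open>\<rho>\<close>.\<close>

definition weakly_contained ::
    "('a, 'b) monoid_scheme \<Rightarrow> ('i \<Rightarrow> complex) set \<Rightarrow> ('a \<Rightarrow> 'i operator)
      \<Rightarrow> ('j \<Rightarrow> complex) set \<Rightarrow> ('a \<Rightarrow> 'j operator) \<Rightarrow> bool" where
  "weakly_contained G H \<pi> K \<rho> \<longleftrightarrow>
     (\<forall>x\<in>H. \<forall>F e. finite F \<longrightarrow> F \<subseteq> carrier G \<longrightarrow> 0 < e \<longrightarrow>
        (\<exists>(n::nat) y. (\<forall>k<n. y k \<in> K) \<and>
           (\<forall>g\<in>F. cmod (ip (\<pi> g x) x - (\<Sum>k<n. ip (\<rho> g (y k)) (y k))) < e)))"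

definition trivial_rep :: "'a \<Rightarrow> unit operator" where
  "trivial_rep g = (\<lambda>x. x)"

text \<open>The conjugate Hilbert space is realised by conjugating coordinates.\<close>

definition conj_vec :: "('i \<Rightarrow> complex) \<Rightarrow> 'i \<Rightarrow> complex" where
  "conj_vec x = (\<lambda>i. cnj (x i))"

definition conj_rep :: "('i \<Rightarrow> complex) set \<Rightarrow> ('a \<Rightarrow> 'i operator) \<Rightarrow> 'a \<Rightarrow> 'i operator" where
  "conj_rep H \<pi> g = (\<lambda>x\<in>conj_vec ` H. conj_vec (\<pi> g (conj_vec x)))"

definition tensor_vec :: "('i \<Rightarrow> complex) \<Rightarrow> ('j \<Rightarrow> complex) \<Rightarrow> 'i \<times> 'j \<Rightarrow> complex" where
  "tensor_vec x y = (\<lambda>(i, j). x i * y j)"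

definition tensor_space ::
    "('i \<Rightarrow> complex) set \<Rightarrow> ('j \<Rightarrow> complex) set \<Rightarrow> ('i \<times> 'j \<Rightarrow> complex) set" where
  "tensor_space H K = l2_closure (cfun.span {tensor_vec x y | x y. x \<in> H \<and> y \<in> K})"

text \<open>The description below determines the operator uniquely, by density of the span of the
  elementary tensors.\<close>

definition tensor_op ::
    "('i \<Rightarrow> complex) set \<Rightarrow> ('j \<Rightarrow> complex) set \<Rightarrow> 'i operator \<Rightarrow> 'j operator
      \<Rightarrow> ('i \<times> 'j) operator" where
  "tensor_op H K S T =
     (THE A. A \<in> bounded_ops (tensor_space H K) \<and>
        (\<forall>x\<in>H. \<forall>y\<in>K. A (tensor_vec x y) = tensor_vec (S x) (T y)))"

definition tensor_rep ::
    "('i \<Rightarrow> complex) set \<Rightarrow> ('j \<Rightarrow> complex) set \<Rightarrow> ('a \<Rightarrow> 'i operator) \<Rightarrow> ('a \<Rightarrow> 'j operator)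
      \<Rightarrow> 'a \<Rightarrow> ('i \<times> 'j) operator" where
  "tensor_rep H K \<pi> \<rho> g = tensor_op H K (\<pi> g) (\<rho> g)"

definition amenable_rep ::
    "('a, 'b) monoid_scheme \<Rightarrow> ('i \<Rightarrow> complex) set \<Rightarrow> ('a \<Rightarrow> 'i operator) \<Rightarrow> bool" where
  "amenable_rep G H \<pi> \<longleftrightarrow>
     weakly_contained G UNIV trivial_rep
       (tensor_space H (conj_vec ` H)) (tensor_rep H (conj_vec ` H) \<pi> (conj_rep H \<pi>))"

definition gen_vN ::
    "('a, 'b) monoid_scheme \<Rightarrow> ('i \<Rightarrow> complex) set \<Rightarrow> ('a \<Rightarrow> 'i operator) \<Rightarrow> 'i operator set" where
  "gen_vN G H \<pi> = commutant H (commutant H (\<pi> ` carrier G))"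


section \<open>Properties of characters, charmenable and charfinite groups\<close>

text \<open>
  For a countable group the GNS space is separable, hence realisable over the index type
  \<^typ>\<open>nat\<close>. The triple is unique up to unitary equivalence, so a property of the GNS triple
  may be stated as holding for some such triple.
\<close>

definition gns_triple ::
    "('a, 'b) monoid_scheme \<Rightarrow> ('a \<Rightarrow> complex) \<Rightarrow> (nat \<Rightarrow> complex) set \<Rightarrow> ('a \<Rightarrow> nat operator)
      \<Rightarrow> (nat \<Rightarrow> complex) \<Rightarrow> bool" where
  "gns_triple G \<phi> H \<pi> \<xi> \<longleftrightarrow>
     unitary_rep G H \<pi> \<and> \<xi> \<in> H \<and>
     l2_closure (cfun.span ((\<lambda>g. \<pi> g \<xi>) ` carrier G)) = H \<and>
     (\<forall>g\<in>carrier G. \<phi> g = ip (\<pi> g \<xi>) \<xi>)"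

definition amenable_character :: "('a, 'b) monoid_scheme \<Rightarrow> ('a \<Rightarrow> complex) \<Rightarrow> bool" where
  "amenable_character G \<phi> \<longleftrightarrow>
     \<phi> \<in> characters G \<and> (\<exists>H \<pi> \<xi>. gns_triple G \<phi> H \<pi> \<xi> \<and> amenable_rep G H \<pi>)"

definition vN_amenable_character :: "('a, 'b) monoid_scheme \<Rightarrow> ('a \<Rightarrow> complex) \<Rightarrow> bool" where
  "vN_amenable_character G \<phi> \<longleftrightarrow>
     \<phi> \<in> characters G \<and>
     (\<exists>H \<pi> \<xi>. gns_triple G \<phi> H \<pi> \<xi> \<and> amenable_rep G H \<pi> \<and> injective_vN H (gen_vN G H \<pi>))"

definition finite_character :: "('a, 'b) monoid_scheme \<Rightarrow> ('a \<Rightarrow> complex) \<Rightarrow> bool" where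
  "finite_character G \<phi> \<longleftrightarrow>
     \<phi> \<in> characters G \<and> (\<exists>H \<pi> \<xi>. gns_triple G \<phi> H \<pi> \<xi> \<and> finite_dim H)"

definition charmenable :: "('a, 'b) monoid_scheme \<Rightarrow> bool" where
  "charmenable G \<longleftrightarrow>
     (\<forall>K. K \<noteq> {} \<longrightarrow> K \<subseteq> PD1 G \<longrightarrow> compact K \<longrightarrow> convex K \<longrightarrow>
        (\<forall>g\<in>carrier G. \<forall>\<phi>\<in>K. conj_fun G g \<phi> \<in> K) \<longrightarrow> (\<exists>\<phi>\<in>K. \<phi> \<in> characters G)) \<and>
     (\<forall>\<phi>. extremal_character G \<phi> \<longrightarrow>
        supported_on G \<phi> (amenable_radical G) \<or> vN_amenable_character G \<phi>)"

definition coord_space :: "nat \<Rightarrow> (nat \<Rightarrow> complex) set" where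
  "coord_space n = {x. \<forall>i\<ge>n. x i = 0}"

definition rep_equiv ::
    "('a, 'b) monoid_scheme \<Rightarrow> nat \<Rightarrow> (('a \<Rightarrow> nat operator) \<times> ('a \<Rightarrow> nat operator)) set" where
  "rep_equiv G n = {(\<pi>, \<rho>).
     unitary_rep G (coord_space n) \<pi> \<and> unitary_rep G (coord_space n) \<rho> \<and>
     unitarily_equivalent G (coord_space n) \<pi> (coord_space n) \<rho>}"

definition charfinite :: "('a, 'b) monoid_scheme \<Rightarrow> bool" where
  "charfinite G \<longleftrightarrow>
     charmenable G \<and>
     finite (amenable_radical G) \<and>
     (\<forall>n. finite ({\<pi>. unitary_rep G (coord_space n) \<pi>} // rep_equiv G n)) \<and>
     (\<forall>\<phi>. extremal_character G \<phi> \<longrightarrow> amenable_character G \<phi> \<longrightarrow> finite_character G \<phi>)"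

end

theory Submission
  imports Defs
begin

text \<open>
  Let \<open>K\<close> be the set of the functions sending \<open>g\<close> to the mass of \<open>{H \<in> X. g \<in> H}\<close>, for the probability
  measures on \<open>X\<close>. It is compact, convex and invariant, hence contains a character \<open>\<phi>\<close>. If \<open>\<phi>\<close>
  vanishes outside \<open>R = Rad(\<Gamma>)\<close>, then by compactness some member of \<open>X\<close> lies in \<open>R\<close>, and by minimality
  all of them do. Otherwise \<open>\<phi> h \<noteq> 0\<close> for some \<open>h\<close> outside \<open>R\<close>.

  If \<open>X\<close> carries no invariant measure, then the quasi-regular representations on \<open>\<Gamma> / H\<close> with \<open>H \<in> X\<close>,
  tensored with an arbitrary representation, have a uniform spectral gap: the square of an almost
  invariant vector would give an almost invariant measure on \<open>X\<close>. The characters whose products with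
  positive definite functions have this spectral gap form a closed face of the set of characters
  which contains \<open>\<phi>\<close>. It has an extreme point \<open>\<psi>\<close> with \<open>\<psi> h \<noteq> 0\<close>, which is an extremal character, so that
  \<open>\<psi>\<close> is amenable; but the spectral gap for \<open>\<psi> \<cdot> cnj \<psi>\<close> excludes this.

  If \<open>\<Gamma>\<close> is charfinite and \<open>X\<close> is infinite, then all members of \<open>X\<close> have infinite index, so that the
  quasi-regular representations have no invariant vectors. This yields a sequence \<open>g n\<close> with
  \<open>\<phi> (h (g n)) \<le> \<phi> h / 2\<close> and \<open>h (g n) \<notin> R\<close>, where \<open>g n\<close> converges to the identity in each of the countably many
  finite dimensional representations of \<open>\<Gamma>\<close>. Hence \<open>\<psi> h - \<psi> (h (g n))\<close> tends to \<open>0\<close> for all extremal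
  characters \<open>\<psi>\<close>, but not for \<open>\<phi>\<close>, contrary to Simons' inequality.
\<close>

section \<open>Extreme points and Simons' inequality\<close>

text \<open>The character \<open>\<psi>\<close> appears only after the spectral gap has been
  established, while its amenability concerns \<open>\<psi> \<cdot> cnj \<psi>\<close>. The gap is
  therefore demanded for the products with all multipliers at once, so that
  \<open>cnj \<psi>\<close> can be inserted afterwards. It is expressed by return means of a
  symmetric random walk: for a fixed multiplier these are linear in the character, and the bounds
  pass from indicator functions of subgroups to their closed convex hull. That they cut out a face
  is less evident, since a convex summand of weight \<open>t\<close> inherits them only up to a
  factor \<open>1 / t\<close>; this factor disappears on taking high powers. Uniformity of the gap
  comes from compactness of the set of all finitely additive probability measures on
  \<open>X\<close>, defined on every subset; countable additivity is restored on clopen sets.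
  Positive definite functions are handled by their forms on finitely supported functions, so that
  Hilbert spaces enter only to test amenability and to treat finite dimensional
  representations.\<close>

definition affine_fun_on :: "'v::real_vector set \<Rightarrow> ('v \<Rightarrow> real) \<Rightarrow> bool" where
  "affine_fun_on K f \<longleftrightarrow> (\<forall>x\<in>K. \<forall>y\<in>K. \<forall>t. 0 \<le> t \<longrightarrow> t \<le> 1 \<longrightarrow>
     f ((1 - t) *\<^sub>R x + t *\<^sub>R y) = (1 - t) * f x + t * f y)"

lemma affine_fun_onD:
  "\<lbrakk>affine_fun_on K f; x \<in> K; y \<in> K; 0 \<le> t; t \<le> 1\<rbrakk>
    \<Longrightarrow> f ((1 - t) *\<^sub>R x + t *\<^sub>R y) = (1 - t) * f x + t * f y"
  by (simp add: affine_fun_on_def)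

text \<open>Lexicographic maximization takes the place of Zorn's lemma in the usual proof of the
  Krein-Milman theorem: for affine functions every stage is a face of the one before.\<close>

primrec lex_max :: "('v \<Rightarrow> real) \<Rightarrow> (nat \<Rightarrow> 'v \<Rightarrow> real) \<Rightarrow> 'v set \<Rightarrow> nat \<Rightarrow> 'v set" where
  "lex_max f c K 0 = {x \<in> K. \<forall>y\<in>K. f y \<le> f x}"
| "lex_max f c K (Suc n) = {x \<in> lex_max f c K n. \<forall>y\<in>lex_max f c K n. c n y \<le> c n x}"

lemma compact_maximizers:
  fixes f :: "'v::topological_space \<Rightarrow> real"
  assumes "compact K" "closed K" "K \<noteq> {}" "continuous_on K f"
  shows "compact {x \<in> K. \<forall>y\<in>K. f y \<le> f x}" "closed {x \<in> K. \<forall>y\<in>K. f y \<le> f x}"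
    "{x \<in> K. \<forall>y\<in>K. f y \<le> f x} \<noteq> {}"
proof -
  obtain m where m: "m \<in> K" "\<forall>y\<in>K. f y \<le> f m"
    using continuous_attains_sup[OF assms(1,3,4)] by blast
  have eq: "{x \<in> K. \<forall>y\<in>K. f y \<le> f x} = K \<inter> f -` {f m..}"
    using m order_trans by (auto intro: order_antisym) 
  show cl: "closed {x \<in> K. \<forall>y\<in>K. f y \<le> f x}"
    unfolding eq by (rule continuous_closed_preimage[OF assms(4,2)]) simp
  then show "compact {x \<in> K. \<forall>y\<in>K. f y \<le> f x}"
    unfolding eq using assms(1) compact_Int_closed[of K "K \<inter> f -` {f m..}"] by (simp add: Int_absorb1)
  show "{x \<in> K. \<forall>y\<in>K. f y \<le> f x} \<noteq> {}" using m by blast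
qed

text \<open>The value at an interior point of a segment is a mean with positive weights of two
  values that do not exceed it, so both differences vanish. This is the face property used at each
  stage of \<open>lex_max\<close>.\<close>

lemma face_of_maximizers:
  fixes f :: "'v::real_vector \<Rightarrow> real"
  assumes "affine_fun_on K f" "a \<in> K" "b \<in> K" "e \<in> open_segment a b" "f a \<le> f e" "f b \<le> f e"
  shows "f a = f e \<and> f b = f e"
proof -
  obtain t where t: "0 < t" "t < 1" "e = (1 - t) *\<^sub>R a + t *\<^sub>R b"
    using assms(4) by (auto simp: in_segment)
  have fe: "f e = (1 - t) * f a + t * f b"
    using affine_fun_onD[OF assms(1-3), of t] t by simp
  have 1: "(1 - t) * (f e - f a) + t * (f e - f b) = 0" using fe by (simp add: algebra_simps)
  have "0 \<le> (1 - t) * (f e - f a)" "0 \<le> t * (f e - f b)" using t assms by auto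
  then have "(1 - t) * (f e - f a) = 0" "t * (f e - f b) = 0" using 1 by linarith+
  then show ?thesis using t by auto
qed

text \<open>Maximizing \<open>f\<close> and then successively a separating sequence of affine functions
  cuts out a single point.\<close>

lemma extreme_point_maximizing:
  fixes K :: "'v::{real_vector,topological_space} set" and f :: "'v \<Rightarrow> real" and c :: "nat \<Rightarrow> 'v \<Rightarrow> real"
  assumes K: "compact K" "closed K" "K \<noteq> {}"
    and f: "continuous_on K f" "affine_fun_on K f"
    and c: "\<And>n. continuous_on K (c n)" "\<And>n. affine_fun_on K (c n)"
    and sep: "\<And>x y. \<lbrakk>x \<in> K; y \<in> K; \<And>n. c n x = c n y\<rbrakk> \<Longrightarrow> x = y"
  shows "\<exists>e. e extreme_point_of K \<and> (\<forall>x\<in>K. f x \<le> f e)"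
proof -
  let ?A = "lex_max f c K"
  have sub: "?A n \<subseteq> K" for n by (induction n) auto
  have A: "compact (?A n) \<and> closed (?A n) \<and> ?A n \<noteq> {}" for n
  proof (induction n)
    case 0
    then show ?case using compact_maximizers[OF K f(1)] by simp
  next
    case (Suc n)
    then show ?case
      using compact_maximizers[of "?A n" "c n"] continuous_on_subset[OF c(1) sub] by simp
  qed
  have mono: "?A m \<subseteq> ?A n" if "n \<le> m" for m n
    using that by (induction m rule: dec_induct) auto
  have "(\<Inter>n. ?A n) \<noteq> {}"
  proof -
    have "K \<inter> (\<Inter>n\<in>UNIV. ?A n) \<noteq> {}"
    proof (rule compact_imp_fip_image[OF K(1)])
      show "closed (?A n)" for n using A by blast
      fix I' :: "nat set" assume "finite I'" "I' \<subseteq> UNIV"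
      then have "?A (Max (insert 0 I')) \<subseteq> K \<inter> (\<Inter>n\<in>I'. ?A n)"
        using mono sub by (intro Int_greatest INT_greatest) auto
      then show "K \<inter> (\<Inter>n\<in>I'. ?A n) \<noteq> {}" using A by blast
    qed
    then show ?thesis by blast
  qed
  then obtain e where e: "\<And>n. e \<in> ?A n" by blast
  have eK: "e \<in> K" using e sub by blast
  have "e \<notin> open_segment a b" if ab: "a \<in> K" "b \<in> K" for a b
  proof
    assume seg: "e \<in> open_segment a b"
    \<comment> \<open>Since \<open>e\<close> survives all stages and each stage is a face, both
      endpoints survive as well; then no \<open>c n\<close> distinguishes them.\<close>
    have mem: "a \<in> ?A n \<and> b \<in> ?A n" for n
    proof (induction n)
      case 0
      then show ?case
        using face_of_maximizers[OF f(2) ab seg] e[of 0] ab by auto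
    next
      case (Suc n)
      then show ?case
        using face_of_maximizers[OF c(2) ab seg, of n] e[of "Suc n"] by auto
    qed
    have "c n a = c n b" for n
      using mem[of n] mem[of "Suc n"] by (auto intro: order_antisym)
    then have "a = b" using sep ab by blast
    then show False using seg by simp
  qed
  then have "e extreme_point_of K" using eK by (auto simp: extreme_point_of_def)
  moreover have "\<forall>x\<in>K. f x \<le> f e" using e[of 0] by simp
  ultimately show ?thesis by blast
qed

text \<open>The set \<open>tail_hull K f n\<close> contains the countable convex combinations of the
  \<open>f k\<close> with \<open>k \<ge> n\<close>.\<close>

definition tail_hull ::
    "'v::{real_vector,topological_space} set \<Rightarrow> (nat \<Rightarrow> 'v \<Rightarrow> real) \<Rightarrow> nat \<Rightarrow> ('v \<Rightarrow> real) set" where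
  "tail_hull K f n = {g. continuous_on K g \<and> affine_fun_on K g \<and>
     (\<forall>x\<in>K. \<forall>t. (\<forall>k\<ge>n. f k x \<le> t) \<longrightarrow> g x \<le> t) \<and>
     (\<forall>x\<in>K. \<forall>t. (\<forall>k\<ge>n. t \<le> f k x) \<longrightarrow> t \<le> g x)}"

lemma half_powers_sums: "(\<lambda>j. (1/2::real) ^ Suc j) sums 1"
  using power_half_series by simp

text \<open>The bound \<open>C\<close> makes the series converge uniformly by the Weierstrass test,
  which preserves continuity; since the weights add up to 1, upper and lower bounds pass to the
  sum.\<close>

lemma tail_hull_sigma_convex:
  assumes bd: "\<And>k x. x \<in> K \<Longrightarrow> \<bar>f k x\<bar> \<le> C" and g: "\<And>j. g j \<in> tail_hull K f n"
  shows "(\<lambda>x. \<Sum>j. (1/2) ^ Suc j * g j x) \<in> tail_hull K f n" (is "?s \<in> _")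
    and "x \<in> K \<Longrightarrow> summable (\<lambda>j. (1/2) ^ Suc j * g j x)"
proof -
  have gb: "\<bar>g j x\<bar> \<le> C" if "x \<in> K" for j x
  proof -
    have "g j x \<le> C" "- C \<le> g j x"
      using g[of j] that bd[OF that] unfolding tail_hull_def by (auto simp: abs_le_iff minus_le_iff)
    then show ?thesis by linarith
  qed
  have nb: "norm ((1/2) ^ Suc j * g j x) \<le> (1/2) ^ Suc j * C" if "x \<in> K" for j x
    unfolding norm_mult using gb[OF that, of j] by (intro mult_mono) auto
  have sC: "summable (\<lambda>j. (1/2) ^ Suc j * C)"
    by (intro summable_mult2 sums_summable[OF half_powers_sums])
  show sm: "summable (\<lambda>j. (1/2) ^ Suc j * g j x)" if "x \<in> K" for x
    by (rule summable_comparison_test[OF _ sC]) (use nb[OF that] in auto)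
  have "uniform_limit K (\<lambda>N x. \<Sum>j<N. (1/2) ^ Suc j * g j x) ?s sequentially"
    by (rule Weierstrass_m_test[OF nb sC])
  then have cont: "continuous_on K ?s"
    by (rule uniform_limit_theorem[rotated])
       (use g in \<open>auto simp: tail_hull_def intro!: always_eventually continuous_intros\<close>)
  have conv: "suminf (\<lambda>j. (1/2) ^ Suc j * t) = (t::real)" for t
    using sums_mult2[OF half_powers_sums, of t] sums_unique by fastforce
  have st: "summable (\<lambda>j. (1/2) ^ Suc j * (t::real))" for t
    by (intro summable_mult2 sums_summable[OF half_powers_sums])
  have "affine_fun_on K ?s"
    unfolding affine_fun_on_def
  proof (intro ballI allI impI)
    fix x y t assume *: "x \<in> K" "y \<in> K" "0 \<le> t" "(t::real) \<le> 1"
    have "?s ((1 - t) *\<^sub>R x + t *\<^sub>R y)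
        = (\<Sum>j. (1 - t) * ((1/2) ^ Suc j * g j x) + t * ((1/2) ^ Suc j * g j y))"
    proof (intro suminf_cong)
      fix j
      have "affine_fun_on K (g j)" using g by (simp add: tail_hull_def)
      from affine_fun_onD[OF this *]
      have "g j ((1 - t) *\<^sub>R x + t *\<^sub>R y) = (1 - t) * g j x + t * g j y" .
      then show "(1/2) ^ Suc j * g j ((1 - t) *\<^sub>R x + t *\<^sub>R y)
          = (1 - t) * ((1/2) ^ Suc j * g j x) + t * ((1/2) ^ Suc j * g j y)"
        by (simp only: distrib_left mult.left_commute)
    qed
    also have "\<dots> = (1 - t) * ?s x + t * ?s y"
      unfolding suminf_add[OF summable_mult[OF sm[OF *(1)]] summable_mult[OF sm[OF *(2)]], symmetric]
        suminf_mult[OF sm[OF *(1)]] suminf_mult[OF sm[OF *(2)]] ..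
    finally show "?s ((1 - t) *\<^sub>R x + t *\<^sub>R y) = (1 - t) * ?s x + t * ?s y" .
  qed
  moreover have "?s x \<le> t" if "x \<in> K" "\<forall>k\<ge>n. f k x \<le> t" for x t
  proof -
    have "?s x \<le> (\<Sum>j. (1/2) ^ Suc j * t)"
      using g that by (intro suminf_le sm st mult_left_mono) (auto simp: tail_hull_def)
    then show ?thesis using conv by simp
  qed
  moreover have "t \<le> ?s x" if "x \<in> K" "\<forall>k\<ge>n. t \<le> f k x" for x t
  proof -
    have "(\<Sum>j. (1/2) ^ Suc j * t) \<le> ?s x"
      using g that by (intro suminf_le sm st mult_left_mono) (auto simp: tail_hull_def)
    then show ?thesis using conv by simp
  qed
  ultimately show "?s \<in> tail_hull K f n" using cont by (auto simp: tail_hull_def)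
qed

lemma tail_hull_antimono: "m \<le> n \<Longrightarrow> tail_hull K f n \<subseteq> tail_hull K f m"
  unfolding tail_hull_def by (auto intro: order_trans)

text \<open>The infimum over \<open>T\<close> may fail to be attained; this is the source of the
  error terms in Simons' inequality.\<close>

lemma near_minimizer:
  fixes S :: "'g \<Rightarrow> real"
  assumes "T \<noteq> {}" "\<And>s. s \<in> T \<Longrightarrow> B \<le> S s" "0 < e"
  shows "\<exists>s\<in>T. \<forall>s'\<in>T. S s \<le> S s' + e"
proof -
  have bd: "bdd_below (S ` T)" using assms(2) by (auto simp: bdd_below_def)
  have "Inf (S ` T) < Inf (S ` T) + e" using assms(3) by simp
  then obtain y where "y \<in> S ` T" "y < Inf (S ` T) + e"
    using cInf_lessD[of "S ` T" "Inf (S ` T) + e"] assms(1) by auto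
  then obtain s where s: "s \<in> T" "S s < Inf (S ` T) + e" by blast
  then have "S s \<le> S s' + e" if "s' \<in> T" for s' using cINF_lower[OF bd that] by linarith
  then show ?thesis using s(1) by blast
qed

text \<open>Simons' inequality replaces Choquet's theorem and dominated convergence.\<close>

lemma simons:
  fixes K :: "'v::{real_vector,topological_space} set" and f :: "nat \<Rightarrow> 'v \<Rightarrow> real"
  assumes K: "compact K" and B: "B \<subseteq> K"
    and bdry: "\<And>g. continuous_on K g \<Longrightarrow> affine_fun_on K g \<Longrightarrow> \<exists>e\<in>B. \<forall>x\<in>K. g x \<le> g e"
    and f: "\<And>n. continuous_on K (f n)" "\<And>n. affine_fun_on K (f n)"
    and bd: "\<And>k x. x \<in> K \<Longrightarrow> \<bar>f k x\<bar> \<le> C"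
    and x0: "x0 \<in> K" "\<And>n. d \<le> f n x0" "0 < d"
  shows "\<exists>e\<in>B. \<forall>m. \<exists>k\<ge>m. d / 4 < f k e"
proof -
  let ?T = "tail_hull K f"
  define S where "S g = (SUP x\<in>K. g x)" for g :: "'v \<Rightarrow> real"
  define good where "good n h g \<longleftrightarrow> g \<in> ?T n \<and>
    (\<forall>g'\<in>?T n. S (\<lambda>x. h x + (1/2)^n * g x) \<le> S (\<lambda>x. h x + (1/2)^n * g' x) + d/4 * (1/4)^n)"
    for n h g
  define p where "p n h = (SOME g. good n h g)" for n h
  define hs where "hs = rec_nat (\<lambda>x. 0) (\<lambda>n h x. h x + (1/2) ^ Suc n * p n h x)"
  define g where "g n = p n (hs n)" for n
  have hs0: "hs 0 = (\<lambda>x. 0)" and hsS: "hs (Suc n) = (\<lambda>x. hs n x + (1/2) ^ Suc n * g n x)" for n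
    by (simp_all add: hs_def g_def)
  have fT: "f n \<in> ?T n" for n using f by (auto simp: tail_hull_def)
  have Tb: "\<bar>g x\<bar> \<le> C" if "g \<in> ?T n" "x \<in> K" for g n x
  proof -
    have "g x \<le> C" "- C \<le> g x"
      using that bd[OF that(2)] unfolding tail_hull_def by (auto simp: abs_le_iff minus_le_iff)
    then show ?thesis by linarith
  qed
  have bddS: "bdd_above (u ` K)" if "continuous_on K u" for u :: "'v \<Rightarrow> real"
    using compact_continuous_image[OF that K] by (simp add: compact_imp_bounded bounded_imp_bdd_above)
  have cT: "continuous_on K u" if "u \<in> ?T n" for u n using that by (simp add: tail_hull_def)
  have up: "u x \<le> S u" if "continuous_on K u" "x \<in> K" for u x
    unfolding S_def using cSUP_upper[OF that(2) bddS[OF that(1)]] .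
  have good_ex: "\<exists>g. good n h g" if h: "continuous_on K h" for n h
  proof -
    have "\<exists>s\<in>?T n. \<forall>s'\<in>?T n. S (\<lambda>x. h x + (1/2)^n * s x)
        \<le> S (\<lambda>x. h x + (1/2)^n * s' x) + d/4 * (1/4)^n"
    proof (rule near_minimizer[where B = "h x0 - C"])
      show "?T n \<noteq> {}" using fT by blast
      show "0 < d/4 * (1/4)^n" using x0 by simp
      fix s assume s: "s \<in> ?T n"
      have C0: "0 \<le> C" using bd[OF x0(1), of 0] by linarith
      have "(1/2)^n * \<bar>s x0\<bar> \<le> 1 * C"
        using Tb[OF s x0(1)] C0 by (intro mult_mono) (auto simp: power_le_one)
      then have "\<bar>(1/2)^n * s x0\<bar> \<le> C" by (simp add: abs_mult)
      moreover have "h x0 + (1/2)^n * s x0 \<le> S (\<lambda>x. h x + (1/2)^n * s x)"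
        by (rule up[of "\<lambda>x. h x + (1/2)^n * s x"]) (use h cT[OF s] x0 in \<open>auto intro!: continuous_intros\<close>)
      ultimately show "h x0 - C \<le> S (\<lambda>x. h x + (1/2)^n * s x)" by linarith
    qed
    then show ?thesis unfolding good_def by blast
  qed
  have hg: "continuous_on K (hs n) \<and> good n (hs n) (g n)" for n
  proof (induction n)
    case 0
    have "continuous_on K (hs 0)" by (simp add: hs0)
    then show ?case using someI_ex[OF good_ex] by (simp add: g_def p_def)
  next
    case (Suc n)
    then have "g n \<in> ?T n" by (simp add: good_def)
    then have "continuous_on K (hs (Suc n))"
      using Suc cT unfolding hsS by (auto intro!: continuous_intros)
    then show ?case using someI_ex[OF good_ex] by (simp add: g_def p_def)
  qed
  have gT: "g n \<in> ?T n" for n using hg by (simp add: good_def)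
  \<comment> \<open>These are the tails of the series, rescaled to total weight 1: on
    \<open>K\<close>, the function \<open>tl 0\<close> equals \<open>hs n + (1/2)^n * tl n\<close>
    for every \<open>n\<close>. The point \<open>e\<close> below is one where \<open>tl 0\<close> is
    maximal.\<close>
  define tl where "tl n = (\<lambda>x. \<Sum>j. (1/2) ^ Suc j * g (n + j) x)" for n
  have tT: "tl n \<in> ?T n" for n
    unfolding tl_def using tail_hull_sigma_convex(1)[where g="\<lambda>j. g (n + j)" and n=n and K=K and f=f]
      gT tail_hull_antimono[of n] bd by (meson le_add1 subsetD)
  have tsm: "summable (\<lambda>j. (1/2) ^ Suc j * g (n + j) x)" if "x \<in> K" for n x
    using tail_hull_sigma_convex(2)[where g="\<lambda>j. g (n + j)" and n=n and K=K and f=f]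
      gT tail_hull_antimono[of n] bd that by (meson le_add1 subsetD)
  have tl_step: "tl n x = 1/2 * g n x + 1/2 * tl (Suc n) x" if "x \<in> K" for n x
  proof -
    have "tl n x = (1/2) ^ Suc 0 * g (n + 0) x + (\<Sum>j. (1/2) ^ Suc (Suc j) * g (n + Suc j) x)"
      unfolding tl_def using suminf_split_head[OF tsm[OF that, of n]] by simp
    also have "(\<Sum>j. (1/2) ^ Suc (Suc j) * g (n + Suc j) x) = 1/2 * tl (Suc n) x"
      unfolding tl_def using suminf_mult[OF tsm[OF that, of "Suc n"], of "1/2"] by (simp add: mult.assoc)
    finally show ?thesis by simp
  qed
  have split: "tl 0 x = hs n x + (1/2) ^ n * tl n x" if "x \<in> K" for n x
  proof (induction n)
    case (Suc n)
    then show ?case using tl_step[OF that, of n] by (simp add: hsS algebra_simps)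
  qed (simp add: hs0)
  obtain e where e: "e \<in> B" "\<forall>x\<in>K. tl 0 x \<le> tl 0 e"
    using bdry[of "tl 0"] tT[of 0] by (auto simp: tail_hull_def)
  have eK: "e \<in> K" using e B by blast
  have "S (tl 0) \<le> tl 0 e" unfolding S_def using e x0 by (intro cSUP_least) auto
  have tl0: "d \<le> tl 0 e"
  proof -
    have "d \<le> tl 0 x0" using x0 tT[of 0] by (simp add: tail_hull_def)
    then show ?thesis using e(2) x0(1) by fastforce
  qed
  \<comment> \<open>The tail \<open>tl n\<close> competes with the near-minimizer
    \<open>g n\<close>. Inserting it turns the function into \<open>tl 0\<close>, whose supremum
    does not exceed its value at \<open>e\<close>.\<close>
  have step: "hs n e + (1/2)^n * g n e \<le> tl 0 e + d/4 * (1/4)^n" for n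
  proof -
    have "hs n e + (1/2)^n * g n e \<le> S (\<lambda>x. hs n x + (1/2)^n * g n x)"
      by (rule up[of "\<lambda>x. hs n x + (1/2)^n * g n x"])
         (use hg[of n] cT[OF gT] eK in \<open>auto intro!: continuous_intros\<close>)
    also have "\<dots> \<le> S (\<lambda>x. hs n x + (1/2)^n * tl n x) + d/4 * (1/4)^n"
      using hg[of n] tT[of n] by (simp add: good_def)
    also have "S (\<lambda>x. hs n x + (1/2)^n * tl n x) = S (tl 0)"
      unfolding S_def using split by (intro SUP_cong) auto
    finally show ?thesis using \<open>S (tl 0) \<le> tl 0 e\<close> by linarith
  qed
  \<comment> \<open>Multiplication by powers of 2 makes the recursion for \<open>hs\<close>
    telescope: each new term is the previous one plus \<open>2^m\<close> times the left side of
    \<open>step\<close>. The errors form a geometric series.\<close>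
  have tele: "2 ^ m * hs m e \<le> (2 ^ m - 1) * tl 0 e + d/2 * (1 - (1/2) ^ m)" for m
  proof (induction m)
    case (Suc m)
    have "2 ^ Suc m * hs (Suc m) e = 2 ^ m * hs m e + 2 ^ m * (hs m e + (1/2) ^ m * g m e)"
      by (simp add: hsS algebra_simps power_divide)
    also have "\<dots> \<le> (2 ^ m - 1) * tl 0 e + d/2 * (1 - (1/2) ^ m) + 2 ^ m * (tl 0 e + d/4 * (1/4)^m)"
      by (intro add_mono Suc mult_left_mono step) auto
    also have "\<dots> = (2 ^ Suc m - 1) * tl 0 e + d/2 * (1 - (1/2) ^ Suc m)"
    proof -
      have "(2::real) ^ m * (1/4) ^ m = (1/2) ^ m" by (simp add: power_mult_distrib[symmetric])
      then show ?thesis by (simp add: algebra_simps)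
    qed
    finally show ?case .
  qed (simp add: hs0)
  \<comment> \<open>Solving \<open>split\<close> for the tail loses at most \<open>d/2\<close> of
    the value \<open>tl 0 e\<close>, which is at least \<open>d\<close>, and this uniformly in
    \<open>m\<close>.\<close>
  have tail: "d / 2 \<le> tl m e" for m
  proof -
    have "tl m e = 2 ^ m * tl 0 e - 2 ^ m * hs m e"
      unfolding split[OF eK, of m] by (simp add: algebra_simps power_divide)
    also have "\<dots> \<ge> tl 0 e - d/2 * (1 - (1/2) ^ m)"
      using tele[of m] by (simp add: algebra_simps)
    finally have "tl 0 e - d/2 * (1 - (1/2) ^ m) \<le> tl m e" .
    moreover have "d/2 * (1 - (1/2) ^ m) \<le> d/2 * 1" using x0(3) by (intro mult_left_mono) auto
    ultimately show ?thesis using tl0 by linarith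
  qed
  have "\<exists>k\<ge>m. d / 4 < f k e" for m
  proof (rule ccontr)
    assume "\<not> ?thesis"
    then have "\<forall>k\<ge>m. f k e \<le> d / 4" by (simp add: not_less)
    then have "tl m e \<le> d / 4" using tT[of m] eK unfolding tail_hull_def by blast
    then show False using tail[of m] x0(3) by linarith
  qed
  then show ?thesis using e(1) by blast
qed

section \<open>Positive definite functions\<close>

text \<open>A list of pairs (coefficient, element) stands for the finitely supported function which
  is the sum of the corresponding weighted point masses.\<close>

definition over :: "'a set \<Rightarrow> (complex \<times> 'a) list set" where
  "over S = {u. snd ` set u \<subseteq> S}"

definition lsum :: "('a \<Rightarrow> complex) \<Rightarrow> (complex \<times> 'a) list \<Rightarrow> complex" where
  "lsum f u = (\<Sum>(a, g)\<leftarrow>u. a * f g)"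

definition lscale :: "complex \<Rightarrow> (complex \<times> 'a) list \<Rightarrow> (complex \<times> 'a) list" where
  "lscale c u = map (\<lambda>(a, g). (c * a, g)) u"

lemma over_simps [simp]:
  "[] \<in> over S" "(p # u \<in> over S) = (snd p \<in> S \<and> u \<in> over S)"
  "(u @ v \<in> over S) = (u \<in> over S \<and> v \<in> over S)"
  "(lscale c u \<in> over S) = (u \<in> over S)"
  by (auto simp: over_def lscale_def case_prod_unfold image_image)

lemma concat_over: "(\<And>u. u \<in> set us \<Longrightarrow> u \<in> over S) \<Longrightarrow> concat us \<in> over S"
  by (induction us) auto

lemma overD: "u \<in> over S \<Longrightarrow> (a, g) \<in> set u \<Longrightarrow> g \<in> S"
  by (force simp: over_def)

lemma lsum_simps [simp]:
  "lsum f [] = 0" "lsum f ((a, g) # u) = a * f g + lsum f u"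
  "lsum f (u @ v) = lsum f u + lsum f v"
  "lsum f (lscale c u) = c * lsum f u"
  by (simp_all add: lsum_def lscale_def o_def case_prod_unfold sum_list_const_mult mult.assoc)

lemma lsum_concat: "lsum f (concat us) = (\<Sum>u\<leftarrow>us. lsum f u)"
  by (induction us) auto

lemma lsum_cong: "u \<in> over S \<Longrightarrow> (\<And>g. g \<in> S \<Longrightarrow> f g = h g) \<Longrightarrow> lsum f u = lsum h u"
  by (induction u) auto

lemma lsum_add: "lsum (\<lambda>g. f g + h g) u = lsum f u + lsum h u"
  by (induction u) (auto simp: algebra_simps)

lemma lsum_cmult: "lsum (\<lambda>g. c * f g) u = c * lsum f u"
  by (induction u) (auto simp: algebra_simps)

lemma lsum_zero [simp]: "lsum (\<lambda>g. 0) u = 0"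
  by (induction u) auto

text \<open>A list may repeat a group element; the inner sum collects its coefficients, which links
  lists to the sums over finite sets in \<open>PD1\<close>.\<close>

lemma lsum_eq_sum:
  assumes "finite F" "u \<in> over F"
  shows "lsum f u = (\<Sum>g\<in>F. (\<Sum>(a, h)\<leftarrow>u. if h = g then a else 0) * f g)"
  using assms(2)
proof (induction u)
  case (Cons p u)
  obtain a h where p: "p = (a, h)" by force
  have "(\<Sum>g\<in>F. (if h = g then a else 0) * f g) = a * f h"
    using Cons assms p by (simp add: if_distrib[of "\<lambda>x. x * _"] sum.delta cong: if_cong)
  then show ?case using Cons by (simp add: p distrib_right sum.distrib)
qed simp

text \<open>The quadratic is minimal at \<open>t = - b / c\<close>; when \<open>c = 0\<close> it is
  affine, and a nonzero slope would make it negative somewhere. The Cauchy-Schwarz inequalities for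
  forms and for square-summable families both rest on this.\<close>

lemma discriminant_le:
  fixes a b c :: real
  assumes q: "\<And>t. 0 \<le> a + 2 * t * b + t\<^sup>2 * c" and "0 \<le> c"
  shows "b\<^sup>2 \<le> a * c"
proof (cases "c = 0")
  case True
  have "b = 0"
  proof (rule ccontr)
    assume "b \<noteq> 0"
    have "0 \<le> a + 2 * (- (a + 1) / (2 * b)) * b" using q[of "- (a + 1) / (2 * b)"] True by simp
    also have "\<dots> = -1" using \<open>b \<noteq> 0\<close> by (simp add: field_simps)
    finally show False by simp
  qed
  then show ?thesis using True by simp
next
  case False
  then have c: "0 < c" using assms(2) by simp
  have "0 \<le> c * (a + 2 * (- b / c) * b + (- b / c)\<^sup>2 * c)"
    by (rule mult_nonneg_nonneg[OF assms(2) q])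
  also have "\<dots> = a * c - b\<^sup>2" using c by (simp add: field_simps power2_eq_square)
  finally show ?thesis by simp
qed

context group
begin

section \<open>The sesquilinear form of a positive definite function\<close>

definition ltrans :: "'a \<Rightarrow> (complex \<times> 'a) list \<Rightarrow> (complex \<times> 'a) list" where
  "ltrans q u = map (\<lambda>(a, g). (a, q \<otimes> g)) u"

text \<open>This is the GNS inner product, possibly degenerate, of two finitely supported functions.
  Neither quotient nor completion is formed: \<open>u @ v\<close> and \<open>lscale c u\<close> play
  the role of the vector operations, and \<open>ltrans\<close> that of the representation.\<close>

definition form :: "('a \<Rightarrow> complex) \<Rightarrow> (complex \<times> 'a) list \<Rightarrow> (complex \<times> 'a) list \<Rightarrow> complex" where
  "form \<omega> u v = lsum (\<lambda>g. \<Sum>(b, h)\<leftarrow>v. cnj b * \<omega> (inv h \<otimes> g)) u"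

definition posdef :: "('a \<Rightarrow> complex) \<Rightarrow> bool" where
  "posdef \<omega> \<longleftrightarrow> (\<forall>u\<in>over (carrier G). form \<omega> u u \<in> \<real>\<^sub>\<ge>\<^sub>0)"

definition nrm2 :: "('a \<Rightarrow> complex) \<Rightarrow> (complex \<times> 'a) list \<Rightarrow> real" where
  "nrm2 \<omega> u = Re (form \<omega> u u)"

lemma ltrans_over [simp]: "q \<in> carrier G \<Longrightarrow> u \<in> over (carrier G) \<Longrightarrow> ltrans q u \<in> over (carrier G)"
  by (auto simp: over_def ltrans_def case_prod_unfold)

lemma form_left [simp]:
  "form \<omega> [] v = 0" "form \<omega> (u @ u') v = form \<omega> u v + form \<omega> u' v"
  "form \<omega> (lscale c u) v = c * form \<omega> u v"
  by (simp_all add: form_def)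

lemma form_concat_left: "form \<omega> (concat us) v = (\<Sum>u\<leftarrow>us. form \<omega> u v)"
  by (simp add: form_def lsum_concat)

lemma form_right [simp]:
  "form \<omega> u [] = 0" "form \<omega> u (v @ v') = form \<omega> u v + form \<omega> u v'"
  "form \<omega> u (lscale c v) = cnj c * form \<omega> u v"
  by (simp_all add: form_def lscale_def lsum_add o_def case_prod_unfold mult.assoc sum_list_const_mult lsum_cmult)

lemma form_concat_right: "form \<omega> u (concat vs) = (\<Sum>v\<leftarrow>vs. form \<omega> u v)"
  by (induction vs) auto

lemma form_single: "form \<omega> [(a, g)] [(b, h)] = a * cnj b * \<omega> (inv h \<otimes> g)"
  by (simp add: form_def)

lemma form_Cons_left: "form \<omega> (p # u) v = form \<omega> [p] v + form \<omega> u v"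
  using form_left(2)[of \<omega> "[p]" u v] by simp

lemma form_Cons_right: "form \<omega> u (p # v) = form \<omega> u [p] + form \<omega> u v"
  using form_right(2)[of \<omega> u "[p]" v] by simp

lemma form_unit:
  assumes "u \<in> over (carrier G)" shows "form \<omega> u [(1, \<one>)] = lsum \<omega> u"
  unfolding form_def by (rule lsum_cong[OF assms]) simp

lemma form_cong:
  assumes "u \<in> over (carrier G)" "v \<in> over (carrier G)" "\<And>g. g \<in> carrier G \<Longrightarrow> \<omega> g = \<omega>' g"
  shows "form \<omega> u v = form \<omega>' u v"
  unfolding form_def
proof (rule lsum_cong[OF assms(1)])
  fix g assume g: "g \<in> carrier G"
  show "(\<Sum>(b, h)\<leftarrow>v. cnj b * \<omega> (inv h \<otimes> g)) = (\<Sum>(b, h)\<leftarrow>v. cnj b * \<omega>' (inv h \<otimes> g))"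
    using assms(2,3) g by (intro arg_cong[where f=sum_list] map_cong refl) (auto dest: overD)
qed

lemma posdef_cong:
  assumes "\<And>g. g \<in> carrier G \<Longrightarrow> \<omega> g = \<omega>' g"
  shows "posdef \<omega> = posdef \<omega>'"
  using form_cong[OF _ _ assms] by (simp add: posdef_def)

lemma form_fun_add: "form (\<lambda>g. \<omega> g + \<omega>' g) u v = form \<omega> u v + form \<omega>' u v"
  unfolding form_def lsum_add[symmetric]
  by (simp add: case_prod_unfold distrib_left sum_list_addf)

lemma form_fun_cmult: "form (\<lambda>g. c * \<omega> g) u v = c * form \<omega> u v"
  unfolding form_def lsum_cmult[symmetric]
  by (simp add: case_prod_unfold sum_list_const_mult[symmetric] mult.left_commute)

lemma posdef_add: "posdef \<omega> \<Longrightarrow> posdef \<omega>' \<Longrightarrow> posdef (\<lambda>g. \<omega> g + \<omega>' g)"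
  by (auto simp: posdef_def form_fun_add complex_nonneg_Reals_iff)

lemma posdef_cmult: "0 \<le> c \<Longrightarrow> posdef \<omega> \<Longrightarrow> posdef (\<lambda>g. of_real c * \<omega> g)"
  by (auto simp: posdef_def form_fun_cmult complex_nonneg_Reals_iff)

text \<open>The kernel \<open>\<omega> (inv h \<otimes> g)\<close> is unchanged when both arguments
  are translated, so the adjoint of a translation is the translation by the inverse.\<close>

lemma form_ltrans_swap:
  assumes "q \<in> carrier G" "u \<in> over (carrier G)" "v \<in> over (carrier G)"
  shows "form \<omega> (ltrans q u) v = form \<omega> u (ltrans (inv q) v)"
proof -
  have "form \<omega> (ltrans q u) v = lsum (\<lambda>g. \<Sum>(b, h)\<leftarrow>v. cnj b * \<omega> (inv h \<otimes> (q \<otimes> g))) u"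
    by (simp add: form_def ltrans_def lsum_def o_def case_prod_unfold)
  also have "\<dots> = form \<omega> u (ltrans (inv q) v)"
    unfolding form_def
  proof (rule lsum_cong[OF assms(2)])
    fix g assume g: "g \<in> carrier G"
    show "(\<Sum>(b, h)\<leftarrow>v. cnj b * \<omega> (inv h \<otimes> (q \<otimes> g)))
        = (\<Sum>(b, h)\<leftarrow>ltrans (inv q) v. cnj b * \<omega> (inv h \<otimes> g))"
      using assms g unfolding ltrans_def map_map o_def case_prod_unfold
      by (intro arg_cong[where f=sum_list] map_cong refl)
         (auto dest: overD simp: case_prod_unfold inv_mult_group m_assoc)
  qed
  finally show ?thesis .
qed

lemma ltrans_ltrans:
  assumes "q \<in> carrier G" "p \<in> carrier G" "u \<in> over (carrier G)"
  shows "ltrans p (ltrans q u) = ltrans (p \<otimes> q) u"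
  using assms by (auto simp: ltrans_def case_prod_unfold m_assoc over_def)

lemma ltrans_one [simp]: "u \<in> over (carrier G) \<Longrightarrow> ltrans \<one> u = u"
  unfolding ltrans_def by (rule map_idI) (auto dest: overD)

lemma form_ltrans:
  assumes "q \<in> carrier G" "u \<in> over (carrier G)" "v \<in> over (carrier G)"
  shows "form \<omega> (ltrans q u) (ltrans q v) = form \<omega> u v"
  using assms by (simp add: form_ltrans_swap ltrans_ltrans)

text \<open>Positivity is tested on combinations of the point masses at \<open>\<one>\<close> and
  \<open>g\<close> with coefficients 1 and \<open>c\<close>. The vanishing of the imaginary parts
  for \<open>c\<close> equal to 0, 1 and \<open>\<i>\<close> determines both components.\<close>

lemma posdef_inv:
  assumes "posdef \<omega>" "g \<in> carrier G" shows "\<omega> (inv g) = cnj (\<omega> g)"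
proof -
  have "form \<omega> [(1, \<one>), (c, g)] [(1, \<one>), (c, g)] \<in> \<real>\<^sub>\<ge>\<^sub>0" for c
    using assms by (auto simp: posdef_def)
  then have *: "\<omega> \<one> + cnj c * \<omega> (inv g) + (c * \<omega> g + c * cnj c * \<omega> \<one>) \<in> \<real>\<^sub>\<ge>\<^sub>0" for c
    using assms(2) by (simp add: form_def algebra_simps)
  have 0: "Im (\<omega> \<one>) = 0" using *[of 0] by (simp add: complex_nonneg_Reals_iff)
  have 1: "Im (\<omega> (inv g)) + Im (\<omega> g) = 0" using *[of 1] 0 by (simp add: complex_nonneg_Reals_iff)
  have 2: "Re (\<omega> g) - Re (\<omega> (inv g)) = 0" using *[of \<i>] 0 by (simp add: complex_nonneg_Reals_iff)
  show ?thesis using 1 2 by (simp add: complex_eq_iff)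
qed

lemma form_hermitian:
  assumes "posdef \<omega>" "u \<in> over (carrier G)" "v \<in> over (carrier G)"
  shows "form \<omega> v u = cnj (form \<omega> u v)"
  using assms(2)
proof (induction u)
  case (Cons p u)
  obtain a g where p: "p = (a, g)" by force
  have g: "g \<in> carrier G" using Cons p by simp
  have "form \<omega> v [(a, g)] = cnj (form \<omega> [(a, g)] v)"
    using assms(3)
  proof (induction v)
    case (Cons p' v)
    obtain b h where p': "p' = (b, h)" by force
    have h: "h \<in> carrier G" using Cons p' by simp
    have "form \<omega> [(b, h)] [(a, g)] = cnj (form \<omega> [(a, g)] [(b, h)])"
      using posdef_inv[OF assms(1), of "inv h \<otimes> g"] g h by (simp add: form_single inv_mult_group)
    then show ?case using Cons form_Cons_left[of \<omega> p' v] form_Cons_right[of \<omega> _ p' v] p' by simp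
  qed simp
  then show ?case using Cons form_Cons_left[of \<omega> p u] form_Cons_right[of \<omega> _ p u] p by simp
qed simp

lemma nrm2_nonneg: "posdef \<omega> \<Longrightarrow> u \<in> over (carrier G) \<Longrightarrow> 0 \<le> nrm2 \<omega> u"
  by (auto simp: posdef_def nrm2_def complex_nonneg_Reals_iff)

lemma nrm2_add:
  assumes "posdef \<omega>" "u \<in> over (carrier G)" "v \<in> over (carrier G)"
  shows "nrm2 \<omega> (u @ v) = nrm2 \<omega> u + 2 * Re (form \<omega> u v) + nrm2 \<omega> v"
  using form_hermitian[OF assms] by (simp add: nrm2_def)

lemma nrm2_lscale: "nrm2 \<omega> (lscale c u) = (cmod c)\<^sup>2 * nrm2 \<omega> u"
proof -
  have "form \<omega> (lscale c u) (lscale c u) = (c * cnj c) * form \<omega> u u" by simp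
  also have "\<dots> = of_real ((cmod c)\<^sup>2) * form \<omega> u u" by (simp only: complex_norm_square)
  finally show ?thesis unfolding nrm2_def by (metis Re_complex_of_real Im_complex_of_real complex.sel(1) times_complex.simps(1) mult_zero_left diff_zero)
qed

lemma nrm2_ltrans:
  "q \<in> carrier G \<Longrightarrow> u \<in> over (carrier G) \<Longrightarrow> nrm2 \<omega> (ltrans q u) = nrm2 \<omega> u"
  by (simp add: nrm2_def form_ltrans)

lemma form_CS_Re:
  assumes "posdef \<omega>" "u \<in> over (carrier G)" "v \<in> over (carrier G)"
  shows "(Re (form \<omega> u v))\<^sup>2 \<le> nrm2 \<omega> u * nrm2 \<omega> v"
proof (rule discriminant_le)
  fix t :: real
  have "0 \<le> nrm2 \<omega> (u @ lscale (of_real t) v)" using assms by (intro nrm2_nonneg) auto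
  then show "0 \<le> nrm2 \<omega> u + 2 * t * Re (form \<omega> u v) + t\<^sup>2 * nrm2 \<omega> v"
    using assms by (simp add: nrm2_add nrm2_lscale)
qed (rule nrm2_nonneg[OF assms(1,3)])

lemma form_CS_Re_sqrt:
  assumes "posdef \<omega>" "u \<in> over (carrier G)" "v \<in> over (carrier G)"
  shows "Re (form \<omega> u v) \<le> sqrt (nrm2 \<omega> u) * sqrt (nrm2 \<omega> v)"
  using form_CS_Re[OF assms] by (metis real_le_rsqrt real_sqrt_mult)

lemma nrm_triangle:
  assumes "posdef \<omega>" "u \<in> over (carrier G)" "v \<in> over (carrier G)"
  shows "sqrt (nrm2 \<omega> (u @ v)) \<le> sqrt (nrm2 \<omega> u) + sqrt (nrm2 \<omega> v)"
proof (rule real_le_lsqrt)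
  show "nrm2 \<omega> (u @ v) \<le> (sqrt (nrm2 \<omega> u) + sqrt (nrm2 \<omega> v))\<^sup>2"
    using form_CS_Re_sqrt[OF assms] nrm2_nonneg[OF assms(1,2)] nrm2_nonneg[OF assms(1,3)]
    by (simp add: nrm2_add[OF assms] power2_sum)
qed (use assms nrm2_nonneg in auto)

lemma nrm_concat:
  assumes "posdef \<omega>" "\<And>u. u \<in> set us \<Longrightarrow> u \<in> over (carrier G)"
  shows "sqrt (nrm2 \<omega> (concat us)) \<le> (\<Sum>u\<leftarrow>us. sqrt (nrm2 \<omega> u))"
  using assms(2)
proof (induction us)
  case (Cons u us)
  have "sqrt (nrm2 \<omega> (u @ concat us)) \<le> sqrt (nrm2 \<omega> u) + sqrt (nrm2 \<omega> (concat us))"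
    using Cons by (intro nrm_triangle assms(1)) (auto intro: concat_over)
  then show ?case using Cons by fastforce
qed (simp add: nrm2_def)

lemma posdef_bound:
  assumes "posdef \<omega>" "g \<in> carrier G" shows "cmod (\<omega> g) \<le> Re (\<omega> \<one>)"
proof (cases "\<omega> g = 0")
  case True
  then show ?thesis using nrm2_nonneg[OF assms(1), of "[(1, \<one>)]"] by (simp add: nrm2_def form_single)
next
  case False
  \<comment> \<open>The phase \<open>c\<close> makes \<open>c * \<omega> g\<close> equal to
    \<open>cmod (\<omega> g)\<close>, so that the Cauchy-Schwarz inequality for real parts bounds
    the modulus.\<close>
  define c where "c = cnj (\<omega> g) / cmod (\<omega> g)"
  have c: "cmod c = 1" using False by (simp add: c_def norm_divide)
  have "c * \<omega> g = of_real (cmod (\<omega> g))"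
  proof -
    have "\<omega> g * cnj (\<omega> g) = of_real (cmod (\<omega> g)) * of_real (cmod (\<omega> g))"
      using complex_norm_square[of "\<omega> g"] by (simp add: power2_eq_square)
    then show ?thesis using False by (simp add: c_def mult.commute)
  qed
  moreover have "form \<omega> [(c, g)] [(1, \<one>)] = c * \<omega> g" using assms by (simp add: form_single)
  moreover have "nrm2 \<omega> [(c, g)] = Re (\<omega> \<one>)"
    using assms c complex_norm_square[of c] by (simp add: nrm2_def form_single)
  moreover have "nrm2 \<omega> [(1, \<one>)] = Re (\<omega> \<one>)" by (simp add: nrm2_def form_single)
  moreover have "0 \<le> nrm2 \<omega> [(1, \<one>)]" using assms by (intro nrm2_nonneg) auto
  moreover have "(Re (form \<omega> [(c, g)] [(1, \<one>)]))\<^sup>2 \<le> nrm2 \<omega> [(c, g)] * nrm2 \<omega> [(1, \<one>)]"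
    using assms by (intro form_CS_Re) auto
  ultimately show ?thesis by (metis Re_complex_of_real power2_eq_square power2_le_imp_le)
qed

section \<open>Symmetric random walks\<close>

text \<open>Repeated entries count with multiplicity in the average, so equality of multisets is
  what makes the averaging operator self-adjoint.\<close>

definition symmetric_list :: "'a list \<Rightarrow> bool" where
  "symmetric_list qs \<longleftrightarrow> qs \<noteq> [] \<and> set qs \<subseteq> carrier G \<and> mset (map (m_inv G) qs) = mset qs"

definition avg :: "'a list \<Rightarrow> (complex \<times> 'a) list \<Rightarrow> (complex \<times> 'a) list" where
  "avg qs u = concat (map (\<lambda>q. lscale (1 / of_nat (length qs)) (ltrans q u)) qs)"

definition walk :: "'a list \<Rightarrow> nat \<Rightarrow> (complex \<times> 'a) list" where
  "walk qs m = (avg qs ^^ m) [(1, \<one>)]"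

text \<open>The list \<open>walk qs m\<close> is the distribution after \<open>m\<close> steps of
  the random walk with uniform steps from \<open>qs\<close>. The mean of \<open>\<omega>\<close>
  against it is the \<open>m\<close>-th moment of the averaging operator at the cyclic vector of
  \<open>\<omega>\<close>, so exponential decay expresses a spectral gap.\<close>

definition walk_mean :: "'a list \<Rightarrow> nat \<Rightarrow> ('a \<Rightarrow> complex) \<Rightarrow> real" where
  "walk_mean qs m \<omega> = Re (lsum \<omega> (walk qs m))"

lemma symmetric_listI: "l \<noteq> [] \<Longrightarrow> set l \<subseteq> carrier G \<Longrightarrow> symmetric_list (l @ map (m_inv G) l)"
proof -
  assume l: "l \<noteq> []" "set l \<subseteq> carrier G"
  then have "map (m_inv G) (map (m_inv G) l) = l" by (auto intro!: map_idI simp: o_def)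
  then show ?thesis using l by (auto simp: symmetric_list_def simp del: map_map)
qed

lemma symmetric_list_sum:
  assumes "symmetric_list qs"
  shows "(\<Sum>q\<leftarrow>qs. f (inv q)) = (\<Sum>q\<leftarrow>qs. (f q :: 'x::comm_monoid_add))"
proof -
  have "(\<Sum>q\<leftarrow>qs. f (inv q)) = sum_mset (image_mset f (mset (map (m_inv G) qs)))"
    by (simp only: mset_map[symmetric] sum_mset_sum_list map_map o_def)
  also have "\<dots> = sum_mset (image_mset f (mset qs))"
    using assms by (simp only: symmetric_list_def)
  also have "\<dots> = (\<Sum>q\<leftarrow>qs. f q)"
    by (simp only: mset_map[symmetric] sum_mset_sum_list)
  finally show ?thesis .
qed

lemma avg_over: "set qs \<subseteq> carrier G \<Longrightarrow> u \<in> over (carrier G) \<Longrightarrow> avg qs u \<in> over (carrier G)"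
  unfolding avg_def by (intro concat_over) auto

lemma walk_over: "set qs \<subseteq> carrier G \<Longrightarrow> walk qs m \<in> over (carrier G)"
  unfolding walk_def by (induction m) (auto simp: avg_over)

lemma form_avg:
  assumes "symmetric_list qs" "u \<in> over (carrier G)" "v \<in> over (carrier G)"
  shows "form \<omega> (avg qs u) v = form \<omega> u (avg qs v)"
proof -
  let ?c = "1 / of_nat (length qs) :: complex"
  have "form \<omega> (avg qs u) v = (\<Sum>q\<leftarrow>qs. ?c * form \<omega> (ltrans q u) v)"
    by (simp add: avg_def form_concat_left o_def)
  also have "\<dots> = (\<Sum>q\<leftarrow>qs. ?c * form \<omega> u (ltrans (inv q) v))"
    using assms form_ltrans_swap unfolding symmetric_list_def
    by (intro arg_cong[where f=sum_list] map_cong refl) (auto simp: subset_iff)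
  also have "\<dots> = (\<Sum>q\<leftarrow>qs. ?c * form \<omega> u (ltrans q v))"
    by (rule symmetric_list_sum[OF assms(1)])
  also have "\<dots> = form \<omega> u (avg qs v)"
    by (simp add: avg_def form_concat_right o_def)
  finally show ?thesis .
qed

text \<open>By self-adjointness of \<open>avg\<close>, steps can be shifted from the right entry to
  the left one, so only the total number of steps matters. In particular even moments are squared
  norms.\<close>

lemma form_walk:
  assumes "symmetric_list qs"
  shows "form \<omega> (walk qs m) (walk qs n) = lsum \<omega> (walk qs (m + n))"
proof -
  have c: "set qs \<subseteq> carrier G" using assms by (simp add: symmetric_list_def)
  show ?thesis
  proof (induction n arbitrary: m)
    case 0
    then show ?case using form_unit[OF walk_over[OF c], of \<omega> m] by (simp add: walk_def)
  next
    case (Suc n)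
    have "form \<omega> (walk qs m) (walk qs (Suc n)) = form \<omega> (walk qs m) (avg qs (walk qs n))"
      by (simp add: walk_def)
    also have "\<dots> = form \<omega> (avg qs (walk qs m)) (walk qs n)"
      using form_avg[OF assms walk_over[OF c] walk_over[OF c]] by simp
    also have "avg qs (walk qs m) = walk qs (Suc m)" by (simp add: walk_def)
    finally show ?case using Suc[of "Suc m"] by simp
  qed
qed

lemma walk_mean_even: "symmetric_list qs \<Longrightarrow> walk_mean qs (2 * m) \<omega> = nrm2 \<omega> (walk qs m)"
  using form_walk[of qs \<omega> m m] by (simp add: walk_mean_def nrm2_def mult_2)

lemma walk_mean_square:
  assumes "symmetric_list qs" "posdef \<omega>"
  shows "(walk_mean qs m \<omega>)\<^sup>2 \<le> Re (\<omega> \<one>) * walk_mean qs (2 * m) \<omega>"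
proof -
  have c: "set qs \<subseteq> carrier G" using assms by (simp add: symmetric_list_def)
  have "(Re (form \<omega> (walk qs m) [(1, \<one>)]))\<^sup>2 \<le> nrm2 \<omega> (walk qs m) * nrm2 \<omega> [(1, \<one>)]"
    by (rule form_CS_Re[OF assms(2) walk_over[OF c]]) simp
  then show ?thesis
    using form_unit[OF walk_over[OF c]] walk_mean_even[OF assms(1)]
    by (simp add: walk_mean_def nrm2_def form_single mult.commute)
qed

text \<open>Only even times are compared, because there the mean of the positive definite difference
  is a squared norm.\<close>

lemma walk_mean_diff:
  assumes "symmetric_list qs" "posdef (\<lambda>g. \<omega>' g - \<omega> g)"
  shows "walk_mean qs (2 * m) \<omega> \<le> walk_mean qs (2 * m) \<omega>'"
proof -
  have "0 \<le> walk_mean qs (2 * m) (\<lambda>g. \<omega>' g - \<omega> g)"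
    using assms walk_over unfolding walk_mean_even[OF assms(1)]
    by (intro nrm2_nonneg) (auto simp: symmetric_list_def)
  moreover have "lsum (\<lambda>g. \<omega>' g - \<omega> g) u = lsum \<omega>' u - lsum \<omega> u" for u
    by (induction u) (auto simp: algebra_simps)
  ultimately show ?thesis by (simp add: walk_mean_def)
qed

text \<open>Iterating Cauchy--Schwarz removes the constant \<open>C\<close>.\<close>

lemma walk_mean_power_trick:
  assumes qs: "symmetric_list qs" and w: "posdef \<omega>" and r: "0 < r"
    and C: "\<And>m. walk_mean qs (2 * m) \<omega> \<le> C * r ^ (2 * m)"
  shows "walk_mean qs m \<omega> \<le> r ^ m * Re (\<omega> \<one>)"
proof (rule ccontr)
  assume "\<not> ?thesis"
  then have gt: "r ^ m * Re (\<omega> \<one>) < walk_mean qs m \<omega>" by simp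
  define n where "n = Re (\<omega> \<one>)"
  have "0 \<le> n" using posdef_bound[OF w one_closed] norm_ge_zero order_trans unfolding n_def by blast
  have pos: "0 < walk_mean qs m \<omega>" using gt \<open>0 \<le> n\<close> r n_def
    by (smt (verit) mult_nonneg_nonneg zero_le_power)
  have "n \<noteq> 0" using walk_mean_square[OF qs w, of m] pos unfolding n_def by auto
  then have n: "0 < n" using \<open>0 \<le> n\<close> by simp
  define x where "x = walk_mean qs m \<omega> / (r ^ m * n)"
  have x: "1 < x" using gt n r by (simp add: x_def n_def)
  have wm: "walk_mean qs m \<omega> = x * (r ^ m * n)" using n r by (simp add: x_def)
  \<comment> \<open>Each use of \<open>walk_mean_square\<close> doubles the time and squares the
    ratio \<open>x\<close> by which the claimed bound is exceeded; the resulting growth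
    \<open>x ^ (2 ^ k)\<close> is incompatible with any constant \<open>C\<close>.\<close>
  have key: "x ^ (2 ^ k) * (r ^ (2 ^ k * m) * n) \<le> walk_mean qs (2 ^ k * m) \<omega>" for k :: nat
  proof (induction k)
    case 0
    then show ?case using wm by simp
  next
    case (Suc k)
    have "n * (x ^ (2 ^ Suc k) * (r ^ (2 ^ Suc k * m) * n)) = (x ^ (2 ^ k) * (r ^ (2 ^ k * m) * n))\<^sup>2"
      by (simp add: power_mult_distrib power_mult[symmetric] power2_eq_square[of n] algebra_simps)
    also have "\<dots> \<le> (walk_mean qs (2 ^ k * m) \<omega>)\<^sup>2"
      using Suc x r n by (intro power_mono) auto
    also have "\<dots> \<le> n * walk_mean qs (2 ^ Suc k * m) \<omega>"
      using walk_mean_square[OF qs w, of "2 ^ k * m"] by (simp add: n_def mult.assoc)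
    finally show ?case using n by simp
  qed
  have bound: "x ^ (2 ^ Suc k) * n \<le> C" for k :: nat
  proof -
    have "x ^ (2 ^ Suc k) * (r ^ (2 ^ Suc k * m) * n) \<le> C * r ^ (2 ^ Suc k * m)"
      using key[of "Suc k"] C[of "2 ^ k * m"] by (simp add: mult.assoc)
    then have "r ^ (2 ^ Suc k * m) * (x ^ (2 ^ Suc k) * n) \<le> r ^ (2 ^ Suc k * m) * C"
      by (simp only: mult_ac)
    then show ?thesis by (rule mult_left_le_imp_le) (use r in simp)
  qed
  obtain K :: nat where K: "C / n < x ^ K" using real_arch_pow[OF x] by blast
  have "K \<le> 2 ^ Suc K" using less_exp[of "Suc K"] by linarith
  then have "x ^ K \<le> x ^ (2 ^ Suc K)" using x by (intro power_increasing) auto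
  then have "C / n < x ^ (2 ^ Suc K)" using K by linarith
  then show False using bound[of K] n by (simp add: divide_less_eq)
qed

text \<open>The conclusion of Schur's product theorem is taken as the definition;
  \<open>posdef_gram_mult\<close> verifies it for functions given by Gram matrices of
  square-summable families.\<close>

definition schur_multiplier :: "('a \<Rightarrow> complex) \<Rightarrow> bool" where
  "schur_multiplier \<kappa> \<longleftrightarrow> \<kappa> \<one> = 1 \<and> (\<forall>\<omega>. posdef \<omega> \<longrightarrow> posdef (\<lambda>g. \<omega> g * \<kappa> g))"

end

section \<open>Compact convex sets of positive definite functions\<close>

lemma continuous_on_lsum:
  assumes "\<And>g. continuous_on S (\<lambda>x. k x g)"
  shows "continuous_on S (\<lambda>x. lsum (k x) u)"
  using assms by (induction u) (auto intro!: continuous_intros)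

lemma continuous_on_sum_list:
  fixes f :: "'b::topological_space \<Rightarrow> 'c \<Rightarrow> complex"
  assumes "\<And>y. continuous_on S (\<lambda>x. f x y)"
  shows "continuous_on S (\<lambda>x. \<Sum>y\<leftarrow>ys. f x y)"
  using assms by (induction ys) (auto intro!: continuous_intros)

lemma continuous_on_eval: "continuous_on S (\<lambda>f::'a \<Rightarrow> complex. f g)"
  by (rule continuous_on_subset[OF continuous_on_product_coordinates]) simp

lemma lsum_scaleR_add:
  "lsum (a *\<^sub>R \<phi> + b *\<^sub>R \<psi>) u = of_real a * lsum \<phi> u + of_real b * lsum \<psi> u"
  by (induction u) (auto simp: scaleR_fun_def scaleR_conv_of_real algebra_simps)

lemma compact_Pi_sets:
  fixes D :: "'a \<Rightarrow> 'b::topological_space set"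
  assumes "\<And>g. compact (D g)" shows "compact {f. \<forall>g. f g \<in> D g}"
proof -
  have "{f. \<forall>g. f g \<in> D g} = PiE UNIV D" by (auto simp: PiE_def Pi_def)
  moreover have "compactin (product_topology (\<lambda>_. euclidean) UNIV) (PiE UNIV D)"
    using assms by (simp add: compactin_PiE)
  ultimately show ?thesis by (simp add: euclidean_product_topology)
qed

section \<open>Kernels cut along the cosets of a subgroup\<close>

definition lfilter :: "('a \<Rightarrow> bool) \<Rightarrow> (complex \<times> 'a) list \<Rightarrow> (complex \<times> 'a) list" where
  "lfilter P u = filter (\<lambda>(a, g). P g) u"

lemma lfilter_over [simp]: "u \<in> over S \<Longrightarrow> lfilter P u \<in> over S"
  by (auto simp: over_def lfilter_def)

lemma lsum_lfilter: "lsum f (lfilter P u) = lsum (\<lambda>g. of_bool (P g) * f g) u"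
  by (induction u) (auto simp: lfilter_def)

definition kform ::
    "('a \<Rightarrow> 'a \<Rightarrow> complex) \<Rightarrow> (complex \<times> 'a) list \<Rightarrow> (complex \<times> 'a) list \<Rightarrow> complex" where
  "kform k u v = lsum (\<lambda>g. \<Sum>(b, h)\<leftarrow>v. cnj b * k g h) u"

lemma kform_cong:
  assumes "u \<in> over S" "v \<in> over T" "\<And>g h. g \<in> S \<Longrightarrow> h \<in> T \<Longrightarrow> k g h = k' g h"
  shows "kform k u v = kform k' u v"
  unfolding kform_def using assms
  by (intro lsum_cong[OF assms(1)] arg_cong[where f=sum_list] map_cong refl) (auto dest: overD)

lemma kform_add: "kform (\<lambda>g h. k g h + k' g h) u v = kform k u v + kform k' u v"
  unfolding kform_def lsum_add[symmetric] by (simp add: case_prod_unfold distrib_left sum_list_addf)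

lemma kform_zero: "kform (\<lambda>g h. 0) u v = 0"
  by (simp add: kform_def case_prod_unfold)

lemma kform_sum: "kform (\<lambda>g h. \<Sum>z\<in>Z. k z g h) u v = (\<Sum>z\<in>Z. kform (k z) u v)"
  by (induction Z rule: infinite_finite_induct) (auto simp: kform_add kform_zero)

lemma kform_lfilter:
  "kform k (lfilter P u) (lfilter Q v) = kform (\<lambda>g h. of_bool (P g) * of_bool (Q h) * k g h) u v"
proof -
  have *: "(\<Sum>(b, h)\<leftarrow>lfilter Q v. cnj b * k' h) = (\<Sum>(b, h)\<leftarrow>v. cnj b * (of_bool (Q h) * k' h))"
    for k' by (induction v) (auto simp: lfilter_def)
  show ?thesis
    unfolding kform_def lsum_lfilter * by (simp add: mult.assoc case_prod_unfold sum_list_const_mult[symmetric] mult.left_commute)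
qed

context group
begin

lemma inv_cancel_left [simp]:
  "x \<in> carrier G \<Longrightarrow> y \<in> carrier G \<Longrightarrow> inv x \<otimes> (x \<otimes> y) = y"
  "x \<in> carrier G \<Longrightarrow> y \<in> carrier G \<Longrightarrow> x \<otimes> (inv x \<otimes> y) = y"
  by (simp_all add: m_assoc[symmetric])

lemma form_kform: "form \<omega> = kform (\<lambda>g h. \<omega> (inv h \<otimes> g))"
  by (simp add: fun_eq_iff form_def kform_def)

lemma l_coset_eq_iff:
  assumes "subgroup H G" "g \<in> carrier G" "h \<in> carrier G"
  shows "l_coset G g H = l_coset G h H \<longleftrightarrow> inv h \<otimes> g \<in> H"
proof
  assume "l_coset G g H = l_coset G h H"
  moreover have "g \<otimes> \<one> \<in> l_coset G g H"
    using subgroup.one_closed[OF assms(1)] unfolding l_coset_def by blast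
  ultimately have "g \<in> l_coset G h H" using assms(2) by simp
  then obtain x where x: "x \<in> H" "g = h \<otimes> x" by (auto simp: l_coset_def)
  have xc: "x \<in> carrier G" using subgroup.mem_carrier[OF assms(1) x(1)] .
  have "inv h \<otimes> g = x" using x xc assms(3) by (simp add: m_assoc[symmetric])
  then show "inv h \<otimes> g \<in> H" using x by simp
next
  assume a: "inv h \<otimes> g \<in> H"
  have "g = h \<otimes> (inv h \<otimes> g)" using assms by (simp add: m_assoc[symmetric])
  then have "g \<in> l_coset G h H" using a by (auto simp: l_coset_def)
  then show "l_coset G g H = l_coset G h H" using l_repr_independence[OF _ assms(3,1)] by simp
qed

text \<open>Membership of \<open>inv h \<otimes> g\<close> in \<open>H\<close> fails for all pairs
  from different left cosets, so the kernel is block diagonal with one block for every coset met by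
  \<open>u\<close>. This is the form of the representation induced from \<open>H\<close>.\<close>

lemma form_subgroup_restrict:
  assumes H: "subgroup H G" and uv: "u \<in> over (carrier G)" "v \<in> over (carrier G)"
    and Z: "finite Z" "(\<lambda>p. l_coset G (snd p) H) ` set u \<subseteq> Z"
  shows "form (\<lambda>g. of_bool (g \<in> H) * \<omega> g) u v
    = (\<Sum>z\<in>Z. form \<omega> (lfilter (\<lambda>g. l_coset G g H = z) u) (lfilter (\<lambda>g. l_coset G g H = z) v))"
proof -
  have u: "u \<in> over {g \<in> carrier G. l_coset G g H \<in> Z}"
    using uv(1) Z(2) by (auto simp: over_def)
  have "(\<Sum>z\<in>Z. form \<omega> (lfilter (\<lambda>g. l_coset G g H = z) u) (lfilter (\<lambda>g. l_coset G g H = z) v))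
    = kform (\<lambda>g h. \<Sum>z\<in>Z. of_bool (l_coset G g H = z) * of_bool (l_coset G h H = z) * \<omega> (inv h \<otimes> g)) u v"
    unfolding form_kform kform_lfilter kform_sum ..
  also have "\<dots> = form (\<lambda>g. of_bool (g \<in> H) * \<omega> g) u v"
    unfolding form_kform
  proof (rule kform_cong[OF u uv(2)])
    fix g h assume gh: "g \<in> {g \<in> carrier G. l_coset G g H \<in> Z}" "h \<in> carrier G"
    have "(\<Sum>z\<in>Z. of_bool (l_coset G g H = z) * of_bool (l_coset G h H = z) * \<omega> (inv h \<otimes> g))
      = (\<Sum>z\<in>Z. if z = l_coset G g H then of_bool (l_coset G h H = l_coset G g H) * \<omega> (inv h \<otimes> g) else 0)"
      by (intro sum.cong) auto
    also have "\<dots> = of_bool (l_coset G h H = l_coset G g H) * \<omega> (inv h \<otimes> g)"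
      using gh Z(1) by (simp add: sum.delta)
    also have "\<dots> = of_bool (inv h \<otimes> g \<in> H) * \<omega> (inv h \<otimes> g)"
      using l_coset_eq_iff[OF H, of g h] gh by (simp add: eq_commute)
    finally show "(\<Sum>z\<in>Z. of_bool (l_coset G g H = z) * of_bool (l_coset G h H = z) * \<omega> (inv h \<otimes> g))
      = of_bool (inv h \<otimes> g \<in> H) * \<omega> (inv h \<otimes> g)" .
  qed
  finally show ?thesis ..
qed

lemma posdef_subgroup_restrict:
  assumes "subgroup H G" "posdef \<omega>" shows "posdef (\<lambda>g. of_bool (g \<in> H) * \<omega> g)"
  unfolding posdef_def
proof
  fix u assume u: "u \<in> over (carrier G)"
  show "form (\<lambda>g. of_bool (g \<in> H) * \<omega> g) u u \<in> \<real>\<^sub>\<ge>\<^sub>0"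
    unfolding form_subgroup_restrict[OF assms(1) u u finite_imageI[OF finite_set] order_refl]
    using assms(2) u by (auto simp: posdef_def complex_nonneg_Reals_iff intro!: sum_nonneg)
qed

lemma form_const1: "form (\<lambda>_. 1) u u = of_real ((cmod (lsum (\<lambda>_. 1) u))\<^sup>2)"
proof -
  have "(\<Sum>(b, h)\<leftarrow>v. cnj b) = cnj (lsum (\<lambda>_. 1) v)" for v :: "(complex \<times> 'a) list"
    by (induction v) auto
  then have "form (\<lambda>_. 1) u u = lsum (\<lambda>_. cnj (lsum (\<lambda>_. 1) u) * 1) u"
    by (simp add: form_def)
  also have "\<dots> = cnj (lsum (\<lambda>_. 1) u) * lsum (\<lambda>_. 1) u" by (rule lsum_cmult)
  finally show ?thesis by (simp only: complex_norm_square mult.commute)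
qed

lemma posdef_const1: "posdef (\<lambda>_. 1)"
  unfolding posdef_def form_const1 nonneg_Reals_of_real_iff by simp

lemma posdef_indicator: "subgroup H G \<Longrightarrow> posdef (\<lambda>g. of_bool (g \<in> H))"
  using posdef_subgroup_restrict[OF _ posdef_const1] by simp

lemma posdef_schur: "posdef \<omega> \<Longrightarrow> schur_multiplier \<kappa> \<Longrightarrow> posdef (\<lambda>g. \<omega> g * \<kappa> g)"
  by (simp add: schur_multiplier_def)

lemma schur_multiplier_posdef: "schur_multiplier \<kappa> \<Longrightarrow> posdef \<kappa>"
  using posdef_schur[OF posdef_const1] by simp

lemma posdef_iff_sets:
  "posdef \<omega> \<longleftrightarrow> (\<forall>F c. finite F \<longrightarrow> F \<subseteq> carrier G \<longrightarrow>
     (\<Sum>g\<in>F. \<Sum>h\<in>F. c g * cnj (c h) * \<omega> (inv h \<otimes> g)) \<in> \<real>\<^sub>\<ge>\<^sub>0)" (is "_ \<longleftrightarrow> ?R")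
proof
  assume w: "posdef \<omega>"
  show ?R
  proof (intro allI impI)
    fix F c assume F: "finite F" "F \<subseteq> carrier G"
    obtain xs where xs: "set xs = F" "distinct xs" using finite_distinct_list[OF F(1)] by blast
    have "form \<omega> (map (\<lambda>g. (c g, g)) xs) (map (\<lambda>g. (c g, g)) xs)
      = (\<Sum>g\<in>F. \<Sum>h\<in>F. c g * cnj (c h) * \<omega> (inv h \<otimes> g))"
      using xs by (simp add: form_def lsum_def o_def sum_list_distinct_conv_sum_set sum_distrib_left mult.assoc)
    moreover have "map (\<lambda>g. (c g, g)) xs \<in> over (carrier G)" using F xs by (auto simp: over_def)
    ultimately show "(\<Sum>g\<in>F. \<Sum>h\<in>F. c g * cnj (c h) * \<omega> (inv h \<otimes> g)) \<in> \<real>\<^sub>\<ge>\<^sub>0"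
      using w unfolding posdef_def by metis
  qed
next
  assume R: ?R
  show "posdef \<omega>" unfolding posdef_def
  proof
    fix u assume u: "u \<in> over (carrier G)"
    let ?F = "snd ` set u" and ?c = "\<lambda>g. \<Sum>(a, h)\<leftarrow>u. if h = g then a else 0"
    have uF: "u \<in> over ?F" by (simp add: over_def)
    have cnj_c: "cnj (?c h) = (\<Sum>(a, h')\<leftarrow>u. if h' = h then cnj a else 0)" for h
      by (induction u) auto
    have inner: "(\<Sum>(b, h)\<leftarrow>u. cnj b * k h) = (\<Sum>h\<in>?F. cnj (?c h) * k h)" for k
    proof -
      have "(\<Sum>(b, h)\<leftarrow>v. cnj b * k h) = cnj (lsum (\<lambda>h. cnj (k h)) v)" for v
        by (induction v) auto
      then show ?thesis by (simp add: lsum_eq_sum[OF _ uF])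
    qed
    have "form \<omega> u u = (\<Sum>g\<in>?F. \<Sum>h\<in>?F. ?c g * cnj (?c h) * \<omega> (inv h \<otimes> g))"
      unfolding form_def inner lsum_eq_sum[OF finite_imageI[OF finite_set] uF]
      by (simp add: sum_distrib_left mult.assoc)
    then show "form \<omega> u u \<in> \<real>\<^sub>\<ge>\<^sub>0" using R u by (simp add: over_def)
  qed
qed

lemma PD1_iff: "\<phi> \<in> PD1 G \<longleftrightarrow> \<phi> \<in> extensional (carrier G) \<and> \<phi> \<one> = 1 \<and> posdef \<phi>"
  by (auto simp: PD1_def posdef_iff_sets)

lemma form_scaleR_add:
  "form (a *\<^sub>R \<phi> + b *\<^sub>R \<psi>) u v = of_real a * form \<phi> u v + of_real b * form \<psi> u v"
  by (simp add: scaleR_fun_def plus_fun_def scaleR_conv_of_real form_fun_add form_fun_cmult)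

lemma convex_PD1: "convex (PD1 G)"
proof (rule convexI)
  fix \<phi> \<psi> and a b :: real assume *: "\<phi> \<in> PD1 G" "\<psi> \<in> PD1 G" "0 \<le> a" "0 \<le> b" "a + b = 1"
  \<comment> \<open>Outside the carrier both functions have the value \<open>undefined\<close>,
    which the combination preserves because \<open>a + b = 1\<close>.\<close>
  have "(a *\<^sub>R \<phi> + b *\<^sub>R \<psi>) g = undefined" if "g \<notin> carrier G" for g
    using *(1,2) that scaleR_add_left[of a b "undefined :: complex"] *(5)
    by (simp add: PD1_iff scaleR_fun_def extensional_def)
  moreover have "posdef (a *\<^sub>R \<phi> + b *\<^sub>R \<psi>)"
    using * by (auto simp: PD1_iff posdef_def form_scaleR_add complex_nonneg_Reals_iff)
  moreover have "(a *\<^sub>R \<phi> + b *\<^sub>R \<psi>) \<one> = 1"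
    using * by (simp add: PD1_iff scaleR_fun_def scaleR_conv_of_real of_real_add[symmetric] del: of_real_add)
  ultimately show "a *\<^sub>R \<phi> + b *\<^sub>R \<psi> \<in> PD1 G" by (auto simp: PD1_iff extensional_def)
qed

lemma PD1_bound: "\<phi> \<in> PD1 G \<Longrightarrow> g \<in> carrier G \<Longrightarrow> cmod (\<phi> g) \<le> 1"
  using posdef_bound[of \<phi> g] by (simp add: PD1_iff)

text \<open>By \<open>PD1_bound\<close> the set lies in a product of closed unit discs over the
  carrier and singletons \<open>{undefined}\<close> elsewhere, which is compact by Tychonoff's
  theorem. Each remaining condition involves finitely many coordinates and is closed.\<close>

lemma compact_closed_PD1: "compact (PD1 G)" "closed (PD1 G)"
proof -
  let ?D = "\<lambda>g. if g \<in> carrier G then cball 0 1 else {undefined} :: complex set"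
  let ?K = "{f. \<forall>g. f g \<in> ?D g}"
  let ?C = "{\<phi>. \<phi> \<one> = 1} \<inter> (\<Inter>u\<in>over (carrier G). {\<phi>. form \<phi> u u \<in> \<real>\<^sub>\<ge>\<^sub>0})"
  have "PD1 G = ?K \<inter> ?C"
    using PD1_bound by (auto simp: PD1_iff posdef_def extensional_def split: if_splits)
  moreover have "compact ?K" by (rule compact_Pi_sets) auto
  moreover have "closed ?C"
  proof (intro closed_Int closed_INT ballI)
    show "closed {\<phi>::'a \<Rightarrow> complex. \<phi> \<one> = 1}"
      by (intro closed_Collect_eq continuous_on_eval continuous_on_const)
    fix u
    have "continuous_on UNIV (\<lambda>\<phi>. form \<phi> u u)"
      unfolding form_def
      by (intro continuous_on_lsum continuous_on_sum_list)
         (auto simp: case_prod_unfold intro!: continuous_intros continuous_on_eval)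
    then have "closed ((\<lambda>\<phi>. form \<phi> u u) -` \<real>\<^sub>\<ge>\<^sub>0)"
      by (intro closed_vimage) (auto simp: closed_nonneg_Reals_complex)
    then show "closed {\<phi>. form \<phi> u u \<in> \<real>\<^sub>\<ge>\<^sub>0}" by (simp add: vimage_def)
  qed
  moreover have "closed ?K"
  proof (intro closed_Collect_all)
    fix g
    have "closed ((\<lambda>f::'a \<Rightarrow> complex. f g) -` ?D g)"
      by (intro closed_vimage continuous_on_eval) auto
    then show "closed {f. f g \<in> ?D g}" by (simp add: vimage_def)
  qed
  ultimately show "compact (PD1 G)" "closed (PD1 G)" by (simp_all only: compact_Int_closed closed_Int)
qed

lemma characters_iff:
  "\<phi> \<in> characters G \<longleftrightarrow>
    \<phi> \<in> PD1 G \<and> (\<forall>g\<in>carrier G. \<forall>x\<in>carrier G. \<phi> (inv g \<otimes> x \<otimes> g) = \<phi> x)"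
proof -
  have "conj_fun G g \<phi> = \<phi> \<longleftrightarrow> (\<forall>x\<in>carrier G. \<phi> (inv g \<otimes> x \<otimes> g) = \<phi> x)"
    if "\<phi> \<in> PD1 G" for g
    using that by (auto simp: conj_fun_def fun_eq_iff PD1_iff extensional_def)
  then show ?thesis by (auto simp: characters_def)
qed

lemma compact_closed_characters: "compact (characters G)" "closed (characters G)"
proof -
  have "characters G
      = PD1 G \<inter> (\<Inter>g\<in>carrier G. \<Inter>x\<in>carrier G. {\<phi>. \<phi> (inv g \<otimes> x \<otimes> g) = \<phi> x})"
    by (auto simp: characters_iff)
  moreover have "closed (\<Inter>g\<in>carrier G. \<Inter>x\<in>carrier G.
      {\<phi>::'a \<Rightarrow> complex. \<phi> (inv g \<otimes> x \<otimes> g) = \<phi> x})"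
    by (intro closed_INT ballI closed_Collect_eq continuous_on_eval)
  ultimately show "compact (characters G)" "closed (characters G)"
    using compact_closed_PD1 by (auto simp: compact_Int_closed)
qed

lemma PD1_eqI:
  "\<phi> \<in> PD1 G \<Longrightarrow> \<psi> \<in> PD1 G \<Longrightarrow> (\<And>g. g \<in> carrier G \<Longrightarrow> \<phi> g = \<psi> g) \<Longrightarrow> \<phi> = \<psi>"
  by (auto simp: PD1_iff intro: extensionalityI)

lemma affine_fun_on_Re_lsum: "affine_fun_on K (\<lambda>\<phi>. Re (lsum \<phi> u))"
  by (simp add: affine_fun_on_def lsum_scaleR_add)

lemma continuous_on_Re_lsum: "continuous_on S (\<lambda>\<phi>::'a \<Rightarrow> complex. Re (lsum \<phi> u))"
  by (intro continuous_on_Re continuous_on_lsum continuous_on_eval)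

lemma PD1_extreme_point_maximizing:
  assumes "countable (carrier G)" "K \<subseteq> PD1 G" "compact K" "closed K" "K \<noteq> {}"
    "continuous_on K f" "affine_fun_on K f"
  shows "\<exists>e. e extreme_point_of K \<and> (\<forall>x\<in>K. f x \<le> f e)"
proof -
  let ?g = "from_nat_into (carrier G)"
  \<comment> \<open>Along an enumeration of the group, even indices record real parts and odd
    indices, through the coefficient \<open>\<i>\<close>, the negatives of imaginary parts. Together
    they separate points.\<close>
  let ?c = "\<lambda>n \<phi>. Re (lsum \<phi> [(if even n then 1 else \<i>, ?g (n div 2))])"
  show ?thesis
  proof (rule extreme_point_maximizing[OF assms(3-7), where c = ?c])
    fix \<phi> \<psi> assume *: "\<phi> \<in> K" "\<psi> \<in> K" "\<And>n. ?c n \<phi> = ?c n \<psi>"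
    show "\<phi> = \<psi>"
    proof (rule PD1_eqI)
      fix g assume "g \<in> carrier G"
      then obtain n where n: "g = ?g n" using from_nat_into_surj[OF assms(1)] by metis
      show "\<phi> g = \<psi> g" using *(3)[of "2 * n"] *(3)[of "2 * n + 1"] n by (simp add: complex_eq_iff)
    qed (use * assms in auto)
  qed (rule continuous_on_Re_lsum affine_fun_on_Re_lsum)+
qed

section \<open>Conjugation and the convex hull of the indicator functions\<close>

definition lconj :: "'a \<Rightarrow> (complex \<times> 'a) list \<Rightarrow> (complex \<times> 'a) list" where
  "lconj q u = map (\<lambda>(a, g). (a, q \<otimes> g \<otimes> inv q)) u"

lemma lconj_over [simp]: "q \<in> carrier G \<Longrightarrow> u \<in> over (carrier G) \<Longrightarrow> lconj q u \<in> over (carrier G)"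
  by (auto simp: over_def lconj_def case_prod_unfold)

lemma lsum_lconj: "lsum f (lconj q u) = lsum (\<lambda>g. f (q \<otimes> g \<otimes> inv q)) u"
  by (simp add: lsum_def lconj_def o_def case_prod_unfold)

lemma lsum_conj_fun:
  assumes "q \<in> carrier G" "u \<in> over (carrier G)"
  shows "lsum (conj_fun G q \<phi>) u = lsum \<phi> (lconj (inv q) u)"
  unfolding lsum_lconj using assms by (intro lsum_cong[OF assms(2)]) (simp add: conj_fun_def)

lemma posdef_conj_fun:
  assumes "posdef \<phi>" "q \<in> carrier G" shows "posdef (conj_fun G q \<phi>)"
  unfolding posdef_def
proof
  fix u assume u: "u \<in> over (carrier G)"
  have "form (conj_fun G q \<phi>) u u = form \<phi> (lconj (inv q) u) (lconj (inv q) u)"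
    unfolding form_def lsum_lconj
  proof (rule lsum_cong[OF u])
    fix g assume g: "g \<in> carrier G"
    have e: "inv (inv q \<otimes> h \<otimes> q) \<otimes> (inv q \<otimes> g \<otimes> q) = inv q \<otimes> (inv h \<otimes> g) \<otimes> q"
      if "h \<in> carrier G" for h
    proof -
      have "inv (inv q \<otimes> h \<otimes> q) = inv q \<otimes> inv h \<otimes> q"
        using that assms(2) by (simp add: inv_mult_group m_assoc)
      then have "inv (inv q \<otimes> h \<otimes> q) \<otimes> (inv q \<otimes> g \<otimes> q) = inv q \<otimes> inv h \<otimes> (q \<otimes> inv q) \<otimes> g \<otimes> q"
        using that g assms(2) by (simp add: m_assoc del: r_inv)
      then show ?thesis using that g assms(2) by (simp add: m_assoc)
    qed
    show "(\<Sum>(b, h)\<leftarrow>u. cnj b * conj_fun G q \<phi> (inv h \<otimes> g))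
      = (\<Sum>(b, h)\<leftarrow>lconj (inv q) u. cnj b * \<phi> (inv h \<otimes> (inv q \<otimes> g \<otimes> inv (inv q))))"
      unfolding lconj_def map_map o_def case_prod_unfold using u g assms(2)
      by (intro arg_cong[where f=sum_list] map_cong refl)
         (auto dest!: overD simp: e conj_fun_def)
  qed
  then show "form (conj_fun G q \<phi>) u u \<in> \<real>\<^sub>\<ge>\<^sub>0" using assms u by (simp add: posdef_def)
qed

lemma conj_fun_PD1: "\<phi> \<in> PD1 G \<Longrightarrow> q \<in> carrier G \<Longrightarrow> conj_fun G q \<phi> \<in> PD1 G"
  by (simp add: PD1_iff posdef_conj_fun) (simp add: conj_fun_def)

text \<open>By Hahn--Banach this is the closed convex hull of the indicator functions of the members
  of \<open>X\<close>, that is, the set of the functions sending \<open>g\<close> to the mass of the subgroups containing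
  \<open>g\<close>, for the probability measures on \<open>X\<close>.\<close>

definition indicator_hull :: "'a set set \<Rightarrow> ('a \<Rightarrow> complex) set" where
  "indicator_hull X = {\<phi> \<in> PD1 G. \<forall>u\<in>over (carrier G). \<forall>t.
     (\<forall>H\<in>X. Re (lsum (\<lambda>g. of_bool (g \<in> H)) u) \<le> t) \<longrightarrow> Re (lsum \<phi> u) \<le> t}"

lemma indicator_hullD:
  "\<lbrakk>\<phi> \<in> indicator_hull X; u \<in> over (carrier G); \<And>H. H \<in> X \<Longrightarrow> Re (lsum (\<lambda>g. of_bool (g \<in> H)) u) \<le> t\<rbrakk>
    \<Longrightarrow> Re (lsum \<phi> u) \<le> t"
  by (simp add: indicator_hull_def)

lemma indicator_in_hull:
  assumes "H \<in> X" "subgroup H G" shows "(\<lambda>g\<in>carrier G. of_bool (g \<in> H)) \<in> indicator_hull X"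
proof -
  have "posdef (\<lambda>g\<in>carrier G. of_bool (g \<in> H))"
    using posdef_indicator[OF assms(2)] by (subst posdef_cong[of _ "\<lambda>g. of_bool (g \<in> H)"]) auto
  moreover have "lsum (\<lambda>g\<in>carrier G. of_bool (g \<in> H)) u = lsum (\<lambda>g. of_bool (g \<in> H)) u"
    if "u \<in> over (carrier G)" for u
    by (rule lsum_cong[OF that]) simp
  ultimately show ?thesis
    using assms subgroup.one_closed[OF assms(2)] by (auto simp: indicator_hull_def PD1_iff)
qed

lemma convex_indicator_hull: "convex (indicator_hull X)"
proof (rule convexI)
  fix \<phi> \<psi> and a b :: real
  assume *: "\<phi> \<in> indicator_hull X" "\<psi> \<in> indicator_hull X" "0 \<le> a" "0 \<le> b" "a + b = 1"
  have "a *\<^sub>R \<phi> + b *\<^sub>R \<psi> \<in> PD1 G"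
    using * convexD[OF convex_PD1] by (auto simp: indicator_hull_def)
  moreover have "Re (lsum (a *\<^sub>R \<phi> + b *\<^sub>R \<psi>) u) \<le> t"
    if "u \<in> over (carrier G)" "\<forall>H\<in>X. Re (lsum (\<lambda>g. of_bool (g \<in> H)) u) \<le> t" for u t
  proof -
    have "a * Re (lsum \<phi> u) + b * Re (lsum \<psi> u) \<le> a * t + b * t"
      using * that by (intro add_mono mult_left_mono) (auto simp: indicator_hull_def)
    then show ?thesis using *(5) by (simp add: lsum_scaleR_add distrib_right[symmetric])
  qed
  ultimately show "a *\<^sub>R \<phi> + b *\<^sub>R \<psi> \<in> indicator_hull X" by (simp add: indicator_hull_def)
qed

lemma compact_indicator_hull: "compact (indicator_hull X)"
proof -
  let ?C = "\<Inter>(u, t)\<in>{(u, t). u \<in> over (carrier G) \<and>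
      (\<forall>H\<in>X. Re (lsum (\<lambda>g. of_bool (g \<in> H)) u) \<le> t)}. {\<phi>. Re (lsum \<phi> u) \<le> t}"
  have "indicator_hull X = PD1 G \<inter> ?C"
    by (auto simp: indicator_hull_def)
  moreover have "closed ?C"
  proof (intro closed_INT ballI)
    fix p :: "(complex \<times> 'a) list \<times> real"
    show "closed (case p of (u, t) \<Rightarrow> {\<phi>. Re (lsum \<phi> u) \<le> t})"
      by (cases p) (simp add: closed_Collect_le continuous_on_Re_lsum continuous_on_const)
  qed
  ultimately show ?thesis using compact_closed_PD1 by (simp add: compact_Int_closed)
qed

lemma conj_subgroup_iff:
  assumes "H \<subseteq> carrier G" "q \<in> carrier G" "g \<in> carrier G"
  shows "g \<in> conj_subgroup G q H \<longleftrightarrow> inv q \<otimes> g \<otimes> q \<in> H"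
proof
  assume "g \<in> conj_subgroup G q H"
  then obtain h where h: "h \<in> H" "g = q \<otimes> h \<otimes> inv q" by (auto simp: conj_subgroup_def)
  have hc: "h \<in> carrier G" using h assms by blast
  have "inv q \<otimes> g \<otimes> q = (inv q \<otimes> q) \<otimes> h \<otimes> (inv q \<otimes> q)"
    unfolding h(2) using hc assms(2) by (simp add: m_assoc del: l_inv)
  then show "inv q \<otimes> g \<otimes> q \<in> H" using h hc assms(2) by simp
next
  assume h: "inv q \<otimes> g \<otimes> q \<in> H"
  have "q \<otimes> (inv q \<otimes> g \<otimes> q) \<otimes> inv q = (q \<otimes> inv q) \<otimes> g \<otimes> (q \<otimes> inv q)"
    using assms by (simp add: m_assoc del: r_inv)
  then have "g = q \<otimes> (inv q \<otimes> g \<otimes> q) \<otimes> inv q" using assms by simp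
  then show "g \<in> conj_subgroup G q H" using h unfolding conj_subgroup_def by blast
qed

lemma conj_indicator_hull:
  assumes X: "\<And>H. H \<in> X \<Longrightarrow> H \<subseteq> carrier G"
    and inv: "\<And>H. H \<in> X \<Longrightarrow> conj_subgroup G q H \<in> X"
    and \<phi>: "\<phi> \<in> indicator_hull X" and q: "q \<in> carrier G"
  shows "conj_fun G q \<phi> \<in> indicator_hull X"
proof -
  have "Re (lsum (conj_fun G q \<phi>) u) \<le> t"
    if u: "u \<in> over (carrier G)" "\<forall>H\<in>X. Re (lsum (\<lambda>g. of_bool (g \<in> H)) u) \<le> t" for u t
    unfolding lsum_conj_fun[OF q u(1)]
  proof (rule indicator_hullD[OF \<phi>])
    fix H assume H: "H \<in> X"
    have "lsum (\<lambda>g. of_bool (g \<in> H)) (lconj (inv q) u) = lsum (\<lambda>g. of_bool (g \<in> conj_subgroup G q H)) u"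
      unfolding lsum_lconj using conj_subgroup_iff[OF X[OF H] q] q
      by (intro lsum_cong[OF u(1)]) simp
    then show "Re (lsum (\<lambda>g. of_bool (g \<in> H)) (lconj (inv q) u)) \<le> t" using u(2) inv[OF H] by simp
  qed (use q u in simp)
  then show ?thesis using \<phi> q conj_fun_PD1 by (simp add: indicator_hull_def)
qed

text \<open>A test list supported at \<open>g\<close> whose coefficient has nonpositive real part
  gives a nonpositive value on every indicator function; the coefficients \<open>\<i>\<close>,
  \<open>-\<i>\<close> and \<open>-1\<close> are enough.\<close>

lemma indicator_hull_real:
  assumes "\<phi> \<in> indicator_hull X" "g \<in> carrier G" shows "Im (\<phi> g) = 0" "0 \<le> Re (\<phi> g)"
proof -
  have "Re (lsum \<phi> [(c, g)]) \<le> 0" if "Re c \<le> 0" for c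
    using assms(2) that by (intro indicator_hullD[OF assms(1)]) (auto simp: over_def mult_le_0_iff)
  from this[of \<i>] this[of "-\<i>"] this[of "-1"] show "Im (\<phi> g) = 0" "0 \<le> Re (\<phi> g)" by auto
qed

lemma charmenable_hull_character:
  assumes "charmenable G" "X \<noteq> {}" "\<And>H. H \<in> X \<Longrightarrow> subgroup H G"
    "\<And>q H. q \<in> carrier G \<Longrightarrow> H \<in> X \<Longrightarrow> conj_subgroup G q H \<in> X"
  obtains \<phi> where "\<phi> \<in> indicator_hull X" "\<phi> \<in> characters G"
proof -
  have "indicator_hull X \<noteq> {}" using assms(2,3) indicator_in_hull by blast
  moreover have "\<forall>g\<in>carrier G. \<forall>\<phi>\<in>indicator_hull X. conj_fun G g \<phi> \<in> indicator_hull X"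
    using conj_indicator_hull assms(3,4) subgroup.subset by meson
  moreover have "indicator_hull X \<subseteq> PD1 G" by (auto simp: indicator_hull_def)
  moreover note compact_indicator_hull convex_indicator_hull
  moreover have "K \<noteq> {} \<longrightarrow> K \<subseteq> PD1 G \<longrightarrow> compact K \<longrightarrow> convex K \<longrightarrow>
      (\<forall>g\<in>carrier G. \<forall>\<phi>\<in>K. conj_fun G g \<phi> \<in> K) \<longrightarrow> (\<exists>\<phi>\<in>K. \<phi> \<in> characters G)" for K
    using assms(1) unfolding charmenable_def by (elim conjE allE)
  ultimately have "\<exists>\<phi>\<in>indicator_hull X. \<phi> \<in> characters G" by metis
  then show thesis using that by blast
qed

end

context group
begin

section \<open>The Chabauty topology\<close>

lemma topspace_chabauty: "topspace (chabauty G) = {H. subgroup H G}"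
  by (auto simp: chabauty_def topspace_pullback_topology)

lemma openin_chabauty_member:
  assumes "g \<in> carrier G" shows "openin (chabauty G) {H. subgroup H G \<and> (g \<in> H) = b}"
proof -
  let ?T = "product_topology (\<lambda>_. discrete_topology (UNIV :: bool set)) (carrier G)"
  have "openin ?T {f \<in> topspace ?T. f g \<in> {b}}"
    by (rule openin_continuous_map_preimage[OF continuous_map_product_projection[OF assms]]) simp
  moreover have "{H. subgroup H G \<and> (g \<in> H) = b}
      = (\<lambda>H. \<lambda>g\<in>carrier G. g \<in> H) -` {f \<in> topspace ?T. f g \<in> {b}} \<inter> {H. subgroup H G}"
    using assms by auto
  ultimately show ?thesis unfolding chabauty_def openin_pullback_topology by blast
qed

lemma openin_chabauty_cylinder:
  assumes "finite Q" "Q \<subseteq> carrier G"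
  shows "openin (chabauty G) {H'. subgroup H' G \<and> H' \<inter> Q = H \<inter> Q}"
proof -
  have "{H'. subgroup H' G \<and> H' \<inter> Q = H \<inter> Q}
    = {H. subgroup H G} \<inter> (\<Inter>g\<in>Q. {H'. subgroup H' G \<and> (g \<in> H') = (g \<in> H)})"
    by auto
  moreover have "openin (chabauty G) \<dots>"
  proof (cases "Q = {}")
    case True
    then show ?thesis using openin_topspace[of "chabauty G"] by (simp add: topspace_chabauty)
  next
    case False
    then show ?thesis using assms openin_topspace[of "chabauty G"]
      by (intro openin_Int openin_INT2) (auto simp: topspace_chabauty intro!: openin_chabauty_member)
  qed
  ultimately show ?thesis by simp
qed

lemma chabauty_basis:
  assumes "openin (chabauty G) U" "H \<in> U"
  shows "\<exists>Q. finite Q \<and> Q \<subseteq> carrier G \<and> (\<forall>H'. subgroup H' G \<longrightarrow> H' \<inter> Q = H \<inter> Q \<longrightarrow> H' \<in> U)"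
proof -
  let ?T = "product_topology (\<lambda>_. discrete_topology (UNIV :: bool set)) (carrier G)"
  let ?f = "\<lambda>H. \<lambda>g\<in>carrier G. g \<in> H"
  obtain V where V: "openin ?T V" "U = ?f -` V \<inter> {H. subgroup H G}"
    using assms(1) unfolding chabauty_def openin_pullback_topology by blast
  obtain W where W: "?f H \<in> PiE (carrier G) W" "finite {i. W i \<noteq> UNIV}" "PiE (carrier G) W \<subseteq> V"
    using product_topology_open_contains_basis[OF V(1), of "?f H"] V(2) assms(2) by auto
  let ?Q = "{i. W i \<noteq> UNIV} \<inter> carrier G"
  have "H' \<in> U" if H': "subgroup H' G" "H' \<inter> ?Q = H \<inter> ?Q" for H'
  proof -
    have "(g \<in> H') \<in> W g" if g: "g \<in> carrier G" for g
    proof (cases "W g = UNIV")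
      case False
      then have "(g \<in> H') = (g \<in> H)" using g H'(2) by blast
      moreover have "(g \<in> H) \<in> W g" using W(1) g by (auto dest!: PiE_mem[of _ _ _ g])
      ultimately show ?thesis by simp
    qed simp
    then have "?f H' \<in> PiE (carrier G) W" by auto
    then have "?f H' \<in> V" by (rule subsetD[OF W(3)])
    then show ?thesis unfolding V(2) using H'(1) by simp
  qed
  then show ?thesis using W(2) by (intro exI[of _ ?Q]) auto
qed

text \<open>The failure of a subgroup axiom is visible in at most three coordinates, so the
  characteristic functions of subgroups form a closed subset of a compact product. Open covers are
  carried over along the pullback that defines the topology.\<close>

lemma compact_space_chabauty: "compact_space (chabauty G)"
proof -
  let ?T = "product_topology (\<lambda>_. discrete_topology (UNIV :: bool set)) (carrier G)"
  let ?f = "\<lambda>H. \<lambda>g\<in>carrier G. g \<in> H"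
  let ?S = "?f ` {H. subgroup H G}"
  have op: "openin ?T {t \<in> topspace ?T. t g = b}" if "g \<in> carrier G" for g b
  proof -
    have "openin ?T {t \<in> topspace ?T. t g \<in> {b}}"
      by (rule openin_continuous_map_preimage[OF continuous_map_product_projection[OF that]]) simp
    then show ?thesis by simp
  qed
  let ?W = "{t \<in> topspace ?T. t \<one> = False}
    \<union> (\<Union>g\<in>carrier G. {t \<in> topspace ?T. t g = True} \<inter> {t \<in> topspace ?T. t (inv g) = False})
    \<union> (\<Union>g\<in>carrier G. \<Union>h\<in>carrier G. {t \<in> topspace ?T. t g = True} \<inter> {t \<in> topspace ?T. t h = True}
        \<inter> {t \<in> topspace ?T. t (g \<otimes> h) = False})"
  have "openin ?T ?W"
  proof (intro openin_Un)
    show "openin ?T {t \<in> topspace ?T. t \<one> = False}" by (rule op) simp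
    have U: "openin ?T (\<Union>g\<in>carrier G. S g)" if "\<And>g. g \<in> carrier G \<Longrightarrow> openin ?T (S g)" for S
      by (rule openin_Union) (use that in \<open>elim imageE, simp only:\<close>)
    show "openin ?T (\<Union>g\<in>carrier G. {t \<in> topspace ?T. t g = True} \<inter> {t \<in> topspace ?T. t (inv g) = False})"
      by (intro U openin_Int op inv_closed)
    show "openin ?T (\<Union>g\<in>carrier G. \<Union>h\<in>carrier G. {t \<in> topspace ?T. t g = True}
        \<inter> {t \<in> topspace ?T. t h = True} \<inter> {t \<in> topspace ?T. t (g \<otimes> h) = False})"
      by (intro U openin_Int op m_closed)
  qed
  moreover have "topspace ?T - ?S = ?W"
  proof
    show "?W \<subseteq> topspace ?T - ?S"
      by (auto simp: subgroup.one_closed subgroup.m_inv_closed subgroup.m_closed fun_eq_iff split: if_splits)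
    show "topspace ?T - ?S \<subseteq> ?W"
    proof (intro subsetI, rule ccontr)
      fix t assume t: "t \<in> topspace ?T - ?S" "t \<notin> ?W"
      let ?H = "{g \<in> carrier G. t g}"
      have "subgroup ?H G"
        by (rule subgroupI) (use t in auto)
      moreover have "?f ?H = t" using t by (auto simp: fun_eq_iff PiE_iff extensional_def)
      ultimately have "t \<in> ?S" by (intro image_eqI[of t ?f ?H]) simp_all
      then show False using t(1) by simp
    qed
  qed
  moreover have "?S \<subseteq> topspace ?T" by auto
  ultimately have "closedin ?T ?S" unfolding closedin_def by (simp only:)
  moreover have "compact_space ?T"
    by (simp add: compact_space_product_topology compact_space_discrete_topology)
  ultimately have S: "compactin ?T ?S" by (rule closedin_compact_space[rotated])
  show ?thesis
    unfolding compact_space_def compactin_def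
  proof (intro conjI allI impI)
    fix \<U> assume U: "(\<forall>U\<in>\<U>. openin (chabauty G) U) \<and> topspace (chabauty G) \<subseteq> \<Union>\<U>"
    have "\<forall>U\<in>\<U>. \<exists>V. openin ?T V \<and> U = ?f -` V \<inter> {H. subgroup H G}"
      using U unfolding chabauty_def openin_pullback_topology by blast
    then obtain V where V: "\<And>U. U \<in> \<U> \<Longrightarrow> openin ?T (V U) \<and> U = ?f -` V U \<inter> {H. subgroup H G}"
      by metis
    have "?S \<subseteq> \<Union>(V ` \<U>)" using U V unfolding topspace_chabauty by blast
    moreover have "openin ?T W" if "W \<in> V ` \<U>" for W using that V by (elim imageE) simp
    ultimately have "\<exists>F. finite F \<and> F \<subseteq> V ` \<U> \<and> ?S \<subseteq> \<Union>F" by (intro compactinD[OF S])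
    then obtain F where F: "finite F" "F \<subseteq> V ` \<U>" "?S \<subseteq> \<Union>F" by (elim exE conjE)
    obtain F' where F': "F' \<subseteq> \<U>" "finite F'" "F = V ` F'"
      using F(1,2) by (meson finite_subset_image)
    have "topspace (chabauty G) \<subseteq> \<Union>F'"
    proof
      fix H assume "H \<in> topspace (chabauty G)"
      then have H: "subgroup H G" by (simp add: topspace_chabauty)
      then have "?f H \<in> \<Union>F" using F(3) by (intro subsetD[OF F(3)]) simp
      then obtain W where W: "W \<in> F'" "?f H \<in> V W" using F'(3) by auto
      then have "H \<in> W" using V[of W] F'(1) H by (subst conjunct2[OF V[of W]]) auto
      then show "H \<in> \<Union>F'" using W(1) by blast
    qed
    then show "\<exists>F. finite F \<and> F \<subseteq> \<U> \<and> topspace (chabauty G) \<subseteq> \<Union>F" using F' by blast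
  qed simp
qed

lemma chabauty_finite_subcover:
  assumes "closedin (chabauty G) X" "\<And>i. i \<in> I \<Longrightarrow> openin (chabauty G) (U i)" "X \<subseteq> (\<Union>i\<in>I. U i)"
  obtains J where "finite J" "J \<subseteq> I" "X \<subseteq> (\<Union>i\<in>J. U i)"
proof -
  have "compactin (chabauty G) X"
    using closedin_compact_space[OF compact_space_chabauty assms(1)] .
  moreover have "openin (chabauty G) W" if "W \<in> U ` I" for W using that assms(2) by (elim imageE) simp
  ultimately have "\<exists>F. finite F \<and> F \<subseteq> U ` I \<and> X \<subseteq> \<Union>F" using assms(3) by (intro compactinD)
  then obtain F where F: "finite F" "F \<subseteq> U ` I" "X \<subseteq> \<Union>F" by (elim exE conjE)
  then obtain J where "J \<subseteq> I" "finite J" "F = U ` J" by (meson finite_subset_image)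
  then show thesis using that F by blast
qed

lemma conj_subgroup_mult:
  assumes "H \<subseteq> carrier G" "g \<in> carrier G" "h \<in> carrier G"
  shows "conj_subgroup G g (conj_subgroup G h H) = conj_subgroup G (g \<otimes> h) H"
  unfolding conj_subgroup_def image_image using assms
  by (intro image_cong refl) (auto simp: inv_mult_group m_assoc subset_iff)

lemma conj_subgroup_one: "H \<subseteq> carrier G \<Longrightarrow> conj_subgroup G \<one> H = H"
  unfolding conj_subgroup_def by (force simp: subset_iff)

lemma closed_invariantD:
  assumes "closed_invariant G X"
  shows "H \<in> X \<Longrightarrow> subgroup H G" "H \<in> X \<Longrightarrow> H \<subseteq> carrier G"
    "H \<in> X \<Longrightarrow> g \<in> carrier G \<Longrightarrow> conj_subgroup G g H \<in> X"
proof -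
  show 1: "subgroup H G" if "H \<in> X" for H
    using assms that closedin_subset[of "chabauty G" X] by (auto simp: closed_invariant_def topspace_chabauty)
  show "H \<in> X \<Longrightarrow> H \<subseteq> carrier G" using subgroup.subset[OF 1] .
  show "H \<in> X \<Longrightarrow> g \<in> carrier G \<Longrightarrow> conj_subgroup G g H \<in> X"
    using assms by (simp add: closed_invariant_def)
qed

text \<open>Lying below \<open>R\<close> means missing every element outside \<open>R\<close>, an
  intersection of clopen conditions. For a minimal \<open>X\<close>, a single member inside
  \<open>R\<close> thus forces all members into \<open>R\<close>.\<close>

lemma closed_invariant_below:
  assumes X: "closed_invariant G X" and R: "\<And>q g. q \<in> carrier G \<Longrightarrow> g \<in> R \<Longrightarrow> q \<otimes> g \<otimes> inv q \<in> R"
    and ne: "\<exists>H\<in>X. H \<subseteq> R"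
  shows "closed_invariant G {H \<in> X. H \<subseteq> R}"
  unfolding closed_invariant_def
proof (intro conjI ballI)
  show "{H \<in> X. H \<subseteq> R} \<noteq> {}" using ne by blast
  have "topspace (chabauty G) - {H \<in> X. H \<subseteq> R}
    = (topspace (chabauty G) - X) \<union> (\<Union>g\<in>carrier G - R. {H. subgroup H G \<and> (g \<in> H) = True})"
    using closed_invariantD(2)[OF X] closed_invariantD(1)[OF X]
    by (auto simp: topspace_chabauty dest: subgroup.subset)
  moreover have "openin (chabauty G) \<dots>"
    using X by (intro openin_Un openin_Union)
      (auto intro: openin_chabauty_member simp: closed_invariant_def simp del: eq_True intro!: openin_diff)
  ultimately show "closedin (chabauty G) {H \<in> X. H \<subseteq> R}"
    using closed_invariantD(1)[OF X] by (auto simp: closedin_def topspace_chabauty)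
  fix g H assume "g \<in> carrier G" "H \<in> {H \<in> X. H \<subseteq> R}"
  then show "conj_subgroup G g H \<in> {H \<in> X. H \<subseteq> R}"
    using closed_invariantD(3)[OF X] R by (auto simp: conj_subgroup_def)
qed

section \<open>Finitely additive probability measures on a space of subgroups\<close>

text \<open>All subsets of \<open>X\<close> are measured, so that such set functions can be read off
  from arbitrary vectors and are cut out of a product by closed conditions. Values at sets that are
  not subsets of \<open>X\<close> are unconstrained.\<close>

definition charge :: "'a set set \<Rightarrow> ('a set set \<Rightarrow> real) \<Rightarrow> bool" where
  "charge X m \<longleftrightarrow> m X = 1 \<and> (\<forall>A\<subseteq>X. 0 \<le> m A) \<and>
     (\<forall>A\<subseteq>X. \<forall>B\<subseteq>X. A \<inter> B = {} \<longrightarrow> m (A \<union> B) = m A + m B)"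

lemma charge_le_1:
  assumes "charge X m" "A \<subseteq> X" shows "m A \<le> 1"
proof -
  have "m (A \<union> (X - A)) = m A + m (X - A)" using assms unfolding charge_def by (metis Diff_disjoint Diff_subset)
  moreover have "A \<union> (X - A) = X" using assms by blast
  moreover have "0 \<le> m (X - A)" "m X = 1" using assms by (auto simp: charge_def)
  ultimately show ?thesis by simp
qed

lemma invariant_charge_dichotomy:
  assumes X: "\<And>g A. g \<in> carrier G \<Longrightarrow> A \<subseteq> X \<Longrightarrow> conj_subgroup G g ` A \<subseteq> X"
  shows "(\<exists>m. charge X m \<and> (\<forall>g\<in>carrier G. \<forall>A\<subseteq>X. m (conj_subgroup G g ` A) = m A)) \<or>
    (\<exists>Q e. finite Q \<and> Q \<subseteq> carrier G \<and> 0 < e \<and>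
      (\<forall>m. charge X m \<longrightarrow> (\<exists>g\<in>Q. \<exists>A\<subseteq>X. e < \<bar>m (conj_subgroup G g ` A) - m A\<bar>)))"
proof (rule disjCI)
  assume "\<not> (\<exists>Q e. finite Q \<and> Q \<subseteq> carrier G \<and> 0 < e \<and>
      (\<forall>m. charge X m \<longrightarrow> (\<exists>g\<in>Q. \<exists>A\<subseteq>X. e < \<bar>m (conj_subgroup G g ` A) - m A\<bar>)))"
  then have ap: "\<exists>m. charge X m \<and> (\<forall>g\<in>Q. \<forall>A\<subseteq>X. \<bar>m (conj_subgroup G g ` A) - m A\<bar> \<le> e)"
    if "finite Q" "Q \<subseteq> carrier G" "0 < e" for Q e
    using that by (meson not_le)
  let ?K = "{m. \<forall>A. m A \<in> {0..1::real}}"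
  let ?C = "\<lambda>(g, n). {m. charge X m \<and> (\<forall>A\<subseteq>X. \<bar>m (conj_subgroup G g ` A) - m A\<bar> \<le> 1 / real (Suc n))}"
  have ev: "continuous_on UNIV (\<lambda>m::'a set set \<Rightarrow> real. m A)" for A
    by (rule continuous_on_product_coordinates)
  have cl: "closed (?C p)" for p
  proof (cases p)
    case (Pair g n)
    have "?C p = {m. m X = 1} \<inter> (\<Inter>A\<in>Pow X. {m. 0 \<le> m A})
      \<inter> (\<Inter>A\<in>Pow X. \<Inter>B\<in>{B. B \<subseteq> X \<and> A \<inter> B = {}}. {m. m (A \<union> B) = m A + m B})
      \<inter> (\<Inter>A\<in>Pow X. {m. \<bar>m (conj_subgroup G g ` A) - m A\<bar> \<le> 1 / real (Suc n)})"
      unfolding Pair charge_def by auto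
    moreover have "closed \<dots>"
      by (intro closed_Int closed_INT ballI closed_Collect_eq closed_Collect_le continuous_intros ev)
    ultimately show ?thesis by simp
  qed
  have "?K \<inter> (\<Inter>p\<in>carrier G \<times> UNIV. ?C p) \<noteq> {}"
  proof (rule compact_imp_fip_image)
    show "compact ?K" by (rule compact_Pi_sets) auto
    show "closed (?C p)" for p by (rule cl)
    fix I' assume I': "finite I'" "I' \<subseteq> carrier G \<times> (UNIV :: nat set)"
    define N where "N = Max (insert 0 (snd ` I'))"
    have "fst ` I' \<subseteq> carrier G" using I'(2) by force
    then obtain m where m: "charge X m"
      "\<forall>g\<in>fst ` I'. \<forall>A\<subseteq>X. \<bar>m (conj_subgroup G g ` A) - m A\<bar> \<le> 1 / real (Suc N)"
      using ap[OF finite_imageI[OF I'(1)], of fst "1 / real (Suc N)"] by (metis of_nat_0_less_iff zero_less_Suc zero_less_divide_1_iff)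
    \<comment> \<open>The compact cube constrains the values at all sets, but a charge is controlled
      only on subsets of \<open>X\<close>. Intersecting with \<open>X\<close> repairs this without
      changing the relevant values.\<close>
    define m' where "m' A = m (A \<inter> X)" for A
    have m'X: "m' A = m A" if "A \<subseteq> X" for A using that by (simp add: m'_def Int_absorb2)
    have ch: "charge X m'"
      using m(1) unfolding charge_def by (simp add: m'X)
    have K: "m' \<in> ?K"
      using m(1) charge_le_1[OF m(1)] by (auto simp: m'_def charge_def)
    have "m' \<in> ?C p" if p: "p \<in> I'" for p
    proof -
      obtain g n where gn: "p = (g, n)" by force
      have "n \<in> snd ` I'" "g \<in> fst ` I'" using p gn by force+
      have gc: "g \<in> carrier G" using I'(2) p gn by auto
      have "n \<le> N" unfolding N_def using \<open>n \<in> snd ` I'\<close> I'(1) by (intro Max_ge) auto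
      then have le: "1 / real (Suc N) \<le> 1 / real (Suc n)" by (simp add: frac_le)
      have "\<bar>m' (conj_subgroup G g ` A) - m' A\<bar> \<le> 1 / real (Suc n)" if A: "A \<subseteq> X" for A
      proof -
        have "\<bar>m (conj_subgroup G g ` A) - m A\<bar> \<le> 1 / real (Suc N)"
          using m(2) \<open>g \<in> fst ` I'\<close> A by blast
        then show ?thesis using le m'X[OF A] m'X[OF X[OF gc A]] by linarith
      qed
      then show ?thesis using ch gn by simp
    qed
    then show "?K \<inter> (\<Inter>p\<in>I'. ?C p) \<noteq> {}" using K by blast
  qed
  then obtain m where "m \<in> (\<Inter>p\<in>carrier G \<times> UNIV. ?C p)" unfolding ex_in_conv[symmetric] by (elim exE IntE)
  then have m: "m \<in> ?C (g, n)" if "g \<in> carrier G" for g n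
    using that by (elim INT_E[of _ _ _ "(g, n)"]) simp_all
  have "m (conj_subgroup G g ` A) = m A" if "g \<in> carrier G" "A \<subseteq> X" for g A
  proof (rule ccontr)
    assume "m (conj_subgroup G g ` A) \<noteq> m A"
    then obtain n where "1 / real (Suc n) < \<bar>m (conj_subgroup G g ` A) - m A\<bar>"
      using reals_Archimedean[of "\<bar>m (conj_subgroup G g ` A) - m A\<bar>"] by (auto simp: inverse_eq_divide)
    moreover have "\<bar>m (conj_subgroup G g ` A) - m A\<bar> \<le> 1 / real (Suc n)"
      using m[OF that(1), of n] that(2) by simp
    ultimately show False by linarith
  qed
  moreover have "charge X m" using m[OF one_closed, of 0] by simp
  ultimately show "\<exists>m. charge X m \<and> (\<forall>g\<in>carrier G. \<forall>A\<subseteq>X. m (conj_subgroup G g ` A) = m A)" by blast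
qed

section \<open>Cylinder sets and extension to a Borel measure\<close>

definition cylinder_sets :: "'a set set \<Rightarrow> 'a set set set" where
  "cylinder_sets X = {A. A \<subseteq> X \<and> (\<exists>Q. finite Q \<and> Q \<subseteq> carrier G \<and>
     (\<forall>H\<in>X. \<forall>H'\<in>X. H \<inter> Q = H' \<inter> Q \<longrightarrow> (H \<in> A) = (H' \<in> A)))}"

lemma cylinder_setsE:
  assumes "A \<in> cylinder_sets X"
  obtains Q where "A \<subseteq> X" "finite Q" "Q \<subseteq> carrier G"
    "\<forall>H\<in>X. \<forall>H'\<in>X. H \<inter> Q = H' \<inter> Q \<longrightarrow> (H \<in> A) = (H' \<in> A)"
proof -
  have "A \<subseteq> X \<and> (\<exists>Q. finite Q \<and> Q \<subseteq> carrier G \<and>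
     (\<forall>H\<in>X. \<forall>H'\<in>X. H \<inter> Q = H' \<inter> Q \<longrightarrow> (H \<in> A) = (H' \<in> A)))"
    using assms by (simp add: cylinder_sets_def)
  then obtain Q where Q: "A \<subseteq> X" "finite Q" "Q \<subseteq> carrier G"
    "\<forall>H\<in>X. \<forall>H'\<in>X. H \<inter> Q = H' \<inter> Q \<longrightarrow> (H \<in> A) = (H' \<in> A)" by (elim conjE exE)
  show thesis by (rule that[OF Q])
qed

lemma cylinder_setsI:
  assumes "A \<subseteq> X" "finite Q" "Q \<subseteq> carrier G"
    "\<And>H H'. H \<in> X \<Longrightarrow> H' \<in> X \<Longrightarrow> H \<inter> Q = H' \<inter> Q \<Longrightarrow> (H \<in> A) = (H' \<in> A)"
  shows "A \<in> cylinder_sets X"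
  unfolding cylinder_sets_def
  by (intro CollectI conjI exI[of _ Q] ballI impI assms)

lemma algebra_cylinder_sets: "algebra X (cylinder_sets X)"
  unfolding algebra_iff_Un
proof (intro conjI ballI)
  show "cylinder_sets X \<subseteq> Pow X" by (auto simp: cylinder_sets_def)
  show "{} \<in> cylinder_sets X" by (auto simp: cylinder_sets_def)
  fix A assume A: "A \<in> cylinder_sets X"
  then obtain Q where Q: "A \<subseteq> X" "finite Q" "Q \<subseteq> carrier G"
      "\<forall>H\<in>X. \<forall>H'\<in>X. H \<inter> Q = H' \<inter> Q \<longrightarrow> (H \<in> A) = (H' \<in> A)"
    by (rule cylinder_setsE)
  show "X - A \<in> cylinder_sets X"
  proof (rule cylinder_setsI[OF _ Q(2,3)])
    fix H H' assume H: "H \<in> X" "H' \<in> X" "H \<inter> Q = H' \<inter> Q"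
    then have "(H \<in> A) = (H' \<in> A)" by (rule Q(4)[rule_format])
    then show "(H \<in> X - A) = (H' \<in> X - A)" using H by simp
  qed simp
  fix B assume "B \<in> cylinder_sets X"
  then obtain Q' where Q': "B \<subseteq> X" "finite Q'" "Q' \<subseteq> carrier G"
      "\<forall>H\<in>X. \<forall>H'\<in>X. H \<inter> Q' = H' \<inter> Q' \<longrightarrow> (H \<in> B) = (H' \<in> B)"
    by (rule cylinder_setsE)
  have U: "(H \<in> A \<union> B) = (H' \<in> A \<union> B)" if "H \<in> X" "H' \<in> X" "H \<inter> (Q \<union> Q') = H' \<inter> (Q \<union> Q')" for H H'
  proof -
    have "H \<inter> Q = H' \<inter> Q" "H \<inter> Q' = H' \<inter> Q'" using that(3) by blast+
    then have "(H \<in> A) = (H' \<in> A)" "(H \<in> B) = (H' \<in> B)"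
      using Q(4)[rule_format, OF that(1,2)] Q'(4)[rule_format, OF that(1,2)] by (simp_all only:)
    then show ?thesis by simp
  qed
  show "A \<union> B \<in> cylinder_sets X"
    by (rule cylinder_setsI[OF _ _ _ U]) (simp_all add: Q(1-3) Q'(1-3))
qed

lemma cylinder_set_open:
  assumes X: "\<And>H. H \<in> X \<Longrightarrow> subgroup H G" and A: "A \<in> cylinder_sets X"
  shows "\<exists>U. openin (chabauty G) U \<and> A = X \<inter> U"
proof -
  obtain Q where Q: "A \<subseteq> X" "finite Q" "Q \<subseteq> carrier G"
      "\<forall>H\<in>X. \<forall>H'\<in>X. H \<inter> Q = H' \<inter> Q \<longrightarrow> (H \<in> A) = (H' \<in> A)"
    using A by (rule cylinder_setsE)
  let ?U = "\<Union>H\<in>A. {H'. subgroup H' G \<and> H' \<inter> Q = H \<inter> Q}"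
  have "openin (chabauty G) ?U" by (auto intro!: openin_chabauty_cylinder Q)
  moreover have "A = X \<inter> ?U"
    using Q(1) Q(4)[rule_format] X by blast
  ultimately show ?thesis by blast
qed

text \<open>Countability of the group makes the pairs \<open>(S, Q)\<close> of finite sets
  countable, so every relatively open set is a countable union of basic cylinders.\<close>

lemma sigma_sets_cylinder_sets:
  assumes X: "\<And>H. H \<in> X \<Longrightarrow> subgroup H G" and c: "countable (carrier G)"
  shows "sigma_sets X (cylinder_sets X) = sigma_sets X {U. openin (subtopology (chabauty G) X) U}"
proof (rule sigma_sets_eqI)
  fix A assume "A \<in> cylinder_sets X"
  then obtain U where "openin (chabauty G) U" "A = X \<inter> U" using cylinder_set_open[OF X] by metis
  then have "openin (subtopology (chabauty G) X) A" by (auto simp: openin_subtopology)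
  then show "A \<in> sigma_sets X {U. openin (subtopology (chabauty G) X) U}" by (auto intro: sigma_sets.Basic)
next
  fix A assume "A \<in> {U. openin (subtopology (chabauty G) X) U}"
  then obtain U where U: "openin (chabauty G) U" "A = U \<inter> X" by (auto simp: openin_subtopology)
  let ?P = "{S. finite S \<and> S \<subseteq> carrier G} \<times> {S. finite S \<and> S \<subseteq> carrier G}"
  let ?c = "\<lambda>(S, Q). {H \<in> X. H \<inter> Q = S}"
  let ?I = "{p \<in> ?P. ?c p \<subseteq> A}"
  have "countable ?P" using countable_Collect_finite_subset[OF c] by auto
  then have cI: "countable ?I" by (rule countable_subset[rotated]) auto
  have cyl: "?c p \<in> sigma_sets X (cylinder_sets X)" if "p \<in> ?I" for p
    using that by (intro sigma_sets.Basic cylinder_setsI[of _ _ "snd p"]) auto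
  have "A \<subseteq> (\<Union>p\<in>?I. ?c p)"
  proof
    fix H assume H: "H \<in> A"
    then obtain Q where Q: "finite Q" "Q \<subseteq> carrier G"
      "\<forall>H'. subgroup H' G \<longrightarrow> H' \<inter> Q = H \<inter> Q \<longrightarrow> H' \<in> U"
      using chabauty_basis[OF U(1), of H] U(2) by blast
    have "(H \<inter> Q, Q) \<in> ?I" using Q U(2) X by auto
    moreover have "H \<in> ?c (H \<inter> Q, Q)" using H U(2) by auto
    ultimately show "H \<in> (\<Union>p\<in>?I. ?c p)" by blast
  qed
  moreover have "(\<Union>p\<in>?I. ?c p) \<subseteq> A" by blast
  ultimately have "A = (\<Union>p\<in>?I. ?c p)" by (rule subset_antisym)
  moreover have "\<Union>(?c ` ?I) \<in> sigma_sets X (cylinder_sets X)"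
    by (rule sigma_sets_UNION[OF countable_image[OF cI]]) (use cyl in \<open>elim imageE, simp only:\<close>)
  ultimately show "A \<in> sigma_sets X (cylinder_sets X)" by (simp only:)
qed

text \<open>Conjugation by \<open>g\<close> replaces the finite window \<open>Q\<close> that
  determines membership by its conjugate.\<close>

lemma conj_cylinder_sets:
  assumes X: "\<And>H. H \<in> X \<Longrightarrow> H \<subseteq> carrier G"
    and inv: "\<And>g H. g \<in> carrier G \<Longrightarrow> H \<in> X \<Longrightarrow> conj_subgroup G g H \<in> X"
    and g: "g \<in> carrier G" and A: "A \<in> cylinder_sets X"
  shows "conj_subgroup G g ` A \<in> cylinder_sets X"
proof -
  obtain Q where Q: "A \<subseteq> X" "finite Q" "Q \<subseteq> carrier G"
      "\<forall>H\<in>X. \<forall>H'\<in>X. H \<inter> Q = H' \<inter> Q \<longrightarrow> (H \<in> A) = (H' \<in> A)"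
    using A by (rule cylinder_setsE)
  let ?c = "conj_subgroup G g" and ?d = "conj_subgroup G (inv g)"
  have cd: "?c (?d H) = H" "?d (?c H) = H" if "H \<in> X" for H
    using X[OF that] g by (simp_all add: conj_subgroup_mult conj_subgroup_one)
  have mem: "H \<in> ?c ` A \<longleftrightarrow> ?d H \<in> A" if "H \<in> X" for H
  proof
    assume "H \<in> ?c ` A"
    then obtain B where B: "B \<in> A" "H = ?c B" by (elim imageE)
    then show "?d H \<in> A" using cd(2)[of B] Q(1) by (simp add: subsetD)
  next
    assume "?d H \<in> A"
    then show "H \<in> ?c ` A" using cd(1)[OF that] by (intro image_eqI[of H ?c "?d H"]) simp_all
  qed
  let ?Q = "(\<lambda>q. g \<otimes> q \<otimes> inv g) ` Q"
  have "(H \<in> ?c ` A) = (H' \<in> ?c ` A)" if H: "H \<in> X" "H' \<in> X" "H \<inter> ?Q = H' \<inter> ?Q" for H H'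
  proof -
    have "(q \<in> ?d H) = (q \<in> ?d H')" if "q \<in> Q" for q
    proof -
      have "q \<in> carrier G" using that Q(3) by blast
      then have "(q \<in> ?d H) = (g \<otimes> q \<otimes> inv g \<in> H)" "(q \<in> ?d H') = (g \<otimes> q \<otimes> inv g \<in> H')"
        using conj_subgroup_iff[OF X] H g by auto
      then show ?thesis using H(3) that by blast
    qed
    then have "?d H \<inter> Q = ?d H' \<inter> Q" by blast
    then have "(?d H \<in> A) = (?d H' \<in> A)" using Q(4)[rule_format] H inv g by simp
    then show ?thesis using mem H by simp
  qed
  moreover have "?c ` A \<subseteq> X" using Q(1) inv g by blast
  moreover have "finite ?Q" "?Q \<subseteq> carrier G" using Q g by auto
  ultimately show ?thesis by (intro cylinder_setsI[of _ _ ?Q])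
qed

text \<open>Cylinder sets are compact and open, so a finitely additive measure on them is
  automatically countably additive.\<close>

lemma invariant_charge_imp_borel_prob:
  assumes ci: "closed_invariant G X" and c: "countable (carrier G)" and m: "charge X m"
    and inv: "\<And>g A. g \<in> carrier G \<Longrightarrow> A \<subseteq> X \<Longrightarrow> m (conj_subgroup G g ` A) = m A"
  shows "\<exists>\<mu>. invariant_borel_prob G X \<mu>"
proof -
  note X = closed_invariantD[OF ci]
  let ?C = "cylinder_sets X" and ?f = "\<lambda>A. ennreal (m A)"
  interpret A: algebra X ?C by (rule algebra_cylinder_sets)
  have C: "A \<subseteq> X" if "A \<in> ?C" for A using that by (auto simp: cylinder_sets_def)
  have m0: "m {} = 0" using m unfolding charge_def by (metis Int_empty_left Un_empty_left add_cancel_left_left empty_subsetI)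
  have pos: "positive ?C ?f" by (simp add: positive_def m0)
  have add: "additive ?C ?f"
    unfolding additive_def using m C by (auto simp: charge_def ennreal_plus)
  have cont: "(\<lambda>i. ?f (A i)) \<longlonglongrightarrow> 0"
    if A: "range A \<subseteq> ?C" "decseq A" "(\<Inter>i. A i) = {}" for A :: "nat \<Rightarrow> _"
  proof -
    have "\<forall>i. \<exists>U. openin (chabauty G) U \<and> X - A i = X \<inter> U"
      using A(1) X(1) by (intro allI cylinder_set_open) auto
    from choice[OF this] obtain U where "\<forall>i. openin (chabauty G) (U i) \<and> X - A i = X \<inter> U i" ..
    then have U: "openin (chabauty G) (U i)" "X - A i = X \<inter> U i" for i by simp_all
    have "X \<subseteq> (\<Union>i\<in>UNIV. U i)"
    proof
      fix H assume H: "H \<in> X"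
      obtain i where "H \<notin> A i" using A(3) by blast
      then have "H \<in> X - A i" using H by simp
      then show "H \<in> (\<Union>i\<in>UNIV. U i)" using U(2)[of i] by auto
    qed
    then obtain J where J: "finite J" "X \<subseteq> (\<Union>i\<in>J. U i)"
      using chabauty_finite_subcover[of X UNIV U] U(1) ci by (auto simp: closed_invariant_def)
    have "A k = {}" if "Max (insert 0 J) \<le> k" for k
    proof (rule ccontr)
      assume "A k \<noteq> {}"
      then obtain H where H: "H \<in> A k" by blast
      have "A k \<subseteq> X" using A(1) C by blast
      then obtain i where i: "i \<in> J" "H \<in> U i" using J(2) H by blast
      have "i \<le> k" using i J(1) that by (meson Max_ge finite.insertI insertI2 order_trans)
      then have "H \<in> A i" using H A(2) by (auto simp: decseq_def)
      then show False using U(2)[of i] i(2) \<open>A k \<subseteq> X\<close> H by blast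
    qed
    then have "eventually (\<lambda>k. ?f (A k) = 0) sequentially"
      by (intro eventually_sequentiallyI[of "Max (insert 0 J)"]) (simp add: m0)
    then show ?thesis by (rule tendsto_eventually)
  qed
  have "\<exists>\<mu>'. (\<forall>s\<in>?C. \<mu>' s = ?f s) \<and> measure_space X (sigma_sets X ?C) \<mu>'"
  proof (rule A.caratheodory_empty_continuous[OF pos add])
    show "(\<lambda>i. ?f (A i)) \<longlonglongrightarrow> 0"
      if "range A \<subseteq> ?C" "decseq A" "(\<Inter>i. A i) = {}" for A :: "nat \<Rightarrow> _"
      by (rule cont[OF that])
  qed simp
  then obtain \<mu>' where \<mu>': "\<forall>s\<in>?C. \<mu>' s = ?f s" "measure_space X (sigma_sets X ?C) \<mu>'"
    by (elim exE conjE)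
  define M where "M = measure_of X ?C \<mu>'"
  have CX: "?C \<subseteq> Pow X" using C by blast
  have spM: "space M = X" and stM: "sets M = sigma_sets X ?C"
    using CX by (simp_all add: M_def)
  have em: "emeasure M A = ?f A" if "A \<in> ?C" for A
  proof -
    have "emeasure M A = \<mu>' A"
      by (rule emeasure_measure_of[OF M_def CX])
         (use \<mu>'(2) that in \<open>auto simp: measure_space_def stM intro: sigma_sets.Basic\<close>)
    then show ?thesis using \<mu>'(1) that by simp
  qed
  have XC: "X \<in> ?C" by (rule A.top)
  have mX: "emeasure M X = 1" using em[OF XC] m by (simp add: charge_def)
  have P: "prob_space M" by (rule prob_spaceI) (simp add: spM mX)
  have invM: "emeasure M (conj_subgroup G g ` A) = emeasure M A" if g: "g \<in> carrier G" and A: "A \<in> sets M" for g A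
  proof -
    let ?d = "conj_subgroup G (inv g)" and ?c = "conj_subgroup G g"
    have dX: "?d H \<in> X" if "H \<in> X" for H using X(3)[OF that] g by simp
    have cd: "?c (?d H) = H" "?d (?c H) = H" if "H \<in> X" for H
      using X(2)[OF that] g by (simp_all add: conj_subgroup_mult conj_subgroup_one)
    have pre: "?d -` B \<inter> X = ?c ` B" if "B \<subseteq> X" for B
    proof
      show "?d -` B \<inter> X \<subseteq> ?c ` B"
      proof
        fix H assume "H \<in> ?d -` B \<inter> X"
        then show "H \<in> ?c ` B" using cd(1)[of H] by (intro image_eqI[of H ?c "?d H"]) simp_all
      qed
      show "?c ` B \<subseteq> ?d -` B \<inter> X"
      proof
        fix H assume "H \<in> ?c ` B"
        then obtain H' where "H' \<in> B" "H = ?c H'" by (elim imageE)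
        then show "H \<in> ?d -` B \<inter> X" using that cd(2)[of H'] X(3)[of H' g] g by (simp add: subsetD)
      qed
    qed
    have me: "?d \<in> measurable M M"
    proof (rule measurable_sigma_sets[OF stM CX])
      show "?d \<in> space M \<rightarrow> X" using dX spM by auto
      fix B assume "B \<in> ?C"
      then show "?d -` B \<inter> space M \<in> sets M"
        using conj_cylinder_sets[OF X(2) X(3) g, of B] C stM spM pre by (auto intro: sigma_sets.Basic)
    qed
    \<comment> \<open>The pushforward under conjugation by \<open>inv g\<close> evaluates images
      under conjugation by \<open>g\<close>. It agrees with \<open>M\<close> on the cylinder
      algebra, a generator stable under intersections, and hence everywhere.\<close>
    have "distr M M ?d = M"
    proof (rule measure_eqI_generator_eq)
      show "Int_stable ?C" by (auto simp: Int_stable_def)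
      show "?C \<subseteq> Pow X" by (rule CX)
      show "sets (distr M M ?d) = sigma_sets X ?C" "sets M = sigma_sets X ?C" using stM by auto
      fix B assume B: "B \<in> ?C"
      have "emeasure (distr M M ?d) B = emeasure M (?c ` B)"
        using B stM spM pre[OF C[OF B]] by (simp add: emeasure_distr[OF me] sigma_sets.Basic)
      also have "\<dots> = ?f B"
        using em conj_cylinder_sets[OF X(2) X(3) g B] inv[OF g C[OF B]] by simp
      finally show "emeasure (distr M M ?d) B = emeasure M B" using em B by simp
    next
      show "range (\<lambda>i::nat. X) \<subseteq> ?C" "(\<Union>i::nat. X) = X" using XC by auto
      show "emeasure (distr M M ?d) X \<noteq> \<infinity>" for i :: nat
        using emeasure_distr[OF me, of X] pre[of X] XC stM spM em[OF conj_cylinder_sets[OF X(2) X(3) g XC]]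
        by (simp add: sigma_sets.Basic)
    qed
    moreover have "emeasure (distr M M ?d) A = emeasure M (?c ` A)"
      using emeasure_distr[OF me A] pre[of A] A sets.sets_into_space[OF A] spM by simp
    ultimately show ?thesis by simp
  qed
  have "invariant_borel_prob G X M"
    unfolding invariant_borel_prob_def
    using P spM stM sigma_sets_cylinder_sets[OF X(1) c] invM by auto
  then show ?thesis by blast
qed

end

section \<open>Spectral gap\<close>

lemma lfilter_append [simp]: "lfilter P (u @ v) = lfilter P u @ lfilter P v"
  by (simp add: lfilter_def)

lemma lfilter_lscale [simp]: "lfilter P (lscale c u) = lscale c (lfilter P u)"
  by (induction u) (auto simp: lfilter_def lscale_def)

context group
begin

lemma conj_subgroup_self:
  assumes H: "subgroup H G" and x: "x \<in> H" shows "conj_subgroup G x H = H"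
proof (rule subset_antisym; rule subsetI)
  note xc = subgroup.mem_carrier[OF H x]
  note m = subgroup.m_closed[OF H] subgroup.m_inv_closed[OF H]
  show "g \<in> H" if "g \<in> conj_subgroup G x H" for g
  proof -
    obtain h where "h \<in> H" "g = x \<otimes> h \<otimes> inv x"
      using \<open>g \<in> conj_subgroup G x H\<close> unfolding conj_subgroup_def by (elim imageE)
    then show "g \<in> H" using x m by simp
  qed
  show "g \<in> conj_subgroup G x H" if "g \<in> H" for g
    using that conj_subgroup_iff[OF subgroup.subset[OF H] xc subgroup.mem_carrier[OF H]] x m by simp
qed

text \<open>Elements of \<open>H\<close> normalize \<open>H\<close>. Hence the map from
  \<open>g\<close> to the conjugate of \<open>H\<close> by \<open>g\<close> factors through left
  cosets, and functions on the conjugacy class become functions on the coset space.\<close>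

lemma conj_subgroup_coset:
  assumes H: "subgroup H G" and gh: "g \<in> carrier G" "h \<in> carrier G" "inv h \<otimes> g \<in> H"
  shows "conj_subgroup G g H = conj_subgroup G h H"
proof -
  have "g = h \<otimes> (inv h \<otimes> g)" using gh by simp
  then have "conj_subgroup G g H = conj_subgroup G h (conj_subgroup G (inv h \<otimes> g) H)"
    using gh subgroup.subset[OF H] conj_subgroup_mult[of H h "inv h \<otimes> g"] by simp
  then show ?thesis using conj_subgroup_self[OF H gh(3)] by simp
qed

lemma conj_mem_image_iff:
  assumes X: "closed_invariant G X" and H: "H \<in> X" and g: "g \<in> carrier G" "x \<in> carrier G" and A: "A \<subseteq> X"
  shows "conj_subgroup G x H \<in> conj_subgroup G g ` A \<longleftrightarrow> conj_subgroup G (inv g \<otimes> x) H \<in> A"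
proof
  note HX = closed_invariantD(2)[OF X]
  assume "conj_subgroup G x H \<in> conj_subgroup G g ` A"
  then obtain B where B: "B \<in> A" "conj_subgroup G x H = conj_subgroup G g B" by (elim imageE)
  have "conj_subgroup G (inv g \<otimes> x) H = conj_subgroup G (inv g) (conj_subgroup G g B)"
    using B(2) conj_subgroup_mult[OF HX[OF H], of "inv g" x] g by simp
  also have "\<dots> = B"
    using conj_subgroup_mult[OF HX, of B "inv g" g] conj_subgroup_one[OF HX, of B] A B g by (simp add: subset_iff)
  finally show "conj_subgroup G (inv g \<otimes> x) H \<in> A" using B(1) by simp
next
  note HX = closed_invariantD(2)[OF X]
  assume "conj_subgroup G (inv g \<otimes> x) H \<in> A"
  moreover have "conj_subgroup G x H = conj_subgroup G g (conj_subgroup G (inv g \<otimes> x) H)"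
    using conj_subgroup_mult[OF HX[OF H], of g "inv g \<otimes> x"] g by simp
  ultimately show "conj_subgroup G x H \<in> conj_subgroup G g ` A" by blast
qed

text \<open>The lists differ, but the contributions of \<open>lscale (-1) v\<close> and
  \<open>v\<close> to the form cancel; with \<open>nrm_triangle\<close> this yields the reverse
  triangle inequality.\<close>

lemma nrm2_cancel:
  "nrm2 \<omega> ((u @ lscale (-1) v) @ v) = nrm2 \<omega> u"
  by (simp add: nrm2_def)

text \<open>In the representation of \<open>G\<close> induced from \<open>H\<close> by the positive definite function \<open>\<kappa>\<close>,
  functions on the conjugacy class of \<open>H\<close> act by multiplication; so a unit vector which is
  almost fixed by \<open>Q\<close> yields a charge which is almost invariant under \<open>Q\<close>.\<close>

lemma no_almost_invariant_vector:
  assumes X: "closed_invariant G X" and Q: "Q \<subseteq> carrier G" "0 < e"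
    and gap: "\<And>m. charge X m \<Longrightarrow> \<exists>g\<in>Q. \<exists>A\<subseteq>X. e < \<bar>m (conj_subgroup G g ` A) - m A\<bar>"
    and H: "H \<in> X" and \<kappa>: "posdef \<kappa>" and \<omega>: "\<omega> = (\<lambda>g. of_bool (g \<in> H) * \<kappa> g)"
    and u: "u \<in> over (carrier G)" "0 < nrm2 \<omega> u"
  shows "\<exists>g\<in>Q. (e / 2)\<^sup>2 * nrm2 \<omega> u \<le> nrm2 \<omega> (u @ lscale (-1) (ltrans g u))"
proof -
  note Hs = closed_invariantD(1)[OF X H]
  have w: "posdef \<omega>" unfolding \<omega> by (rule posdef_subgroup_restrict[OF Hs \<kappa>])
  define P where "P A g \<longleftrightarrow> conj_subgroup G g H \<in> A" for A g
  \<comment> \<open>The kernel of \<open>\<omega>\<close> connects only elements of one coset of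
    \<open>H\<close>, on which the conjugate of \<open>H\<close> is constant. Cutting by
    \<open>P A\<close> is therefore an orthogonal projection whose squared norm is additive in
    \<open>A\<close>.\<close>
  have Pinv: "P A g = P A h" if "g \<in> carrier G" "h \<in> carrier G" "\<omega> (inv h \<otimes> g) \<noteq> 0" for A g h
    using conj_subgroup_coset[OF Hs that(1,2)] that(3) by (auto simp: P_def \<omega> split: if_splits)
  have T: "nrm2 \<omega> (lfilter (P A) v) = Re (kform (\<lambda>g h. of_bool (P A g) * \<omega> (inv h \<otimes> g)) v v)"
    if "v \<in> over (carrier G)" for A v
    unfolding nrm2_def form_kform kform_lfilter
    by (intro arg_cong[where f=Re] kform_cong[OF that that]) (use Pinv in force)
  have T_add: "nrm2 \<omega> (lfilter (P (A \<union> B)) v) = nrm2 \<omega> (lfilter (P A) v) + nrm2 \<omega> (lfilter (P B) v)"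
    if "v \<in> over (carrier G)" "A \<inter> B = {}" for A B v
    unfolding T[OF that(1)] plus_complex.sel[symmetric] kform_add[symmetric]
    by (intro arg_cong[where f=Re] kform_cong[OF that(1) that(1)]) (use that(2) in \<open>auto simp: P_def\<close>)
  have T_X: "lfilter (P X) v = v" if "v \<in> over (carrier G)" for v
    unfolding lfilter_def using closed_invariantD(3)[OF X H]
    by (intro filter_True) (auto simp: P_def dest: overD[OF that])
  have T_nn: "0 \<le> nrm2 \<omega> (lfilter (P A) v)" if "v \<in> over (carrier G)" for A v
    by (intro nrm2_nonneg[OF w] lfilter_over that)
  have T_le: "nrm2 \<omega> (lfilter (P A) v) \<le> nrm2 \<omega> v" if "v \<in> over (carrier G)" "A \<subseteq> X" for A v
  proof -
    have "A \<union> (X - A) = X" using that by blast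
    then have "nrm2 \<omega> v = nrm2 \<omega> (lfilter (P A) v) + nrm2 \<omega> (lfilter (P (X - A)) v)"
      using T_add[OF that(1), of A "X - A"] T_X[OF that(1)] by simp
    then show ?thesis using T_nn[OF that(1)] by simp
  qed
  define m where "m A = nrm2 \<omega> (lfilter (P A) u) / nrm2 \<omega> u" for A
  have "charge X m"
    unfolding charge_def m_def using u(2) T_X[OF u(1)] T_nn[OF u(1)] T_add[OF u(1)]
    by (simp add: add_divide_distrib)
  then obtain g A where gA: "g \<in> Q" "A \<subseteq> X" "e < \<bar>m (conj_subgroup G g ` A) - m A\<bar>"
    using gap by blast
  have g: "g \<in> carrier G" using gA(1) Q(1) by blast
  let ?u' = "ltrans (inv g) u"
  have u': "?u' \<in> over (carrier G)" using g u(1) by simp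
  \<comment> \<open>Cutting by the translated set is cutting by \<open>A\<close> conjugated by the
    translation, so the values of \<open>m\<close> at both sets are squared norms of the same
    projection at \<open>u\<close> and at its translate.\<close>
  have filt: "lfilter (P (conj_subgroup G g ` A)) v = ltrans g (lfilter (P A) (ltrans (inv g) v))"
    if "v \<in> over (carrier G)" for v
    using that
  proof (induction v)
    case (Cons p v)
    obtain a x where p: "p = (a, x)" by force
    have x: "x \<in> carrier G" using Cons p by simp
    have "P (conj_subgroup G g ` A) x = P A (inv g \<otimes> x)"
      unfolding P_def by (rule conj_mem_image_iff[OF X H g x gA(2)])
    then show ?case using Cons x g by (simp add: p lfilter_def ltrans_def)
  qed (simp add: lfilter_def ltrans_def)
  have "nrm2 \<omega> (lfilter (P (conj_subgroup G g ` A)) u) = nrm2 \<omega> (lfilter (P A) ?u')"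
    unfolding filt[OF u(1)] by (rule nrm2_ltrans[OF g]) (rule lfilter_over[OF u'])
  then have "e < \<bar>nrm2 \<omega> (lfilter (P A) ?u') - nrm2 \<omega> (lfilter (P A) u)\<bar> / nrm2 \<omega> u"
    using gA(3) u(2) by (simp add: m_def diff_divide_distrib[symmetric])
  then have big: "e * nrm2 \<omega> u < \<bar>nrm2 \<omega> (lfilter (P A) ?u') - nrm2 \<omega> (lfilter (P A) u)\<bar>"
    using u(2) by (simp add: less_divide_eq)
  define N where "N v = sqrt (nrm2 \<omega> v)" for v
  have NN: "(N v)\<^sup>2 = nrm2 \<omega> v" "0 \<le> N v" if "v \<in> over (carrier G)" for v
    using nrm2_nonneg[OF w that] by (simp_all add: N_def)
  let ?a = "N (lfilter (P A) ?u')" and ?b = "N (lfilter (P A) u)"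
  let ?D = "N (?u' @ lscale (-1) u)"
  have over: "lfilter (P A) ?u' \<in> over (carrier G)" "lfilter (P A) u \<in> over (carrier G)"
    "?u' @ lscale (-1) u \<in> over (carrier G)" "lfilter (P A) (?u' @ lscale (-1) u) \<in> over (carrier G)"
    using u(1) u' by (simp_all del: lfilter_append)
  have ND: "N (lfilter (P A) (?u' @ lscale (-1) u)) \<le> ?D"
    unfolding N_def using T_le[OF over(3) gA(2)] by simp
  have 1: "?a \<le> N (lfilter (P A) (?u' @ lscale (-1) u)) + ?b"
  proof -
    have "?a = N ((lfilter (P A) ?u' @ lscale (-1) (lfilter (P A) u)) @ lfilter (P A) u)"
      unfolding N_def nrm2_cancel ..
    also have "\<dots> \<le> N (lfilter (P A) (?u' @ lscale (-1) u)) + ?b"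
      unfolding N_def using over by (simp add: nrm_triangle[OF w] del: append_assoc)
    finally show ?thesis .
  qed
  have 2: "?b \<le> N (lfilter (P A) (?u' @ lscale (-1) u)) + ?a"
  proof -
    have "?b = N ((lfilter (P A) u @ lscale (-1) (lfilter (P A) ?u')) @ lfilter (P A) ?u')"
      unfolding N_def nrm2_cancel ..
    also have "\<dots> \<le> N (lfilter (P A) u @ lscale (-1) (lfilter (P A) ?u')) + ?a"
      unfolding N_def using over by (simp add: nrm_triangle[OF w] del: append_assoc)
    also have "N (lfilter (P A) u @ lscale (-1) (lfilter (P A) ?u'))
        = N (lfilter (P A) (?u' @ lscale (-1) u))"
      by (simp add: N_def nrm2_def)
    finally show ?thesis .
  qed
  have absab: "\<bar>?a - ?b\<bar> \<le> ?D" using 1 2 ND by linarith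
  have nu': "nrm2 \<omega> ?u' = nrm2 \<omega> u" using nrm2_ltrans g u(1) by simp
  have ab: "0 \<le> ?a" "0 \<le> ?b" "?a \<le> N u" "?b \<le> N u"
    using NN over T_le[OF u' gA(2)] T_le[OF u(1) gA(2)] nu' by (auto simp: N_def)
  \<comment> \<open>The difference of squares factors, and the sum of the two norms is at most
    \<open>2 * N u\<close>; this is the origin of \<open>e / 2\<close>.\<close>
  have "e * (N u)\<^sup>2 < \<bar>?a\<^sup>2 - ?b\<^sup>2\<bar>" using big NN over u(1) by simp
  also have "\<dots> = \<bar>?a - ?b\<bar> * (?a + ?b)"
    using ab by (simp add: power2_eq_square square_diff_square_factored abs_mult mult.commute)
  also have "\<dots> \<le> ?D * (2 * N u)"
    using absab ab by (intro mult_mono) auto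
  finally have "N u * (e * N u) < N u * (2 * ?D)" by (simp add: power2_eq_square mult_ac)
  then have "e / 2 * N u < ?D" using u by (simp add: N_def)
  then have "(e / 2 * N u)\<^sup>2 \<le> ?D\<^sup>2" using Q(2) NN(2)[OF u(1)] by (intro power_mono) auto
  then have "(e / 2)\<^sup>2 * nrm2 \<omega> u \<le> nrm2 \<omega> (?u' @ lscale (-1) u)"
    by (simp only: power_mult_distrib NN(1)[OF u(1)] NN(1)[OF over(3)])
  also have "\<dots> = nrm2 \<omega> (ltrans g (?u' @ lscale (-1) u))"
    using nrm2_ltrans[OF g over(3)] by simp
  also have "ltrans g (?u' @ lscale (-1) u) = u @ lscale (-1) (ltrans g u)"
  proof -
    have "ltrans g ?u' = u" using ltrans_ltrans[OF inv_closed[OF g] g u(1)] u(1) g by simp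
    moreover have "ltrans g (?u' @ lscale (-1) u) = ltrans g ?u' @ lscale (-1) (ltrans g u)"
      by (simp add: ltrans_def lscale_def case_prod_unfold)
    ultimately show ?thesis by simp
  qed
  finally show ?thesis using gA(1) by blast
qed

text \<open>In the sum over \<open>qs\<close> the terms for \<open>\<one>\<close> and
  \<open>g\<close> are combined, where the hypothesis improves on the trivial factor 2; each
  remaining term contributes at most the norm of \<open>u\<close>, since translations preserve
  it.\<close>

lemma avg_contraction:
  assumes w: "posdef \<omega>" and u: "u \<in> over (carrier G)" and qs: "qs = \<one> # rest" "set qs \<subseteq> carrier G"
    and g: "g \<in> set rest" and \<delta>: "0 \<le> \<delta>" "\<delta> \<le> 4" "nrm2 \<omega> (u @ ltrans g u) \<le> (4 - \<delta>) * nrm2 \<omega> u"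
  shows "sqrt (nrm2 \<omega> (avg qs u))
    \<le> (sqrt (4 - \<delta>) + (real (length qs) - 2)) / real (length qs) * sqrt (nrm2 \<omega> u)"
proof -
  let ?N = "length qs"
  obtain xs ys where xy: "rest = xs @ g # ys" using g by (meson split_list)
  let ?L = "\<lambda>zs. concat (map (\<lambda>q. ltrans q u) zs)"
  have avgf: "form \<omega> (avg zs v) z = 1 / of_nat (length zs) * form \<omega> (concat (map (\<lambda>q. ltrans q v) zs)) z"
    "form \<omega> z (avg zs v) = 1 / of_nat (length zs) * form \<omega> z (concat (map (\<lambda>q. ltrans q v) zs))" for zs v z
    by (simp_all add: avg_def form_concat_left form_concat_right o_def sum_list_const_mult divide_inverse sum_list_mult_const mult.commute)
  have "form \<omega> (avg qs u) (avg qs u) = of_real (1 / (real ?N)\<^sup>2) * form \<omega> (?L qs) (?L qs)"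
    unfolding avgf by (simp add: power2_eq_square)
  then have "nrm2 \<omega> (avg qs u) = 1 / (real ?N)\<^sup>2 * nrm2 \<omega> (?L qs)"
    by (simp add: nrm2_def del: of_real_divide)
  also have "nrm2 \<omega> (?L qs) = nrm2 \<omega> ((u @ ltrans g u) @ (?L xs @ ?L ys))"
    using u by (simp add: qs xy nrm2_def algebra_simps)
  finally have eq: "sqrt (nrm2 \<omega> (avg qs u)) = sqrt (nrm2 \<omega> ((u @ ltrans g u) @ (?L xs @ ?L ys))) / real ?N"
    by (simp add: real_sqrt_divide)
  have gc: "g \<in> carrier G" "set xs \<subseteq> carrier G" "set ys \<subseteq> carrier G" using qs xy by auto
  have Lo: "?L zs \<in> over (carrier G)" if "set zs \<subseteq> carrier G" for zs
    using that u by (intro concat_over) auto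
  have Ln: "sqrt (nrm2 \<omega> (?L zs)) \<le> real (length zs) * sqrt (nrm2 \<omega> u)" if "set zs \<subseteq> carrier G" for zs
  proof -
    have "sqrt (nrm2 \<omega> (?L zs)) \<le> (\<Sum>v\<leftarrow>map (\<lambda>q. ltrans q u) zs. sqrt (nrm2 \<omega> v))"
      using that u by (intro nrm_concat[OF w]) auto
    also have "\<dots> = (\<Sum>q\<leftarrow>zs. sqrt (nrm2 \<omega> u))"
      unfolding map_map o_def using that u by (intro arg_cong[where f=sum_list] map_cong refl) (auto simp: nrm2_ltrans)
    finally show ?thesis by (simp add: sum_list_triv)
  qed
  have "sqrt (nrm2 \<omega> ((u @ ltrans g u) @ (?L xs @ ?L ys)))
      \<le> sqrt (nrm2 \<omega> (u @ ltrans g u)) + sqrt (nrm2 \<omega> (?L xs @ ?L ys))"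
    using u gc Lo by (intro nrm_triangle[OF w]) auto
  also have "sqrt (nrm2 \<omega> (?L xs @ ?L ys)) \<le> sqrt (nrm2 \<omega> (?L xs)) + sqrt (nrm2 \<omega> (?L ys))"
    using u gc Lo by (intro nrm_triangle[OF w]) auto
  also have "\<dots> \<le> real (length xs) * sqrt (nrm2 \<omega> u) + real (length ys) * sqrt (nrm2 \<omega> u)"
    by (intro add_mono Ln gc)
  also have "sqrt (nrm2 \<omega> (u @ ltrans g u)) \<le> sqrt (4 - \<delta>) * sqrt (nrm2 \<omega> u)"
    using \<delta>(3) by (simp add: real_sqrt_mult[symmetric])
  finally have "sqrt (nrm2 \<omega> ((u @ ltrans g u) @ (?L xs @ ?L ys)))
      \<le> (sqrt (4 - \<delta>) + (real ?N - 2)) * sqrt (nrm2 \<omega> u)"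
    by (simp add: qs xy algebra_simps)
  then have "sqrt (nrm2 \<omega> (avg qs u)) \<le> (sqrt (4 - \<delta>) + (real ?N - 2)) * sqrt (nrm2 \<omega> u) / real ?N"
    unfolding eq by (rule divide_right_mono) simp
  then show ?thesis by simp
qed

text \<open>Some \<open>g\<close> in \<open>Q\<close> moves a given list by a definite proportion,
  but which one depends on the list, on \<open>H\<close> and on \<open>\<kappa>\<close>. Averaging
  over all of \<open>Q\<close> gives a contraction by a factor \<open>r\<close> that depends on none
  of them.\<close>

lemma spectral_gap:
  assumes X: "closed_invariant G X" and Q: "finite Q" "Q \<subseteq> carrier G" "0 < e"
    and gap: "\<And>m. charge X m \<Longrightarrow> \<exists>g\<in>Q. \<exists>A\<subseteq>X. e < \<bar>m (conj_subgroup G g ` A) - m A\<bar>"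
  obtains qs r where "symmetric_list qs" "0 < r" "r < 1"
    "\<And>H \<kappa> m. \<lbrakk>H \<in> X; posdef \<kappa>; \<kappa> \<one> = 1\<rbrakk> \<Longrightarrow> walk_mean qs m (\<lambda>g. of_bool (g \<in> H) * \<kappa> g) \<le> r ^ m"
proof -
  obtain l where l: "set l = Q" using finite_list[OF Q(1)] by blast
  \<comment> \<open>The leading identity is the partner of \<open>g\<close> in
    \<open>avg_contraction\<close>; the second identity, which lies in \<open>rest\<close>, is the
    witness for lists of norm 0.\<close>
  define qs where "qs = (\<one> # l) @ map (m_inv G) (\<one> # l)"
  define rest where "rest = l @ map (m_inv G) (\<one> # l)"
  have sym: "symmetric_list qs" unfolding qs_def by (rule symmetric_listI) (use l Q in auto)
  have qsr: "qs = \<one> # rest" "set qs \<subseteq> carrier G" using l Q(2) by (auto simp: qs_def rest_def)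
  \<comment> \<open>The bound by 1 keeps \<open>4 - \<delta>\<close> positive; the other entry is
    the displacement from \<open>no_almost_invariant_vector\<close>.\<close>
  define \<delta> where "\<delta> = min 1 ((e / 2)\<^sup>2)"
  have \<delta>: "0 < \<delta>" "\<delta> \<le> 1" "\<delta> \<le> (e / 2)\<^sup>2" using Q(3) by (auto simp: \<delta>_def)
  define N where "N = real (length qs)"
  have N: "2 \<le> N" by (simp add: N_def qs_def)
  define r where "r = (sqrt (4 - \<delta>) + (N - 2)) / N"
  have "0 < sqrt (4 - \<delta>)" using \<delta> by simp
  then have r0: "0 < r" using N unfolding r_def by (intro divide_pos_pos add_pos_nonneg) auto
  have "sqrt (4 - \<delta>) < sqrt 4" using \<delta>(1) by (intro real_sqrt_less_mono) simp
  then have "sqrt (4 - \<delta>) < 2" by simp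
  then have r1: "r < 1" using N by (simp add: r_def divide_less_eq)
  have "walk_mean qs m (\<lambda>g. of_bool (g \<in> H) * \<kappa> g) \<le> r ^ m"
    if H: "H \<in> X" and \<kappa>: "posdef \<kappa>" "\<kappa> \<one> = 1" for H \<kappa> m
  proof -
    define \<omega> where "\<omega> = (\<lambda>g. of_bool (g \<in> H) * \<kappa> g)"
    note Hs = closed_invariantD(1)[OF X H]
    have w: "posdef \<omega>" unfolding \<omega>_def by (rule posdef_subgroup_restrict[OF Hs \<kappa>(1)])
    have w1: "\<omega> \<one> = 1" using \<kappa>(2) subgroup.one_closed[OF Hs] by (simp add: \<omega>_def)
    have contr: "sqrt (nrm2 \<omega> (avg qs u)) \<le> r * sqrt (nrm2 \<omega> u)" if u: "u \<in> over (carrier G)" for u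
    proof -
      have "\<exists>g\<in>set rest. nrm2 \<omega> (u @ ltrans g u) \<le> (4 - \<delta>) * nrm2 \<omega> u"
      proof (cases "nrm2 \<omega> u = 0")
        case True
        have "nrm2 \<omega> (u @ u) = 4 * nrm2 \<omega> u" by (simp add: nrm2_def)
        then have "nrm2 \<omega> (u @ ltrans \<one> u) \<le> (4 - \<delta>) * nrm2 \<omega> u" using True u by simp
        then show ?thesis by (intro bexI[of _ \<one>]) (auto simp: rest_def)
      next
        case False
        then have pos: "0 < nrm2 \<omega> u" using nrm2_nonneg[OF w u] by simp
        obtain g where g: "g \<in> Q" "(e / 2)\<^sup>2 * nrm2 \<omega> u \<le> nrm2 \<omega> (u @ lscale (-1) (ltrans g u))"
          using no_almost_invariant_vector[OF X Q(2,3) gap H \<kappa>(1) \<omega>_def u pos] by blast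
        have gc: "g \<in> carrier G" using g Q(2) by blast
        \<comment> \<open>The parallelogram law converts the lower bound on the difference into an
          upper bound on the sum.\<close>
        have "nrm2 \<omega> (u @ ltrans g u) + nrm2 \<omega> (u @ lscale (-1) (ltrans g u))
            = 2 * nrm2 \<omega> u + 2 * nrm2 \<omega> (ltrans g u)"
          by (simp add: nrm2_def)
        also have "\<dots> = 4 * nrm2 \<omega> u" using nrm2_ltrans[OF gc u] by simp
        finally have "nrm2 \<omega> (u @ ltrans g u) \<le> 4 * nrm2 \<omega> u - (e / 2)\<^sup>2 * nrm2 \<omega> u" using g(2) by linarith
        also have "\<dots> \<le> 4 * nrm2 \<omega> u - \<delta> * nrm2 \<omega> u" using \<delta>(3) pos by simp
        finally show ?thesis using g(1) l by (intro bexI[of _ g]) (auto simp: rest_def algebra_simps)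
      qed
      then obtain g where g: "g \<in> set rest" "nrm2 \<omega> (u @ ltrans g u) \<le> (4 - \<delta>) * nrm2 \<omega> u" by blast
      show ?thesis
        using avg_contraction[OF w u qsr g(1) _ _ g(2)] \<delta> by (simp add: r_def N_def)
    qed
    have walk: "sqrt (nrm2 \<omega> (walk qs k)) \<le> r ^ k" for k
    proof (induction k)
      case 0
      then show ?case by (simp add: walk_def nrm2_def form_single w1)
    next
      case (Suc k)
      have "sqrt (nrm2 \<omega> (walk qs (Suc k))) \<le> r * sqrt (nrm2 \<omega> (walk qs k))"
        using contr[OF walk_over[OF qsr(2)], of k] by (simp add: walk_def)
      also have "\<dots> \<le> r * r ^ k" using Suc r0 by (intro mult_left_mono) auto
      finally show ?case by simp
    qed
    have "(walk_mean qs m \<omega>)\<^sup>2 \<le> nrm2 \<omega> (walk qs m)"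
      using walk_mean_square[OF sym w, of m] walk_mean_even[OF sym] w1 by simp
    then have "\<bar>walk_mean qs m \<omega>\<bar> \<le> sqrt (nrm2 \<omega> (walk qs m))" by (rule real_le_rsqrt[of "\<bar>_\<bar>", simplified])
    then show ?thesis using walk[of m] unfolding \<omega>_def by linarith
  qed
  then show thesis using that sym r0 r1 by blast
qed

section \<open>The face of characters with a spectral gap\<close>

definition lweight :: "('a \<Rightarrow> complex) \<Rightarrow> (complex \<times> 'a) list \<Rightarrow> (complex \<times> 'a) list" where
  "lweight \<kappa> u = map (\<lambda>(a, g). (a * \<kappa> g, g)) u"

lemma lsum_lweight: "lsum f (lweight \<kappa> u) = lsum (\<lambda>g. f g * \<kappa> g) u"
  by (induction u) (auto simp: lweight_def)

lemma lweight_over: "u \<in> over S \<Longrightarrow> lweight \<kappa> u \<in> over S"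
  by (auto simp: over_def lweight_def case_prod_unfold)

definition gap_face :: "'a list \<Rightarrow> real \<Rightarrow> ('a \<Rightarrow> complex) set" where
  "gap_face qs r = {\<psi> \<in> characters G.
     \<forall>\<kappa>. schur_multiplier \<kappa> \<longrightarrow> (\<forall>m. walk_mean qs m (\<lambda>g. \<psi> g * \<kappa> g) \<le> r ^ m)}"

text \<open>For a fixed multiplier the bound is a real linear inequality in \<open>\<phi>\<close>,
  the one tested by the list \<open>lweight \<kappa> (walk qs m)\<close>. It holds for the indicator
  functions of members of \<open>X\<close> and hence on the hull.\<close>

lemma indicator_hull_gap_face:
  assumes qs: "set qs \<subseteq> carrier G" and \<phi>: "\<phi> \<in> indicator_hull X" "\<phi> \<in> characters G"
    and gap: "\<And>H \<kappa> m. \<lbrakk>H \<in> X; posdef \<kappa>; \<kappa> \<one> = 1\<rbrakk> \<Longrightarrow> walk_mean qs m (\<lambda>g. of_bool (g \<in> H) * \<kappa> g) \<le> r ^ m"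
  shows "\<phi> \<in> gap_face qs r"
proof -
  have "walk_mean qs m (\<lambda>g. \<phi> g * \<kappa> g) \<le> r ^ m" if "schur_multiplier \<kappa>" for \<kappa> m
    unfolding walk_mean_def lsum_lweight[symmetric]
  proof (rule indicator_hullD[OF \<phi>(1)])
    show "lweight \<kappa> (walk qs m) \<in> over (carrier G)" by (rule lweight_over[OF walk_over[OF qs]])
    fix H assume "H \<in> X"
    then show "Re (lsum (\<lambda>g. of_bool (g \<in> H)) (lweight \<kappa> (walk qs m))) \<le> r ^ m"
      unfolding lsum_lweight walk_mean_def[symmetric]
      using that schur_multiplier_posdef[OF that] by (intro gap) (auto simp: schur_multiplier_def)
  qed
  then show ?thesis using \<phi>(2) by (simp add: gap_face_def)
qed

lemma closed_gap_face: "compact (gap_face qs r)" "closed (gap_face qs r)"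
proof -
  let ?C = "\<Inter>\<kappa>\<in>Collect schur_multiplier. \<Inter>m. {\<psi>. Re (lsum \<psi> (lweight \<kappa> (walk qs m))) \<le> r ^ m}"
  have "gap_face qs r = characters G \<inter> ?C"
    by (auto simp: gap_face_def walk_mean_def lsum_lweight)
  moreover have "closed ?C"
    by (intro closed_INT ballI closed_Collect_le continuous_on_Re_lsum continuous_on_const)
  ultimately show "compact (gap_face qs r)" "closed (gap_face qs r)"
    using compact_closed_characters by (simp_all only: compact_Int_closed closed_Int)
qed

text \<open>Dropping the remainder coming from \<open>b\<close> can only decrease even moments, so
  those of \<open>a\<close> times a multiplier are at most \<open>r ^ (2 * k) / t\<close>;
  \<open>walk_mean_power_trick\<close> then discards the factor \<open>1 / t\<close>.\<close>

lemma gap_face_split: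
  assumes qs: "symmetric_list qs" and r: "0 < r" and t: "0 < t"
    and \<psi>: "\<psi> \<in> gap_face qs r" and a: "a \<in> characters G" and b: "posdef b"
    and eq: "\<And>g. g \<in> carrier G \<Longrightarrow> \<psi> g = of_real t * a g + b g"
  shows "a \<in> gap_face qs r"
proof -
  have c: "set qs \<subseteq> carrier G" using qs by (simp add: symmetric_list_def)
  have "walk_mean qs m (\<lambda>g. a g * \<kappa> g) \<le> r ^ m" if \<kappa>: "schur_multiplier \<kappa>" for \<kappa> m
  proof -
    have pa: "posdef (\<lambda>g. a g * \<kappa> g)"
      using a \<kappa> by (auto simp: characters_def PD1_iff intro: posdef_schur)
    have one: "a \<one> * \<kappa> \<one> = 1" using a \<kappa> by (auto simp: characters_def PD1_iff schur_multiplier_def)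
    have "walk_mean qs m (\<lambda>g. a g * \<kappa> g) \<le> r ^ m * Re (a \<one> * \<kappa> \<one>)"
    proof (rule walk_mean_power_trick[OF qs pa r, where C = "1 / t"])
      fix k
      have "posdef (\<lambda>g. b g * \<kappa> g)" by (rule posdef_schur[OF b \<kappa>])
      then have "posdef (\<lambda>g. \<psi> g * \<kappa> g - of_real t * (a g * \<kappa> g))"
        by (subst posdef_cong[of _ "\<lambda>g. b g * \<kappa> g"]) (auto simp: eq algebra_simps)
      from walk_mean_diff[OF qs this]
      have "walk_mean qs (2 * k) (\<lambda>g. of_real t * (a g * \<kappa> g)) \<le> walk_mean qs (2 * k) (\<lambda>g. \<psi> g * \<kappa> g)" .
      also have "\<dots> \<le> r ^ (2 * k)" using \<psi> \<kappa> by (simp add: gap_face_def)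
      finally have "t * walk_mean qs (2 * k) (\<lambda>g. a g * \<kappa> g) \<le> r ^ (2 * k)"
        by (simp add: walk_mean_def lsum_cmult)
      then show "walk_mean qs (2 * k) (\<lambda>g. a g * \<kappa> g) \<le> 1 / t * r ^ (2 * k)"
        using t by (simp add: field_simps)
    qed
    then show ?thesis using one by simp
  qed
  then show ?thesis using a by (simp add: gap_face_def)
qed

text \<open>By \<open>gap_face_split\<close> a segment of characters with an interior point in
  \<open>gap_face\<close> has both endpoints there. The set is therefore a face, and its extreme
  points are extreme among all characters.\<close>

lemma gap_face_extreme:
  assumes qs: "symmetric_list qs" and r: "0 < r" and e: "\<psi> extreme_point_of gap_face qs r"
  shows "extremal_character G \<psi>"
  unfolding extremal_character_def extreme_point_of_def
proof (intro conjI ballI notI)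
  have \<psi>: "\<psi> \<in> gap_face qs r" using e by (simp add: extreme_point_of_def)
  then show "\<psi> \<in> characters G" by (simp add: gap_face_def)
  fix a b assume ab: "a \<in> characters G" "b \<in> characters G" and seg: "\<psi> \<in> open_segment a b"
  obtain t where t: "0 < t" "t < 1" "\<psi> = (1 - t) *\<^sub>R a + t *\<^sub>R b"
    using seg by (auto simp: in_segment)
  have pd: "posdef a" "posdef b" using ab by (auto simp: characters_def PD1_iff)
  have "a \<in> gap_face qs r"
    by (rule gap_face_split[OF qs r _ \<psi> ab(1) posdef_cmult[of t, OF _ pd(2)], of "1 - t"])
       (use t in \<open>auto simp: scaleR_fun_def scaleR_conv_of_real\<close>)
  moreover have "b \<in> gap_face qs r"
    by (rule gap_face_split[OF qs r _ \<psi> ab(2) posdef_cmult[of "1 - t", OF _ pd(1)], of t])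
       (use t in \<open>auto simp: scaleR_fun_def scaleR_conv_of_real\<close>)
  ultimately show False using e seg by (auto simp: extreme_point_of_def)
qed

lemma gap_face_extremal_character:
  assumes "countable (carrier G)" and qs: "symmetric_list qs" and r: "0 < r"
    and \<phi>: "\<phi> \<in> gap_face qs r" and h: "h \<in> carrier G" "0 < Re (\<phi> h)"
  obtains \<psi> where "\<psi> \<in> gap_face qs r" "extremal_character G \<psi>" "\<psi> h \<noteq> 0"
proof -
  have "gap_face qs r \<subseteq> PD1 G" by (auto simp: gap_face_def characters_def)
  moreover have "gap_face qs r \<noteq> {}" using \<phi> by blast
  ultimately obtain \<psi> where \<psi>: "\<psi> extreme_point_of gap_face qs r"
    "\<forall>x\<in>gap_face qs r. Re (lsum x [(1, h)]) \<le> Re (lsum \<psi> [(1, h)])"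
    using PD1_extreme_point_maximizing[OF assms(1) _ closed_gap_face _ continuous_on_Re_lsum affine_fun_on_Re_lsum]
    by blast
  have "0 < Re (\<psi> h)" using \<psi>(2) \<phi> h(2) by fastforce
  moreover have "\<psi> \<in> gap_face qs r" using \<psi>(1) by (simp add: extreme_point_of_def)
  ultimately show thesis using that gap_face_extreme[OF qs r \<psi>(1)] by fastforce
qed

end

section \<open>Square-summable families\<close>

lemma cscale_apply [simp]: "cscale c x i = c * x i"
  by (simp add: cscale_def)

lemma diff_cscale: "x - y = x + cscale (-1) y"
  by (simp add: fun_eq_iff)

lemma ell2_add:
  assumes "x \<in> ell2" "y \<in> ell2" shows "x + y \<in> ell2"
proof -
  have sm: "(\<lambda>i. 2 * (cmod (x i))\<^sup>2 + 2 * (cmod (y i))\<^sup>2) summable_on UNIV"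
    using assms by (intro summable_on_add summable_on_cmult_right) (auto simp: ell2_def)
  have le: "norm ((cmod ((x + y) i))\<^sup>2) \<le> 2 * (cmod (x i))\<^sup>2 + 2 * (cmod (y i))\<^sup>2" for i
  proof -
    have "(cmod (x i + y i))\<^sup>2 \<le> (cmod (x i) + cmod (y i))\<^sup>2"
      by (intro power_mono norm_triangle_ineq) auto
    also have "\<dots> \<le> 2 * (cmod (x i))\<^sup>2 + 2 * (cmod (y i))\<^sup>2"
      using sum_squares_bound[of "cmod (x i)" "cmod (y i)"] by (simp add: power2_sum)
    finally show ?thesis by simp
  qed
  have "(\<lambda>i. norm ((cmod ((x + y) i))\<^sup>2)) summable_on UNIV"
    by (rule Infinite_Sum.abs_summable_on_comparison_test'[OF sm]) (rule le)
  then show ?thesis by (simp add: ell2_def)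
qed

lemma ell2_cscale: "x \<in> ell2 \<Longrightarrow> cscale c x \<in> ell2"
  by (auto simp: ell2_def norm_mult power_mult_distrib intro: summable_on_cmult_right)

lemma ell2_zero: "0 \<in> ell2"
  by (simp add: ell2_def)

lemma subspace_ell2: "cfun.subspace ell2"
  by (simp add: cfun.subspace_def ell2_add ell2_cscale ell2_zero)

lemma ell2_diff: "x \<in> ell2 \<Longrightarrow> y \<in> ell2 \<Longrightarrow> x - y \<in> ell2"
  by (rule cfun.subspace_diff[OF subspace_ell2])

lemma ip_summable:
  assumes "x \<in> ell2" "y \<in> ell2" shows "(\<lambda>i. x i * cnj (y i)) summable_on UNIV"
proof -
  have sm: "(\<lambda>i. (cmod (x i))\<^sup>2 + (cmod (y i))\<^sup>2) summable_on UNIV"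
    using assms by (intro summable_on_add) (auto simp: ell2_def)
  have le: "norm (x i * cnj (y i)) \<le> (cmod (x i))\<^sup>2 + (cmod (y i))\<^sup>2" for i
  proof -
    have "0 \<le> cmod (x i) * cmod (y i)" by simp
    then show ?thesis
      using sum_squares_bound[of "cmod (x i)" "cmod (y i)"] unfolding norm_mult complex_mod_cnj by linarith
  qed
  have "(\<lambda>i. norm (x i * cnj (y i))) summable_on UNIV"
    by (rule Infinite_Sum.abs_summable_on_comparison_test'[OF sm]) (rule le)
  then show ?thesis by (rule abs_summable_summable)
qed

lemma ip_has_sum: "x \<in> ell2 \<Longrightarrow> y \<in> ell2 \<Longrightarrow> ((\<lambda>i. x i * cnj (y i)) has_sum ip x y) UNIV"
  unfolding ip_def by (rule has_sum_infsum[OF ip_summable])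

lemma ip_add:
  assumes "x \<in> ell2" "y \<in> ell2" "z \<in> ell2"
  shows "ip (x + y) z = ip x z + ip y z" "ip z (x + y) = ip z x + ip z y"
  using infsum_add[OF ip_summable[OF assms(1,3)] ip_summable[OF assms(2,3)]]
    infsum_add[OF ip_summable[OF assms(3,1)] ip_summable[OF assms(3,2)]]
  by (simp_all add: ip_def algebra_simps)

lemma ip_cscale: "ip (cscale c x) y = c * ip x y" "ip x (cscale c y) = cnj c * ip x y"
  by (simp_all add: ip_def infsum_cmult_right' mult.assoc mult.left_commute)

lemma ip_cnj: "ip y x = cnj (ip x y)"
  unfolding ip_def infsum_cnj[symmetric] by (simp add: mult.commute)

lemma ip_zero [simp]: "ip 0 x = 0" "ip x 0 = 0"
  by (simp_all add: ip_def)

lemma l2norm_nonneg [simp]: "0 \<le> l2norm x"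
  by (simp add: l2norm_def infsum_nonneg)

lemma l2norm_square: "(l2norm x)\<^sup>2 = (\<Sum>\<^sub>\<infinity>i. (cmod (x i))\<^sup>2)"
  by (simp add: l2norm_def infsum_nonneg)

lemma ip_self: assumes "x \<in> ell2" shows "ip x x = of_real ((l2norm x)\<^sup>2)"
proof -
  have "((\<lambda>i. (cmod (x i))\<^sup>2) has_sum (l2norm x)\<^sup>2) UNIV"
    unfolding l2norm_square using assms by (simp add: ell2_def)
  then have "((\<lambda>i. complex_of_real ((cmod (x i))\<^sup>2)) has_sum of_real ((l2norm x)\<^sup>2)) UNIV"
    by (rule has_sum_of_real)
  then show ?thesis unfolding complex_norm_square ip_def by (rule infsumI)
qed

lemma Re_ip_self: "x \<in> ell2 \<Longrightarrow> Re (ip x x) = (l2norm x)\<^sup>2"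
  by (simp add: ip_self del: of_real_power)

lemma l2norm_add_square:
  assumes "x \<in> ell2" "y \<in> ell2"
  shows "(l2norm (x + y))\<^sup>2 = (l2norm x)\<^sup>2 + 2 * Re (ip x y) + (l2norm y)\<^sup>2"
  using assms ip_cnj[of y x] by (simp add: Re_ip_self[symmetric] ell2_add ip_add)

lemma l2norm_cscale: "l2norm (cscale c x) = cmod c * l2norm x"
  by (simp add: l2norm_def norm_mult power_mult_distrib infsum_cmult_right' real_sqrt_mult)

lemma l2norm_zero [simp]: "l2norm 0 = 0"
  by (simp add: l2norm_def)

lemma l2norm_minus_commute: "l2norm (x - y) = l2norm (y - x)"
  by (simp add: l2norm_def norm_minus_commute)

lemma Re_ip_le:
  assumes "x \<in> ell2" "y \<in> ell2" shows "\<bar>Re (ip x y)\<bar> \<le> l2norm x * l2norm y"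
proof -
  have "(Re (ip x y))\<^sup>2 \<le> (l2norm x)\<^sup>2 * (l2norm y)\<^sup>2"
  proof (rule discriminant_le)
    fix t :: real
    have "0 \<le> (l2norm (x + cscale (of_real t) y))\<^sup>2" by simp
    then show "0 \<le> (l2norm x)\<^sup>2 + 2 * t * Re (ip x y) + t\<^sup>2 * (l2norm y)\<^sup>2"
      using assms by (simp add: l2norm_add_square ell2_cscale ip_cscale l2norm_cscale power_mult_distrib)
  qed simp
  then have "\<bar>Re (ip x y)\<bar>\<^sup>2 \<le> (l2norm x * l2norm y)\<^sup>2" by (simp add: power_mult_distrib)
  then show ?thesis by (rule power2_le_imp_le) simp
qed

lemma l2norm_triangle:
  assumes "x \<in> ell2" "y \<in> ell2" shows "l2norm (x + y) \<le> l2norm x + l2norm y"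
proof (rule power2_le_imp_le)
  show "(l2norm (x + y))\<^sup>2 \<le> (l2norm x + l2norm y)\<^sup>2"
    using Re_ip_le[OF assms] by (simp add: l2norm_add_square[OF assms] power2_sum)
qed simp

lemma l2norm_diff_triangle:
  assumes "x \<in> ell2" "y \<in> ell2" "z \<in> ell2"
  shows "l2norm (x - z) \<le> l2norm (x - y) + l2norm (y - z)"
  using l2norm_triangle[of "x - y" "y - z"] assms by (simp add: ell2_diff)

lemma l2norm_eq_0D: assumes "x \<in> ell2" "l2norm x = 0" shows "x = 0"
proof
  fix i
  have "(\<Sum>\<^sub>\<infinity>i. (cmod (x i))\<^sup>2) \<le> 0" using assms(2) l2norm_square[of x] by simp
  then have "(cmod (x i))\<^sup>2 = 0"
    using assms(1) by (intro nonneg_infsum_le_0D[where A=UNIV]) (auto simp: ell2_def)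
  then show "x i = 0 i" by simp
qed

lemma l2_closureI: "x \<in> ell2 \<Longrightarrow> (\<And>e. 0 < e \<Longrightarrow> \<exists>y\<in>S. l2norm (x - y) < e) \<Longrightarrow> x \<in> l2_closure S"
  by (simp add: l2_closure_def)

lemma l2_closureD: "x \<in> l2_closure S \<Longrightarrow> 0 < e \<Longrightarrow> \<exists>y\<in>S. l2norm (x - y) < e"
  by (simp add: l2_closure_def)

lemma l2_closure_ell2: "l2_closure S \<subseteq> ell2"
  by (auto simp: l2_closure_def)

lemma l2_closure_superset: "S \<subseteq> ell2 \<Longrightarrow> S \<subseteq> l2_closure S"
  by (force intro: l2_closureI)

lemma l2_closure_mono: "S \<subseteq> S' \<Longrightarrow> l2_closure S \<subseteq> l2_closure S'"
  by (fastforce simp: l2_closure_def)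

lemma l2_closure_idem:
  assumes "S \<subseteq> ell2" shows "l2_closure (l2_closure S) \<subseteq> l2_closure S"
proof
  fix x assume x: "x \<in> l2_closure (l2_closure S)"
  then have xe: "x \<in> ell2" using l2_closure_ell2 by blast
  show "x \<in> l2_closure S"
  proof (rule l2_closureI[OF xe])
    fix e :: real assume "0 < e"
    then obtain y where y: "y \<in> l2_closure S" "l2norm (x - y) < e / 2"
      using l2_closureD[OF x, of "e/2"] by auto
    then obtain z where z: "z \<in> S" "l2norm (y - z) < e / 2"
      using l2_closureD[OF y(1), of "e/2"] \<open>0 < e\<close> by auto
    have "l2norm (x - z) \<le> l2norm (x - y) + l2norm (y - z)"
      using xe y(1) z(1) l2_closure_ell2 assms by (intro l2norm_diff_triangle) auto
    then show "\<exists>y\<in>S. l2norm (x - y) < e" using y z by force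
  qed
qed

lemma subspace_l2_closure:
  assumes S: "cfun.subspace S" "S \<subseteq> ell2" shows "cfun.subspace (l2_closure S)"
  unfolding cfun.subspace_def
proof (intro conjI ballI allI)
  have e: "x \<in> ell2" if "x \<in> l2_closure S" for x using that l2_closure_ell2 by blast
  show "0 \<in> l2_closure S"
    using l2_closure_superset[OF S(2)] cfun.subspace_0[OF S(1)] by blast
  fix x assume x: "x \<in> l2_closure S"
  show "cscale c x \<in> l2_closure S" for c
  proof (rule l2_closureI[OF ell2_cscale[OF e[OF x]]])
    fix d :: real assume d: "0 < d"
    then obtain y where y: "y \<in> S" "l2norm (x - y) < d / (cmod c + 1)"
      using l2_closureD[OF x, of "d / (cmod c + 1)"] by (auto simp: add_nonneg_pos)
    have c1: "0 < cmod c + 1" by (simp add: add_nonneg_pos)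
    have "cscale c x - cscale c y = cscale c (x - y)" by (simp add: fun_eq_iff algebra_simps)
    then have "l2norm (cscale c x - cscale c y) = cmod c * l2norm (x - y)" by (simp add: l2norm_cscale)
    also have "\<dots> \<le> (cmod c + 1) * l2norm (x - y)" by (intro mult_right_mono) auto
    also have "\<dots> < d" using y(2) c1 by (simp add: less_divide_eq mult.commute)
    finally show "\<exists>z\<in>S. l2norm (cscale c x - z) < d" using y(1) cfun.subspace_scale[OF S(1)] by blast
  qed
  fix y assume y: "y \<in> l2_closure S"
  show "x + y \<in> l2_closure S"
  proof (rule l2_closureI[OF ell2_add[OF e[OF x] e[OF y]]])
    fix d :: real assume d: "0 < d"
    obtain x' where x': "x' \<in> S" "l2norm (x - x') < d / 2" using l2_closureD[OF x, of "d/2"] d by auto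
    obtain y' where y': "y' \<in> S" "l2norm (y - y') < d / 2" using l2_closureD[OF y, of "d/2"] d by auto
    have "l2norm ((x - x') + (y - y')) \<le> l2norm (x - x') + l2norm (y - y')"
      using x' y' S(2) e x y by (intro l2norm_triangle ell2_diff) auto
    moreover have "(x - x') + (y - y') = (x + y) - (x' + y')" by simp
    ultimately have "l2norm ((x + y) - (x' + y')) < d" using x'(2) y'(2) by simp
    then show "\<exists>z\<in>S. l2norm (x + y - z) < d" using cfun.subspace_add[OF S(1) x'(1) y'(1)] by blast
  qed
qed

lemma hilbertD:
  assumes "hilbert H"
  shows "H \<subseteq> ell2" "cfun.subspace H" "l2_closure H \<subseteq> H"
  using assms by (auto simp: hilbert_def)

section \<open>Isometries and tensor products\<close>

definition isometry_on :: "('i \<Rightarrow> complex) set \<Rightarrow> 'i operator \<Rightarrow> bool" where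
  "isometry_on H S \<longleftrightarrow> linear_between H H S \<and> (\<forall>x\<in>H. l2norm (S x) = l2norm x)"

lemma isometry_onD:
  assumes "isometry_on H S"
  shows "x \<in> H \<Longrightarrow> S x \<in> H" "x \<in> H \<Longrightarrow> y \<in> H \<Longrightarrow> S (x + y) = S x + S y"
    "x \<in> H \<Longrightarrow> S (cscale c x) = cscale c (S x)" "x \<in> H \<Longrightarrow> l2norm (S x) = l2norm x"
  using assms by (auto simp: isometry_on_def linear_between_def)

lemma isometry_on_diff:
  assumes "isometry_on H S" "cfun.subspace H" "x \<in> H" "y \<in> H" shows "S (x - y) = S x - S y"
  unfolding diff_cscale
  using assms isometry_onD(2,3)[OF assms(1)] by (metis cfun.subspace_scale)

text \<open>Polarization: the norms of sums give the real part, and replacing \<open>y\<close> by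
  \<open>cscale \<i> y\<close> gives the imaginary part.\<close>

lemma isometry_on_ip:
  assumes S: "isometry_on H S" and H: "cfun.subspace H" "H \<subseteq> ell2" and xy: "x \<in> H" "y \<in> H"
  shows "ip (S x) (S y) = ip x y"
proof -
  note I = isometry_onD[OF S]
  have Re: "Re (ip (S a) (S b)) = Re (ip a b)" if ab: "a \<in> H" "b \<in> H" for a b
  proof -
    have e: "a \<in> ell2" "b \<in> ell2" "S a \<in> ell2" "S b \<in> ell2" using ab I(1) H(2) by auto
    have "l2norm (S a + S b) = l2norm (a + b)"
      using I ab H(1) by (metis cfun.subspace_add)
    then show ?thesis using l2norm_add_square[OF e(1,2)] l2norm_add_square[OF e(3,4)] I(4) ab by simp
  qed
  have "Re (ip (S x) (S (cscale \<i> y))) = Re (ip x (cscale \<i> y))"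
    using xy H(1) by (intro Re) (auto simp: cfun.subspace_scale)
  then have "Im (ip (S x) (S y)) = Im (ip x y)"
    using I(3)[OF xy(2), of \<i>] by (simp add: ip_cscale)
  then show ?thesis using Re[OF xy] by (simp add: complex_eq_iff)
qed

text \<open>Agreement on \<open>E\<close> passes to the span by linearity and to its closure by
  boundedness. This yields the uniqueness of tensor product operators and their compatibility with
  the group law.\<close>

lemma linear_continuous_eq:
  assumes S: "cfun.subspace S" "S \<subseteq> ell2" and E: "l2_closure (cfun.span E) = S"
    and lin: "linear_between S S A" "linear_between S S B"
    and bd: "\<And>x. x \<in> S \<Longrightarrow> l2norm (A x) \<le> C * l2norm x" "\<And>x. x \<in> S \<Longrightarrow> l2norm (B x) \<le> D * l2norm x"
    and ES: "E \<subseteq> S" and eq: "\<And>x. x \<in> E \<Longrightarrow> A x = B x" and x: "x \<in> S"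
  shows "A x = B x"
proof -
  have span_sub: "cfun.span E \<subseteq> S" using cfun.span_minimal[OF ES S(1)] .
  have "cfun.subspace {x \<in> S. A x = B x}"
  proof -
    have "A 0 = B 0"
      using lin cfun.subspace_0[OF S(1)] unfolding linear_between_def
      by (metis cfun.scale_zero_left)
    then show ?thesis
      using lin S(1) by (auto simp: cfun.subspace_def linear_between_def)
  qed
  then have span_eq: "A y = B y" if "y \<in> cfun.span E" for y
    using cfun.span_minimal[of E "{x \<in> S. A x = B x}"] ES eq that by blast
  have mem: "A y \<in> ell2" "B y \<in> ell2" "A y \<in> S" "B y \<in> S" if "y \<in> S" for y
    using lin S(2) that by (auto simp: linear_between_def)
  have "l2norm (A x - B x) \<le> 0"
  proof (rule field_le_epsilon)
    fix e :: real assume e: "0 < e"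
    define M where "M = \<bar>C\<bar> + \<bar>D\<bar> + 1"
    have M: "0 < M" by (simp add: M_def add_nonneg_pos)
    obtain y where y: "y \<in> cfun.span E" "l2norm (x - y) < e / M"
      using l2_closureD[of x "cfun.span E" "e / M"] x E e M by auto
    have yS: "y \<in> S" "x - y \<in> S" using y span_sub x cfun.subspace_diff[OF S(1)] by auto
    have A: "A x = A y + A (x - y)" and B: "B x = B y + B (x - y)"
      using lin yS unfolding linear_between_def by (metis add.commute diff_add_cancel)+
    have "A x - B x = A (x - y) + cscale (-1) (B (x - y))"
      unfolding A B span_eq[OF y(1)] by (simp add: fun_eq_iff)
    then have "l2norm (A x - B x) \<le> l2norm (A (x - y)) + l2norm (cscale (-1) (B (x - y)))"
      using l2norm_triangle[OF mem(1)[OF yS(2)] ell2_cscale[OF mem(2)[OF yS(2)], of "-1"]] by (simp only:)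
    also have "l2norm (cscale (-1) (B (x - y))) = l2norm (B (x - y))"
      unfolding l2norm_cscale by simp
    also have "l2norm (A (x - y)) + l2norm (B (x - y)) \<le> C * l2norm (x - y) + D * l2norm (x - y)" using bd yS(2) by (intro add_mono)
    also have "\<dots> \<le> M * l2norm (x - y)"
      unfolding M_def distrib_right[symmetric] by (intro mult_right_mono) auto
    also have "\<dots> \<le> e" using y(2) M by (simp add: less_divide_eq mult.commute less_imp_le)
    finally show "l2norm (A x - B x) \<le> 0 + e" by (simp only: add_0)
  qed
  then have "l2norm (A x - B x) = 0" using l2norm_nonneg[of "A x - B x"] by linarith
  then have "A x - B x = 0" by (rule l2norm_eq_0D[OF ell2_diff[OF mem(1)[OF x] mem(2)[OF x]]])
  then show ?thesis by simp
qed

lemma isometry_maps_closure: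
  assumes W: "cfun.subspace W" "W \<subseteq> ell2" and F: "isometry_on W F"
    and E: "E \<subseteq> W" "F ` E \<subseteq> cfun.span E" "l2_closure (cfun.span E) \<subseteq> W"
    and z: "z \<in> l2_closure (cfun.span E)"
  shows "F z \<in> l2_closure (cfun.span E)"
proof -
  note I = isometry_onD[OF F]
  have sW: "cfun.span E \<subseteq> W" using cfun.span_minimal[OF E(1) W(1)] .
  have F0: "F 0 = 0" using I(3)[OF cfun.subspace_0[OF W(1)], of 0] by (simp add: fun_eq_iff)
  have "cfun.subspace {y \<in> W. F y \<in> cfun.span E}"
    using W(1) I F0 cfun.span_zero cfun.span_add cfun.span_scale
    by (auto simp: cfun.subspace_def)
  then have span: "F y \<in> cfun.span E" if "y \<in> cfun.span E" for y
    using cfun.span_minimal[of E "{y \<in> W. F y \<in> cfun.span E}"] E that by blast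
  have zW: "z \<in> W" using z E(3) by blast
  show ?thesis
  proof (rule l2_closureI)
    show "F z \<in> ell2" using I(1)[OF zW] W(2) by blast
    fix e :: real assume "0 < e"
    then obtain y where y: "y \<in> cfun.span E" "l2norm (z - y) < e" using l2_closureD[OF z] by blast
    have yW: "y \<in> W" using y sW by blast
    have "l2norm (F z - F y) = l2norm (z - y)"
      using isometry_on_diff[OF F W(1) zW yW] I(4)[OF cfun.subspace_diff[OF W(1) zW yW]] by simp
    then show "\<exists>y\<in>cfun.span E. l2norm (F z - y) < e" using span y by metis
  qed
qed

section \<open>Tensor products of isometries\<close>

definition row :: "('i \<times> 'j \<Rightarrow> complex) \<Rightarrow> 'i \<Rightarrow> 'j \<Rightarrow> complex" where
  "row z i = (\<lambda>j. z (i, j))"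

definition rows_in :: "('j \<Rightarrow> complex) set \<Rightarrow> ('i \<times> 'j \<Rightarrow> complex) set" where
  "rows_in K = {z \<in> ell2. \<forall>i. row z i \<in> K}"

text \<open>This is the tensor product of the identity with \<open>T\<close>, acting on a matrix row
  by row; conjugation by \<open>swap_fun\<close> gives the operators on the other factor.\<close>

definition row_op :: "'j operator \<Rightarrow> ('i \<times> 'j) operator" where
  "row_op T z = (\<lambda>(i, j). T (row z i) j)"

lemma row_linear [simp]: "row (z + w) i = row z i + row w i" "row (z - w) i = row z i - row w i"
  "row (cscale c z) i = cscale c (row z i)" "row 0 i = 0"
  by (simp_all add: row_def fun_eq_iff)

lemma row_ell2:
  assumes "z \<in> ell2"
  shows "row z i \<in> ell2" "(\<lambda>i. (l2norm (row z i))\<^sup>2) summable_on UNIV"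
    "(\<Sum>\<^sub>\<infinity>i. (l2norm (row z i))\<^sup>2) = (l2norm z)\<^sup>2" "l2norm (row z i) \<le> l2norm z"
proof -
  have sm: "(\<lambda>p. (cmod (z p))\<^sup>2) summable_on Sigma UNIV (\<lambda>_. UNIV)"
    using assms by (simp add: ell2_def)
  show re: "row z i \<in> ell2" for i
    using summable_on_SigmaD1[of "\<lambda>i j. (cmod (z (i, j)))\<^sup>2" UNIV "\<lambda>_. UNIV" i] sm
    by (simp add: ell2_def row_def case_prod_unfold)
  show s: "(\<lambda>i. (l2norm (row z i))\<^sup>2) summable_on UNIV"
    unfolding l2norm_square row_def using summable_on_SigmaD[OF sm] re by (simp add: ell2_def row_def)
  show eq: "(\<Sum>\<^sub>\<infinity>i. (l2norm (row z i))\<^sup>2) = (l2norm z)\<^sup>2"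
    unfolding l2norm_square row_def using infsum_Sigma_banach[OF sm] by simp
  have "(\<Sum>i\<in>{i}. (l2norm (row z i))\<^sup>2) \<le> (\<Sum>\<^sub>\<infinity>i. (l2norm (row z i))\<^sup>2)"
    by (rule finite_sum_le_infsum[OF s]) auto
  then have "(l2norm (row z i))\<^sup>2 \<le> (l2norm z)\<^sup>2" using eq by simp
  then show "l2norm (row z i) \<le> l2norm z" by (rule power2_le_imp_le) simp
qed

lemma ell2_prodI:
  assumes "\<And>i. row z i \<in> ell2" "(\<lambda>i. (l2norm (row z i))\<^sup>2) summable_on UNIV"
  shows "z \<in> ell2"
proof -
  have "(\<lambda>p. (cmod (z p))\<^sup>2) summable_on Sigma UNIV (\<lambda>_. UNIV)"
  proof (rule summable_on_SigmaI[OF _ assms(2)])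
    fix i
    show "((\<lambda>j. (cmod (z (i, j)))\<^sup>2) has_sum (l2norm (row z i))\<^sup>2) UNIV"
      unfolding l2norm_square using assms(1)[of i] by (simp add: ell2_def row_def)
  qed simp
  then show ?thesis by (simp add: ell2_def)
qed

lemma subspace_rows_in: "cfun.subspace K \<Longrightarrow> cfun.subspace (rows_in K)"
  by (auto simp: rows_in_def cfun.subspace_def ell2_add ell2_cscale ell2_zero)

lemma closed_rows_in:
  assumes K: "hilbert K" shows "l2_closure (rows_in K) \<subseteq> rows_in K"
proof
  fix z assume z: "z \<in> l2_closure (rows_in K)"
  then have ze: "z \<in> ell2" using l2_closure_ell2 by blast
  have "row z i \<in> l2_closure K" for i
  proof (rule l2_closureI[OF row_ell2(1)[OF ze]])
    fix e :: real assume "0 < e"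
    then obtain y where y: "y \<in> rows_in K" "l2norm (z - y) < e" using l2_closureD[OF z] by blast
    have "l2norm (row z i - row y i) \<le> l2norm (z - y)"
      using row_ell2(4)[of "z - y" i] ze y by (simp add: ell2_diff rows_in_def)
    then show "\<exists>y\<in>K. l2norm (row z i - y) < e"
      using y by (intro bexI[of _ "row y i"]) (auto simp: rows_in_def)
  qed
  then show "z \<in> rows_in K" using ze hilbertD(3)[OF K] by (auto simp: rows_in_def)
qed

text \<open>The squared norm of a family indexed by pairs is the sum of the squared norms of its
  rows, and \<open>T\<close> preserves each of them.\<close>

lemma row_op_isometry:
  fixes K :: "('j \<Rightarrow> complex) set"
  assumes K: "hilbert K" and T: "isometry_on K T"
  shows "isometry_on (rows_in K :: ('i \<times> 'j \<Rightarrow> complex) set) (row_op T)"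
proof -
  let ?R = "rows_in K :: ('i \<times> 'j \<Rightarrow> complex) set"
  note I = isometry_onD[OF T]
  have row: "row (row_op T z) i = T (row z i)" for z i by (simp add: row_def row_op_def fun_eq_iff)
  have mem: "row_op T z \<in> ?R" if z: "z \<in> ?R" for z
  proof -
    have "row_op T z \<in> ell2"
      using z I(1,4) row_ell2(2)[of z] hilbertD(1)[OF K]
      by (intro ell2_prodI) (auto simp: row rows_in_def)
    then show ?thesis using z I(1) by (simp add: rows_in_def row)
  qed
  have nrm: "l2norm (row_op T z) = l2norm z" if z: "z \<in> ?R" for z
  proof -
    have "(l2norm (row_op T z))\<^sup>2 = (l2norm z)\<^sup>2"
      using z mem[OF z] I(4) row_ell2(3)[of z, symmetric] row_ell2(3)[of "row_op T z", symmetric]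
      by (simp add: rows_in_def row)
    then show ?thesis by simp
  qed
  have "linear_between ?R ?R (row_op T)"
    using mem I by (auto simp: linear_between_def rows_in_def row_op_def fun_eq_iff)
  then show ?thesis using nrm by (simp add: isometry_on_def)
qed

definition swap_fun :: "('i \<times> 'j \<Rightarrow> complex) \<Rightarrow> 'j \<times> 'i \<Rightarrow> complex" where
  "swap_fun z = (\<lambda>(j, i). z (i, j))"

lemma swap_fun_simps [simp]:
  "swap_fun (swap_fun z) = z" "swap_fun (z + w) = swap_fun z + swap_fun w"
  "swap_fun (z - w) = swap_fun z - swap_fun w"
  "swap_fun 0 = 0" "swap_fun (cscale c z) = cscale c (swap_fun z)" "swap_fun (tensor_vec x y) = tensor_vec y x"
  by (auto simp: swap_fun_def tensor_vec_def fun_eq_iff)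

lemma swap_fun_o: "(\<lambda>p. (cmod (swap_fun z p))\<^sup>2) = (\<lambda>p. (cmod (z p))\<^sup>2) \<circ> prod.swap"
  by (auto simp: swap_fun_def fun_eq_iff)

lemma swap_fun_l2 [simp]: "l2norm (swap_fun z) = l2norm z" "swap_fun z \<in> ell2 \<longleftrightarrow> z \<in> ell2"
proof -
  have "infsum (\<lambda>p. (cmod (z p))\<^sup>2) (prod.swap ` UNIV) = infsum ((\<lambda>p. (cmod (z p))\<^sup>2) \<circ> prod.swap) UNIV"
    by (rule infsum_reindex) simp
  then show "l2norm (swap_fun z) = l2norm z" by (simp add: l2norm_def swap_fun_o)
  have "(\<lambda>p. (cmod (z p))\<^sup>2) summable_on (prod.swap ` UNIV)
      \<longleftrightarrow> ((\<lambda>p. (cmod (z p))\<^sup>2) \<circ> prod.swap) summable_on UNIV"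
    by (rule summable_on_reindex) simp
  then show "swap_fun z \<in> ell2 \<longleftrightarrow> z \<in> ell2" by (simp add: ell2_def swap_fun_o)
qed

lemma tensor_vec_row: "row (tensor_vec x y) i = cscale (x i) y"
  by (simp add: row_def tensor_vec_def fun_eq_iff)

lemma tensor_vec_ell2:
  assumes "x \<in> ell2" "y \<in> ell2" shows "tensor_vec x y \<in> ell2"
    and l2norm_tensor_vec: "l2norm (tensor_vec x y) = l2norm x * l2norm y"
proof -
  have r: "(l2norm (row (tensor_vec x y) i))\<^sup>2 = (cmod (x i))\<^sup>2 * (l2norm y)\<^sup>2" for i
    by (simp add: tensor_vec_row l2norm_cscale power_mult_distrib)
  show e: "tensor_vec x y \<in> ell2"
  proof (rule ell2_prodI)
    show "row (tensor_vec x y) i \<in> ell2" for i using assms by (simp add: tensor_vec_row ell2_cscale)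
    show "(\<lambda>i. (l2norm (row (tensor_vec x y) i))\<^sup>2) summable_on UNIV"
      unfolding r using assms by (intro summable_on_cmult_left) (simp add: ell2_def)
  qed
  have "(l2norm (tensor_vec x y))\<^sup>2 = (l2norm x * l2norm y)\<^sup>2"
    unfolding row_ell2(3)[OF e, symmetric] r power_mult_distrib l2norm_square[of x]
    by (rule infsum_cmult_left')
  then show "l2norm (tensor_vec x y) = l2norm x * l2norm y" by simp
qed

lemma tensor_vec_linear:
  "tensor_vec (x + x') y = tensor_vec x y + tensor_vec x' y"
  "tensor_vec x (y + y') = tensor_vec x y + tensor_vec x y'"
  "tensor_vec (x - x') y = tensor_vec x y - tensor_vec x' y"
  "tensor_vec x (y - y') = tensor_vec x y - tensor_vec x y'"
  "tensor_vec (cscale c x) y = cscale c (tensor_vec x y)"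
  "tensor_vec x (cscale c y) = cscale c (tensor_vec x y)"
  "tensor_vec 0 y = 0" "tensor_vec x 0 = 0"
  by (auto simp: tensor_vec_def fun_eq_iff algebra_simps)

lemma ip_tensor_vec:
  assumes "x \<in> ell2" "y \<in> ell2" "x' \<in> ell2" "y' \<in> ell2"
  shows "ip (tensor_vec x y) (tensor_vec x' y') = ip x x' * ip y y'"
proof -
  have "(\<lambda>p. tensor_vec x y p * cnj (tensor_vec x' y' p)) summable_on Sigma UNIV (\<lambda>_. UNIV)"
    using ip_summable[OF tensor_vec_ell2(1)[OF assms(1,2)] tensor_vec_ell2(1)[OF assms(3,4)]] by simp
  from infsum_Sigma_banach[OF this]
  have "ip (tensor_vec x y) (tensor_vec x' y') = (\<Sum>\<^sub>\<infinity>i. \<Sum>\<^sub>\<infinity>j. (x i * cnj (x' i)) * (y j * cnj (y' j)))"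
    by (simp add: ip_def tensor_vec_def mult_ac)
  also have "\<dots> = ip x x' * ip y y'"
    by (simp add: ip_def infsum_cmult_right' infsum_cmult_left')
  finally show ?thesis .
qed

abbreviation elementary_tensors ::
    "('i \<Rightarrow> complex) set \<Rightarrow> ('j \<Rightarrow> complex) set \<Rightarrow> ('i \<times> 'j \<Rightarrow> complex) set" where
  "elementary_tensors H K \<equiv> {tensor_vec x y | x y. x \<in> H \<and> y \<in> K}"

lemma elementary_tensors_ell2:
  assumes "hilbert H" "hilbert K"
  shows "elementary_tensors H K \<subseteq> ell2" "cfun.span (elementary_tensors H K) \<subseteq> ell2"
proof -
  show 1: "elementary_tensors H K \<subseteq> ell2"
    using hilbertD(1)[OF assms(1)] hilbertD(1)[OF assms(2)] by (auto intro!: tensor_vec_ell2(1))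
  show "cfun.span (elementary_tensors H K) \<subseteq> ell2" by (rule cfun.span_minimal[OF 1 subspace_ell2])
qed

lemma tensor_space_props:
  assumes "hilbert H" "hilbert K"
  shows "cfun.subspace (tensor_space H K)" "tensor_space H K \<subseteq> ell2"
    "elementary_tensors H K \<subseteq> tensor_space H K"
proof -
  note e = elementary_tensors_ell2[OF assms]
  show "cfun.subspace (tensor_space H K)"
    unfolding tensor_space_def by (rule subspace_l2_closure[OF cfun.subspace_span e(2)])
  show "tensor_space H K \<subseteq> ell2" unfolding tensor_space_def by (rule l2_closure_ell2)
  show "elementary_tensors H K \<subseteq> tensor_space H K"
    unfolding tensor_space_def by (rule subset_trans[OF cfun.span_superset l2_closure_superset[OF e(2)]])
qed

text \<open>On the larger space \<open>rows_in K\<close> the operator is already known to be an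
  isometry. It maps elementary tensors to elementary tensors, so it preserves the closure of their
  span.\<close>

lemma row_op_tensor_space:
  assumes H: "hilbert H" and K: "hilbert K" and T: "isometry_on K T"
  shows "isometry_on (tensor_space H K) (row_op T)"
    "\<And>x y. y \<in> K \<Longrightarrow> row_op T (tensor_vec x y) = tensor_vec x (T y)"
proof -
  note I = isometry_onD[OF T]
  let ?E = "elementary_tensors H K"
  show E: "row_op T (tensor_vec x y) = tensor_vec x (T y)" if "y \<in> K" for x y
    unfolding row_op_def tensor_vec_row I(3)[OF that] by (simp add: tensor_vec_def cscale_def)
  have W: "cfun.subspace (rows_in K)" "rows_in K \<subseteq> ell2"
    using subspace_rows_in[OF hilbertD(2)[OF K]] by (auto simp: rows_in_def)
  have EW: "?E \<subseteq> rows_in K"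
    using hilbertD(2)[OF K] elementary_tensors_ell2(1)[OF H K]
    by (auto simp: rows_in_def tensor_vec_row cfun.subspace_scale)
  have TW: "tensor_space H K \<subseteq> rows_in K"
    unfolding tensor_space_def
    using l2_closure_mono[OF cfun.span_minimal[OF EW W(1)]] closed_rows_in[OF K] by blast
  have FE: "row_op T ` ?E \<subseteq> cfun.span ?E"
  proof
    fix z assume "z \<in> row_op T ` ?E"
    then obtain x y where "x \<in> H" "y \<in> K" "z = tensor_vec x (T y)" using E by auto
    then show "z \<in> cfun.span ?E" using I(1) by (intro cfun.span_base) auto
  qed
  note R = row_op_isometry[OF K T]
  have "row_op T z \<in> tensor_space H K" if "z \<in> tensor_space H K" for z
    using isometry_maps_closure[OF W R EW FE] TW that unfolding tensor_space_def by blast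
  then show "isometry_on (tensor_space H K) (row_op T)"
    using R TW unfolding isometry_on_def linear_between_def by (auto simp: subset_iff)
qed

lemma swap_tensor_space:
  assumes z: "z \<in> tensor_space H K" shows "swap_fun z \<in> tensor_space K H"
proof -
  have sub: "swap_fun y \<in> cfun.span (elementary_tensors K H)"
    if "y \<in> cfun.span (elementary_tensors H K)" for y
  proof -
    have "cfun.subspace {y. swap_fun y \<in> cfun.span (elementary_tensors K H)}"
      by (auto simp: cfun.subspace_def intro: cfun.span_zero cfun.span_add cfun.span_scale)
    moreover have "elementary_tensors H K \<subseteq> {y. swap_fun y \<in> cfun.span (elementary_tensors K H)}"
      by (auto intro!: cfun.span_base) blast
    ultimately show ?thesis using cfun.span_minimal that by blast
  qed
  show ?thesis
    unfolding tensor_space_def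
  proof (rule l2_closureI)
    show "swap_fun z \<in> ell2" using z l2_closure_ell2 by (auto simp: tensor_space_def)
    fix e :: real assume "0 < e"
    then obtain y where y: "y \<in> cfun.span (elementary_tensors H K)" "l2norm (z - y) < e"
      using l2_closureD[OF z[unfolded tensor_space_def]] by blast
    have "l2norm (swap_fun z - swap_fun y) = l2norm (z - y)"
      unfolding swap_fun_simps(3)[symmetric] by (rule swap_fun_l2(1))
    then show "\<exists>y\<in>cfun.span (elementary_tensors K H). l2norm (swap_fun z - y) < e"
      using sub[OF y(1)] y(2) by (intro bexI[of _ "swap_fun y"]) (simp_all only:)
  qed
qed

lemma isometry_on_comp:
  "isometry_on H S \<Longrightarrow> isometry_on H T \<Longrightarrow> isometry_on H (\<lambda>x. S (T x))"
  by (auto simp: isometry_on_def linear_between_def image_subset_iff)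

lemma col_op_tensor_space:
  assumes H: "hilbert H" and K: "hilbert K" and S: "isometry_on H S"
  shows "isometry_on (tensor_space H K) (\<lambda>z. swap_fun (row_op S (swap_fun z)))"
proof -
  have R: "isometry_on (tensor_space K H) (row_op S)" by (rule row_op_tensor_space(1)[OF K H S])
  note I = isometry_onD[OF R]
  show ?thesis
    using I swap_tensor_space[of _ H K] swap_tensor_space[of _ K H]
    by (auto simp: isometry_on_def linear_between_def)
qed

text \<open>As \<open>tensor_op\<close> is a definite description, both existence and uniqueness are
  due. Existence composes two isometries that act on one factor each; uniqueness follows from
  density of the span of the elementary tensors.\<close>

lemma tensor_op:
  assumes H: "hilbert H" and K: "hilbert K" and S: "isometry_on H S" and T: "isometry_on K T"
  shows "isometry_on (tensor_space H K) (tensor_op H K S T)"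
    "\<And>x y. x \<in> H \<Longrightarrow> y \<in> K \<Longrightarrow> tensor_op H K S T (tensor_vec x y) = tensor_vec (S x) (T y)"
proof -
  let ?W = "tensor_space H K"
  note W = tensor_space_props[OF H K]
  define F where "F z = row_op T (swap_fun (row_op S (swap_fun z)))" for z
  have F: "isometry_on ?W F"
    unfolding F_def by (rule isometry_on_comp[OF row_op_tensor_space(1)[OF H K T] col_op_tensor_space[OF H K S]])
  have FE: "F (tensor_vec x y) = tensor_vec (S x) (T y)" if "x \<in> H" "y \<in> K" for x y
    using that by (simp add: F_def row_op_tensor_space(2)[OF K H S] row_op_tensor_space(2)[OF H K T])
  \<comment> \<open>Members of \<open>bounded_ops\<close> are extensional, hence the
    restriction.\<close>
  define A where "A = restrict F ?W"
  have A: "isometry_on ?W A"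
    using F W(1) by (auto simp: isometry_on_def linear_between_def A_def cfun.subspace_def)
  have AE: "A (tensor_vec x y) = tensor_vec (S x) (T y)" if "x \<in> H" "y \<in> K" for x y
    using FE[OF that] W(3) that by (auto simp: A_def)
  have Ab: "A \<in> bounded_ops ?W"
    using A by (auto simp: bounded_ops_def isometry_on_def A_def intro!: exI[of _ 1])
  have uniq: "B = A" if B: "B \<in> bounded_ops ?W" "\<forall>x\<in>H. \<forall>y\<in>K. B (tensor_vec x y) = tensor_vec (S x) (T y)" for B
  proof (rule extensionalityI)
    show "B \<in> extensional ?W" "A \<in> extensional ?W" using B(1) Ab by (auto simp: bounded_ops_def)
    obtain C where C: "\<And>x. x \<in> ?W \<Longrightarrow> l2norm (B x) \<le> C * l2norm x"
      using B(1) by (auto simp: bounded_ops_def)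
    fix z assume z: "z \<in> ?W"
    show "B z = A z"
    proof (rule linear_continuous_eq[OF W(1,2) _ _ _ C, where E = "elementary_tensors H K" and D = 1])
      show "linear_between ?W ?W B" "linear_between ?W ?W A"
        using B(1) A by (auto simp: bounded_ops_def isometry_on_def)
      show "l2_closure (cfun.span (elementary_tensors H K)) = ?W" by (simp add: tensor_space_def)
      show "l2norm (A x) \<le> 1 * l2norm x" if "x \<in> ?W" for x using isometry_onD(4)[OF A that] by simp
      show "B x = A x" if "x \<in> elementary_tensors H K" for x using that B(2) AE by auto
    qed (use z W(3) in auto)
  qed
  have "tensor_op H K S T = A"
    unfolding tensor_op_def
    by (rule the_equality) (intro conjI ballI Ab AE, assumption+, elim conjE, rule uniq)
  then show "isometry_on ?W (tensor_op H K S T)"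
    "\<And>x y. x \<in> H \<Longrightarrow> y \<in> K \<Longrightarrow> tensor_op H K S T (tensor_vec x y) = tensor_vec (S x) (T y)"
    using A AE by auto
qed

section \<open>Amenable characters\<close>

definition vsum :: "('a \<Rightarrow> 'i \<Rightarrow> complex) \<Rightarrow> (complex \<times> 'a) list \<Rightarrow> 'i \<Rightarrow> complex" where
  "vsum f u = (\<Sum>(a, g)\<leftarrow>u. cscale a (f g))"

lemma vsum_simps [simp]: "vsum f [] = 0" "vsum f ((a, g) # u) = cscale a (f g) + vsum f u"
  by (simp_all add: vsum_def)

lemma vsum_mem:
  assumes "cfun.subspace S" "u \<in> over A" "\<And>g. g \<in> A \<Longrightarrow> f g \<in> S" shows "vsum f u \<in> S"
  using assms(2)
  by (induction u) (auto simp: cfun.subspace_0[OF assms(1)] intro!: cfun.subspace_add[OF assms(1)]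
      cfun.subspace_scale[OF assms(1)] assms(3))

lemma vsum_cong: "u \<in> over A \<Longrightarrow> (\<And>g. g \<in> A \<Longrightarrow> f g = f' g) \<Longrightarrow> vsum f u = vsum f' u"
  by (induction u) auto

lemma vsum_add: "vsum (\<lambda>g. f g + f' g) u = vsum f u + vsum f' u"
  by (induction u) (auto simp: fun_eq_iff algebra_simps)

lemma vsum_cscale: "vsum (\<lambda>g. cscale c (f g)) u = cscale c (vsum f u)"
  by (induction u) (auto simp: fun_eq_iff algebra_simps)

lemma ip_vsum_left:
  assumes "u \<in> over A" "\<And>g. g \<in> A \<Longrightarrow> f g \<in> ell2" "w \<in> ell2"
  shows "ip (vsum f u) w = lsum (\<lambda>g. ip (f g) w) u"
  using assms(1)
proof (induction u)
  case (Cons p u)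
  obtain a g where p: "p = (a, g)" by force
  have "vsum f u \<in> ell2" using Cons vsum_mem[OF subspace_ell2] assms(2) by auto
  then have eq: "ip (vsum f ((a, g) # u)) w = a * ip (f g) w + ip (vsum f u) w"
    unfolding vsum_simps ip_cscale(1)[symmetric] using Cons assms p
    by (intro ip_add(1)) (auto simp: ell2_cscale)
  show ?case unfolding p eq using Cons p by simp
qed simp

lemma ip_vsum_right:
  assumes "v \<in> over A" "\<And>g. g \<in> A \<Longrightarrow> f g \<in> ell2" "w \<in> ell2"
  shows "ip w (vsum f v) = (\<Sum>(b, h)\<leftarrow>v. cnj b * ip w (f h))"
  using assms(1)
proof (induction v)
  case (Cons p u)
  obtain a g where p: "p = (a, g)" by force
  have "vsum f u \<in> ell2" using Cons vsum_mem[OF subspace_ell2] assms(2) by auto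
  then have eq: "ip w (vsum f ((a, g) # u)) = cnj a * ip w (f g) + ip w (vsum f u)"
    unfolding vsum_simps ip_cscale(2)[symmetric] using Cons assms p
    by (intro ip_add(2)) (auto simp: ell2_cscale)
  show ?case unfolding p eq using Cons p by simp
qed simp

lemma l2norm_vsum:
  assumes "u \<in> over A" "\<And>g. g \<in> A \<Longrightarrow> f g \<in> ell2" "\<And>g. g \<in> A \<Longrightarrow> l2norm (f g) \<le> M"
  shows "l2norm (vsum f u) \<le> (\<Sum>(a, g)\<leftarrow>u. cmod a) * M"
  using assms(1)
proof (induction u)
  case (Cons p u)
  obtain a g where p: "p = (a, g)" by force
  have "vsum f u \<in> ell2" using Cons vsum_mem[OF subspace_ell2] assms(2) by auto
  then have "l2norm (cscale a (f g) + vsum f u) \<le> l2norm (cscale a (f g)) + l2norm (vsum f u)"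
    using Cons p assms(2) by (intro l2norm_triangle ell2_cscale) auto
  also have "l2norm (cscale a (f g)) \<le> cmod a * M"
    unfolding l2norm_cscale using Cons p assms(3) by (intro mult_left_mono) auto
  finally have "l2norm (vsum f ((a, g) # u)) \<le> cmod a * M + l2norm (vsum f u)"
    unfolding vsum_simps by simp
  then show ?case unfolding p using Cons p by (simp add: distrib_right del: vsum_simps)
qed simp

lemma has_sum_kform:
  assumes k: "\<And>g h. g \<in> S \<Longrightarrow> h \<in> S \<Longrightarrow> ((\<lambda>i. k i g h) has_sum K g h) UNIV"
    and uv: "u \<in> over S" "v \<in> over S"
  shows "((\<lambda>i. kform (k i) u v) has_sum kform K u v) UNIV"
proof -
  have inner: "((\<lambda>i. \<Sum>(b, h)\<leftarrow>v. cnj b * k i g h) has_sum (\<Sum>(b, h)\<leftarrow>v. cnj b * K g h)) UNIV"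
    if "g \<in> S" for g
    using uv(2)
  proof (induction v)
    case (Cons p v)
    obtain b h where "p = (b, h)" by force
    then show ?case using Cons k[OF that, of h]
      by (auto intro!: has_sum_add has_sum_cmult_right)
  qed simp
  show ?thesis
    unfolding kform_def using uv(1)
  proof (induction u)
    case (Cons p u)
    obtain a g where "p = (a, g)" by force
    then show ?case using Cons inner[of g]
      by (auto intro!: has_sum_add has_sum_cmult_right)
  qed simp
qed

context group
begin

section \<open>Gram functions and unitary representations\<close>

lemma form_lweight:
  "form \<omega> (lweight \<kappa> u) (lweight \<kappa> v) = kform (\<lambda>g h. \<kappa> g * cnj (\<kappa> h) * \<omega> (inv h \<otimes> g)) u v"
proof -
  have "(\<Sum>(b, h)\<leftarrow>lweight \<kappa> v. cnj b * \<omega> (inv h \<otimes> g)) = (\<Sum>(b, h)\<leftarrow>v. cnj b * (cnj (\<kappa> h) * \<omega> (inv h \<otimes> g)))" for g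
    by (simp add: lweight_def o_def case_prod_unfold mult.assoc)
  then show ?thesis
    unfolding form_def kform_def lsum_lweight
    by (simp add: case_prod_unfold sum_list_const_mult[symmetric] mult_ac)
qed

text \<open>Schur's product theorem: each coordinate \<open>i\<close> of the vectors contributes the
  form of \<open>\<omega>'\<close> at the list with weights multiplied by \<open>f g i\<close>,
  which is nonnegative, and the form of the product is the convergent sum of these
  contributions.\<close>

lemma posdef_gram_mult:
  assumes f: "\<And>g. g \<in> carrier G \<Longrightarrow> f g \<in> ell2"
    and \<omega>: "\<And>g h. g \<in> carrier G \<Longrightarrow> h \<in> carrier G \<Longrightarrow> \<omega> (inv h \<otimes> g) = ip (f g) (f h)"
    and w': "posdef \<omega>'"
  shows "posdef (\<lambda>g. \<omega>' g * \<omega> g)"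
  unfolding posdef_def
proof
  fix u assume u: "u \<in> over (carrier G)"
  let ?k = "\<lambda>i g h. f g i * cnj (f h i) * \<omega>' (inv h \<otimes> g)"
  have "((\<lambda>i. kform (?k i) u u) has_sum kform (\<lambda>g h. \<omega>' (inv h \<otimes> g) * \<omega> (inv h \<otimes> g)) u u) UNIV"
  proof (rule has_sum_kform[OF _ u u])
    fix g h assume gh: "g \<in> carrier G" "h \<in> carrier G"
    show "((\<lambda>i. ?k i g h) has_sum \<omega>' (inv h \<otimes> g) * \<omega> (inv h \<otimes> g)) UNIV"
      unfolding \<omega>[OF gh] mult.commute[of _ "\<omega>' _"]
      by (intro has_sum_cmult_right ip_has_sum f gh)
  qed
  then have hs: "((\<lambda>i. kform (?k i) u u) has_sum form (\<lambda>g. \<omega>' g * \<omega> g) u u) UNIV"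
    by (simp add: form_kform)
  have nn: "kform (?k i) u u \<in> \<real>\<^sub>\<ge>\<^sub>0" for i
    using w' lweight_over[OF u, of "\<lambda>g. f g i"] unfolding posdef_def
    by (simp add: form_lweight[symmetric, where \<kappa> = "\<lambda>g. f g i" and \<omega> = \<omega>'])
  have Re: "0 \<le> Re (form (\<lambda>g. \<omega>' g * \<omega> g) u u)"
    using nn by (intro has_sum_nonneg[OF has_sum_Re[OF hs]]) (simp add: complex_nonneg_Reals_iff)
  have "((\<lambda>i. 0) has_sum Im (form (\<lambda>g. \<omega>' g * \<omega> g) u u)) (UNIV :: 'c set)"
    using has_sum_Im[OF hs] nn by (simp add: complex_nonneg_Reals_iff)
  then have "Im (form (\<lambda>g. \<omega>' g * \<omega> g) u u) = 0" by (metis has_sum_0 has_sum_unique)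
  then show "form (\<lambda>g. \<omega>' g * \<omega> g) u u \<in> \<real>\<^sub>\<ge>\<^sub>0" using Re by (simp add: complex_nonneg_Reals_iff)
qed

lemma posdef_gram:
  assumes "\<And>g. g \<in> carrier G \<Longrightarrow> f g \<in> ell2"
    "\<And>g h. g \<in> carrier G \<Longrightarrow> h \<in> carrier G \<Longrightarrow> \<omega> (inv h \<otimes> g) = ip (f g) (f h)"
  shows "posdef \<omega>"
  using posdef_gram_mult[where f=f and \<omega>=\<omega>, OF assms posdef_const1] by simp

lemma form_gram:
  assumes f: "\<And>g. g \<in> carrier G \<Longrightarrow> f g \<in> ell2"
    and \<omega>: "\<And>g h. g \<in> carrier G \<Longrightarrow> h \<in> carrier G \<Longrightarrow> \<omega> (inv h \<otimes> g) = ip (f g) (f h)"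
    and uv: "u \<in> over (carrier G)" "v \<in> over (carrier G)"
  shows "form \<omega> u v = ip (vsum f u) (vsum f v)"
proof -
  have "form \<omega> u v = kform (\<lambda>g h. ip (f g) (f h)) u v"
    unfolding form_kform by (rule kform_cong[OF uv]) (rule \<omega>)
  also have "\<dots> = ip (vsum f u) (vsum f v)"
  proof -
    have "ip (vsum f u) (vsum f v) = lsum (\<lambda>g. ip (f g) (vsum f v)) u"
      by (rule ip_vsum_left[OF uv(1)]) (auto intro: f vsum_mem[OF subspace_ell2 uv(2)])
    also have "\<dots> = kform (\<lambda>g h. ip (f g) (f h)) u v"
      unfolding kform_def by (rule lsum_cong[OF uv(1)], rule ip_vsum_right[OF uv(2)]) (auto intro: f)
    finally show ?thesis ..
  qed
  finally show ?thesis .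
qed

text \<open>This is the passage from lists to vectors: the squared norm of a list is that of the
  corresponding combination of the \<open>f g\<close> in the Hilbert space.\<close>

lemma nrm2_gram:
  assumes f: "\<And>g. g \<in> carrier G \<Longrightarrow> f g \<in> ell2"
    and \<omega>: "\<And>g h. g \<in> carrier G \<Longrightarrow> h \<in> carrier G \<Longrightarrow> \<omega> (inv h \<otimes> g) = ip (f g) (f h)"
    and u: "u \<in> over (carrier G)"
  shows "nrm2 \<omega> u = (l2norm (vsum f u))\<^sup>2"
proof -
  have "form \<omega> u u = ip (vsum f u) (vsum f u)" by (rule form_gram[where f = f and \<omega> = \<omega>, OF f \<omega> u u])
  moreover have "vsum f u \<in> ell2" by (rule vsum_mem[OF subspace_ell2 u f])
  ultimately show ?thesis by (simp only: nrm2_def Re_ip_self)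
qed

lemma unitary_repD:
  assumes "unitary_rep G H \<pi>"
  shows "hilbert H" "g \<in> carrier G \<Longrightarrow> isometry_on H (\<pi> g)"
    "g \<in> carrier G \<Longrightarrow> x \<in> H \<Longrightarrow> y \<in> H \<Longrightarrow> ip (\<pi> g x) (\<pi> g y) = ip x y"
    "g \<in> carrier G \<Longrightarrow> h \<in> carrier G \<Longrightarrow> x \<in> H \<Longrightarrow> \<pi> (g \<otimes> h) x = \<pi> g (\<pi> h x)"
    "x \<in> H \<Longrightarrow> \<pi> \<one> x = x" "g \<in> carrier G \<Longrightarrow> x \<in> H \<Longrightarrow> \<pi> g x \<in> H"
proof -
  show H: "hilbert H" using assms by (simp add: unitary_rep_def)
  have U: "unitary_between H H (\<pi> g)" if "g \<in> carrier G" for g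
    using assms that by (simp add: unitary_rep_def)
  show ipU: "ip (\<pi> g x) (\<pi> g y) = ip x y" if "g \<in> carrier G" "x \<in> H" "y \<in> H" for g x y
    using U[OF that(1)] that by (simp add: unitary_between_def)
  show mem: "\<pi> g x \<in> H" if "g \<in> carrier G" "x \<in> H" for g x
    using U[OF that(1)] that by (auto simp: unitary_between_def linear_between_def)
  show "isometry_on H (\<pi> g)" if g: "g \<in> carrier G" for g
  proof -
    have "l2norm (\<pi> g x) = l2norm x" if x: "x \<in> H" for x
    proof -
      have "(l2norm (\<pi> g x))\<^sup>2 = (l2norm x)\<^sup>2"
        using ipU[OF g x x] mem[OF g x] x hilbertD(1)[OF H] by (simp add: Re_ip_self[symmetric] subset_iff)
      then show ?thesis by simp
    qed
    then show ?thesis using U[OF g] by (simp add: isometry_on_def unitary_between_def)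
  qed
  show mult: "\<pi> (g \<otimes> h) x = \<pi> g (\<pi> h x)" if "g \<in> carrier G" "h \<in> carrier G" "x \<in> H" for g h x
    using assms that by (simp add: unitary_rep_def compose_def)
  show "\<pi> \<one> x = x" if "x \<in> H" for x
  proof -
    have "\<pi> \<one> (\<pi> \<one> x) = \<pi> \<one> x" using mult[of \<one> \<one> x] that by simp
    moreover have "inj_on (\<pi> \<one>) H" using U[of \<one>] by (simp add: unitary_between_def bij_betw_def)
    ultimately show ?thesis using mem[of \<one> x] that by (auto dest: inj_onD)
  qed
qed

lemma unitary_rep_coefficient:
  assumes "unitary_rep G H \<pi>" "g \<in> carrier G" "h \<in> carrier G" "x \<in> H"
  shows "ip (\<pi> g x) (\<pi> h x) = ip (\<pi> (inv h \<otimes> g) x) x"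
proof -
  note U = unitary_repD[OF assms(1)]
  have "g = h \<otimes> (inv h \<otimes> g)" using assms by simp
  then have "\<pi> g x = \<pi> h (\<pi> (inv h \<otimes> g) x)" using U(4)[of h "inv h \<otimes> g" x] assms by simp
  then show ?thesis using U(3)[of h "\<pi> (inv h \<otimes> g) x" x] U(6) assms by simp
qed

end

lemma conj_vec_simps [simp]:
  "conj_vec (conj_vec x) = x" "conj_vec (x + y) = conj_vec x + conj_vec y"
  "conj_vec (x - y) = conj_vec x - conj_vec y" "conj_vec 0 = 0"
  "conj_vec (cscale c x) = cscale (cnj c) (conj_vec x)"
  "l2norm (conj_vec x) = l2norm x" "conj_vec x \<in> ell2 \<longleftrightarrow> x \<in> ell2"
  by (auto simp: conj_vec_def fun_eq_iff l2norm_def ell2_def)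

lemma ip_conj_vec: "ip (conj_vec x) (conj_vec y) = cnj (ip x y)"
  by (simp add: ip_def conj_vec_def flip: infsum_cnj)

lemma conj_vec_image_iff: "x \<in> conj_vec ` H \<longleftrightarrow> conj_vec x \<in> H"
  by (metis conj_vec_simps(1) image_iff)

lemma hilbert_conj_vec:
  assumes "hilbert H" shows "hilbert (conj_vec ` H)"
  unfolding hilbert_def
proof (intro conjI subsetI)
  note H = hilbertD[OF assms]
  show "x \<in> ell2" if "x \<in> conj_vec ` H" for x using that H(1) by auto
  show "cfun.subspace (conj_vec ` H)"
    using H(2) by (auto simp: cfun.subspace_def conj_vec_image_iff)
  fix x assume x: "x \<in> l2_closure (conj_vec ` H)"
  have "conj_vec x \<in> l2_closure H"
  proof (rule l2_closureI)
    show "conj_vec x \<in> ell2" using x l2_closure_ell2 by auto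
    fix e :: real assume "0 < e"
    then obtain y where y: "y \<in> H" "l2norm (x - conj_vec y) < e" using l2_closureD[OF x] by blast
    have "l2norm (conj_vec x - y) = l2norm (conj_vec (x - conj_vec y))" by simp
    then show "\<exists>y\<in>H. l2norm (conj_vec x - y) < e" using y by (metis conj_vec_simps(6))
  qed
  then show "x \<in> conj_vec ` H" using H(3) by (auto simp: conj_vec_image_iff)
qed

lemma conj_rep_isometry:
  assumes "isometry_on H (\<pi> g)" "cfun.subspace H"
  shows "isometry_on (conj_vec ` H) (conj_rep H \<pi> g)"
  using isometry_onD[OF assms(1)] assms(2)
  by (auto simp: isometry_on_def linear_between_def conj_rep_def conj_vec_image_iff cfun.subspace_def)

lemma conj_rep_conj_vec: "x \<in> H \<Longrightarrow> conj_rep H \<pi> g (conj_vec x) = conj_vec (\<pi> g x)"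
  by (simp add: conj_rep_def)

lemma span_tensor_vec:
  assumes a: "a \<in> cfun.span A" and b: "b \<in> cfun.span B"
  shows "tensor_vec a (conj_vec b) \<in> cfun.span {tensor_vec x (conj_vec y) | x y. x \<in> A \<and> y \<in> B}"
    (is "_ \<in> cfun.span ?E")
proof -
  have 1: "tensor_vec a (conj_vec y) \<in> cfun.span ?E" if "y \<in> B" for y
  proof -
    have "cfun.subspace {a. tensor_vec a (conj_vec y) \<in> cfun.span ?E}"
      by (auto simp: cfun.subspace_def tensor_vec_linear intro: cfun.span_zero cfun.span_add cfun.span_scale)
    moreover have "A \<subseteq> {a. tensor_vec a (conj_vec y) \<in> cfun.span ?E}"
      using that by (auto intro!: cfun.span_base)
    ultimately show ?thesis using cfun.span_minimal a by blast
  qed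
  have "cfun.subspace {b. tensor_vec a (conj_vec b) \<in> cfun.span ?E}"
    by (auto simp: cfun.subspace_def tensor_vec_linear intro: cfun.span_zero cfun.span_add cfun.span_scale)
  moreover have "B \<subseteq> {b. tensor_vec a (conj_vec b) \<in> cfun.span ?E}" using 1 by blast
  ultimately show ?thesis using cfun.span_minimal b by blast
qed

text \<open>With \<open>A\<close> the orbit of a cyclic vector, the tensors of orbit points alone
  have dense span; on these the coefficients of the tensor product can be computed from the
  character.\<close>

lemma tensor_space_dense:
  assumes A: "A \<subseteq> ell2" "l2_closure (cfun.span A) = H"
  shows "tensor_space H (conj_vec ` H)
    \<subseteq> l2_closure (cfun.span {tensor_vec x (conj_vec y) | x y. x \<in> A \<and> y \<in> A})" (is "_ \<subseteq> l2_closure (cfun.span ?E)")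
proof -
  have E: "?E \<subseteq> ell2" using A(1) by (auto intro!: tensor_vec_ell2(1))
  have sE: "cfun.span ?E \<subseteq> ell2" by (rule cfun.span_minimal[OF E subspace_ell2])
  have sA: "cfun.span A \<subseteq> ell2" by (rule cfun.span_minimal[OF A(1) subspace_ell2])
  have He: "H \<subseteq> ell2" using A(2) l2_closure_ell2 by blast
  have el: "tensor_vec x (conj_vec y) \<in> l2_closure (cfun.span ?E)" if xy: "x \<in> H" "y \<in> H" for x y
  proof (rule l2_closureI)
    have xe: "x \<in> ell2" "y \<in> ell2" using xy He by auto
    then show "tensor_vec x (conj_vec y) \<in> ell2" by (simp add: tensor_vec_ell2(1))
    fix e :: real assume e: "0 < e"
    \<comment> \<open>\<open>M\<close> bounds the norms of \<open>y\<close> and of the approximant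
      \<open>x'\<close>, which is chosen within distance 1 of \<open>x\<close>.\<close>
    define M where "M = l2norm x + l2norm y + 2"
    have M: "0 < M" unfolding M_def using l2norm_nonneg[of x] l2norm_nonneg[of y] by linarith
    obtain x' where x': "x' \<in> cfun.span A" "l2norm (x - x') < min 1 (e / (2 * M))"
      using l2_closureD[of x "cfun.span A" "min 1 (e / (2 * M))"] xy A(2) e M by auto
    obtain y' where y': "y' \<in> cfun.span A" "l2norm (y - y') < min 1 (e / (2 * M))"
      using l2_closureD[of y "cfun.span A" "min 1 (e / (2 * M))"] xy A(2) e M by auto
    have e': "x' \<in> ell2" "y' \<in> ell2" using x' y' sA by auto
    have "x + (x' - x) = x'" by (simp add: fun_eq_iff)
    then have "l2norm x' \<le> l2norm x + l2norm (x' - x)"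
      using l2norm_triangle[OF xe(1) ell2_diff[OF e'(1) xe(1)]] by (simp only:)
    then have nx': "l2norm x' \<le> M"
      using x'(2) l2norm_minus_commute[of x' x] l2norm_nonneg[of y] unfolding M_def by linarith
    have "tensor_vec x (conj_vec y) - tensor_vec x' (conj_vec y')
        = tensor_vec (x - x') (conj_vec y) + tensor_vec x' (conj_vec (y - y'))"
      by (simp add: tensor_vec_linear)
    then have "l2norm (tensor_vec x (conj_vec y) - tensor_vec x' (conj_vec y'))
        \<le> l2norm (tensor_vec (x - x') (conj_vec y)) + l2norm (tensor_vec x' (conj_vec (y - y')))"
      using l2norm_triangle[OF tensor_vec_ell2(1) tensor_vec_ell2(1)] xe e' ell2_diff conj_vec_simps(7) by metis
    also have "\<dots> = l2norm (x - x') * l2norm y + l2norm x' * l2norm (y - y')"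
      using xe e' by (simp add: l2norm_tensor_vec ell2_diff del: conj_vec_simps(3))
    also have "\<dots> \<le> l2norm (x - x') * M + M * l2norm (y - y')"
      using nx' l2norm_nonneg[of x] by (intro add_mono mult_left_mono mult_right_mono) (auto simp: M_def)
    also have "\<dots> < e / 2 + e / 2"
      using x'(2) y'(2) M by (intro add_strict_mono) (simp_all add: less_divide_eq mult.commute mult.left_commute)
    finally show "\<exists>z\<in>cfun.span ?E. l2norm (tensor_vec x (conj_vec y) - z) < e"
      using span_tensor_vec[OF x'(1) y'(1)] by auto
  qed
  have "elementary_tensors H (conj_vec ` H) \<subseteq> l2_closure (cfun.span ?E)" using el by auto
  then have "cfun.span (elementary_tensors H (conj_vec ` H)) \<subseteq> l2_closure (cfun.span ?E)"
    by (rule cfun.span_minimal[OF _ subspace_l2_closure[OF cfun.subspace_span sE]])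
  then show ?thesis
    unfolding tensor_space_def using l2_closure_mono l2_closure_idem[OF sE] by blast
qed

context group
begin

text \<open>The averaging operator of the tensor representation contracts by \<open>r\<close>. On
  tensors of orbit points its powers are bounded by the gap, on linear combinations up to a constant
  that \<open>walk_mean_power_trick\<close> discards, and the rest follows by density. Weak
  containment would need vectors whose diagonal coefficients nearly exhaust their squared
  norms.\<close>

lemma gap_face_not_amenable:
  assumes qs: "symmetric_list qs" and r: "0 < r" "r < 1" and \<psi>: "\<psi> \<in> gap_face qs r"
  shows "\<not> amenable_character G \<psi>"
proof
  assume "amenable_character G \<psi>"
  then obtain H \<pi> \<xi> where gns: "gns_triple G \<psi> H \<pi> \<xi>" and am: "amenable_rep G H \<pi>"
    by (auto simp: amenable_character_def)
  have rep: "unitary_rep G H \<pi>" and \<xi>: "\<xi> \<in> H"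
    and dense: "l2_closure (cfun.span ((\<lambda>g. \<pi> g \<xi>) ` carrier G)) = H"
    and coef: "\<And>g. g \<in> carrier G \<Longrightarrow> \<psi> g = ip (\<pi> g \<xi>) \<xi>"
    using gns by (auto simp: gns_triple_def)
  note U = unitary_repD[OF rep]
  note H = hilbertD[OF U(1)]
  have c: "set qs \<subseteq> carrier G" using qs by (simp add: symmetric_list_def)
  have char: "\<psi> \<in> PD1 G" "\<And>g x. g \<in> carrier G \<Longrightarrow> x \<in> carrier G \<Longrightarrow> \<psi> (inv g \<otimes> x \<otimes> g) = \<psi> x"
    using \<psi> by (auto simp: gap_face_def characters_iff)
  let ?K = "conj_vec ` H"
  let ?T = "tensor_space H ?K"
  define \<rho> where "\<rho> = tensor_rep H ?K \<pi> (conj_rep H \<pi>)"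
  have K: "hilbert ?K" by (rule hilbert_conj_vec[OF U(1)])
  note T = tensor_space_props[OF U(1) K]
  have \<rho>: "isometry_on ?T (\<rho> g)"
    "\<And>x y. x \<in> H \<Longrightarrow> y \<in> H \<Longrightarrow> \<rho> g (tensor_vec x (conj_vec y)) = tensor_vec (\<pi> g x) (conj_vec (\<pi> g y))"
    if g: "g \<in> carrier G" for g
    using tensor_op[OF U(1) K U(2)[OF g] conj_rep_isometry[where \<pi>=\<pi>, OF U(2)[OF g] H(2)]]
    by (auto simp: \<rho>_def tensor_rep_def conj_rep_conj_vec)
  have \<rho>m: "\<rho> g y \<in> ?T" if "g \<in> carrier G" "y \<in> ?T" for g y using isometry_onD(1)[OF \<rho>(1)[OF that(1)] that(2)] .
  have \<rho>e: "\<rho> g y \<in> ell2" if "g \<in> carrier G" "y \<in> ?T" for g y using \<rho>m[OF that] T(2) by blast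
  have clT: "l2_closure (cfun.span (elementary_tensors H ?K)) = ?T" by (simp add: tensor_space_def)
  have eqT: "A y = B y"
    if "isometry_on ?T A" "isometry_on ?T B" "y \<in> ?T"
      "\<And>a b. a \<in> H \<Longrightarrow> b \<in> H \<Longrightarrow> A (tensor_vec a (conj_vec b)) = B (tensor_vec a (conj_vec b))" for A B y
    by (rule linear_continuous_eq[OF T(1,2) clT, where C = 1 and D = 1])
       (use that T(3) isometry_onD(4)[OF that(1)] isometry_onD(4)[OF that(2)] in \<open>auto simp: isometry_on_def\<close>)
  have \<rho>mult: "\<rho> (g \<otimes> h) y = \<rho> g (\<rho> h y)" if "g \<in> carrier G" "h \<in> carrier G" "y \<in> ?T" for g h y
    by (rule eqT[OF \<rho>(1) isometry_on_comp[OF \<rho>(1) \<rho>(1)]]) (use that U(4,6) in \<open>simp_all add: \<rho>(2)\<close>)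
  have \<rho>one: "\<rho> \<one> y = y" if "y \<in> ?T" for y
    by (rule eqT[OF \<rho>(1), where B = "\<lambda>x. x"])
       (use that U(5) in \<open>simp_all add: \<rho>(2) isometry_on_def linear_between_def\<close>)
  define \<omega> where "\<omega> y g = ip (\<rho> g y) y" for y g
  have gram: "\<omega> y (inv h \<otimes> g) = ip (\<rho> g y) (\<rho> h y)" if "y \<in> ?T" "g \<in> carrier G" "h \<in> carrier G" for y g h
  proof -
    have "\<rho> g y = \<rho> h (\<rho> (inv h \<otimes> g) y)"
      using \<rho>mult[of h "inv h \<otimes> g" y] that by simp
    then show ?thesis
      unfolding \<omega>_def using isometry_on_ip[OF \<rho>(1) T(1,2), of h "\<rho> (inv h \<otimes> g) y" y] \<rho>m that by simp
  qed
  define B where "B u y = vsum (\<lambda>g. \<rho> g y) u" for u y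
  have nB: "nrm2 (\<omega> y) u = (l2norm (B u y))\<^sup>2" if "y \<in> ?T" "u \<in> over (carrier G)" for y u
    unfolding B_def by (rule nrm2_gram[where \<omega>="\<omega> y"]) (use that gram \<rho>e in auto)
  have Bm: "B u y \<in> ?T" if "y \<in> ?T" "u \<in> over (carrier G)" for y u
    unfolding B_def by (rule vsum_mem[OF T(1) that(2)]) (rule \<rho>m[OF _ that(1)])
  have Badd: "B u (y + z) = B u y + B u z" if "y \<in> ?T" "z \<in> ?T" "u \<in> over (carrier G)" for y z u
    unfolding B_def vsum_add[symmetric] using isometry_onD(2)[OF \<rho>(1)] that by (intro vsum_cong[OF that(3)]) auto
  have Bscale: "B u (cscale a y) = cscale a (B u y)" if "y \<in> ?T" "u \<in> over (carrier G)" for a y u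
    unfolding B_def vsum_cscale[symmetric] using isometry_onD(3)[OF \<rho>(1)] that by (intro vsum_cong[OF that(2)]) auto
  have wo: "walk qs m \<in> over (carrier G)" for m by (rule walk_over[OF c])
  text \<open>The coefficients of the elementary tensors of translates of \<open>\<xi>\<close> are all equal to
    \<open>\<psi> \<cdot> cnj \<psi>\<close>, because \<open>\<psi>\<close> is conjugation invariant.\<close>
  let ?A = "(\<lambda>g. \<pi> g \<xi>) ` carrier G"
  let ?E = "{tensor_vec x (conj_vec y) | x y. x \<in> ?A \<and> y \<in> ?A}"
  have AH: "?A \<subseteq> H" using U(6) \<xi> by auto
  have "?E \<subseteq> elementary_tensors H ?K" using AH by blast
  then have ET: "?E \<subseteq> ?T" using T(3) by (rule subset_trans)
  \<comment> \<open>The conjugate character is a multiplier because it is a coefficient of the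
    conjugate representation.\<close>
  have schur: "schur_multiplier (\<lambda>g. cnj (\<psi> g))"
    unfolding schur_multiplier_def
  proof (intro conjI allI impI)
    show "cnj (\<psi> \<one>) = 1" using char(1) by (simp add: PD1_iff)
    fix \<omega>' assume "posdef \<omega>'"
    then show "posdef (\<lambda>g. \<omega>' g * cnj (\<psi> g))"
      by (rule posdef_gram_mult[rotated 2, where f = "\<lambda>g. conj_vec (\<pi> g \<xi>)" and \<omega> = "\<lambda>g. cnj (\<psi> g)"])
         (use U(6) \<xi> H(1) unitary_rep_coefficient[OF rep _ _ \<xi>] coef in \<open>auto simp: ip_conj_vec\<close>)
  qed
  \<comment> \<open>The constant \<open>C\<close> may depend on \<open>y\<close>; in this form the
    condition is stable under linear combinations.\<close>
  define P where "P = {y \<in> ?T. \<exists>C\<ge>0. \<forall>m. l2norm (B (walk qs m) y) \<le> C * r ^ m}"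
  have EP: "?E \<subseteq> P"
  proof
    fix y assume "y \<in> ?E"
    then obtain h k where hk: "h \<in> carrier G" "k \<in> carrier G"
      and y: "y = tensor_vec (\<pi> h \<xi>) (conj_vec (\<pi> k \<xi>))" by blast
    have yT: "y \<in> ?T" using \<open>y \<in> ?E\<close> ET by blast
    have co: "ip (\<pi> g (\<pi> h \<xi>)) (\<pi> h \<xi>) = \<psi> g" if "g \<in> carrier G" "h \<in> carrier G" for g h
    proof -
      have "ip (\<pi> g (\<pi> h \<xi>)) (\<pi> h \<xi>) = ip (\<pi> (g \<otimes> h) \<xi>) (\<pi> h \<xi>)" using U(4) \<xi> that by simp
      also have "\<dots> = \<psi> (inv h \<otimes> (g \<otimes> h))" using unitary_rep_coefficient[OF rep _ _ \<xi>] coef that by simp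
      also have "\<dots> = \<psi> g" using char(2)[of h g] that by (simp add: m_assoc)
      finally show ?thesis .
    qed
    have \<omega>y: "\<omega> y g = \<psi> g * cnj (\<psi> g)" if g: "g \<in> carrier G" for g
    proof -
      have m: "\<pi> h \<xi> \<in> H" "\<pi> k \<xi> \<in> H" "\<pi> g (\<pi> h \<xi>) \<in> H" "\<pi> g (\<pi> k \<xi>) \<in> H" using U(6) \<xi> hk g by auto
      have "\<omega> y g = ip (tensor_vec (\<pi> g (\<pi> h \<xi>)) (conj_vec (\<pi> g (\<pi> k \<xi>)))) (tensor_vec (\<pi> h \<xi>) (conj_vec (\<pi> k \<xi>)))"
        unfolding \<omega>_def y \<rho>(2)[OF g m(1,2)] ..
      also have "\<dots> = ip (\<pi> g (\<pi> h \<xi>)) (\<pi> h \<xi>) * cnj (ip (\<pi> g (\<pi> k \<xi>)) (\<pi> k \<xi>))"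
        using m H(1) by (subst ip_tensor_vec) (auto simp: ip_conj_vec)
      finally show ?thesis using co g hk by simp
    qed
    have "l2norm (B (walk qs m) y) \<le> 1 * r ^ m" for m
    proof (rule power2_le_imp_le)
      have "(l2norm (B (walk qs m) y))\<^sup>2 = walk_mean qs (2 * m) (\<omega> y)"
        using nB[OF yT wo] walk_mean_even[OF qs] by simp
      also have "\<dots> = walk_mean qs (2 * m) (\<lambda>g. \<psi> g * cnj (\<psi> g))"
        unfolding walk_mean_def using lsum_cong[OF wo \<omega>y] by simp
      also have "\<dots> \<le> r ^ (2 * m)" using \<psi> schur unfolding gap_face_def by blast
      finally show "(l2norm (B (walk qs m) y))\<^sup>2 \<le> (1 * r ^ m)\<^sup>2" by (simp add: power_mult[symmetric] mult.commute)
    qed (use r in simp)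
    then show "y \<in> P" unfolding P_def using yT by (intro CollectI conjI exI[of _ 1]) auto
  qed
  have "cfun.subspace P"
    unfolding cfun.subspace_def
  proof (intro conjI ballI allI)
    have "B u 0 = 0" if "u \<in> over (carrier G)" for u
      using Bscale[OF cfun.subspace_0[OF T(1)] that, of 0] by (simp add: fun_eq_iff)
    then show "0 \<in> P" unfolding P_def using cfun.subspace_0[OF T(1)] wo by (auto intro!: exI[of _ 0])
    fix y assume "y \<in> P"
    then obtain C where y: "y \<in> ?T" and C: "0 \<le> C" "\<And>m. l2norm (B (walk qs m) y) \<le> C * r ^ m"
      by (auto simp: P_def)
    show "cscale a y \<in> P" for a
    proof -
      have "l2norm (B (walk qs m) (cscale a y)) \<le> cmod a * C * r ^ m" for m
        unfolding Bscale[OF y wo] l2norm_cscale using C(2)[of m] by (simp add: mult.assoc mult_left_mono)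
      then show ?thesis unfolding P_def using C(1) cfun.subspace_scale[OF T(1) y]
        by (intro CollectI conjI exI[of _ "cmod a * C"]) auto
    qed
    fix z assume "z \<in> P"
    then obtain D where z: "z \<in> ?T" and D: "0 \<le> D" "\<And>m. l2norm (B (walk qs m) z) \<le> D * r ^ m"
      by (auto simp: P_def)
    have "l2norm (B (walk qs m) (y + z)) \<le> (C + D) * r ^ m" for m
    proof -
      have "l2norm (B (walk qs m) (y + z)) \<le> l2norm (B (walk qs m) y) + l2norm (B (walk qs m) z)"
        unfolding Badd[OF y z wo] using Bm[OF y wo] Bm[OF z wo] T(2) by (intro l2norm_triangle) auto
      then show ?thesis using C(2)[of m] D(2)[of m] by (simp add: distrib_right)
    qed
    then show "y + z \<in> P" unfolding P_def using C(1) D(1) cfun.subspace_add[OF T(1) y z]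
      by (intro CollectI conjI exI[of _ "C + D"]) auto
  qed
  then have span_P: "cfun.span ?E \<subseteq> P" using cfun.span_minimal[OF EP] by blast
  let ?B = "B (walk qs 1)"
  have contr_span: "l2norm (?B y) \<le> r * l2norm y" if "y \<in> cfun.span ?E" for y
  proof -
    have "y \<in> P" using subsetD[OF span_P that] .
    then obtain C where y: "y \<in> ?T" and C: "0 \<le> C" "\<And>m. l2norm (B (walk qs m) y) \<le> C * r ^ m"
      by (auto simp: P_def)
    have pd: "posdef (\<omega> y)" by (rule posdef_gram[where f = "\<lambda>g. \<rho> g y" and \<omega> = "\<omega> y"]) (use y gram \<rho>e in auto)
    \<comment> \<open>The mean at time 2 is the squared norm after one averaging step, so the power
      trick at this time is exactly the contraction.\<close>
    have "walk_mean qs 2 (\<omega> y) \<le> r ^ 2 * Re (\<omega> y \<one>)"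
    proof (rule walk_mean_power_trick[OF qs pd r(1)])
      fix m
      have "walk_mean qs (2 * m) (\<omega> y) = (l2norm (B (walk qs m) y))\<^sup>2"
        using nB[OF y wo] walk_mean_even[OF qs] by simp
      also have "\<dots> \<le> (C * r ^ m)\<^sup>2" using C by (intro power_mono) auto
      finally show "walk_mean qs (2 * m) (\<omega> y) \<le> C\<^sup>2 * r ^ (2 * m)"
        by (simp add: power_mult_distrib power_mult[symmetric] mult.commute)
    qed
    moreover have "walk_mean qs 2 (\<omega> y) = (l2norm (?B y))\<^sup>2"
      using nB[OF y wo, of 1] walk_mean_even[OF qs, of 1] by simp
    moreover have "Re (\<omega> y \<one>) = (l2norm y)\<^sup>2"
      using y T(2) by (simp add: \<omega>_def \<rho>one Re_ip_self subset_iff)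
    ultimately have "(l2norm (?B y))\<^sup>2 \<le> (r * l2norm y)\<^sup>2" by (simp add: power_mult_distrib)
    then show ?thesis by (rule power2_le_imp_le) (use r in simp)
  qed
  \<comment> \<open>This crude bound is applied only to the difference from an approximating vector,
    whose size is chosen in terms of \<open>M + r\<close>.\<close>
  define M where "M = (\<Sum>(a, g)\<leftarrow>walk qs 1. cmod a)"
  have M0: "0 \<le> M" unfolding M_def by (intro sum_list_nonneg) auto
  have contr: "l2norm (?B y) \<le> r * l2norm y" if y: "y \<in> ?T" for y
  proof (rule field_le_epsilon)
    fix e :: real assume e: "0 < e"
    have "y \<in> l2_closure (cfun.span ?E)"
      using tensor_space_dense[OF _ dense] AH H(1) y by blast
    then obtain z where z: "z \<in> cfun.span ?E" "l2norm (y - z) < e / (M + r)"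
      using l2_closureD[of y _ "e / (M + r)"] e r(1) M0 by (auto simp: add_nonneg_pos)
    have zT: "z \<in> ?T" using z(1) span_P by (auto simp: P_def)
    have yz: "y - z \<in> ?T" using cfun.subspace_diff[OF T(1) y zT] .
    have ell: "y \<in> ell2" "z \<in> ell2" "y - z \<in> ell2" "?B z \<in> ell2" "?B (y - z) \<in> ell2"
      using y zT yz Bm[OF zT wo] Bm[OF yz wo] T(2) by auto
    have "l2norm (?B y) = l2norm (?B z + ?B (y - z))" using Badd[OF zT yz wo, of 1] by simp
    also have "\<dots> \<le> l2norm (?B z) + l2norm (?B (y - z))" using ell by (intro l2norm_triangle)
    also have "\<dots> \<le> r * (l2norm y + l2norm (y - z)) + M * l2norm (y - z)"
    proof (rule add_mono)
      have "y + (z - y) = z" by (simp add: fun_eq_iff)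
      then have "l2norm z \<le> l2norm y + l2norm (y - z)"
        using l2norm_triangle[OF ell(1) ell2_diff[OF ell(2,1)]] l2norm_minus_commute[of y z] by (simp only:)
      then have "r * l2norm z \<le> r * (l2norm y + l2norm (y - z))" using r(1) by (intro mult_left_mono) auto
      then show "l2norm (?B z) \<le> r * (l2norm y + l2norm (y - z))"
        using contr_span[OF z(1)] by (rule order_trans[rotated])
      show "l2norm (?B (y - z)) \<le> M * l2norm (y - z)"
        unfolding B_def M_def
        by (rule l2norm_vsum[OF wo]) (use yz \<rho>e isometry_onD(4)[OF \<rho>(1)] in auto)
    qed
    also have "\<dots> = r * l2norm y + (M + r) * l2norm (y - z)" by (simp only: distrib_left distrib_right add_ac)
    also have "(M + r) * l2norm (y - z) \<le> e"
      using z(2) r(1) M0 by (simp add: less_divide_eq add_nonneg_pos mult.commute less_imp_le)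
    finally show "l2norm (?B y) \<le> r * l2norm y + e" by simp
  qed
  \<comment> \<open>Almost invariance up to \<open>e\<close> will give
    \<open>1 - e \<le> r * (1 + e)\<close>, hence \<open>1 - r \<le> 2 * e\<close>, whereas
    \<open>2 * e\<close> is only half of \<open>1 - r\<close>.\<close>
  define e where "e = (1 - r) / 4"
  have e: "0 < e" using r by (simp add: e_def)
  have F: "finite (insert \<one> (set qs))" "insert \<one> (set qs) \<subseteq> carrier G" using c by auto
  have "weakly_contained G UNIV (trivial_rep :: 'a \<Rightarrow> unit operator) ?T \<rho>"
    using am unfolding amenable_rep_def \<rho>_def .
  \<comment> \<open>Including \<open>\<one>\<close> bounds the total squared norm of the vectors
    \<open>y k\<close> by \<open>1 + e\<close>. The constant function 1 on the one-element index
    type is a unit vector of the trivial representation.\<close>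
  from this[unfolded weakly_contained_def, rule_format, OF UNIV_I F e, of "\<lambda>_. 1"]
  obtain n :: nat and y where y: "\<forall>k<n. y k \<in> ?T"
    and ye: "\<forall>g\<in>insert \<one> (set qs). cmod (ip (trivial_rep g (\<lambda>_::unit. 1)) (\<lambda>_. 1) - (\<Sum>k<n. ip (\<rho> g (y k)) (y k))) < e"
    by (elim exE conjE)
  define S where "S g = (\<Sum>k<n. ip (\<rho> g (y k)) (y k))" for g
  have close: "\<bar>1 - Re (S g)\<bar> < e" if "g \<in> insert \<one> (set qs)" for g
  proof -
    have "cmod (1 - S g) < e" using bspec[OF ye that] by (simp add: S_def ip_def trivial_rep_def)
    then show ?thesis using abs_Re_le_cmod[of "1 - S g"] by simp
  qed
  have "Re (S \<one>) = (\<Sum>k<n. (l2norm (y k))\<^sup>2)"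
    using y T(2) by (simp add: S_def \<rho>one Re_ip_self subset_iff)
  then have nrm: "(\<Sum>k<n. (l2norm (y k))\<^sup>2) < 1 + e" using close[of \<one>] by simp
  have w1: "lsum f (walk qs 1) = (\<Sum>q\<leftarrow>qs. f q) / of_nat (length qs)" for f :: "'a \<Rightarrow> complex"
  proof -
    have "lsum f (walk qs 1) = (\<Sum>q\<leftarrow>qs. 1 / of_nat (length qs) * f (q \<otimes> \<one>))"
      by (simp add: walk_def avg_def lsum_concat o_def ltrans_def)
    also have "\<dots> = (\<Sum>q\<leftarrow>qs. 1 / of_nat (length qs) * f q)"
      using c by (intro arg_cong[where f=sum_list] map_cong refl) auto
    also have "\<dots> = 1 / of_nat (length qs) * (\<Sum>q\<leftarrow>qs. f q)" by (rule sum_list_const_mult)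
    finally show ?thesis by simp
  qed
  have ne: "0 < length qs" using qs by (simp add: symmetric_list_def)
  have "(\<Sum>q\<leftarrow>qs. 1 - e) \<le> (\<Sum>q\<leftarrow>qs. Re (S q))"
  proof (rule sum_list_mono)
    show "1 - e \<le> Re (S q)" if "q \<in> set qs" for q using close[of q] that by simp
  qed
  moreover have "Re (\<Sum>q\<leftarrow>xs. S q) = (\<Sum>q\<leftarrow>xs. Re (S q))" for xs by (induction xs) auto
  ultimately have "real (length qs) * (1 - e) \<le> Re (\<Sum>q\<leftarrow>qs. S q)"
    by (simp add: sum_list_triv)
  then have low: "1 - e \<le> Re (lsum S (walk qs 1))"
    unfolding w1 using ne by (simp add: le_divide_eq mult.commute)
  have lsumS: "lsum S u = (\<Sum>k<n. lsum (\<lambda>g. ip (\<rho> g (y k)) (y k)) u)" for u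
    unfolding S_def by (induction n) (auto simp: lsum_add)
  have "lsum (\<lambda>g. ip (\<rho> g (y k)) (y k)) (walk qs 1) = ip (?B (y k)) (y k)" if "k < n" for k
    unfolding B_def by (rule ip_vsum_left[OF wo, symmetric]) (use that y T(2) in \<open>auto intro: \<rho>e\<close>)
  then have "Re (lsum S (walk qs 1)) = (\<Sum>k<n. Re (ip (?B (y k)) (y k)))"
    unfolding lsumS Re_sum by (intro sum.cong refl arg_cong[where f=Re]) simp
  also have "\<dots> \<le> (\<Sum>k<n. r * (l2norm (y k))\<^sup>2)"
  proof (rule sum_mono)
    fix k assume "k \<in> {..<n}"
    then have yk: "y k \<in> ?T" using y by simp
    have "Re (ip (?B (y k)) (y k)) \<le> l2norm (?B (y k)) * l2norm (y k)"
      using Re_ip_le[of "?B (y k)" "y k"] Bm[OF yk wo] yk T(2) by force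
    also have "\<dots> \<le> r * l2norm (y k) * l2norm (y k)" by (intro mult_right_mono contr[OF yk]) simp
    finally show "Re (ip (?B (y k)) (y k)) \<le> r * (l2norm (y k))\<^sup>2" by (simp add: power2_eq_square mult.assoc)
  qed
  also have "\<dots> = r * (\<Sum>k<n. (l2norm (y k))\<^sup>2)" by (simp add: sum_distrib_left)
  also have "\<dots> \<le> r * (1 + e)" using nrm r by (intro mult_left_mono) auto
  finally have "1 - e \<le> r * (1 + e)" using low by simp
  then have "1 - r \<le> e * (1 + r)" by (simp add: algebra_simps)
  also have "\<dots> \<le> e * 2" using e r by (intro mult_left_mono) auto
  finally show False using r by (simp add: e_def)
qed

end

section \<open>Subgroups of infinite index\<close>

lemma lsum_sum_fun: "lsum (\<lambda>g. \<Sum>i\<in>I. f i g) u = (\<Sum>i\<in>I. lsum (f i) u)"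
  by (induction I rule: infinite_finite_induct) (simp_all add: lsum_add del: sum_of_bool_eq)

context group
begin

text \<open>The formula excludes a cover of the group by finitely many right cosets of
  \<open>H\<close>, a form suited to building separated sets greedily.\<close>

definition infinite_index :: "'a set \<Rightarrow> bool" where
  "infinite_index H \<longleftrightarrow> (\<forall>F. finite F \<longrightarrow> F \<subseteq> carrier G \<longrightarrow> (\<exists>g\<in>carrier G. \<forall>h\<in>F. g \<otimes> inv h \<notin> H))"

lemma closedin_chabauty_finite:
  assumes "finite A" "\<And>H. H \<in> A \<Longrightarrow> subgroup H G" shows "closedin (chabauty G) A"
proof -
  have "closedin (chabauty G) {H}" if H: "subgroup H G" for H
  proof -
    have "topspace (chabauty G) - {H} = (\<Union>g\<in>carrier G. {H'. subgroup H' G \<and> (g \<in> H') = (g \<notin> H)})"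
      using subgroup.subset[OF H] by (auto simp: topspace_chabauty dest: subgroup.subset)
    moreover have "openin (chabauty G) \<dots>"
      by (rule openin_Union, elim imageE, simp only:, rule openin_chabauty_member)
    ultimately show ?thesis using H by (simp add: closedin_def topspace_chabauty)
  qed
  then have "closedin (chabauty G) (\<Union>H\<in>A. {H})"
    using assms by (intro closedin_Union) auto
  then show ?thesis by simp
qed

text \<open>A subgroup of finite index has finitely many conjugates. They form a closed invariant
  subset, so minimality would make \<open>X\<close> finite.\<close>

lemma infinite_URS_infinite_index:
  assumes X: "URS G X" "infinite X" and H: "H \<in> X" shows "infinite_index H"
proof (rule ccontr)
  assume "\<not> infinite_index H"
  then obtain F where F: "finite F" "F \<subseteq> carrier G" "\<And>g. g \<in> carrier G \<Longrightarrow> \<exists>h\<in>F. g \<otimes> inv h \<in> H"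
    by (auto simp: infinite_index_def)
  have ci: "closed_invariant G X" using X by (simp add: URS_def)
  note C = closed_invariantD[OF ci]
  let ?Y = "(\<lambda>h. conj_subgroup G (inv h) H) ` F"
  have orb: "conj_subgroup G g H \<in> ?Y" if g: "g \<in> carrier G" for g
  proof -
    obtain h where h: "h \<in> F" "inv g \<otimes> inv h \<in> H" using F(3)[of "inv g"] g by auto
    have hc: "h \<in> carrier G" using h F(2) by blast
    have "inv (inv g \<otimes> inv h) \<in> H" using subgroup.m_inv_closed[OF C(1)[OF H] h(2)] .
    then have "inv (inv h) \<otimes> g \<in> H" using g hc by (simp add: inv_mult_group)
    then have "conj_subgroup G g H = conj_subgroup G (inv h) H"
      using conj_subgroup_coset[OF C(1)[OF H] g, of "inv h"] hc by simp
    then show ?thesis using h(1) by blast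
  qed
  have YX: "?Y \<subseteq> X" using C(3)[OF H] F(2) by auto
  have "conj_subgroup G g (conj_subgroup G (inv h) H) \<in> ?Y" if "g \<in> carrier G" "h \<in> F" for g h
    using orb[of "g \<otimes> inv h"] that F(2) conj_subgroup_mult[OF C(2)[OF H], of g "inv h"] by (auto simp: subset_iff)
  moreover have "?Y \<noteq> {}" using F(3)[OF one_closed] by blast
  moreover have "closedin (chabauty G) ?Y"
    using F(1) YX C(1) by (intro closedin_chabauty_finite) auto
  ultimately have "closed_invariant G ?Y" by (auto simp: closed_invariant_def)
  then have "?Y = X" using X(1) YX by (simp add: URS_def)
  then show False using F(1) X(2) by (metis finite_imageI)
qed

lemma infinite_index_separated:
  assumes H: "subgroup H G" "infinite_index H"
  shows "\<exists>D. finite D \<and> D \<subseteq> carrier G \<and> card D = N \<and> (\<forall>g\<in>D. \<forall>h\<in>D. g \<noteq> h \<longrightarrow> g \<otimes> inv h \<notin> H)"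
proof (induction N)
  case 0
  then show ?case by (intro exI[of _ "{}"]) auto
next
  case (Suc N)
  then obtain D where D: "finite D" "D \<subseteq> carrier G" "card D = N"
    "\<forall>g\<in>D. \<forall>h\<in>D. g \<noteq> h \<longrightarrow> g \<otimes> inv h \<notin> H" by blast
  obtain g where g: "g \<in> carrier G" "\<forall>h\<in>D. g \<otimes> inv h \<notin> H"
    using H(2) D(1,2) by (auto simp: infinite_index_def)
  have "g \<notin> D" using g subgroup.one_closed[OF H(1)] by (metis r_inv)
  moreover have "h \<otimes> inv g \<notin> H" if h: "h \<in> D" for h
  proof
    assume "h \<otimes> inv g \<in> H"
    from subgroup.m_inv_closed[OF H(1) this] have "g \<otimes> inv h \<in> H"
      using g h D(2) by (simp add: inv_mult_group subset_iff)
    then show False using g h by blast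
  qed
  ultimately show ?case
    using D g by (intro exI[of _ "insert g D"]) auto
qed

text \<open>Separation by a finite set \<open>D\<close> says that finitely many elements are missing
  from \<open>H\<close>, so it persists in a neighbourhood of \<open>H\<close>. Compactness yields
  one finite \<open>E\<close> for all of \<open>Y\<close>, while \<open>D\<close> still varies with
  \<open>H\<close>.\<close>

lemma uniformly_separated:
  assumes ci: "closed_invariant G Y" and inf: "\<And>H. H \<in> Y \<Longrightarrow> infinite_index H"
  obtains E where "finite E" "E \<subseteq> carrier G"
    "\<And>H. H \<in> Y \<Longrightarrow> \<exists>D\<subseteq>E. card D = N \<and> (\<forall>g\<in>D. \<forall>h\<in>D. g \<noteq> h \<longrightarrow> g \<otimes> inv h \<notin> H)"
proof -
  note C = closed_invariantD[OF ci]
  have "\<forall>H\<in>Y. \<exists>D. finite D \<and> D \<subseteq> carrier G \<and> card D = N \<and> (\<forall>g\<in>D. \<forall>h\<in>D. g \<noteq> h \<longrightarrow> g \<otimes> inv h \<notin> H)"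
    using infinite_index_separated[OF C(1) inf] by blast
  from bchoice[OF this] obtain D where D: "\<forall>H\<in>Y. finite (D H) \<and> D H \<subseteq> carrier G \<and> card (D H) = N \<and>
      (\<forall>g\<in>D H. \<forall>h\<in>D H. g \<noteq> h \<longrightarrow> g \<otimes> inv h \<notin> H)" ..
  define Q where "Q H = (\<lambda>(g, h). g \<otimes> inv h) ` {(g, h) \<in> D H \<times> D H. g \<noteq> h}" for H
  have Q: "finite (Q H)" "Q H \<subseteq> carrier G" "H \<inter> Q H = {}" if "H \<in> Y" for H
  proof -
    note d = bspec[OF D that]
    have "{(g, h) \<in> D H \<times> D H. g \<noteq> h} \<subseteq> D H \<times> D H" by auto
    then show "finite (Q H)" unfolding Q_def using d by (intro finite_imageI) (rule finite_subset, auto)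
    show "Q H \<subseteq> carrier G" using d by (auto simp: Q_def subset_iff)
    show "H \<inter> Q H = {}" using d by (auto simp: Q_def)
  qed
  let ?U = "\<lambda>H. {H'. subgroup H' G \<and> H' \<inter> Q H = H \<inter> Q H}"
  have cov: "Y \<subseteq> (\<Union>H\<in>Y. ?U H)" using C(1) by auto
  have op: "openin (chabauty G) (?U H)" if "H \<in> Y" for H
    by (rule openin_chabauty_cylinder[OF Q(1,2)[OF that]])
  have cl: "closedin (chabauty G) Y" using ci by (simp add: closed_invariant_def)
  obtain J where J: "finite J" "J \<subseteq> Y" "Y \<subseteq> (\<Union>H\<in>J. ?U H)"
    by (rule chabauty_finite_subcover[OF cl op cov])
  show thesis
  proof (rule that[of "\<Union>H\<in>J. D H"])
    show "finite (\<Union>H\<in>J. D H)" "(\<Union>H\<in>J. D H) \<subseteq> carrier G" using J(1,2) D by auto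
    fix H assume "H \<in> Y"
    then obtain H' where H': "H' \<in> J" "H \<inter> Q H' = H' \<inter> Q H'" using J(3) by blast
    have HY: "H' \<in> Y" using H'(1) J(2) by blast
    have "H \<inter> Q H' = {}" using H'(2) Q(3)[OF HY] by simp
    then have sepH: "\<forall>g\<in>D H'. \<forall>h\<in>D H'. g \<noteq> h \<longrightarrow> g \<otimes> inv h \<notin> H" by (auto simp: Q_def)
    have cardD: "card (D H') = N" using bspec[OF D HY] by simp
    show "\<exists>D'\<subseteq>(\<Union>H\<in>J. D H). card D' = N \<and> (\<forall>g\<in>D'. \<forall>h\<in>D'. g \<noteq> h \<longrightarrow> g \<otimes> inv h \<notin> H)"
      by (intro exI[of _ "D H'"] conjI UN_upper[OF H'(1)] cardD sepH)
  qed
qed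

section \<open>Probability vectors of small norm\<close>

definition convex_lists :: "(complex \<times> 'a) list set" where
  "convex_lists = {v \<in> over (carrier G). (\<forall>p\<in>set v. fst p \<in> \<real>\<^sub>\<ge>\<^sub>0) \<and> lsum (\<lambda>_. 1) v = 1}"

lemma lsum_nonneg:
  assumes "\<forall>p\<in>set v. fst p \<in> \<real>\<^sub>\<ge>\<^sub>0" "\<And>g. f g \<in> \<real>\<^sub>\<ge>\<^sub>0" shows "lsum f v \<in> \<real>\<^sub>\<ge>\<^sub>0"
  using assms(1) by (induction v) (auto simp: assms(2))

lemma lsum_mono_Re:
  assumes "v \<in> over S" "\<forall>p\<in>set v. fst p \<in> \<real>\<^sub>\<ge>\<^sub>0" "\<And>g. g \<in> S \<Longrightarrow> Re (f g) \<le> Re (f' g)"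
  shows "Re (lsum f v) \<le> Re (lsum f' v)"
  using assms(1,2)
proof (induction v)
  case (Cons p v)
  obtain a g where p: "p = (a, g)" by force
  have "Re (a * f g) \<le> Re (a * f' g)"
    using Cons p assms(3)[of g] by (auto simp: complex_nonneg_Reals_iff intro: mult_left_mono)
  then show ?case using Cons p by simp
qed simp

lemma nrm2_const1: "nrm2 (\<lambda>_. 1) u = (cmod (lsum (\<lambda>_. 1) u))\<^sup>2"
  unfolding nrm2_def form_const1 by (rule Re_complex_of_real)

abbreviation coset_mass :: "'a set \<Rightarrow> (complex \<times> 'a) list \<Rightarrow> 'a \<Rightarrow> complex" where
  "coset_mass H u k \<equiv> lsum (\<lambda>g. of_bool (inv k \<otimes> g \<in> H)) u"

text \<open>Up to null vectors a list is a function on the left cosets, with value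
  \<open>coset_mass H u k\<close> at the coset of \<open>k\<close>. The system \<open>R\<close> may
  exceed the support, so that several lists can be evaluated over the same representatives.\<close>

lemma nrm2_subgroup_indicator:
  assumes H: "subgroup H G" and u: "u \<in> over (carrier G)"
    and R: "finite R" "R \<subseteq> carrier G" "inj_on (\<lambda>k. l_coset G k H) R"
    and cov: "(\<lambda>p. l_coset G (snd p) H) ` set u \<subseteq> (\<lambda>k. l_coset G k H) ` R"
  shows "nrm2 (\<lambda>g. of_bool (g \<in> H)) u = (\<Sum>k\<in>R. (cmod (coset_mass H u k))\<^sup>2)"
proof -
  have "form (\<lambda>g. of_bool (g \<in> H) * 1) u u = (\<Sum>z\<in>(\<lambda>k. l_coset G k H) ` R.
      form (\<lambda>_. 1) (lfilter (\<lambda>g. l_coset G g H = z) u) (lfilter (\<lambda>g. l_coset G g H = z) u))"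
    by (rule form_subgroup_restrict[OF H u u finite_imageI[OF R(1)] cov])
  then have "nrm2 (\<lambda>g. of_bool (g \<in> H)) u
    = (\<Sum>z\<in>(\<lambda>k. l_coset G k H) ` R. nrm2 (\<lambda>_. 1) (lfilter (\<lambda>g. l_coset G g H = z) u))"
    by (simp add: nrm2_def)
  also have "\<dots> = (\<Sum>k\<in>R. nrm2 (\<lambda>_. 1) (lfilter (\<lambda>g. l_coset G g H = l_coset G k H) u))"
    using R(3) by (simp add: sum.reindex)
  also have "\<dots> = (\<Sum>k\<in>R. (cmod (coset_mass H u k))\<^sup>2)"
  proof (rule sum.cong[OF refl])
    fix k assume "k \<in> R"
    then have k: "k \<in> carrier G" using R(2) by blast
    have "lsum (\<lambda>_. 1) (lfilter (\<lambda>g. l_coset G g H = l_coset G k H) u) = coset_mass H u k"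
      unfolding lsum_lfilter by (rule lsum_cong[OF u]) (simp add: l_coset_eq_iff[OF H _ k])
    then show "nrm2 (\<lambda>_. 1) (lfilter (\<lambda>g. l_coset G g H = l_coset G k H) u) = (cmod (coset_mass H u k))\<^sup>2"
      by (simp add: nrm2_const1)
  qed
  finally show ?thesis .
qed

text \<open>A function on \<open>G / H\<close> which is nearly invariant under \<open>E\<close> has small norm, since
  \<open>E\<close> moves every point to at least \<open>N\<close> different places.\<close>

lemma nrm2_spread:
  assumes ci: "closed_invariant G Y" and H: "H \<in> Y" and E: "finite E" "E \<subseteq> carrier G"
    and N: "0 < N" and sep: "\<And>H. H \<in> Y \<Longrightarrow> \<exists>D\<subseteq>E. card D = N \<and> (\<forall>g\<in>D. \<forall>h\<in>D. g \<noteq> h \<longrightarrow> g \<otimes> inv h \<notin> H)"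
    and v: "v \<in> convex_lists"
  shows "nrm2 (\<lambda>g. of_bool (g \<in> H)) v \<le> 2 / real N
    + real (card E) / (real N)\<^sup>2 * (\<Sum>g\<in>E. nrm2 (\<lambda>g. of_bool (g \<in> H)) (v @ lscale (-1) (ltrans g v)))"
proof -
  let ?\<omega> = "\<lambda>g. of_bool (g \<in> H) :: complex"
  note C = closed_invariantD[OF ci]
  note Hs = C(1)[OF H]
  have vo: "v \<in> over (carrier G)" and vn: "\<forall>p\<in>set v. fst p \<in> \<real>\<^sub>\<ge>\<^sub>0" and v1: "lsum (\<lambda>_. 1) v = 1"
    using v by (auto simp: convex_lists_def)
  let ?w = "\<lambda>g. v @ lscale (-1) (ltrans g v)"
  let ?c = "\<lambda>k. l_coset G k H"
  let ?S = "snd ` set v \<union> (\<Union>g\<in>E. (\<lambda>p. g \<otimes> snd p) ` set v)"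
  have Sf: "finite (?c ` ?S)" using E(1) by auto
  have Sc: "?S \<subseteq> carrier G" using vo E(2) by (auto simp: over_def subset_iff)
  \<comment> \<open>One representative for each coset met by \<open>v\<close> or by a translate of
    \<open>v\<close> under \<open>E\<close>: the norms of \<open>v\<close> and of all differences
    become sums over the same \<open>R\<close>.\<close>
  obtain R where R: "R \<subseteq> ?S" "inj_on ?c R" "?c ` ?S = ?c ` R"
    using subset_image_inj[of "?c ` ?S" ?c ?S] by auto
  have Rf: "finite R" using R(2,3) Sf by (metis finite_image_iff)
  have Rc: "R \<subseteq> carrier G" using R(1) Sc by blast
  have nv: "nrm2 ?\<omega> v = (\<Sum>k\<in>R. (cmod (coset_mass H v k))\<^sup>2)"
    by (rule nrm2_subgroup_indicator[OF Hs vo Rf Rc R(2)]) (use R(3) in blast)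
  have nw: "nrm2 ?\<omega> (?w g) = (\<Sum>k\<in>R. (cmod (coset_mass H (?w g) k))\<^sup>2)" if g: "g \<in> E" for g
  proof (rule nrm2_subgroup_indicator[OF Hs _ Rf Rc R(2)])
    show "?w g \<in> over (carrier G)" using vo g E(2) by auto
    have "snd ` set (?w g) \<subseteq> ?S" using g by (auto simp: ltrans_def lscale_def image_iff) force+
    then have "?c ` snd ` set (?w g) \<subseteq> ?c ` R" unfolding R(3)[symmetric] by (rule image_mono)
    then show "(\<lambda>p. l_coset G (snd p) H) ` set (?w g) \<subseteq> ?c ` R" by (simp add: image_image)
  qed
  define x where "x k = Re (coset_mass H v k)" for k
  have xn: "coset_mass H v k \<in> \<real>\<^sub>\<ge>\<^sub>0" for k by (rule lsum_nonneg[OF vn]) (simp add: complex_nonneg_Reals_iff)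
  have xv: "coset_mass H v k = of_real (x k)" "0 \<le> x k" for k
    using xn[of k] by (auto simp: x_def complex_nonneg_Reals_iff complex_eq_iff)
  have nvx: "nrm2 ?\<omega> v = (\<Sum>k\<in>R. (x k)\<^sup>2)" unfolding nv xv by simp
  have mass_w: "coset_mass H (?w g) k = of_real (x k - x (inv g \<otimes> k))" if "g \<in> carrier G" "k \<in> carrier G" for g k
  proof -
    have "coset_mass H (ltrans g v) k = lsum (\<lambda>y. of_bool (inv k \<otimes> (g \<otimes> y) \<in> H)) v"
      by (simp add: lsum_def ltrans_def o_def case_prod_unfold)
    also have "\<dots> = coset_mass H v (inv g \<otimes> k)"
      by (rule lsum_cong[OF vo]) (use that in \<open>simp add: inv_mult_group m_assoc\<close>)
    finally show ?thesis by (simp add: xv)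
  qed
  have le1: "(\<Sum>i\<in>I. x (f i)) \<le> 1"
    if I: "finite I" "\<And>i j y. \<lbrakk>i \<in> I; j \<in> I; i \<noteq> j; y \<in> carrier G; inv (f i) \<otimes> y \<in> H; inv (f j) \<otimes> y \<in> H\<rbrakk> \<Longrightarrow> False"
    for I :: "'a set" and f
  proof -
    have "(\<Sum>i\<in>I. x (f i)) = Re (lsum (\<lambda>y. \<Sum>i\<in>I. of_bool (inv (f i) \<otimes> y \<in> H)) v)"
      unfolding x_def lsum_sum_fun Re_sum ..
    also have "\<dots> \<le> Re (lsum (\<lambda>_. 1) v)"
    proof (rule lsum_mono_Re[OF vo vn])
      fix y assume y: "y \<in> carrier G"
      have "(\<Sum>i\<in>I. of_bool (inv (f i) \<otimes> y \<in> H) :: real) = real (card {i \<in> I. inv (f i) \<otimes> y \<in> H})"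
        using I(1) by (simp add: sum.If_cases of_bool_def Int_def)
      also have "card {i \<in> I. inv (f i) \<otimes> y \<in> H} \<le> 1"
        using I y by (intro card_le_Suc0_iff_eq[THEN iffD2, simplified One_nat_def[symmetric]]) auto
      finally have le: "(\<Sum>i\<in>I. of_bool (inv (f i) \<otimes> y \<in> H) :: real) \<le> 1" by simp
      have "Re (of_bool P) = of_bool P" for P by (cases P) auto
      then show "Re (\<Sum>i\<in>I. of_bool (inv (f i) \<otimes> y \<in> H)) \<le> Re 1"
        unfolding Re_sum using le by simp
    qed
    finally show ?thesis using v1 by simp
  qed
  have sumx: "(\<Sum>k\<in>R. x k) \<le> 1"
  proof (rule le1[OF Rf, of "\<lambda>k. k"])
    fix i j y assume *: "i \<in> R" "j \<in> R" "i \<noteq> j" "y \<in> carrier G" "inv i \<otimes> y \<in> H" "inv j \<otimes> y \<in> H"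
    have "?c y = ?c i" "?c y = ?c j" using * Rc l_coset_eq_iff[OF Hs] by auto
    then show False using * R(2) by (auto dest: inj_onD)
  qed
  let ?M = "real (card E)" and ?N = "real N"
  have M0: "0 < ?M"
  proof -
    obtain D where "D \<subseteq> E" "card D = N" using sep[OF H] by blast
    then have "N \<le> card E" using E(1) card_mono by blast
    then show ?thesis using N by simp
  qed
  have point: "?N * (x k)\<^sup>2 \<le> x k + ?N / 2 * (x k)\<^sup>2 + ?M / (2 * ?N) * (\<Sum>g\<in>E. (x k - x (inv g \<otimes> k))\<^sup>2)"
    if k: "k \<in> carrier G" for k
  proof -
    \<comment> \<open>Separation is taken for the conjugate of \<open>H\<close> by \<open>k\<close>:
      the cosets of \<open>inv g \<otimes> k\<close> with \<open>g \<in> D\<close> are then pairwise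
      different, so their masses add up to at most 1.\<close>
    obtain D where D: "D \<subseteq> E" "card D = N"
      "\<forall>g\<in>D. \<forall>h\<in>D. g \<noteq> h \<longrightarrow> g \<otimes> inv h \<notin> conj_subgroup G k H"
      using sep[OF C(3)[OF H k]] by blast
    have Df: "finite D" using D(1) E(1) finite_subset by blast
    have "(\<Sum>g\<in>D. x (inv g \<otimes> k)) \<le> 1"
    proof (rule le1[OF Df])
      fix g h y assume *: "g \<in> D" "h \<in> D" "g \<noteq> h" "y \<in> carrier G"
        "inv (inv g \<otimes> k) \<otimes> y \<in> H" "inv (inv h \<otimes> k) \<otimes> y \<in> H"
      have gh: "g \<in> carrier G" "h \<in> carrier G" using * D(1) E(2) by auto
      have "(inv (inv g \<otimes> k) \<otimes> y) \<otimes> inv (inv (inv h \<otimes> k) \<otimes> y) \<in> H"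
        using * subgroup.m_closed[OF Hs] subgroup.m_inv_closed[OF Hs] by blast
      also have "(inv (inv g \<otimes> k) \<otimes> y) \<otimes> inv (inv (inv h \<otimes> k) \<otimes> y) = inv k \<otimes> (g \<otimes> inv h) \<otimes> k"
        using gh k * by (simp add: inv_mult_group m_assoc)
      finally have "g \<otimes> inv h \<in> conj_subgroup G k H"
        using conj_subgroup_iff[OF C(2)[OF H] k] gh by simp
      then show False using D(3) * by blast
    qed
    moreover have "?N * x k = (\<Sum>g\<in>D. x (inv g \<otimes> k)) + (\<Sum>g\<in>D. x k - x (inv g \<otimes> k))"
      using D(2) by (simp add: sum_subtractf)
    moreover have "(\<Sum>g\<in>D. x k - x (inv g \<otimes> k)) \<le> (\<Sum>g\<in>E. \<bar>x k - x (inv g \<otimes> k)\<bar>)"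
      using D(1) E(1) by (intro order_trans[OF sum_mono sum_mono2]) auto
    ultimately have "?N * x k \<le> 1 + (\<Sum>g\<in>E. \<bar>x k - x (inv g \<otimes> k)\<bar>)" by linarith
    then have "x k * (?N * x k) \<le> x k * (1 + (\<Sum>g\<in>E. \<bar>x k - x (inv g \<otimes> k)\<bar>))"
      by (rule mult_left_mono[OF _ xv(2)])
    also have "\<dots> = x k + (\<Sum>g\<in>E. x k * \<bar>x k - x (inv g \<otimes> k)\<bar>)"
      by (simp add: distrib_left sum_distrib_left)
    also have "(\<Sum>g\<in>E. x k * \<bar>x k - x (inv g \<otimes> k)\<bar>)
      \<le> (\<Sum>g\<in>E. ?N / (2 * ?M) * (x k)\<^sup>2 + ?M / (2 * ?N) * (x k - x (inv g \<otimes> k))\<^sup>2)"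
    proof (rule sum_mono)
      fix g
      \<comment> \<open>With this weight the quadratic terms, summed over \<open>E\<close>, amount
        to half of the left side and can be absorbed there.\<close>
      define s d where "s = ?N / ?M" and "d = \<bar>x k - x (inv g \<otimes> k)\<bar>"
      have s: "0 < s" using N M0 by (simp add: s_def)
      have "0 \<le> (s * x k - d)\<^sup>2 / (2 * s)" using s by simp
      also have "\<dots> = s / 2 * (x k)\<^sup>2 - x k * d + 1 / (2 * s) * d\<^sup>2"
        using s by (simp add: power2_diff field_simps power2_eq_square)
      finally have "x k * d \<le> s / 2 * (x k)\<^sup>2 + 1 / (2 * s) * d\<^sup>2" by linarith
      then show "x k * \<bar>x k - x (inv g \<otimes> k)\<bar>
        \<le> ?N / (2 * ?M) * (x k)\<^sup>2 + ?M / (2 * ?N) * (x k - x (inv g \<otimes> k))\<^sup>2"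
        by (simp add: s_def d_def mult.commute)
    qed
    also have "\<dots> = ?N / 2 * (x k)\<^sup>2 + ?M / (2 * ?N) * (\<Sum>g\<in>E. (x k - x (inv g \<otimes> k))\<^sup>2)"
      using M0 by (simp add: sum.distrib sum_distrib_left)
    finally show ?thesis by (simp add: power2_eq_square mult_ac)
  qed
  have "?N * nrm2 ?\<omega> v = (\<Sum>k\<in>R. ?N * (x k)\<^sup>2)" by (simp add: nvx sum_distrib_left)
  also have "\<dots> \<le> (\<Sum>k\<in>R. x k + ?N / 2 * (x k)\<^sup>2 + ?M / (2 * ?N) * (\<Sum>g\<in>E. (x k - x (inv g \<otimes> k))\<^sup>2))"
    using point Rc by (intro sum_mono) auto
  also have "\<dots> = (\<Sum>k\<in>R. x k) + ?N / 2 * (\<Sum>k\<in>R. (x k)\<^sup>2) + ?M / (2 * ?N) * (\<Sum>g\<in>E. \<Sum>k\<in>R. (x k - x (inv g \<otimes> k))\<^sup>2)"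
    unfolding sum.distrib sum_distrib_left[symmetric] by (subst sum.swap) simp
  also have "(\<Sum>g\<in>E. \<Sum>k\<in>R. (x k - x (inv g \<otimes> k))\<^sup>2) = (\<Sum>g\<in>E. nrm2 ?\<omega> (?w g))"
  proof (rule sum.cong[OF refl])
    fix g assume g: "g \<in> E"
    show "(\<Sum>k\<in>R. (x k - x (inv g \<otimes> k))\<^sup>2) = nrm2 ?\<omega> (?w g)"
      unfolding nw[OF g]
    proof (rule sum.cong[OF refl])
      fix k assume "k \<in> R"
      then have "coset_mass H (?w g) k = of_real (x k - x (inv g \<otimes> k))"
        using mass_w g E(2) Rc by blast
      then show "(x k - x (inv g \<otimes> k))\<^sup>2 = (cmod (coset_mass H (?w g) k))\<^sup>2"
        by (simp only: norm_of_real power2_abs)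
    qed
  qed
  finally have "?N * nrm2 ?\<omega> v \<le> 1 + ?N / 2 * nrm2 ?\<omega> v + ?M / (2 * ?N) * (\<Sum>g\<in>E. nrm2 ?\<omega> (?w g))"
    using sumx nvx by simp
  moreover have "n * ?N \<le> 2 + ?M / ?N * S" if "?N * n \<le> 1 + ?N / 2 * n + ?M / (2 * ?N) * S" for n S :: real
  proof -
    have eq: "1 + ?N / 2 * n + ?M / (2 * ?N) * S = 1 + n * ?N / 2 + (?M / ?N * S) / 2" "?N * n = n * ?N"
      by (simp_all add: mult.commute)
    have "a \<le> 2 + d" if "a \<le> 1 + a / 2 + d / 2" for a d :: real using that by linarith
    then show ?thesis using that unfolding eq by blast
  qed
  ultimately have "nrm2 ?\<omega> v * ?N \<le> 2 + ?M / ?N * (\<Sum>g\<in>E. nrm2 ?\<omega> (?w g))" by blast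
  then have "nrm2 ?\<omega> v \<le> (2 + ?M / ?N * (\<Sum>g\<in>E. nrm2 ?\<omega> (?w g))) / ?N" using N by (simp add: le_divide_eq)
  also have "\<dots> = 2 / ?N + ?M / ?N\<^sup>2 * (\<Sum>g\<in>E. nrm2 ?\<omega> (?w g))"
    by (simp add: add_divide_distrib power2_eq_square)
  finally show ?thesis .
qed

text \<open>This is the convolution of the adjoint of \<open>v\<close> with \<open>u\<close>. It
  makes \<open>form \<omega> u v\<close> a linear functional of \<open>\<omega>\<close>, to which
  the inequalities defining \<open>indicator_hull\<close> apply.\<close>

definition lstar :: "(complex \<times> 'a) list \<Rightarrow> (complex \<times> 'a) list \<Rightarrow> (complex \<times> 'a) list" where
  "lstar u v = concat (map (\<lambda>(a, g). map (\<lambda>(b, h). (a * cnj b, inv h \<otimes> g)) v) u)"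

lemma lsum_lstar: "lsum \<omega> (lstar u v) = form \<omega> u v"
proof -
  have *: "lsum \<omega> (map (\<lambda>(b, h). (a * cnj b, inv h \<otimes> g)) v) = a * (\<Sum>(b, h)\<leftarrow>v. cnj b * \<omega> (inv h \<otimes> g))" for a g
    by (induction v) (auto simp: algebra_simps)
  show ?thesis
    unfolding lstar_def form_def lsum_concat lsum_def[of _ u]
    by (simp add: o_def case_prod_unfold *[unfolded case_prod_unfold])
qed

lemma lstar_over:
  assumes "u \<in> over (carrier G)" "v \<in> over (carrier G)" shows "lstar u v \<in> over (carrier G)"
  using assms unfolding lstar_def over_def by (fastforce simp: subset_iff)

text \<open>Both sides are linear in the positive definite function, so an estimate with the same
  \<open>a\<close>, \<open>b\<close> and \<open>E\<close> for all members of \<open>Y\<close>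
  extends to the hull. This is what the uniformity in \<open>uniformly_separated\<close> is
  for.\<close>

lemma hull_spread:
  assumes Y: "\<phi> \<in> indicator_hull Y" and v: "v \<in> over (carrier G)" and E: "finite E" "E \<subseteq> carrier G"
    and le: "\<And>H. H \<in> Y \<Longrightarrow> nrm2 (\<lambda>g. of_bool (g \<in> H)) v
      \<le> a + b * (\<Sum>g\<in>E. nrm2 (\<lambda>g. of_bool (g \<in> H)) (v @ lscale (-1) (ltrans g v)))"
  shows "nrm2 \<phi> v \<le> a + b * (\<Sum>g\<in>E. nrm2 \<phi> (v @ lscale (-1) (ltrans g v)))"
proof -
  obtain es where es: "set es = E" "distinct es" using finite_distinct_list[OF E(1)] by blast
  let ?w = "\<lambda>g. v @ lscale (-1) (ltrans g v)"
  let ?L = "lstar v v @ lscale (of_real (- b)) (concat (map (\<lambda>g. lstar (?w g) (?w g)) es))"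
  have L: "Re (lsum \<omega> ?L) = nrm2 \<omega> v - b * (\<Sum>g\<in>E. nrm2 \<omega> (?w g))" for \<omega>
  proof -
    have "Re (lsum \<omega> (concat (map (\<lambda>g. lstar (?w g) (?w g)) es))) = (\<Sum>g\<leftarrow>es. nrm2 \<omega> (?w g))"
      by (induction es) (auto simp: lsum_lstar nrm2_def simp del: form_left form_right)
    also have "\<dots> = (\<Sum>g\<in>E. nrm2 \<omega> (?w g))" using es by (simp add: sum_list_distinct_conv_sum_set)
    finally show ?thesis by (simp add: lsum_lstar nrm2_def[of _ v] del: form_left form_right)
  qed
  have "Re (lsum \<phi> ?L) \<le> a"
  proof (rule indicator_hullD[OF Y])
    have "?w g \<in> over (carrier G)" if "g \<in> E" for g using that v E(2) by auto
    then show "?L \<in> over (carrier G)" using v es by (auto intro!: lstar_over concat_over)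
    show "Re (lsum (\<lambda>g. of_bool (g \<in> H)) ?L) \<le> a" if "H \<in> Y" for H
      unfolding L using le[OF that] by simp
  qed
  then show ?thesis unfolding L by simp
qed

lemma convex_lists_half:
  assumes "u \<in> convex_lists" "v \<in> convex_lists" shows "lscale (1/2) (u @ v) \<in> convex_lists"
proof -
  have "\<forall>p\<in>set (lscale (1/2) w). fst p \<in> \<real>\<^sub>\<ge>\<^sub>0" if "\<forall>p\<in>set w. fst p \<in> \<real>\<^sub>\<ge>\<^sub>0" for w :: "(complex \<times> 'a) list"
    using that by (auto simp: lscale_def complex_nonneg_Reals_iff)
  from this[of "u @ v"] show ?thesis using assms by (auto simp: convex_lists_def)
qed

lemma convex_lists_ltrans:
  assumes "v \<in> convex_lists" "g \<in> carrier G" shows "ltrans g v \<in> convex_lists"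
  using assms by (auto simp: convex_lists_def ltrans_def[of g v] lsum_def o_def case_prod_unfold)
     (auto simp: over_def)

text \<open>A convex list of nearly minimal norm is nearly fixed by finitely many translations,
  because its midpoint with a translate is again a convex list. The spreading estimate then makes
  its norm small, which a positive infimum excludes.\<close>

lemma small_convex_list:
  assumes w: "posdef \<omega>" and e: "0 < e"
    and spread: "\<And>N. 0 < N \<Longrightarrow> \<exists>E a. finite E \<and> E \<subseteq> carrier G \<and> 0 \<le> a \<and> (\<forall>v\<in>convex_lists.
      nrm2 \<omega> v \<le> c / real N + a * (\<Sum>g\<in>E. nrm2 \<omega> (v @ lscale (-1) (ltrans g v))))"
  shows "\<exists>v\<in>convex_lists. nrm2 \<omega> v < e"
proof (rule ccontr)
  assume "\<not> ?thesis"
  then have ge: "\<And>v. v \<in> convex_lists \<Longrightarrow> e \<le> nrm2 \<omega> v" by (simp add: not_less)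
  define \<theta> where "\<theta> = (INF v\<in>convex_lists. nrm2 \<omega> v)"
  have ne: "[(1, \<one>)] \<in> convex_lists" by (simp add: convex_lists_def)
  have bd: "bdd_below (nrm2 \<omega> ` convex_lists)" using ge by (auto simp: bdd_below_def)
  have \<theta>e: "e \<le> \<theta>" unfolding \<theta>_def using ne ge by (intro cINF_greatest) auto
  have \<theta>le: "\<theta> \<le> nrm2 \<omega> v" if "v \<in> convex_lists" for v unfolding \<theta>_def by (rule cINF_lower[OF bd that])
  obtain N :: nat where N: "2 * c / e < real N" using reals_Archimedean2 by blast
  define N' where "N' = Suc N"
  have N': "0 < N'" "c / real N' < e / 2"
  proof -
    have "2 * c / e < real N'" using N by (simp add: N'_def)
    then show "c / real N' < e / 2" using e by (simp add: N'_def field_simps)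
  qed (simp add: N'_def)
  obtain E a where E: "finite E" "E \<subseteq> carrier G" "0 \<le> a"
    "\<forall>v\<in>convex_lists. nrm2 \<omega> v \<le> c / real N' + a * (\<Sum>g\<in>E. nrm2 \<omega> (v @ lscale (-1) (ltrans g v)))"
    using spread[OF N'(1)] by blast
  \<comment> \<open>Displacements with squared norm at most \<open>4 * \<eta>\<close> contribute at
    most \<open>e / 2\<close> in total; the other half of \<open>e\<close> is left for
    \<open>c / real N'\<close>. The summand 1 keeps the denominator positive.\<close>
  define \<eta> where "\<eta> = e / (8 * (a * real (card E) + 1))"
  have P: "0 < a * real (card E) + 1" using E(3) by (simp add: add_nonneg_pos)
  have \<eta>: "0 < \<eta>" using P e by (simp add: \<eta>_def)
  have "\<exists>v\<in>convex_lists. nrm2 \<omega> v < \<theta> + \<eta>"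
    using cINF_less_iff[OF _ bd, of "\<theta> + \<eta>"] ne \<eta> unfolding \<theta>_def by auto
  then obtain v where v: "v \<in> convex_lists" "nrm2 \<omega> v < \<theta> + \<eta>" by blast
  have vo: "v \<in> over (carrier G)" using v by (simp add: convex_lists_def)
  have small: "nrm2 \<omega> (v @ lscale (-1) (ltrans g v)) \<le> 4 * \<eta>" if g: "g \<in> E" for g
  proof -
    have gc: "g \<in> carrier G" using g E(2) by blast
    have "\<theta> \<le> nrm2 \<omega> (lscale (1/2) (v @ ltrans g v))"
      by (intro \<theta>le convex_lists_half convex_lists_ltrans v gc)
    then have "4 * \<theta> \<le> nrm2 \<omega> (v @ ltrans g v)" by (simp add: nrm2_lscale norm_divide power2_eq_square)
    moreover have "nrm2 \<omega> (v @ ltrans g v) + nrm2 \<omega> (v @ lscale (-1) (ltrans g v))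
        = 2 * nrm2 \<omega> v + 2 * nrm2 \<omega> (ltrans g v)"
      by (simp add: nrm2_def)
    moreover have "nrm2 \<omega> (ltrans g v) = nrm2 \<omega> v" by (rule nrm2_ltrans[OF gc vo])
    ultimately show ?thesis using v(2) by linarith
  qed
  have "\<theta> \<le> nrm2 \<omega> v" by (rule \<theta>le[OF v(1)])
  also have "\<dots> \<le> c / real N' + a * (\<Sum>g\<in>E. nrm2 \<omega> (v @ lscale (-1) (ltrans g v)))" using E(4) v(1) by blast
  also have "(\<Sum>g\<in>E. nrm2 \<omega> (v @ lscale (-1) (ltrans g v))) \<le> real (card E) * (4 * \<eta>)"
    using small by (intro sum_bounded_above) auto
  finally have "\<theta> \<le> c / real N' + a * (real (card E) * (4 * \<eta>))" using E(3) by (simp add: mult_left_mono)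
  also have "a * (real (card E) * (4 * \<eta>)) \<le> (a * real (card E) + 1) * (4 * \<eta>)" using \<eta> by (simp add: algebra_simps)
  also have "\<dots> = e / 2"
  proof -
    have "X * (4 * (e / (8 * X))) = e / 2" if "0 < X" for X using that by (simp add: field_simps)
    then show ?thesis unfolding \<eta>_def using P by blast
  qed
  finally show False using N'(2) \<theta>e by linarith
qed

text \<open>By the Cauchy-Schwarz inequality the averages of \<open>\<omega> (c \<otimes> g)\<close>
  over a convex list of small norm are small. As the real parts are nonnegative, the sum over all
  \<open>c \<in> C\<close> can be treated at once, and some \<open>g\<close> does as well as
  required.\<close>

lemma small_correlation:
  assumes w: "posdef \<omega>" and nn: "\<And>g. g \<in> carrier G \<Longrightarrow> 0 \<le> Re (\<omega> g)" and C: "finite C" "C \<subseteq> carrier G"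
    and small: "\<And>e. 0 < e \<Longrightarrow> \<exists>v\<in>convex_lists. nrm2 \<omega> v < e" and e: "0 < e"
  shows "\<exists>g\<in>carrier G. \<forall>c\<in>C. Re (\<omega> (c \<otimes> g)) < e"
proof -
  define n where "n = Re (\<omega> \<one>)"
  have n: "0 \<le> n" using nn[OF one_closed] by (simp add: n_def)
  define K where "K = real (card C) * sqrt n + 1"
  have K: "0 < K" using n by (simp add: K_def add_nonneg_pos)
  obtain v where v: "v \<in> convex_lists" "nrm2 \<omega> v < (e / K)\<^sup>2" using small[of "(e / K)\<^sup>2"] e K by auto
  have vo: "v \<in> over (carrier G)" and vn: "\<forall>p\<in>set v. fst p \<in> \<real>\<^sub>\<ge>\<^sub>0" and v1: "lsum (\<lambda>_. 1) v = 1"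
    using v by (auto simp: convex_lists_def)
  have sq: "sqrt (nrm2 \<omega> v) < e / K" using v(2) e K by (simp add: real_less_lsqrt nrm2_nonneg[OF w vo])
  have c: "Re (lsum (\<lambda>g. \<omega> (c \<otimes> g)) v) \<le> sqrt (nrm2 \<omega> v) * sqrt n" if "c \<in> C" for c
  proof -
    have cc: "c \<in> carrier G" using that C(2) by blast
    have "lsum (\<lambda>g. \<omega> (c \<otimes> g)) v = form \<omega> v [(1, inv c)]"
      unfolding form_def by (rule lsum_cong[OF vo]) (simp add: cc)
    moreover have "Re (form \<omega> v [(1, inv c)]) \<le> sqrt (nrm2 \<omega> v) * sqrt (nrm2 \<omega> [(1, inv c)])"
      using cc by (intro form_CS_Re_sqrt[OF w vo]) auto
    moreover have "nrm2 \<omega> [(1, inv c)] = n" using cc by (simp add: nrm2_def form_single n_def)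
    ultimately show ?thesis by simp
  qed
  have lsumC: "lsum (\<lambda>g. \<Sum>c\<in>C. \<omega> (c \<otimes> g)) v = (\<Sum>c\<in>C. lsum (\<lambda>g. \<omega> (c \<otimes> g)) v)"
    by (rule lsum_sum_fun)
  have "Re (lsum (\<lambda>g. \<Sum>c\<in>C. \<omega> (c \<otimes> g)) v) \<le> real (card C) * (sqrt (nrm2 \<omega> v) * sqrt n)"
    unfolding lsumC Re_sum using c by (intro sum_bounded_above)
  also have "\<dots> \<le> K * sqrt (nrm2 \<omega> v)"
    using nrm2_nonneg[OF w vo] by (simp add: K_def algebra_simps)
  also have "\<dots> < K * (e / K)" using sq K by (intro mult_strict_left_mono)
  finally have lt: "Re (lsum (\<lambda>g. \<Sum>c\<in>C. \<omega> (c \<otimes> g)) v) < e" using K by simp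
  have "\<exists>g\<in>carrier G. Re (\<Sum>c\<in>C. \<omega> (c \<otimes> g)) < e"
  proof (rule ccontr)
    assume "\<not> ?thesis"
    then have "Re (lsum (\<lambda>_. of_real e * 1) v) \<le> Re (lsum (\<lambda>g. \<Sum>c\<in>C. \<omega> (c \<otimes> g)) v)"
      by (intro lsum_mono_Re[OF vo vn]) (auto simp: not_less)
    then show False using lt unfolding lsum_cmult v1 by simp
  qed
  then obtain g where g: "g \<in> carrier G" "(\<Sum>c\<in>C. Re (\<omega> (c \<otimes> g))) < e" by (auto simp: Re_sum)
  have "Re (\<omega> (c \<otimes> g)) < e" if "c \<in> C" for c
  proof -
    have "Re (\<omega> (c \<otimes> g)) \<le> (\<Sum>c\<in>C. Re (\<omega> (c \<otimes> g)))"
      using that C g(1) nn by (intro member_le_sum) auto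
    then show ?thesis using g(2) by linarith
  qed
  then show ?thesis using g(1) by blast
qed

text \<open>Small correlations for the sum of \<open>\<phi>\<close> and the indicator function of
  the trivial subgroup make values of \<open>\<phi>\<close> small and also avoid \<open>R\<close>,
  since at the identity the indicator would contribute 1. Each term is chosen against all earlier
  ones, so that subsequences keep both properties.\<close>

lemma separating_sequence:
  assumes X: "URS G X" "infinite X" and \<phi>: "\<phi> \<in> indicator_hull X" and R: "finite R"
    and h: "h \<in> carrier G" and d: "0 < d"
  obtains \<gamma> :: "nat \<Rightarrow> 'a" where "range \<gamma> \<subseteq> carrier G"
    "\<And>j k. j < k \<Longrightarrow> Re (\<phi> (h \<otimes> (inv (\<gamma> j) \<otimes> \<gamma> k))) < d"
    "\<And>j k. j < k \<Longrightarrow> h \<otimes> (inv (\<gamma> j) \<otimes> \<gamma> k) \<notin> R"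
proof -
  have ci: "closed_invariant G X" using X by (simp add: URS_def)
  note C = closed_invariantD[OF ci]
  have "infinite (carrier G)"
  proof
    assume "finite (carrier G)"
    moreover have "X \<subseteq> Pow (carrier G)" using C(2) by blast
    ultimately show False using X(2) finite_subset by blast
  qed
  \<comment> \<open>The trivial subgroup joins the family so that the same estimates cover its
    indicator function; it has infinite index because the group is infinite.\<close>
  let ?Y = "insert {\<one>} X"
  have triv: "subgroup {\<one>} G" by (rule subgroupI) auto
  have ciY: "closed_invariant G ?Y"
  proof -
    have "closedin (chabauty G) {{\<one>}}" by (rule closedin_chabauty_finite) (use triv in auto)
    moreover have "closedin (chabauty G) X" using ci by (simp add: closed_invariant_def)
    ultimately have "closedin (chabauty G) ({{\<one>}} \<union> X)" by (rule closedin_Un)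
    then show ?thesis using ci by (auto simp: closed_invariant_def conj_subgroup_def)
  qed
  have "infinite_index {\<one>}"
    unfolding infinite_index_def
  proof (intro allI impI)
    fix F assume F: "finite F" "F \<subseteq> carrier G"
    then obtain g where g: "g \<in> carrier G" "g \<notin> F" using \<open>infinite (carrier G)\<close> by (meson finite_subset subsetI)
    have "g \<otimes> inv f \<notin> {\<one>}" if "f \<in> F" for f
    proof
      assume "g \<otimes> inv f \<in> {\<one>}"
      then have "g = f" using g(1) that F(2) by (metis inv_equality inv_inv inv_closed singletonD subsetD)
      then show False using g(2) that by blast
    qed
    then show "\<exists>g\<in>carrier G. \<forall>f\<in>F. g \<otimes> inv f \<notin> {\<one>}" using g(1) by blast
  qed
  then have inf: "infinite_index H" if "H \<in> ?Y" for H
    using that infinite_URS_infinite_index[OF X] by blast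
  define \<omega> where "\<omega> = (\<lambda>g. \<phi> g + of_bool (g \<in> {\<one>}))"
  have pd\<phi>: "posdef \<phi>" using \<phi> by (simp add: indicator_hull_def PD1_iff)
  have w: "posdef \<omega>" unfolding \<omega>_def by (rule posdef_add[OF pd\<phi> posdef_indicator[OF triv]])
  have nrm_w: "nrm2 \<omega> u = nrm2 \<phi> u + nrm2 (\<lambda>g. of_bool (g \<in> {\<one>})) u" for u
    by (simp add: nrm2_def \<omega>_def form_fun_add)
  have "\<exists>v\<in>convex_lists. nrm2 \<omega> v < e" if e: "0 < e" for e
  \<comment> \<open>The constant 4 collects \<open>2 / real N\<close> from \<open>\<phi>\<close> and
    again from the trivial subgroup.\<close>
  proof (rule small_convex_list[OF w e, where c = 4])
    fix N :: nat assume N: "0 < N"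
    obtain E where E: "finite E" "E \<subseteq> carrier G"
      "\<And>H. H \<in> ?Y \<Longrightarrow> \<exists>D\<subseteq>E. card D = N \<and> (\<forall>g\<in>D. \<forall>h\<in>D. g \<noteq> h \<longrightarrow> g \<otimes> inv h \<notin> H)"
      using uniformly_separated[OF ciY inf] by blast
    let ?a = "real (card E) / (real N)\<^sup>2"
    have sp: "nrm2 (\<lambda>g. of_bool (g \<in> H)) v \<le> 2 / real N
        + ?a * (\<Sum>g\<in>E. nrm2 (\<lambda>g. of_bool (g \<in> H)) (v @ lscale (-1) (ltrans g v)))"
      if "H \<in> ?Y" "v \<in> convex_lists" for H v
      by (rule nrm2_spread[OF ciY that(1) E(1,2) N E(3) that(2)])
    have "nrm2 \<omega> v \<le> 4 / real N + ?a * (\<Sum>g\<in>E. nrm2 \<omega> (v @ lscale (-1) (ltrans g v)))"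
      if v: "v \<in> convex_lists" for v
    proof -
      have vo: "v \<in> over (carrier G)" using v by (simp add: convex_lists_def)
      have "nrm2 \<phi> v \<le> 2 / real N + ?a * (\<Sum>g\<in>E. nrm2 \<phi> (v @ lscale (-1) (ltrans g v)))"
        by (rule hull_spread[OF \<phi> vo E(1,2)]) (use sp v in blast)
      then show ?thesis
        using sp[of "{\<one>}" v] v unfolding nrm_w sum.distrib distrib_left by simp
    qed
    then show "\<exists>E a. finite E \<and> E \<subseteq> carrier G \<and> 0 \<le> a \<and> (\<forall>v\<in>convex_lists.
        nrm2 \<omega> v \<le> 4 / real N + a * (\<Sum>g\<in>E. nrm2 \<omega> (v @ lscale (-1) (ltrans g v))))"
      using E(1,2) by (intro exI[of _ E] exI[of _ ?a]) auto
  qed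
  note small = this
  have nn: "0 \<le> Re (\<omega> g)" if "g \<in> carrier G" for g
    using indicator_hull_real[OF \<phi> that] by (simp add: \<omega>_def)
  define good where "good S g \<longleftrightarrow> g \<in> carrier G \<and>
    (\<forall>f\<in>S. Re (\<phi> (h \<otimes> (inv f \<otimes> g))) < d \<and> h \<otimes> (inv f \<otimes> g) \<notin> R)" for S g
  have good_ex: "\<exists>g. good S g" if S: "finite S" "S \<subseteq> carrier G" for S
  proof -
    \<comment> \<open>The first family controls the values of \<open>\<phi>\<close>. The second,
      with an element for each \<open>s \<in> R\<close>, excludes
      \<open>h \<otimes> (inv f \<otimes> g) = s\<close>, because the argument of
      \<open>\<omega>\<close> would then be \<open>\<one>\<close>.\<close>
    let ?C = "(\<lambda>f. h \<otimes> inv f) ` S \<union> (\<lambda>(s, f). inv s \<otimes> (h \<otimes> inv f)) ` ((R \<inter> carrier G) \<times> S)"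
    have "finite ?C" "?C \<subseteq> carrier G" using S R h by (auto simp: subset_iff)
    then obtain g where g: "g \<in> carrier G" "\<forall>c\<in>?C. Re (\<omega> (c \<otimes> g)) < min d 1"
      using small_correlation[OF w nn _ _ small, of ?C "min d 1"] d by auto
    have "Re (\<phi> (h \<otimes> (inv f \<otimes> g))) < d \<and> h \<otimes> (inv f \<otimes> g) \<notin> R" if f: "f \<in> S" for f
    proof
      have fc: "f \<in> carrier G" using f S by blast
      have "h \<otimes> inv f \<in> ?C" using f by blast
      then have "Re (\<omega> (h \<otimes> inv f \<otimes> g)) < d" using g(2) by fastforce
      then show "Re (\<phi> (h \<otimes> (inv f \<otimes> g))) < d"
        using h g(1) fc by (simp add: \<omega>_def m_assoc of_bool_def split: if_splits)
      show "h \<otimes> (inv f \<otimes> g) \<notin> R"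
      proof
        let ?s = "h \<otimes> (inv f \<otimes> g)"
        assume s: "?s \<in> R"
        have sc: "?s \<in> carrier G" using h g(1) fc by simp
        then have "inv ?s \<otimes> (h \<otimes> inv f) \<in> ?C" using s f by force
        then have "Re (\<omega> (inv ?s \<otimes> (h \<otimes> inv f) \<otimes> g)) < 1" using g(2) by fastforce
        moreover have "inv ?s \<otimes> (h \<otimes> inv f) \<otimes> g = inv ?s \<otimes> ?s"
          using h g(1) fc sc by (simp add: m_assoc del: l_inv inv_cancel_left)
        ultimately have "Re (\<omega> \<one>) < 1" using sc by simp
        then show False using indicator_hull_real(2)[OF \<phi> one_closed] by (simp add: \<omega>_def)
      qed
    qed
    then show ?thesis using g(1) unfolding good_def by blast
  qed
  define nxt where "nxt S = (SOME g. good S g)" for S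
  define gl where "gl = rec_nat [] (\<lambda>_ l. l @ [nxt (set l)])"
  have gl0: "gl 0 = []" and glS: "gl (Suc n) = gl n @ [nxt (set (gl n))]" for n by (simp_all add: gl_def)
  define \<gamma> where "\<gamma> n = nxt (set (gl n))" for n
  have seq: "set (gl n) = \<gamma> ` {..<n}" for n
    by (induction n) (auto simp: gl0 glS \<gamma>_def lessThan_Suc)
  have gc: "set (gl n) \<subseteq> carrier G \<and> good (set (gl n)) (\<gamma> n)" for n
  proof (induction n)
    case 0
    then show ?case using someI_ex[OF good_ex, of "{}"] by (simp add: gl0 \<gamma>_def nxt_def)
  next
    case (Suc n)
    have sub: "set (gl (Suc n)) \<subseteq> carrier G" using Suc by (simp add: glS \<gamma>_def good_def)
    then show ?case using someI_ex[OF good_ex[OF _ sub]] by (simp add: \<gamma>_def nxt_def)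
  qed
  show thesis
  proof (rule that[of \<gamma>])
    show "range \<gamma> \<subseteq> carrier G" using gc by (auto simp: good_def)
    fix j k :: nat assume "j < k"
    then have "\<gamma> j \<in> set (gl k)" by (simp add: seq)
    then show "Re (\<phi> (h \<otimes> (inv (\<gamma> j) \<otimes> \<gamma> k))) < d" "h \<otimes> (inv (\<gamma> j) \<otimes> \<gamma> k) \<notin> R"
      using gc[of k] by (auto simp: good_def)
  qed
qed

end

section \<open>Finite dimensional representations\<close>

lemma coord_space_ip:
  assumes "x \<in> coord_space n" shows "ip x y = (\<Sum>i<n. x i * cnj (y i))"
proof -
  have "((\<lambda>i. x i * cnj (y i)) has_sum (\<Sum>i<n. x i * cnj (y i))) UNIV"
    using assms by (intro has_sum_finite_neutralI) (auto simp: coord_space_def not_less)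
  then show ?thesis unfolding ip_def by (rule infsumI)
qed

lemma coord_space_ell2: "coord_space n \<subseteq> ell2"
proof
  fix x assume "x \<in> coord_space n"
  then have "((\<lambda>i. (cmod (x i))\<^sup>2) has_sum (\<Sum>i<n. (cmod (x i))\<^sup>2)) UNIV"
    by (intro has_sum_finite_neutralI) (auto simp: coord_space_def not_less)
  then show "x \<in> ell2" by (auto simp: ell2_def summable_on_def)
qed

lemma cmod_le_l2norm: assumes "x \<in> ell2" shows "cmod (x i) \<le> l2norm x"
proof (rule power2_le_imp_le)
  have "(\<Sum>j\<in>{i}. (cmod (x j))\<^sup>2) \<le> (\<Sum>\<^sub>\<infinity>j. (cmod (x j))\<^sup>2)"
    using assms by (intro finite_sum_le_infsum) (auto simp: ell2_def)
  then show "(cmod (x i))\<^sup>2 \<le> (l2norm x)\<^sup>2" by (simp add: l2norm_square)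
qed simp

lemma hilbert_coord_space: "hilbert (coord_space n)"
  unfolding hilbert_def
proof (intro conjI subsetI)
  show "x \<in> ell2" if "x \<in> coord_space n" for x using that coord_space_ell2 by blast
  show "cfun.subspace (coord_space n)" by (auto simp: cfun.subspace_def coord_space_def)
  fix x :: "nat \<Rightarrow> complex" assume x: "x \<in> l2_closure (coord_space n)"
  then have xe: "x \<in> ell2" using l2_closure_ell2 by blast
  have "x i = 0" if i: "n \<le> i" for i
  proof -
    have "cmod (x i) \<le> 0"
    proof (rule field_le_epsilon)
      fix e :: real assume "0 < e"
      then obtain y where y: "y \<in> coord_space n" "l2norm (x - y) < e" using l2_closureD[OF x] by blast
      have "x - y \<in> ell2" using xe y coord_space_ell2 ell2_diff by blast
      then have "cmod ((x - y) i) \<le> l2norm (x - y)" by (rule cmod_le_l2norm)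
      moreover have "y i = 0" using y i by (simp add: coord_space_def)
      ultimately show "cmod (x i) \<le> 0 + e" using y(2) by simp
    qed
    then show ?thesis by simp
  qed
  then show "x \<in> coord_space n" by (simp add: coord_space_def)
qed

definition lincomb :: "nat \<Rightarrow> (nat \<Rightarrow> 'i \<Rightarrow> complex) \<Rightarrow> (nat \<Rightarrow> complex) \<Rightarrow> 'i \<Rightarrow> complex" where
  "lincomb n e c = (\<lambda>j. \<Sum>i<n. c i * e i j)"

lemma lincomb_0: "lincomb 0 e c = 0"
  by (simp add: lincomb_def fun_eq_iff)

lemma lincomb_Suc: "lincomb (Suc n) e c = lincomb n e c + cscale (c n) (e n)"
  by (simp add: lincomb_def fun_eq_iff)

lemma lincomb_add: "lincomb n e (\<lambda>i. c i + d i) = lincomb n e c + lincomb n e d"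
  by (simp add: lincomb_def fun_eq_iff distrib_right sum.distrib)

lemma lincomb_cscale: "lincomb n e (\<lambda>i. a * c i) = cscale a (lincomb n e c)"
  by (simp add: lincomb_def fun_eq_iff sum_distrib_left mult.assoc)

lemma lincomb_mem:
  assumes "cfun.subspace S" "\<And>i. i < n \<Longrightarrow> e i \<in> S" shows "lincomb n e c \<in> S"
  using assms(2)
  by (induction n) (auto simp: lincomb_0 lincomb_Suc cfun.subspace_0[OF assms(1)]
      intro!: cfun.subspace_add[OF assms(1)] cfun.subspace_scale[OF assms(1)])

lemma ip_lincomb:
  assumes "\<And>i. i < n \<Longrightarrow> e i \<in> ell2" "y \<in> ell2"
  shows "ip (lincomb n e c) y = (\<Sum>i<n. c i * ip (e i) y)"
  using assms(1)
proof (induction n)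
  case (Suc n)
  have eq: "ip (lincomb (Suc n) e c) y = ip (lincomb n e c) y + c n * ip (e n) y"
    unfolding lincomb_Suc ip_cscale(1)[symmetric]
    using Suc(2) assms(2) by (intro ip_add(1) lincomb_mem[OF subspace_ell2] ell2_cscale) auto
  show ?case unfolding eq using Suc by simp
qed (simp add: lincomb_0)

definition orthonormal_basis ::
    "('i \<Rightarrow> complex) set \<Rightarrow> nat \<Rightarrow> (nat \<Rightarrow> 'i \<Rightarrow> complex) \<Rightarrow> bool" where
  "orthonormal_basis H n e \<longleftrightarrow> (\<forall>i<n. e i \<in> H) \<and> (\<forall>i<n. \<forall>j<n. ip (e i) (e j) = of_bool (i = j)) \<and>
     (\<forall>x\<in>H. x = lincomb n e (\<lambda>i. ip x (e i)))"

text \<open>Gram-Schmidt by induction on \<open>B\<close>. A vector that already lies in the span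
  contributes nothing, so the length of the basis is left open instead of being
  \<open>card B\<close>.\<close>

lemma orthonormal_basis_exists:
  assumes "finite B" "B \<subseteq> ell2" shows "\<exists>n e. orthonormal_basis (cfun.span B) n e"
  using assms
proof (induction B)
  case empty
  show ?case unfolding cfun.span_empty orthonormal_basis_def
    by (intro exI[of _ 0]) (auto simp only: lincomb_0 singleton_iff less_zeroE)
next
  case (insert b B)
  have b: "b \<in> ell2" and B: "B \<subseteq> ell2" using insert.prems by auto
  obtain n e where on: "orthonormal_basis (cfun.span B) n e" using insert.IH[OF B] by (elim exE)
  have sB: "cfun.span B \<subseteq> ell2" by (rule cfun.span_minimal[OF B subspace_ell2])
  have e: "e i \<in> cfun.span B" "e i \<in> ell2" if "i < n" for i
    using on that sB by (auto simp: orthonormal_basis_def)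
  have eo: "ip (e i) (e j) = of_bool (i = j)" if "i < n" "j < n" for i j
    using on that by (simp add: orthonormal_basis_def)
  have ex: "x = lincomb n e (\<lambda>i. ip x (e i))" if "x \<in> cfun.span B" for x
    using on that unfolding orthonormal_basis_def by blast
  define p where "p = lincomb n e (\<lambda>i. ip b (e i))"
  define b' where "b' = b + cscale (-1) p"
  have p: "p \<in> cfun.span B" unfolding p_def by (intro lincomb_mem[OF cfun.subspace_span] e(1))
  have pe: "p \<in> ell2" using p sB by blast
  have be: "b' \<in> ell2" unfolding b'_def by (intro ell2_add ell2_cscale b pe)
  have b_eq: "b = p + b'" by (simp add: b'_def fun_eq_iff)
  have "ip p (e j) = ip b (e j)" if j: "j < n" for j
  proof -
    have "ip p (e j) = (\<Sum>i<n. ip b (e i) * ip (e i) (e j))" unfolding p_def by (rule ip_lincomb[OF e(2) e(2)[OF j]])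
    also have "\<dots> = (\<Sum>i<n. if i = j then ip b (e i) else 0)" using eo j by (intro sum.cong) auto
    finally show ?thesis using j by (simp add: sum.delta)
  qed
  then have orth: "ip b' (e j) = 0" if "j < n" for j
    unfolding b'_def ip_add(1)[OF b ell2_cscale[OF pe] e(2)[OF that]] ip_cscale using that by simp
  have orth_span: "ip x b' = 0" if "x \<in> cfun.span B" for x
  proof -
    have "ip x b' = ip (lincomb n e (\<lambda>i. ip x (e i))) b'" using ex[OF that] by simp
    also have "\<dots> = (\<Sum>i<n. ip x (e i) * ip (e i) b')" by (rule ip_lincomb[OF e(2) be])
    also have "\<dots> = 0" using orth ip_cnj[of _ b'] by (intro sum.neutral) auto
    finally show ?thesis .
  qed
  show ?case
  proof (cases "b' = 0")
    case True
    then have "b \<in> cfun.span B" using p b_eq by simp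
    then have "cfun.span (insert b B) = cfun.span B" by (rule cfun.span_redundant)
    then show ?thesis using on by (intro exI) (simp only:)
  next
    case False
    define \<nu> where "\<nu> = l2norm b'"
    have \<nu>: "\<nu> \<noteq> 0" using False l2norm_eq_0D[OF be] by (auto simp: \<nu>_def)
    define f where "f = cscale (1 / of_real \<nu>) b'"
    define e' where "e' = e(n := f)"
    have f2: "f \<in> ell2" unfolding f_def by (rule ell2_cscale[OF be])
    have b'f: "b' = cscale (of_real \<nu>) f" using \<nu> by (simp add: f_def fun_eq_iff)
    have sub: "cfun.span B \<subseteq> cfun.span (insert b B)" by (rule cfun.span_mono) auto
    have "b' \<in> cfun.span (insert b B)"
      unfolding b'_def using p sub by (intro cfun.span_add cfun.span_scale) (auto intro: cfun.span_base)
    then have fs: "f \<in> cfun.span (insert b B)" unfolding f_def by (rule cfun.span_scale)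
    have ff: "ip f f = 1"
      using \<nu> by (simp add: f_def ip_cscale ip_self[OF be] \<nu>_def power2_eq_square)
    have fo: "ip f (e j) = 0" "ip (e j) f = 0" if "j < n" for j
      using orth[OF that] orth_span[OF e(1)[OF that]] by (simp_all add: f_def ip_cscale)
    have lin': "lincomb (Suc n) e' c = lincomb n e c + cscale (c n) f" for c
      unfolding lincomb_Suc by (simp add: e'_def lincomb_def)
    \<comment> \<open>The vectors that equal their expansion form a subspace, so the expansion has
      to be checked only on the generators.\<close>
    let ?S = "{x \<in> ell2. x = lincomb (Suc n) e' (\<lambda>i. ip x (e' i))}"
    have e'2: "e' i \<in> ell2" if "i < Suc n" for i using that e(2) f2 by (auto simp: e'_def less_Suc_eq)
    have "cfun.subspace ?S"
      unfolding cfun.subspace_def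
    proof (intro conjI ballI allI)
      show "0 \<in> ?S" by (simp add: ell2_zero lincomb_def fun_eq_iff)
      fix x assume x: "x \<in> ?S"
      show "cscale a x \<in> ?S" for a
        using x lincomb_cscale[of "Suc n" e' a "\<lambda>i. ip x (e' i)"] by (auto simp: ell2_cscale ip_cscale)
      fix y assume y: "y \<in> ?S"
      have "lincomb (Suc n) e' (\<lambda>i. ip (x + y) (e' i)) = lincomb (Suc n) e' (\<lambda>i. ip x (e' i) + ip y (e' i))"
        unfolding lincomb_def using x y e'2 by (intro ext sum.cong refl) (simp add: ip_add)
      also have "\<dots> = x + y"
      proof -
        have "lincomb (Suc n) e' (\<lambda>i. ip z (e' i)) = z" if "z \<in> ?S" for z
          using that by (elim CollectE conjE) (rule sym)
        from this[OF x] this[OF y] show ?thesis unfolding lincomb_add by (simp only:)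
      qed
      finally show "x + y \<in> ?S" using x y by (auto simp: ell2_add)
    qed
    moreover have "insert b B \<subseteq> ?S"
    proof -
      have in_span: "x \<in> ?S" if x: "x \<in> cfun.span B" for x
      proof -
        have "ip x f = 0" using orth_span[OF x] by (simp add: f_def ip_cscale)
        then have "lincomb (Suc n) e' (\<lambda>i. ip x (e' i)) = lincomb n e (\<lambda>i. ip x (e' i))"
          unfolding lin' by (simp add: e'_def fun_eq_iff)
        also have "\<dots> = lincomb n e (\<lambda>i. ip x (e i))" by (simp add: lincomb_def e'_def)
        finally show ?thesis using ex[OF x] x sB by auto
      qed
      have "b' \<in> ?S"
      proof -
        have "ip b' f = of_real \<nu>" unfolding b'f ip_cscale ff by simp
        then have "lincomb (Suc n) e' (\<lambda>i. ip b' (e' i)) = lincomb n e (\<lambda>i. ip b' (e' i)) + b'"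
          unfolding lin' b'f[symmetric] using b'f by (simp add: e'_def)
        also have "lincomb n e (\<lambda>i. ip b' (e' i)) = 0" using orth by (simp add: lincomb_def e'_def fun_eq_iff)
        finally show ?thesis using be by simp
      qed
      then have "b \<in> ?S"
        using in_span[OF p] cfun.subspace_add[OF \<open>cfun.subspace ?S\<close>] unfolding b_eq by blast
      then show ?thesis using in_span cfun.span_base by blast
    qed
    ultimately have span_S: "cfun.span (insert b B) \<subseteq> ?S" by (rule cfun.span_minimal[rotated])
    have "orthonormal_basis (cfun.span (insert b B)) (Suc n) e'"
      unfolding orthonormal_basis_def
    proof (intro conjI allI impI ballI)
      show "e' i \<in> cfun.span (insert b B)" if "i < Suc n" for i
        using that e(1) sub fs by (auto simp: e'_def less_Suc_eq)
      show "ip (e' i) (e' j) = of_bool (i = j)" if "i < Suc n" "j < Suc n" for i j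
        using that eo fo ff by (auto simp: e'_def less_Suc_eq)
      show "x = lincomb (Suc n) e' (\<lambda>i. ip x (e' i))" if "x \<in> cfun.span (insert b B)" for x
        using span_S that by blast
    qed
    then show ?thesis by blast
  qed
qed

text \<open>Representation classes are counted only on the model spaces
  \<open>coord_space n\<close>; coordinates in an orthonormal basis carry a finite dimensional GNS
  space there.\<close>

lemma finite_dim_coordinates:
  assumes "finite_dim H" "H \<subseteq> ell2"
  obtains n U where "unitary_between H (coord_space n) U"
proof -
  obtain B where B: "finite B" "H = cfun.span B" using assms(1) by (auto simp: finite_dim_def)
  have "B \<subseteq> ell2" using B assms(2) cfun.span_superset by blast
  then obtain n e where "orthonormal_basis H n e" using orthonormal_basis_exists[OF B(1)] B(2) by blast
  then have e: "\<And>i. i < n \<Longrightarrow> e i \<in> H" and eo: "\<And>i j. i < n \<Longrightarrow> j < n \<Longrightarrow> ip (e i) (e j) = of_bool (i = j)"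
    and ex: "\<And>x. x \<in> H \<Longrightarrow> x = lincomb n e (\<lambda>i. ip x (e i))"
    unfolding orthonormal_basis_def by blast+
  have e2: "e i \<in> ell2" if "i < n" for i using e[OF that] assms(2) by blast
  define U where "U x = (\<lambda>i. if i < n then ip x (e i) else 0)" for x
  have Uc: "U x \<in> coord_space n" for x by (simp add: U_def coord_space_def)
  have ipU: "ip (U x) (U y) = ip x y" if "x \<in> H" "y \<in> H" for x y
  proof -
    have "ip x y = ip (lincomb n e (\<lambda>i. ip x (e i))) y" using ex[OF that(1)] by simp
    also have "\<dots> = (\<Sum>i<n. ip x (e i) * ip (e i) y)"
      by (rule ip_lincomb[OF e2]) (use that(2) assms(2) in auto)
    also have "\<dots> = (\<Sum>i<n. U x i * cnj (U y i))"
      using ip_cnj[of _ y] by (intro sum.cong) (auto simp: U_def)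
    finally show ?thesis using coord_space_ip[OF Uc] by simp
  qed
  have lin: "linear_between H (coord_space n) U"
    using Uc assms(2) e2 unfolding linear_between_def
    by (auto simp: U_def fun_eq_iff ip_add ip_cscale subset_iff)
  have inj: "inj_on U H"
  proof (rule inj_onI)
    fix x y assume *: "x \<in> H" "y \<in> H" "U x = U y"
    have "lincomb n e (\<lambda>i. ip x (e i)) = lincomb n e (\<lambda>i. ip y (e i))"
      unfolding lincomb_def
    proof (intro ext sum.cong refl)
      fix j i assume "i \<in> {..<n}"
      then have "ip x (e i) = ip y (e i)" using fun_cong[OF *(3), of i] by (simp add: U_def)
      then show "ip x (e i) * e i j = ip y (e i) * e i j" by simp
    qed
    then show "x = y" using ex[OF *(1)] ex[OF *(2)] by simp
  qed
  have surj: "U ` H = coord_space n"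
  proof
    show "U ` H \<subseteq> coord_space n" using Uc by blast
    show "coord_space n \<subseteq> U ` H"
    proof
      fix c assume c: "c \<in> coord_space n"
      have mem: "lincomb n e c \<in> H" unfolding B(2) by (rule lincomb_mem[OF cfun.subspace_span]) (use e B(2) in blast)
      have "U (lincomb n e c) = c"
      proof
        fix j show "U (lincomb n e c) j = c j"
        proof (cases "j < n")
          case True
          have "ip (lincomb n e c) (e j) = (\<Sum>i<n. c i * ip (e i) (e j))" by (rule ip_lincomb[OF e2 e2[OF True]])
          also have "\<dots> = (\<Sum>i<n. if i = j then c i else 0)" using eo True by (intro sum.cong) auto
          finally show ?thesis using True by (simp add: U_def sum.delta)
        qed (use c in \<open>simp add: U_def coord_space_def\<close>)
      qed
      then show "c \<in> U ` H" using mem by force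
    qed
  qed
  have "unitary_between H (coord_space n) U"
    unfolding unitary_between_def bij_betw_def using lin inj surj ipU by blast
  then show thesis by (rule that)
qed

lemma unitary_between_inv:
  assumes H: "cfun.subspace H" and un: "unitary_between H K U"
  shows "unitary_between K H (inv_into H U)" "x \<in> H \<Longrightarrow> inv_into H U (U x) = x"
    "y \<in> K \<Longrightarrow> U (inv_into H U y) = y" "y \<in> K \<Longrightarrow> inv_into H U y \<in> H"
proof -
  let ?V = "inv_into H U"
  have U: "bij_betw U H K" "\<And>x y. x \<in> H \<Longrightarrow> y \<in> H \<Longrightarrow> ip (U x) (U y) = ip x y"
    "\<And>x y. x \<in> H \<Longrightarrow> y \<in> H \<Longrightarrow> U (x + y) = U x + U y" "\<And>x c. x \<in> H \<Longrightarrow> U (cscale c x) = cscale c (U x)"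
    using un by (auto simp: unitary_between_def linear_between_def)
  show VU: "?V (U x) = x" if "x \<in> H" for x using bij_betw_inv_into_left[OF U(1) that] .
  show UV: "U (?V y) = y" if "y \<in> K" for y using bij_betw_inv_into_right[OF U(1) that] .
  have bV: "bij_betw ?V K H" by (rule bij_betw_inv_into[OF U(1)])
  show Vm: "?V y \<in> H" if "y \<in> K" for y using bV that by (auto simp: bij_betw_def)
  have "ip (?V x) (?V y) = ip x y" if "x \<in> K" "y \<in> K" for x y
    using U(2)[OF Vm[OF that(1)] Vm[OF that(2)]] UV that by simp
  moreover have "?V (x + y) = ?V x + ?V y" if "x \<in> K" "y \<in> K" for x y
    using VU[OF cfun.subspace_add[OF H Vm[OF that(1)] Vm[OF that(2)]]]
      U(3)[OF Vm[OF that(1)] Vm[OF that(2)]] UV that by simp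
  moreover have "?V (cscale c x) = cscale c (?V x)" if "x \<in> K" for x c
    using VU[OF cfun.subspace_scale[OF H Vm[OF that], of c]] U(4)[OF Vm[OF that]] UV that by simp
  ultimately show "unitary_between K H ?V"
    using bV Vm unfolding unitary_between_def linear_between_def by blast
qed

context group
begin

lemma transport_rep:
  assumes rep: "unitary_rep G H \<pi>" and un: "unitary_between H K U" and K: "hilbert K" and \<xi>: "\<xi> \<in> H"
  defines "\<rho> \<equiv> \<lambda>g. \<lambda>y\<in>K. U (\<pi> g (inv_into H U y))"
  shows "unitary_rep G K \<rho>" "U \<xi> \<in> K" "g \<in> carrier G \<Longrightarrow> ip (\<rho> g (U \<xi>)) (U \<xi>) = ip (\<pi> g \<xi>) \<xi>"
proof -
  note R = unitary_repD[OF rep]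
  note V = unitary_between_inv[OF hilbertD(2)[OF R(1)] un]
  let ?V = "inv_into H U"
  have U: "bij_betw U H K" "\<And>x y. x \<in> H \<Longrightarrow> y \<in> H \<Longrightarrow> ip (U x) (U y) = ip x y"
    "\<And>x y. x \<in> H \<Longrightarrow> y \<in> H \<Longrightarrow> U (x + y) = U x + U y" "\<And>x c. x \<in> H \<Longrightarrow> U (cscale c x) = cscale c (U x)"
    "\<And>x. x \<in> H \<Longrightarrow> U x \<in> K"
    using un by (auto simp: unitary_between_def linear_between_def)
  have Vl: "\<And>x y. x \<in> K \<Longrightarrow> y \<in> K \<Longrightarrow> ip (?V x) (?V y) = ip x y"
    "\<And>x y. x \<in> K \<Longrightarrow> y \<in> K \<Longrightarrow> ?V (x + y) = ?V x + ?V y" "\<And>x c. x \<in> K \<Longrightarrow> ?V (cscale c x) = cscale c (?V x)"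
    "bij_betw ?V K H"
    using V(1) by (auto simp: unitary_between_def linear_between_def)
  note K' = hilbertD[OF K]
  note I = isometry_onD[OF R(2)]
  have \<rho>K: "\<rho> g y = U (\<pi> g (?V y))" if "y \<in> K" for g y using that by (simp add: \<rho>_def)
  have \<rho>m: "\<rho> g y \<in> K" if "g \<in> carrier G" "y \<in> K" for g y using that U(5) R(6) V(4) by (simp add: \<rho>K)
  show "unitary_rep G K \<rho>"
    unfolding unitary_rep_def
  proof (intro conjI ballI K)
    fix g assume g: "g \<in> carrier G"
    show "\<rho> g \<in> extensional K" by (simp add: \<rho>_def)
    have "bij_betw (\<pi> g) H H" using rep g by (simp add: unitary_rep_def unitary_between_def)
    then have "bij_betw (U \<circ> (\<pi> g \<circ> ?V)) K K"
      using Vl(4) U(1) by (intro bij_betw_trans[of _ K H] bij_betw_trans[of _ K H])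
    then have bij: "bij_betw (\<rho> g) K K"
      by (subst bij_betw_cong[of K _ "U \<circ> (\<pi> g \<circ> ?V)"]) (simp_all add: \<rho>K)
    have ipr: "ip (\<rho> g x) (\<rho> g y) = ip x y" if "x \<in> K" "y \<in> K" for x y
      using that g by (simp add: \<rho>K U(2) R(6) V(4) R(3) Vl(1))
    have lin: "linear_between K K (\<rho> g)"
      unfolding linear_between_def
    proof (intro conjI allI ballI)
      show "\<rho> g ` K \<subseteq> K" using \<rho>m[OF g] by blast
      fix x assume x: "x \<in> K"
      show "\<rho> g (cscale c x) = cscale c (\<rho> g x)" for c
        using x g cfun.subspace_scale[OF K'(2) x, of c] by (simp add: \<rho>K Vl(3) I(3) V(4) U(4) R(6))
      show "\<rho> g (x + y) = \<rho> g x + \<rho> g y" if y: "y \<in> K" for y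
        using x y g cfun.subspace_add[OF K'(2) x y] by (simp add: \<rho>K Vl(2) I(2) V(4) U(3) R(6))
    qed
    show "unitary_between K K (\<rho> g)" unfolding unitary_between_def using lin bij ipr by blast
    fix h assume h: "h \<in> carrier G"
    show "\<rho> (g \<otimes> h) = compose K (\<rho> g) (\<rho> h)"
    proof (rule extensionalityI)
      show "\<rho> (g \<otimes> h) \<in> extensional K" "compose K (\<rho> g) (\<rho> h) \<in> extensional K" by (simp_all add: \<rho>_def)
      fix y assume y: "y \<in> K"
      have "\<rho> g (\<rho> h y) = U (\<pi> g (?V (U (\<pi> h (?V y)))))" using \<rho>m[OF h y] y by (simp add: \<rho>K)
      also have "\<dots> = U (\<pi> (g \<otimes> h) (?V y))" using V(2,4) R(4,6) g h y by simp
      finally show "\<rho> (g \<otimes> h) y = compose K (\<rho> g) (\<rho> h) y" using y by (simp add: compose_def \<rho>K)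
    qed
  qed
  show "U \<xi> \<in> K" by (rule U(5)[OF \<xi>])
  show "ip (\<rho> g (U \<xi>)) (U \<xi>) = ip (\<pi> g \<xi>) \<xi>" if "g \<in> carrier G"
    using that \<xi> by (simp add: \<rho>K U(5) V(2) U(2) R(6))
qed

lemma finite_character_coefficient:
  assumes "finite_character G \<psi>"
  obtains n \<rho> v where "unitary_rep G (coord_space n) \<rho>" "v \<in> coord_space n"
    "\<forall>g\<in>carrier G. \<psi> g = ip (\<rho> g v) v"
proof -
  obtain H \<pi> \<xi> where gns: "gns_triple G \<psi> H \<pi> \<xi>" and fin: "finite_dim H"
    using assms by (auto simp: finite_character_def)
  have rep: "unitary_rep G H \<pi>" and \<xi>: "\<xi> \<in> H" and coef: "\<And>g. g \<in> carrier G \<Longrightarrow> \<psi> g = ip (\<pi> g \<xi>) \<xi>"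
    using gns by (auto simp: gns_triple_def)
  have "H \<subseteq> ell2" using hilbertD(1)[OF unitary_repD(1)[OF rep]] .
  then obtain n U where U: "unitary_between H (coord_space n) U" using finite_dim_coordinates[OF fin] by blast
  note T = transport_rep[OF rep U hilbert_coord_space \<xi>]
  show thesis by (rule that[OF T(1,2)], intro ballI, simp only: coef, rule T(3)[symmetric])
qed

lemma unitarily_equivalent_coefficient:
  assumes eq: "unitarily_equivalent G H \<pi> K \<rho>" and rep: "unitary_rep G H \<pi>" and v: "v \<in> H"
  obtains w where "w \<in> K" "\<And>g. g \<in> carrier G \<Longrightarrow> ip (\<rho> g w) w = ip (\<pi> g v) v"
proof -
  obtain U where U: "unitary_between H K U" "\<forall>g\<in>carrier G. \<forall>x\<in>H. U (\<pi> g x) = \<rho> g (U x)"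
    using eq by (auto simp: unitarily_equivalent_def)
  have "U v \<in> K" using U(1) v by (auto simp: unitary_between_def linear_between_def)
  moreover have "ip (\<rho> g (U v)) (U v) = ip (\<pi> g v) v" if "g \<in> carrier G" for g
  proof -
    have "ip (\<rho> g (U v)) (U v) = ip (U (\<pi> g v)) (U v)" using U(2) that v by simp
    then show ?thesis using U(1) v unitary_repD(6)[OF rep that v] by (simp add: unitary_between_def)
  qed
  ultimately show thesis using that by blast
qed

lemma unitarily_equivalent_refl: "unitarily_equivalent G H \<pi> H \<pi>"
  unfolding unitarily_equivalent_def
  by (intro exI[of _ "\<lambda>x. x"]) (auto simp: unitary_between_def linear_between_def bij_betw_def inj_on_def)

text \<open>One representation per class leaves countably many. The intertwining unitary carries the
  vector along, so a finite character is a coefficient of the chosen representative as well.\<close>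

lemma countable_representatives:
  assumes fin: "\<And>n. finite ({\<pi>. unitary_rep G (coord_space n) \<pi>} // rep_equiv G n)"
  obtains C :: "(nat \<times> ('a \<Rightarrow> nat operator)) set" where "countable C"
    "\<And>n \<rho>. (n, \<rho>) \<in> C \<Longrightarrow> unitary_rep G (coord_space n) \<rho>"
    "\<And>\<psi>. finite_character G \<psi> \<Longrightarrow> \<exists>n \<rho> v. (n, \<rho>) \<in> C \<and> v \<in> coord_space n \<and> (\<forall>g\<in>carrier G. \<psi> g = ip (\<rho> g v) v)"
proof -
  let ?A = "\<lambda>n. {\<pi>. unitary_rep G (coord_space n) \<pi>}"
  define C where "C = (\<lambda>(n, c). (n, SOME \<rho>. \<rho> \<in> c)) ` (SIGMA n:UNIV. ?A n // rep_equiv G n)"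
  have cls: "(SOME \<rho>. \<rho> \<in> rep_equiv G n `` {\<pi>}) \<in> rep_equiv G n `` {\<pi>}" if "unitary_rep G (coord_space n) \<pi>" for n \<pi>
  proof (rule someI[of "\<lambda>\<rho>. \<rho> \<in> rep_equiv G n `` {\<pi>}"])
    show "\<pi> \<in> rep_equiv G n `` {\<pi>}" using that unitarily_equivalent_refl by (auto simp: rep_equiv_def)
  qed
  show thesis
  proof (rule that[of C])
    have "countable (SIGMA n:UNIV. ?A n // rep_equiv G n)"
      by (intro countable_SIGMA countable_finite fin countableI_type)
    then show "countable C" unfolding C_def by (rule countable_image)
    show "unitary_rep G (coord_space n) \<rho>" if nC: "(n, \<rho>) \<in> C" for n \<rho>
    proof -
      obtain c where c: "c \<in> ?A n // rep_equiv G n" "\<rho> = (SOME \<rho>. \<rho> \<in> c)"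
        using nC unfolding C_def by auto
      obtain \<pi> where "\<pi> \<in> ?A n" "c = rep_equiv G n `` {\<pi>}" using c(1) by (rule quotientE)
      then have "unitary_rep G (coord_space n) \<pi>" "\<rho> = (SOME \<rho>. \<rho> \<in> rep_equiv G n `` {\<pi>})"
        using c(2) by simp_all
      then show ?thesis using cls[of n \<pi>] by (auto simp: rep_equiv_def)
    qed
    fix \<psi> assume "finite_character G \<psi>"
    then obtain n \<pi> v where \<pi>: "unitary_rep G (coord_space n) \<pi>" "v \<in> coord_space n"
      "\<forall>g\<in>carrier G. \<psi> g = ip (\<pi> g v) v" by (rule finite_character_coefficient)
    let ?\<rho> = "SOME \<rho>. \<rho> \<in> rep_equiv G n `` {\<pi>}"
    have "(n, ?\<rho>) \<in> C" unfolding C_def using \<pi>(1)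
      by (intro image_eqI[of _ _ "(n, rep_equiv G n `` {\<pi>})"]) (auto simp: quotientI)
    moreover have "unitarily_equivalent G (coord_space n) \<pi> (coord_space n) ?\<rho>"
      using cls[OF \<pi>(1)] by (auto simp: rep_equiv_def)
    then obtain w where "w \<in> coord_space n" "\<And>g. g \<in> carrier G \<Longrightarrow> ip (?\<rho> g w) w = ip (\<pi> g v) v"
      using unitarily_equivalent_coefficient[OF _ \<pi>(1,2)] by blast
    ultimately show "\<exists>n \<rho> v. (n, \<rho>) \<in> C \<and> v \<in> coord_space n \<and> (\<forall>g\<in>carrier G. \<psi> g = ip (\<rho> g v) v)"
      using \<pi>(3) by metis
  qed
qed

definition unit_vec :: "nat \<Rightarrow> nat \<Rightarrow> complex" where
  "unit_vec b = (\<lambda>i. of_bool (i = b))"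

lemma coord_space_expansion:
  assumes "w \<in> coord_space n" shows "w = lincomb n unit_vec w"
proof
  fix j
  have "lincomb n unit_vec w j = (\<Sum>i<n. if i = j then w i else 0)"
    unfolding lincomb_def unit_vec_def by (intro sum.cong) auto
  then show "w j = lincomb n unit_vec w j"
    using assms by (auto simp: sum.delta coord_space_def)
qed

lemma rep_lincomb:
  assumes rep: "unitary_rep G (coord_space n) \<rho>" and g: "g \<in> carrier G" and m: "m \<le> n"
  shows "\<rho> g (lincomb m unit_vec c) = lincomb m (\<lambda>b. \<rho> g (unit_vec b)) c"
  using m
proof (induction m)
  case 0
  have "(0 :: nat \<Rightarrow> complex) \<in> coord_space n" by (simp add: coord_space_def)
  from isometry_onD(3)[OF unitary_repD(2)[OF rep g] this, of 0]
  show ?case unfolding lincomb_0 by (metis cfun.scale_zero_left)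
next
  case (Suc m)
  note I = isometry_onD[OF unitary_repD(2)[OF rep g]]
  have sub: "cfun.subspace (coord_space n)" using hilbertD(2)[OF hilbert_coord_space] .
  have u: "unit_vec b \<in> coord_space n" if "b < n" for b using that by (auto simp: unit_vec_def coord_space_def)
  have 1: "lincomb m unit_vec c \<in> coord_space n" using Suc by (intro lincomb_mem[OF sub] u) auto
  have 2: "unit_vec m \<in> coord_space n" using Suc u by auto
  have 3: "cscale (c m) (unit_vec m) \<in> coord_space n" by (rule cfun.subspace_scale[OF sub 2])
  have "\<rho> g (lincomb m unit_vec c) = lincomb m (\<lambda>b. \<rho> g (unit_vec b)) c" using Suc by simp
  then show ?case unfolding lincomb_Suc I(2)[OF 1 3] I(3)[OF 2] by (simp only:)
qed

text \<open>Matrix entries of unitaries lie in the unit disc, so sequential compactness of a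
  countable product of discs gives one subsequence for all representatives. Arbitrary vectors follow
  by linearity.\<close>

lemma convergent_coefficients:
  assumes C: "countable C" "\<And>n \<rho>. (n, \<rho>) \<in> C \<Longrightarrow> unitary_rep G (coord_space n) \<rho>"
    and \<gamma>: "range \<gamma> \<subseteq> carrier G"
  obtains r :: "nat \<Rightarrow> nat" where "strict_mono r"
    "\<And>n \<rho> w a. (n, \<rho>) \<in> C \<Longrightarrow> w \<in> coord_space n \<Longrightarrow> convergent (\<lambda>m. \<rho> (\<gamma> (r m)) w a)"
proof -
  define J where "J = (SIGMA p:C. {..<fst p} \<times> (UNIV :: nat set))"
  have cJ: "countable J" unfolding J_def by (intro countable_SIGMA C(1) countableI_type)
  \<comment> \<open>An enumeration of an empty \<open>J\<close> returns elements outside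
    \<open>J\<close>; the default 0 keeps all coordinates in the unit disc.\<close>
  define t where "t m i = (let ((n, \<rho>), b, a) = from_nat_into J i in
      if from_nat_into J i \<in> J then \<rho> (\<gamma> m) (unit_vec b) a else 0)" for m i
  have "cmod (t m i) \<le> 1" for m i
  proof -
    obtain n \<rho> b a where i: "from_nat_into J i = ((n, \<rho>), b, a)" by (metis prod.exhaust)
    show ?thesis
    proof (cases "((n, \<rho>), b, a) \<in> J")
      case True
      then have m: "(n, \<rho>) \<in> C" "b < n" by (auto simp: J_def)
      have g: "\<gamma> m \<in> carrier G" using \<gamma> by blast
      note R = unitary_repD[OF C(2)[OF m(1)]]
      have u: "unit_vec b \<in> coord_space n" using m(2) by (auto simp: unit_vec_def coord_space_def)
      have "cmod (\<rho> (\<gamma> m) (unit_vec b) a) \<le> l2norm (\<rho> (\<gamma> m) (unit_vec b))"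
        using R(6)[OF g u] coord_space_ell2 by (intro cmod_le_l2norm) blast
      also have "\<dots> = l2norm (unit_vec b)" by (rule isometry_onD(4)[OF R(2)[OF g] u])
      also have "\<dots> = 1"
      proof -
        have "(l2norm (unit_vec b))\<^sup>2 = Re (\<Sum>i<n. unit_vec b i * cnj (unit_vec b i))"
          using u coord_space_ell2 coord_space_ip[OF u, of "unit_vec b"] by (simp add: Re_ip_self[symmetric] subset_iff)
        also have "(\<Sum>i<n. unit_vec b i * cnj (unit_vec b i)) = (\<Sum>i<n. if i = b then 1 else 0)"
          by (intro sum.cong) (auto simp: unit_vec_def)
        finally have "(l2norm (unit_vec b))\<^sup>2 = 1" using m(2) by (simp add: sum.delta)
        then show ?thesis using l2norm_nonneg[of "unit_vec b"] by (simp add: power2_eq_1_iff)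
      qed
      finally show ?thesis using True by (simp add: t_def i)
    qed (simp add: t_def i)
  qed
  then have tK: "\<forall>m. t m \<in> {f. \<forall>i. f i \<in> cball 0 1}" by simp
  have "compact {f :: nat \<Rightarrow> complex. \<forall>i. f i \<in> cball 0 1}" by (rule compact_Pi_sets) auto
  then have "seq_compact {f :: nat \<Rightarrow> complex. \<forall>i. f i \<in> cball 0 1}" by (rule compact_imp_seq_compact)
  then obtain l r where r: "strict_mono (r :: nat \<Rightarrow> nat)" "(t \<circ> r) \<longlonglongrightarrow> l"
    using seq_compactE[OF _ tK] by metis
  have tl: "(\<lambda>m. t (r m) i) \<longlonglongrightarrow> l i" for i
    using continuous_on_tendsto_compose[OF continuous_on_eval[of UNIV i] r(2)] by (simp add: o_def)
  have unit_conv: "convergent (\<lambda>m. \<rho> (\<gamma> (r m)) (unit_vec b) a)" if "(n, \<rho>) \<in> C" "b < n" for n \<rho> b a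
  proof -
    have J: "((n, \<rho>), b, a) \<in> J" using that by (auto simp: J_def)
    then obtain i where i: "from_nat_into J i = ((n, \<rho>), b, a)" using from_nat_into_surj[OF cJ] by blast
    have "(\<lambda>m. t (r m) i) = (\<lambda>m. \<rho> (\<gamma> (r m)) (unit_vec b) a)" using J by (simp add: t_def i)
    then show ?thesis using tl[of i] unfolding convergent_def by metis
  qed
  show thesis
  proof (rule that[OF r(1)])
    fix n \<rho> w a assume C': "(n, \<rho>) \<in> C" and w: "w \<in> coord_space n"
    have "\<rho> (\<gamma> (r m)) w a = (\<Sum>b<n. w b * \<rho> (\<gamma> (r m)) (unit_vec b) a)" for m
    proof -
      have g: "\<gamma> (r m) \<in> carrier G" using \<gamma> by blast
      have "\<rho> (\<gamma> (r m)) w = \<rho> (\<gamma> (r m)) (lincomb n unit_vec w)" using coord_space_expansion[OF w] by simp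
      also have "\<dots> = lincomb n (\<lambda>b. \<rho> (\<gamma> (r m)) (unit_vec b)) w" by (rule rep_lincomb[OF C(2)[OF C'] g order_refl])
      finally show ?thesis by (simp add: lincomb_def)
    qed
    moreover have "convergent (\<lambda>m. \<Sum>b<n. w b * \<rho> (\<gamma> (r m)) (unit_vec b) a)"
    proof (rule convergent_sum)
      fix b assume "b \<in> {..<n}"
      then show "convergent (\<lambda>m. w b * \<rho> (\<gamma> (r m)) (unit_vec b) a)"
        using unit_conv[OF C', of b a] by (auto simp: convergent_def intro: tendsto_mult_left)
    qed
    ultimately show "convergent (\<lambda>m. \<rho> (\<gamma> (r m)) w a)" by simp
  qed
qed

text \<open>Both factors of \<open>inv (\<gamma> m) \<otimes> \<gamma> (m + 1)\<close> have the same limit in the compact group of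
  unitary matrices.\<close>

lemma coefficient_limit:
  assumes rep: "unitary_rep G (coord_space n) \<rho>" and v: "v \<in> coord_space n" and h: "h \<in> carrier G"
    and \<gamma>: "range \<gamma> \<subseteq> carrier G"
    and conv: "\<And>w a. w \<in> coord_space n \<Longrightarrow> convergent (\<lambda>m. \<rho> (\<gamma> m) w a)"
  shows "(\<lambda>m. ip (\<rho> (h \<otimes> (inv (\<gamma> m) \<otimes> \<gamma> (Suc m))) v) v) \<longlonglongrightarrow> ip (\<rho> h v) v"
proof -
  note R = unitary_repD[OF rep]
  define u where "u = \<rho> (inv h) v"
  have u: "u \<in> coord_space n" unfolding u_def using R(6) h v by simp
  have g: "\<gamma> m \<in> carrier G" for m using \<gamma> by blast
  have eq: "ip (\<rho> (h \<otimes> (inv (\<gamma> m) \<otimes> \<gamma> k)) v) v = (\<Sum>a<n. \<rho> (\<gamma> k) v a * cnj (\<rho> (\<gamma> m) u a))" for m k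
  proof -
    have "ip (\<rho> (\<gamma> k) v) (\<rho> (\<gamma> m) u) = ip (\<rho> (\<gamma> k) v) (\<rho> (\<gamma> m \<otimes> inv h) v)"
      unfolding u_def using R(4)[OF g inv_closed[OF h] v] by simp
    also have "\<dots> = ip (\<rho> (inv (\<gamma> m \<otimes> inv h) \<otimes> \<gamma> k) v) v"
      by (rule unitary_rep_coefficient[OF rep _ _ v]) (use g h in auto)
    also have "inv (\<gamma> m \<otimes> inv h) \<otimes> \<gamma> k = h \<otimes> (inv (\<gamma> m) \<otimes> \<gamma> k)"
      using g h by (simp add: inv_mult_group m_assoc)
    finally show ?thesis using coord_space_ip[OF R(6)[OF g v]] by simp
  qed
  obtain L where L: "\<And>a. (\<lambda>m. \<rho> (\<gamma> m) v a) \<longlonglongrightarrow> L a" using conv[OF v] unfolding convergent_def by metis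
  obtain M where M: "\<And>a. (\<lambda>m. \<rho> (\<gamma> m) u a) \<longlonglongrightarrow> M a" using conv[OF u] unfolding convergent_def by metis
  have lim: "(\<lambda>m. \<Sum>a<n. \<rho> (\<gamma> (f m)) v a * cnj (\<rho> (\<gamma> m) u a)) \<longlonglongrightarrow> (\<Sum>a<n. L a * cnj (M a))"
    if "filterlim f sequentially sequentially" for f
    by (intro tendsto_sum tendsto_mult tendsto_cnj M filterlim_compose[OF L that])
  \<comment> \<open>For equal indices the sequence is constant, which identifies the common
    limit.\<close>
  have "(\<lambda>m. ip (\<rho> (h \<otimes> (inv (\<gamma> m) \<otimes> \<gamma> m)) v) v) \<longlonglongrightarrow> (\<Sum>a<n. L a * cnj (M a))"
    unfolding eq by (rule lim) (rule filterlim_ident)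
  then have "(\<lambda>m::nat. ip (\<rho> h v) v) \<longlonglongrightarrow> (\<Sum>a<n. L a * cnj (M a))"
    using g h by simp
  then have "(\<Sum>a<n. L a * cnj (M a)) = ip (\<rho> h v) v" using LIMSEQ_unique tendsto_const by blast
  then show ?thesis unfolding eq using lim[OF filterlim_Suc] by simp
qed

end

section \<open>Uniformly recurrent subgroups of charmenable groups\<close>

context group
begin

text \<open>By Bauer's maximum principle the extremal characters form a boundary in the sense of
  Simons' inequality.\<close>

lemma characters_bdry:
  assumes "countable (carrier G)" "characters G \<noteq> {}"
    "continuous_on (characters G) f" "affine_fun_on (characters G) f"
  shows "\<exists>e\<in>{\<psi>. extremal_character G \<psi>}. \<forall>x\<in>characters G. f x \<le> f e"
proof -
  have "characters G \<subseteq> PD1 G" by (auto simp: characters_def)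
  from PD1_extreme_point_maximizing[OF assms(1) this compact_closed_characters assms(2-4)]
  show ?thesis by (auto simp: extremal_character_def)
qed

lemma charfinite_URS_finite:
  assumes cc: "countable (carrier G)" and cf: "charfinite G" and X: "URS G X"
    and \<phi>: "\<phi> \<in> indicator_hull X" "\<phi> \<in> characters G"
    and h: "h \<in> carrier G" "h \<notin> amenable_radical G" "\<phi> h \<noteq> 0"
  shows "finite X"
proof (rule ccontr)
  assume inf: "infinite X"
  let ?R = "amenable_radical G"
  define d where "d = Re (\<phi> h)"
  have d: "0 < d" using indicator_hull_real[OF \<phi>(1) h(1)] h(3) by (auto simp: d_def complex_eq_iff)
  have R: "finite ?R" and reps: "\<And>n. finite ({\<pi>. unitary_rep G (coord_space n) \<pi>} // rep_equiv G n)"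
    and fin: "\<And>\<phi>. extremal_character G \<phi> \<Longrightarrow> amenable_character G \<phi> \<Longrightarrow> finite_character G \<phi>"
    and dich: "\<And>\<phi>. extremal_character G \<phi> \<Longrightarrow> supported_on G \<phi> ?R \<or> vN_amenable_character G \<phi>"
    using cf unfolding charfinite_def charmenable_def by blast+
  obtain \<gamma> :: "nat \<Rightarrow> 'a" where \<gamma>: "range \<gamma> \<subseteq> carrier G"
    "\<And>j k. j < k \<Longrightarrow> Re (\<phi> (h \<otimes> (inv (\<gamma> j) \<otimes> \<gamma> k))) < d / 2"
    "\<And>j k. j < k \<Longrightarrow> h \<otimes> (inv (\<gamma> j) \<otimes> \<gamma> k) \<notin> ?R"
    using separating_sequence[OF X inf \<phi>(1) R h(1), of "d / 2"] d by auto
  obtain C where C: "countable C" "\<And>n \<rho>. (n, \<rho>) \<in> C \<Longrightarrow> unitary_rep G (coord_space n) \<rho>"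
    "\<And>\<psi>. finite_character G \<psi> \<Longrightarrow> \<exists>n \<rho> v. (n, \<rho>) \<in> C \<and> v \<in> coord_space n \<and> (\<forall>g\<in>carrier G. \<psi> g = ip (\<rho> g v) v)"
    using countable_representatives[OF reps] by blast
  obtain r :: "nat \<Rightarrow> nat" where r: "strict_mono r"
    "\<And>n \<rho> w a. (n, \<rho>) \<in> C \<Longrightarrow> w \<in> coord_space n \<Longrightarrow> convergent (\<lambda>m. \<rho> (\<gamma> (r m)) w a)"
    using convergent_coefficients[OF C(1,2) \<gamma>(1)] by blast
  \<comment> \<open>Consecutive terms of the convergent subsequence are compared; their indices are
    strictly increasing, as the bounds on \<open>\<gamma>\<close> require.\<close>
  define x where "x m = h \<otimes> (inv (\<gamma> (r m)) \<otimes> \<gamma> (r (Suc m)))" for m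
  have gc: "\<gamma> m \<in> carrier G" for m using \<gamma>(1) by blast
  have xc: "x m \<in> carrier G" for m using gc h(1) by (simp add: x_def)
  have rS: "r m < r (Suc m)" for m using r(1) by (simp add: strict_mono_def)
  define f where "f m \<psi> = Re (lsum \<psi> [(1, h), (-1, x m)])" for m and \<psi> :: "'a \<Rightarrow> complex"
  have f: "f m \<psi> = Re (\<psi> h) - Re (\<psi> (x m))" for m \<psi> by (simp add: f_def)
  have "\<exists>e\<in>{\<psi>. extremal_character G \<psi>}. \<forall>m. \<exists>k\<ge>m. (d / 2) / 4 < f k e"
  proof (rule simons[OF compact_closed_characters(1), where C = 2])
    show "{\<psi>. extremal_character G \<psi>} \<subseteq> characters G" by (auto simp: extremal_character_def extreme_point_of_def)
    show "continuous_on (characters G) (f n)" for n unfolding f_def by (rule continuous_on_Re_lsum)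
    show "affine_fun_on (characters G) (f n)" for n unfolding f_def by (rule affine_fun_on_Re_lsum)
    show "\<phi> \<in> characters G" by (rule \<phi>(2))
    show "0 < d / 2" using d by simp
    show "d / 2 \<le> f n \<phi>" for n using \<gamma>(2)[OF rS[of n]] by (simp add: f d_def x_def)
    show "\<bar>f k \<psi>\<bar> \<le> 2" if "\<psi> \<in> characters G" for k \<psi>
    proof -
      have "cmod (\<psi> h) \<le> 1" "cmod (\<psi> (x k)) \<le> 1" using that PD1_bound h(1) xc by (auto simp: characters_def)
      then show ?thesis unfolding f using abs_Re_le_cmod[of "\<psi> h"] abs_Re_le_cmod[of "\<psi> (x k)"] by linarith
    qed
    fix g assume "continuous_on (characters G) g" "affine_fun_on (characters G) g"
    then show "\<exists>e\<in>{\<psi>. extremal_character G \<psi>}. \<forall>x\<in>characters G. g x \<le> g e"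
      using \<phi>(2) by (intro characters_bdry[OF cc]) auto
  qed
  then obtain \<psi> where \<psi>: "extremal_character G \<psi>" "\<And>m. \<exists>k\<ge>m. d / 8 < f k \<psi>" by auto
  from dich[OF \<psi>(1)] show False
  proof
    \<comment> \<open>Both \<open>h\<close> and \<open>x k\<close> lie outside the radical, the
      latter by the choice of \<open>\<gamma>\<close>, so both values vanish.\<close>
    assume "supported_on G \<psi> ?R"
    then have "f k \<psi> = 0" for k
      using h xc \<gamma>(3)[OF rS[of k]] by (simp add: f supported_on_def x_def)
    then show False using \<psi>(2)[of 0] d by simp
  next
    assume "vN_amenable_character G \<psi>"
    then have "amenable_character G \<psi>" by (auto simp: vN_amenable_character_def amenable_character_def)
    then have "finite_character G \<psi>" by (rule fin[OF \<psi>(1)])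
    then obtain n \<rho> v where v: "(n, \<rho>) \<in> C" "v \<in> coord_space n" "\<forall>g\<in>carrier G. \<psi> g = ip (\<rho> g v) v"
      using C(3) by blast
    have "(\<lambda>m. ip (\<rho> (h \<otimes> (inv ((\<gamma> \<circ> r) m) \<otimes> (\<gamma> \<circ> r) (Suc m))) v) v) \<longlonglongrightarrow> ip (\<rho> h v) v"
      by (rule coefficient_limit[OF C(2)[OF v(1)] v(2) h(1)]) (use gc r(2)[OF v(1)] in auto)
    then have "(\<lambda>m. \<psi> (x m)) \<longlonglongrightarrow> \<psi> h" using v(3) xc h(1) by (simp add: x_def)
    then have "(\<lambda>m. f m \<psi>) \<longlonglongrightarrow> Re (\<psi> h) - Re (\<psi> h)" unfolding f by (intro tendsto_intros tendsto_Re)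
    then have "eventually (\<lambda>m. f m \<psi> < d / 8) sequentially" using d by (intro order_tendstoD) auto
    then obtain m where "\<And>k. m \<le> k \<Longrightarrow> f k \<psi> < d / 8" by (auto simp: eventually_sequentially)
    then show False using \<psi>(2)[of m] by fastforce
  qed
qed

lemma charmenable_URS_measure:
  assumes cc: "countable (carrier G)" and cm: "charmenable G" and X: "URS G X"
    and \<phi>: "\<phi> \<in> indicator_hull X" "\<phi> \<in> characters G"
    and h: "h \<in> carrier G" "h \<notin> amenable_radical G" "\<phi> h \<noteq> 0"
  shows "\<exists>\<mu>. invariant_borel_prob G X \<mu>"
proof -
  have ci: "closed_invariant G X" using X by (simp add: URS_def)
  have "conj_subgroup G g ` A \<subseteq> X" if "g \<in> carrier G" "A \<subseteq> X" for g A
    using closed_invariantD(3)[OF ci] that by blast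
  from invariant_charge_dichotomy[OF this] show ?thesis
  proof
    assume "\<exists>m. charge X m \<and> (\<forall>g\<in>carrier G. \<forall>A\<subseteq>X. m (conj_subgroup G g ` A) = m A)"
    then show ?thesis using invariant_charge_imp_borel_prob[OF ci cc] by blast
  next
    assume "\<exists>Q e. finite Q \<and> Q \<subseteq> carrier G \<and> 0 < e \<and>
      (\<forall>m. charge X m \<longrightarrow> (\<exists>g\<in>Q. \<exists>A\<subseteq>X. e < \<bar>m (conj_subgroup G g ` A) - m A\<bar>))"
    then obtain Q e where Q: "finite Q" "Q \<subseteq> carrier G" "0 < e"
      "\<And>m. charge X m \<Longrightarrow> \<exists>g\<in>Q. \<exists>A\<subseteq>X. e < \<bar>m (conj_subgroup G g ` A) - m A\<bar>" by blast
    obtain qs r where qs: "symmetric_list qs" and r: "0 < r" "r < 1" and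
      gap: "\<And>H \<kappa> m. \<lbrakk>H \<in> X; posdef \<kappa>; \<kappa> \<one> = 1\<rbrakk> \<Longrightarrow> walk_mean qs m (\<lambda>g. of_bool (g \<in> H) * \<kappa> g) \<le> r ^ m"
      using spectral_gap[OF ci Q] by blast
    have "set qs \<subseteq> carrier G" using qs by (simp add: symmetric_list_def)
    then have F: "\<phi> \<in> gap_face qs r" by (rule indicator_hull_gap_face[OF _ \<phi> gap])
    have "0 < Re (\<phi> h)" using indicator_hull_real[OF \<phi>(1) h(1)] h(3) by (auto simp: complex_eq_iff)
    then obtain \<psi> where \<psi>: "\<psi> \<in> gap_face qs r" "extremal_character G \<psi>" "\<psi> h \<noteq> 0"
      using gap_face_extremal_character[OF cc qs r(1) F h(1)] by blast
    have "\<not> supported_on G \<psi> (amenable_radical G)" using h(1,2) \<psi>(3) by (auto simp: supported_on_def)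
    then have "vN_amenable_character G \<psi>" using cm \<psi>(2) unfolding charmenable_def by blast
    then have "amenable_character G \<psi>" by (auto simp: vN_amenable_character_def amenable_character_def)
    then show ?thesis using gap_face_not_amenable[OF qs r \<psi>(1)] by blast
  qed
qed

text \<open>Here \<open>S\<close> need not be conjugation invariant, but the support of \<open>\<phi>\<close> is.\<close>

lemma supported_hull_URS:
  assumes X: "URS G X" and \<phi>: "\<phi> \<in> indicator_hull X" "\<phi> \<in> characters G"
    and S: "\<And>g. g \<in> carrier G \<Longrightarrow> \<phi> g \<noteq> 0 \<Longrightarrow> g \<in> S" and H: "H \<in> X"
  shows "H \<subseteq> S"
proof -
  have ci: "closed_invariant G X" using X by (simp add: URS_def)
  note C = closed_invariantD[OF ci]
  \<comment> \<open>This is the largest conjugation invariant subset of \<open>S\<close>; it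
    contains the support of \<open>\<phi>\<close> because that support is conjugation
    invariant.\<close>
  define T where "T = {g \<in> carrier G. \<forall>q\<in>carrier G. q \<otimes> g \<otimes> inv q \<in> S}"
  have TS: "T \<subseteq> S"
  proof
    fix g assume g: "g \<in> T"
    then have "\<one> \<otimes> g \<otimes> inv \<one> \<in> S" by (simp only: T_def mem_Collect_eq one_closed)
    then show "g \<in> S" using g by (simp add: T_def)
  qed
  have inT: "q \<otimes> g \<otimes> inv q \<in> T" if q: "q \<in> carrier G" and g: "g \<in> T" for q g
  proof -
    have gc: "g \<in> carrier G" using g by (simp add: T_def)
    have "p \<otimes> (q \<otimes> g \<otimes> inv q) \<otimes> inv p \<in> S" if p: "p \<in> carrier G" for p
    proof -
      have "(p \<otimes> q) \<otimes> g \<otimes> inv (p \<otimes> q) \<in> S" using g p q by (simp only: T_def mem_Collect_eq m_closed)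
      then show ?thesis using p q gc by (simp add: inv_mult_group m_assoc)
    qed
    then show ?thesis using q gc by (simp add: T_def)
  qed
  have supp: "\<phi> g = 0" if g: "g \<in> carrier G" "g \<notin> T" for g
  proof (rule ccontr)
    assume nz: "\<phi> g \<noteq> 0"
    have "q \<otimes> g \<otimes> inv q \<in> S" if q: "q \<in> carrier G" for q
    proof (rule S)
      have "inv (inv q) \<otimes> g \<otimes> inv q = q \<otimes> g \<otimes> inv q" using q by simp
      then have "\<phi> (q \<otimes> g \<otimes> inv q) = \<phi> g" using \<phi>(2) g(1) q by (metis characters_iff inv_closed)
      then show "\<phi> (q \<otimes> g \<otimes> inv q) \<noteq> 0" using nz by simp
    qed (use q g(1) in simp)
    then show False using g by (simp add: T_def)
  qed
  have ne: "\<exists>H\<in>X. H \<subseteq> T"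
  proof (rule ccontr)
    assume "\<not> ?thesis"
    then have "\<forall>H\<in>X. \<exists>g\<in>carrier G - T. g \<in> H" using C(2) by blast
    then have cov: "X \<subseteq> (\<Union>g\<in>carrier G - T. {H. subgroup H G \<and> (g \<in> H) = True})" using C(1) by blast
    have op: "openin (chabauty G) {H. subgroup H G \<and> (g \<in> H) = True}" if "g \<in> carrier G - T" for g
      by (rule openin_chabauty_member) (use that in simp)
    have cl: "closedin (chabauty G) X" using ci by (simp add: closed_invariant_def)
    obtain J where J: "finite J" "J \<subseteq> carrier G - T" "X \<subseteq> (\<Union>g\<in>J. {H. subgroup H G \<and> (g \<in> H) = True})"
      by (rule chabauty_finite_subcover[OF cl op cov])
    obtain js where js: "set js = J" using finite_list[OF J(1)] by blast
    have l: "Re (lsum f (map (\<lambda>g. (-1, g)) zs)) = - (\<Sum>g\<leftarrow>zs. Re (f g))" for f :: "'a \<Rightarrow> complex" and zs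
      by (induction zs) auto
    \<comment> \<open>Every member of \<open>X\<close> meets \<open>J\<close>, so the indicator
      functions, and with them \<open>\<phi>\<close>, have sum at least 1 over \<open>J\<close>,
      although \<open>\<phi>\<close> vanishes there. The signs are reversed because
      \<open>indicator_hull\<close> is given by upper bounds.\<close>
    have "Re (lsum \<phi> (map (\<lambda>g. (-1, g)) js)) \<le> -1"
    proof (rule indicator_hullD[OF \<phi>(1)])
      show "map (\<lambda>g. (-1, g)) js \<in> over (carrier G)" using js J(2) by (auto simp: over_def)
      fix H assume "H \<in> X"
      then obtain g where g: "g \<in> J" "g \<in> H" using J(3) by auto
      have "Re (of_bool (g \<in> H)) \<le> (\<Sum>g\<leftarrow>js. Re (of_bool (g \<in> H)))"
        by (rule member_le_sum_list) (use g js in \<open>auto simp: of_bool_def\<close>)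
      then show "Re (lsum (\<lambda>g. of_bool (g \<in> H)) (map (\<lambda>g. (-1, g)) js)) \<le> -1"
        unfolding l using g(2) by simp
    qed
    moreover have "(\<Sum>g\<leftarrow>js. Re (\<phi> g)) = (\<Sum>g\<leftarrow>js. 0)"
      using supp js J(2) by (intro arg_cong[where f=sum_list] map_cong refl) auto
    ultimately show False unfolding l by simp
  qed
  have "closed_invariant G {H \<in> X. H \<subseteq> T}"
    by (rule closed_invariant_below[where R = T, OF ci inT ne])
  then have "{H \<in> X. H \<subseteq> T} = X" using X by (simp add: URS_def)
  then show ?thesis using H TS by blast
qed

end

theorem proposition3p5:
  fixes \<Gamma> :: "('a, 'b) monoid_scheme" and X :: "'a set set"
  assumes "group \<Gamma>" and "countable (carrier \<Gamma>)"
    and "charmenable \<Gamma>" and "URS \<Gamma> X"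
  shows "((\<forall>H\<in>X. H \<subseteq> amenable_radical \<Gamma>) \<or> (\<exists>\<mu>. invariant_borel_prob \<Gamma> X \<mu>)) \<and>
    (charfinite \<Gamma> \<longrightarrow> finite X)"
proof -
  interpret group \<Gamma> by (rule assms(1))
  have ci: "closed_invariant \<Gamma> X" using assms(4) by (simp add: URS_def)
  have "X \<noteq> {}" using ci by (simp add: closed_invariant_def)
  then obtain \<phi> where \<phi>: "\<phi> \<in> indicator_hull X" "\<phi> \<in> characters \<Gamma>"
    using charmenable_hull_character[OF assms(3)] closed_invariantD[OF ci] by metis
  show ?thesis
  proof (cases "\<exists>h\<in>carrier \<Gamma>. h \<notin> amenable_radical \<Gamma> \<and> \<phi> h \<noteq> 0")
    case True
    then obtain h where h: "h \<in> carrier \<Gamma>" "h \<notin> amenable_radical \<Gamma>" "\<phi> h \<noteq> 0" by blast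
    show ?thesis
      using charmenable_URS_measure[OF assms(2-4) \<phi> h] charfinite_URS_finite[OF assms(2) _ assms(4) \<phi> h] by blast
  next
    case False
    then have sub: "H \<subseteq> amenable_radical \<Gamma>" if "H \<in> X" for H
      using supported_hull_URS[OF assms(4) \<phi> _ that] by blast
    \<comment> \<open>In this case finiteness has another source: the radical is finite and has only
      finitely many subsets.\<close>
    have "finite X" if "charfinite \<Gamma>"
    proof (rule finite_subset)
      show "X \<subseteq> Pow (amenable_radical \<Gamma>)" using sub by blast
      show "finite (Pow (amenable_radical \<Gamma>))" using that by (simp add: charfinite_def)
    qed
    then show ?thesis using sub by blast
  qed
qed

end
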